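(* Let $n\ge 1$, fix $f\in\mathcal{S}(\mathbb{R}^n)$, and let $\psi:[0,\infty)\to[1,\infty)$ be an increasing function such that the series $\sum_{k\ge 0}\psi(k)^{-(2n+2)}$ (over integers $k\ge 0$) converges. Then there exists a subset $\mathcal{X}(\psi)\subset\mathbb{R}^{n\times n}_{\mathrm{sym}}$ of full Lebesgue measure such that for every $X\in\mathcal{X}(\psi)$ there is a constant $c=c(f,X)$ with $$|\theta_f(M,X,\bm{x},\bm{y})|\le c\,M^{\frac n2}\,\psi(\log M)$$ for all $M\ge 1$ and all $\bm{x},\bm{y}\in\mathbb{R}^n$. The constant is independent of $M$, $\bm{x}$ and $\bm{y}$.
   Context: $\mathbb{R}^{n\times n}_{\mathrm{sym}}$ denotes the space of real symmetric $n\times n$ matrices, $\mathcal{S}(\mathbb{R}^n)$ the complex-valued Schwartz functions, and $\mathrm{e}(z)=e^{2\pi i z}$. Vectors in $\mathbb{R}^n$ are row vectors. For $f\in\mathcal{S}(\mathbb{R}^n)$, $M>0$, $X\in\mathbb{R}^{n\times n}_{\mathrm{sym}}$ and $\bm{x},\bm{y}\in\mathbb{R}^n$, the theta sum is $$\theta_f(M,X,\bm{x},\bm{y})=\sum_{\bm{m}\in\mathbb{Z}^n} f\big(M^{-1}(\bm{m}+\bm{x})\big)\,\mathrm{e}\big(\tfrac12\bm{m}X{}^t\bm{m}+\bm{m}\,{}^t\bm{y}\big).$$ *)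

theory Defs
  imports "HOL-Analysis.Analysis" "HOL-Library.Uprod"
begin

section \<open>Schwartz functions\<close>

definition partial_deriv :: "'n::finite \<Rightarrow> (real^'n \<Rightarrow> complex) \<Rightarrow> real^'n \<Rightarrow> complex" where
  "partial_deriv i f x = frechet_derivative f (at x) (axis i 1)"

definition iter_partial :: "'n::finite list \<Rightarrow> (real^'n \<Rightarrow> complex) \<Rightarrow> real^'n \<Rightarrow> complex" where
  "iter_partial is f = foldr partial_deriv is f"

text \<open>
  A function is smooth iff all of its iterated partial derivatives exist and are (totally)
  differentiable. The value of \<^const>\<open>frechet_derivative\<close> is meaningful only because of the
  differentiability clause. The lists of coordinates play the role of the differentiation
  multi-indices, and \<open>\<alpha>\<close> is the multi-index of the monomial.
\<close>

definition schwartz :: "(real^'n::finite \<Rightarrow> complex) \<Rightarrow> bool" where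
  "schwartz f \<longleftrightarrow>
     (\<forall>is. iter_partial is f differentiable_on UNIV) \<and>
     (\<forall>(\<alpha>::'n \<Rightarrow> nat) is. bounded (range (\<lambda>x. (\<Prod>i\<in>UNIV. (x $ i) ^ \<alpha> i) *\<^sub>R iter_partial is f x)))"


section \<open>Lebesgue measure on real symmetric matrices\<close>

definition sym_matrices :: "(real^'n^'n::finite) set" where
  "sym_matrices = {X. transpose X = X}"

text \<open>
  A symmetric matrix is determined by its entries at the \<open>n (n + 1) / 2\<close> unordered pairs of
  indices (the entries on and above the diagonal). Lebesgue measure on the symmetric matrices is
  Lebesgue measure in these coordinates.
\<close>

instance uprod :: (finite) finite
  by standard simp

definition sym_matrix :: "real^('n uprod) \<Rightarrow> real^'n^'n::finite" where
  "sym_matrix v = (\<chi> i j. v $ Upair i j)"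

definition sym_lebesgue :: "(real^'n^'n::finite) measure" where
  "sym_lebesgue = completion (distr lborel (restrict_space borel sym_matrices) sym_matrix)"

lemma bij_betw_sym_matrix: "bij_betw sym_matrix UNIV (sym_matrices :: (real^'n^'n::finite) set)"
proof (rule bij_betwI')
  fix v w :: "real^('n uprod)"
  show "sym_matrix v = sym_matrix w \<longleftrightarrow> v = w"
  proof
    assume "sym_matrix v = sym_matrix w"
    then have "v $ Upair i j = w $ Upair i j" for i j
      by (simp add: sym_matrix_def vec_eq_iff)
    then have "v $ p = w $ p" for p
      by (cases p) auto
    then show "v = w" by (simp add: vec_eq_iff)
  qed simp
  show "sym_matrix v \<in> sym_matrices"
  proof -
    have "v $ Upair j i = v $ Upair i j" for i j
      by (rule arg_cong[where f = "($) v"]) simp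
    then show ?thesis
      by (simp add: sym_matrix_def sym_matrices_def transpose_def vec_eq_iff)
  qed
next
  fix X :: "real^'n^'n" assume "X \<in> sym_matrices"
  then have sym: "X $ i $ j = X $ j $ i" for i j
    by (auto simp: sym_matrices_def transpose_def vec_eq_iff)
  define v :: "real^('n uprod)" where
    "v = (\<chi> p. let (i, j) = SOME (i, j). Upair i j = p in X $ i $ j)"
  have "v $ Upair i j = X $ i $ j" for i j
  proof -
    obtain k l where kl: "(SOME (k, l). Upair k l = Upair i j) = (k, l)" by fastforce
    have "case (SOME (k, l). Upair k l = Upair i j) of (k, l) \<Rightarrow> Upair k l = Upair i j"
      by (rule someI[of _ "(i, j)"]) simp
    then have "Upair k l = Upair i j" unfolding kl by simp
    then show ?thesis using sym kl by (auto simp: v_def)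
  qed
  then show "\<exists>v\<in>UNIV. X = sym_matrix v"
    by (intro bexI[of _ v]) (simp_all add: sym_matrix_def vec_eq_iff)
qed

lemma continuous_sym_matrix: "continuous_on UNIV (sym_matrix :: _ \<Rightarrow> real^'n^'n::finite)"
  unfolding sym_matrix_def by (intro continuous_intros)

lemma measurable_sym_matrix:
  "sym_matrix \<in> lborel \<rightarrow>\<^sub>M restrict_space borel (sym_matrices :: (real^'n^'n::finite) set)"
proof (rule measurable_restrict_space2)
  show "sym_matrix \<in> lborel \<rightarrow>\<^sub>M (borel :: (real^'n^'n) measure)"
    using borel_measurable_continuous_onI[OF continuous_sym_matrix] by simp
qed (use bij_betw_sym_matrix in \<open>auto simp: bij_betw_def\<close>)

lemma space_sym_lebesgue: "space sym_lebesgue = sym_matrices"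
  by (simp add: sym_lebesgue_def space_restrict_space)


section \<open>Theta sums\<close>

definition e_fun :: "complex \<Rightarrow> complex" where
  "e_fun z = exp (2 * of_real pi * \<i> * z)"

definition int_vectors :: "(real^'n::finite) set" where
  "int_vectors = {m. \<forall>i. m $ i \<in> \<int>}"

definition theta ::
  "(real^'n::finite \<Rightarrow> complex) \<Rightarrow> real \<Rightarrow> real^'n^'n \<Rightarrow> real^'n \<Rightarrow> real^'n \<Rightarrow> complex" where
  "theta f M X x y =
     (\<Sum>\<^sub>\<infinity>m\<in>int_vectors.
        f (inverse M *\<^sub>R (m + x)) * e_fun (of_real (1 / 2 * ((m v* X) \<bullet> m) + m \<bullet> y)))"

end

theory Submission
  imports Defs
begin

text \<open>
  Expanding \<open>|\<theta>\<^sub>f|\<^sup>2\<close> over differences \<open>h\<close> of summation indices and summing by parts \<open>2n\<close> times in the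
  direction where \<open>h X\<close> is farthest from the integers gives
  \<open>|\<theta>\<^sub>f(M, X, x, y)|\<^sup>2 \<le> C M\<^sup>n #S(\<epsilon> M, \<epsilon> / M)\<close>, where \<open>S(a, b)\<close> is the set of integer vectors \<open>h\<close> with
  \<open>|h| \<le> a\<close> and \<open>h X\<close> within \<open>b\<close> of an integer vector. It therefore suffices to show
  that for \<open>a b\<close> small the set of \<open>X\<close> (modulo \<open>1\<close>) with \<open>#S(a, b) \<ge> T\<close> has measure at most \<open>C T\<^bsup>-(n+1)\<^esup>\<close>;
  the Borel--Cantelli lemma with \<open>a = \<epsilon> e\<^bsup>k+1\<^esup>\<close>, \<open>b = \<epsilon> e\<^bsup>-k\<^esup>\<close>, \<open>T = \<psi>(k)\<^sup>2\<close> then finishes the proof.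

  For the measure bound let \<open>s\<close> be the dimension of the span \<open>E\<close> of \<open>S(a, b)\<close>. Since \<open>a b\<close> is small, the
  form \<open>h \<cdot> k'\<close> (with \<open>k'\<close> the integer vector close to \<open>- h' X\<close>) is symmetric on \<open>S(2a, 2b)\<close>, so that in
  coordinates indexed by some \<open>J\<close> on \<open>E\<close> the matrix \<open>X\<close> is close to a symmetric \<open>s \<times> s\<close> matrix \<open>W\<close> that
  maps all short vectors to integral ones. The lattice of \<open>x\<close> for which \<open>x W\<close> is integral has an index \<open>\<nu>\<close>
  with \<open>T \<nu> \<le> g(Y)\<close>, where \<open>g(Y)\<close> is the volume of the convex body of all \<open>x\<close> with \<open>x\<close> and \<open>x Y\<close>
  small, and \<open>Y = X|\<^sub>E - W\<close>. One counts the
  at least \<open>(T / 2)\<^sup>s\<close> independent \<open>s\<close>-tuples in \<open>S(2a, 2b) \<inter> E\<close>, bounds the number of subspaces \<open>E\<close> and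
  of matrices \<open>W\<close> modulo \<open>1\<close> with given index, unfolds the integral over \<open>X\<close> to one over \<open>Y\<close>, and bounds
  the \<open>(s + 1)\<close>-st moment of \<open>g\<close> by induction on \<open>s\<close>.
\<close>

section \<open>Index of subgroups\<close>

text \<open>The exponent \<open>n + 1\<close> is a budget. Let \<open>s\<close> be the dimension of
  \<open>E\<close> and \<open>u = n - s\<close>; everything is up to constants. Averaging over at
  least \<open>(T / 2) ^ s\<close> tuples gains \<open>T ^ (- s)\<close>. For given \<open>E\<close>
  and \<open>W\<close> there are at most \<open>(g / \<nu>) ^ s\<close> tuples, and each member must
  be nearly integral in the \<open>u\<close> directions that \<open>E\<close> leaves free, at the
  price \<open>b ^ u\<close> divided by the index of the subspace. There are
  \<open>R ^ (s + 1)\<close> matrices and \<open>R ^ n\<close> subspaces of index at most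
  \<open>R\<close>, so inverse \<open>s\<close>-th powers of both indices, summed up to
  \<open>R = g / T\<close>, give \<open>(g / T) ^ (u + 1)\<close>: in all
  \<open>T ^ (- (n + 1))\<close>. Of the remaining \<open>g ^ (n + 1)\<close>, the factor
  \<open>g ^ u\<close> is at most \<open>a ^ (s * u)\<close>, which \<open>b ^ (s * u)\<close>
  compensates, and \<open>g ^ (s + 1)\<close> is integrated. The series is assumed to converge at
  exactly this exponent, so not even a logarithm may be lost. Hence the sums that would diverge
  logarithmically, for an empty set of coordinates, are treated apart.\<close>

definition subgrp :: "'a::ab_group_add set \<Rightarrow> bool" where
  "subgrp A \<longleftrightarrow> 0 \<in> A \<and> (\<forall>x\<in>A. \<forall>y\<in>A. x - y \<in> A)"

definition cosets :: "'a::ab_group_add set \<Rightarrow> 'a set \<Rightarrow> 'a set set" where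
  "cosets A B = (\<lambda>a. {x\<in>A. x - a \<in> B}) ` A"

text \<open>\<open>card\<close> returns 0 when there are infinitely many cosets, so an upper bound
  on \<open>idx\<close> carries information only together with \<open>finite (cosets A B)\<close>;
  the two travel together throughout.\<close>

definition idx :: "'a::ab_group_add set \<Rightarrow> 'a set \<Rightarrow> nat" where
  "idx A B = card (cosets A B)"

text \<open>A partial transversal: members are pairwise incongruent modulo B. Indices are bounded
  from both sides through such sets, without quotient groups.\<close>

definition separated :: "'a::ab_group_add set \<Rightarrow> 'a set \<Rightarrow> bool" where
  "separated B R \<longleftrightarrow> (\<forall>r\<in>R. \<forall>r'\<in>R. r - r' \<in> B \<longrightarrow> r = r')"

lemma subgrpD:
  assumes "subgrp A"
  shows subgrp_zero: "0 \<in> A" and subgrp_diff: "x \<in> A \<Longrightarrow> y \<in> A \<Longrightarrow> x - y \<in> A"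
    and subgrp_minus: "x \<in> A \<Longrightarrow> - x \<in> A" and subgrp_add: "x \<in> A \<Longrightarrow> y \<in> A \<Longrightarrow> x + y \<in> A"
proof -
  show 0: "0 \<in> A" and d: "\<And>x y. x \<in> A \<Longrightarrow> y \<in> A \<Longrightarrow> x - y \<in> A"
    using assms by (auto simp: subgrp_def)
  show m: "\<And>x. x \<in> A \<Longrightarrow> - x \<in> A" using d[OF 0] by simp
  show "x \<in> A \<Longrightarrow> y \<in> A \<Longrightarrow> x + y \<in> A" using d[of x "- y"] m by simp
qed

lemma subgrp_sum:
  assumes "subgrp A" "\<And>i. i \<in> I \<Longrightarrow> f i \<in> A"
  shows "sum f I \<in> A"
  using assms(2)
  by (induction I rule: infinite_finite_induct) (auto intro: subgrp_add subgrp_zero assms(1))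

lemma subgrp_of_nat_scaleR:
  fixes A :: "'a::real_vector set"
  assumes "subgrp A" "x \<in> A"
  shows "of_nat k *\<^sub>R x \<in> A"
  by (induction k) (use assms in \<open>auto intro: subgrp_add subgrp_zero simp: scaleR_add_left\<close>)

lemma subgrp_of_int_scaleR:
  fixes A :: "'a::real_vector set"
  assumes "subgrp A" "x \<in> A"
  shows "of_int k *\<^sub>R x \<in> A"
proof (cases "k \<ge> 0")
  case True
  then have "of_int k *\<^sub>R x = of_nat (nat k) *\<^sub>R x" by simp
  then show ?thesis using subgrp_of_nat_scaleR[OF assms] by metis
next
  case False
  then have "of_int k *\<^sub>R x = - (of_nat (nat (- k)) *\<^sub>R x)" by (simp flip: scaleR_minus_left)
  then show ?thesis using subgrp_of_nat_scaleR[OF assms] subgrp_minus[OF assms(1)] by metis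
qed

lemma coset_eq_iff:
  assumes "subgrp A" "subgrp B" "B \<subseteq> A" "a \<in> A" "b \<in> A"
  shows "{x\<in>A. x - a \<in> B} = {x\<in>A. x - b \<in> B} \<longleftrightarrow> a - b \<in> B"
proof
  assume "{x\<in>A. x - a \<in> B} = {x\<in>A. x - b \<in> B}"
  moreover have "a \<in> {x\<in>A. x - a \<in> B}" using assms by (auto intro: subgrp_zero)
  ultimately show "a - b \<in> B" by blast
next
  assume ab: "a - b \<in> B"
  have "x - a \<in> B \<longleftrightarrow> x - b \<in> B" for x
    using subgrp_add[OF assms(2) _ ab, of "x - a"] subgrp_diff[OF assms(2) _ ab, of "x - b"] by auto
  then show "{x\<in>A. x - a \<in> B} = {x\<in>A. x - b \<in> B}" by auto
qed

lemma separated_card_le: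
  assumes "subgrp A" "subgrp B" "B \<subseteq> A" "finite (cosets A B)" "R \<subseteq> A" "separated B R"
  shows "finite R" "card R \<le> idx A B"
proof -
  let ?f = "\<lambda>a. {x\<in>A. x - a \<in> B}"
  have inj: "inj_on ?f R"
  proof (rule inj_onI)
    fix r r' assume "r \<in> R" "r' \<in> R" "?f r = ?f r'"
    then show "r = r'"
      using coset_eq_iff[OF assms(1-3), of r r'] assms(5,6) unfolding separated_def by blast
  qed
  have sub: "?f ` R \<subseteq> cosets A B" using assms(5) by (auto simp: cosets_def)
  show "finite R" by (rule finite_imageD[OF finite_subset[OF sub assms(4)] inj])
  show "card R \<le> idx A B"
    unfolding idx_def using card_image[OF inj] card_mono[OF assms(4) sub] by simp
qed

lemma transversal_exists:
  assumes "subgrp A" "subgrp B" "B \<subseteq> A" "finite (cosets A B)"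
  obtains R where "R \<subseteq> A" "separated B R" "finite R" "card R = idx A B"
    "\<And>a. a \<in> A \<Longrightarrow> \<exists>r\<in>R. a - r \<in> B"
proof -
  let ?f = "\<lambda>a. {x\<in>A. x - a \<in> B}"
  obtain R where R: "R \<subseteq> A" "inj_on ?f R" "?f ` R = cosets A B"
    using subset_image_inj[of "cosets A B" ?f A] by (auto simp: cosets_def)
  show thesis
  proof
    show "R \<subseteq> A" by fact
    show "separated B R" unfolding separated_def
    proof (intro ballI impI)
      fix r r' assume r: "r \<in> R" "r' \<in> R" "r - r' \<in> B"
      then have "?f r = ?f r'" using coset_eq_iff[OF assms(1-3), of r r'] R(1) by blast
      then show "r = r'" using R(2) r by (auto dest: inj_onD)
    qed
    show "finite R" using R(2) assms(4) unfolding R(3)[symmetric] by (rule finite_imageD[rotated])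
    show "card R = idx A B" unfolding idx_def using card_image[OF R(2)] unfolding R(3) by presburger
    fix a assume a: "a \<in> A"
    then have "?f a \<in> ?f ` R" unfolding R(3) cosets_def by (rule imageI)
    then obtain r where "r \<in> R" "?f a = ?f r" by (rule imageE) 
    then show "\<exists>r\<in>R. a - r \<in> B" using coset_eq_iff[OF assms(1-3) a] R(1) by blast
  qed
qed

lemma finite_cosets_covering:
  assumes "subgrp A" "subgrp B" "B \<subseteq> A" "finite R" "R \<subseteq> A" "\<And>a. a \<in> A \<Longrightarrow> \<exists>r\<in>R. a - r \<in> B"
  shows "finite (cosets A B)"
proof -
  have "cosets A B \<subseteq> (\<lambda>a. {x\<in>A. x - a \<in> B}) ` R"
  proof
    fix C assume "C \<in> cosets A B"
    then obtain a where a: "a \<in> A" "C = {x\<in>A. x - a \<in> B}" unfolding cosets_def by blast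
    obtain r where r: "r \<in> R" "a - r \<in> B" using assms(6)[OF a(1)] by blast
    then have "C = {x\<in>A. x - r \<in> B}" unfolding a(2) using coset_eq_iff[OF assms(1-3) a(1), of r] assms(5) by blast
    then show "C \<in> (\<lambda>a. {x\<in>A. x - a \<in> B}) ` R" using r(1) by blast
  qed
  then show ?thesis by (rule finite_subset) (rule finite_imageI[OF assms(4)])
qed

text \<open>A choice of one element per coset is separated; were it infinite, some
  \<open>N + 1\<close> of its elements would already violate the bound.\<close>

lemma finite_cosets_separated:
  assumes "subgrp A" "subgrp B" "B \<subseteq> A"
    and "\<And>R. finite R \<Longrightarrow> R \<subseteq> A \<Longrightarrow> separated B R \<Longrightarrow> card R \<le> N"
  shows "finite (cosets A B)" "idx A B \<le> N"
proof -
  let ?f = "\<lambda>a. {x\<in>A. x - a \<in> B}"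
  obtain R where R: "R \<subseteq> A" "inj_on ?f R" "?f ` R = cosets A B"
    using subset_image_inj[of "cosets A B" ?f A] by (auto simp: cosets_def)
  have sep: "separated B R" unfolding separated_def
  proof (intro ballI impI)
    fix r r' assume r: "r \<in> R" "r' \<in> R" "r - r' \<in> B"
    then have "?f r = ?f r'" using coset_eq_iff[OF assms(1-3), of r r'] R(1) by blast
    then show "r = r'" using R(2) r by (auto dest: inj_onD)
  qed
  have "finite R"
  proof (rule ccontr)
    assume "infinite R"
    then obtain F where F: "F \<subseteq> R" "finite F" "card F = Suc N"
      using infinite_arbitrarily_large by meson
    have "separated B F" using sep F(1) unfolding separated_def by (meson subsetD)
    then have "card F \<le> N" using assms(4)[OF F(2) subset_trans[OF F(1) R(1)]] by metis
    then show False using F(3) by simp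
  qed
  then show "finite (cosets A B)" unfolding R(3)[symmetric] by (rule finite_imageI)
  show "idx A B \<le> N"
  proof -
    have "card (cosets A B) = card R" using card_image[OF R(2)] unfolding R(3) .
    then show ?thesis unfolding idx_def using assms(4)[OF \<open>finite R\<close> R(1) sep] by presburger
  qed
qed

lemma idx_pos:
  assumes "subgrp A" "finite (cosets A B)"
  shows "idx A B \<ge> 1"
proof -
  have "cosets A B \<noteq> {}" unfolding cosets_def using subgrp_zero[OF assms(1)] by blast
  then show ?thesis using assms(2) by (simp add: idx_def Suc_leI card_gt_0_iff)
qed

text \<open>Half of the tower law: sums \<open>r + q\<close> of representatives of A modulo B and of
  B modulo C are pairwise incongruent modulo C.\<close>

lemma finite_cosets_mono:
  assumes "subgrp A" "subgrp B" "subgrp C" "C \<subseteq> B" "B \<subseteq> A" "finite (cosets A C)"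
  shows "finite (cosets A B)" "finite (cosets B C)" "idx A B * idx B C \<le> idx A C" "idx A B \<le> idx A C"
proof -
  have CA: "C \<subseteq> A" using assms(4,5) by (rule subset_trans)
  note low = separated_card_le[OF assms(1,3) CA assms(6)]
  show fAB: "finite (cosets A B)"
  proof (rule finite_cosets_separated[OF assms(1,2,5)])
    fix R assume "finite R" "R \<subseteq> A" "separated B R"
    moreover from this have "separated C R" using assms(4) unfolding separated_def by blast
    ultimately show "card R \<le> idx A C" by (intro low(2))
  qed
  show fBC: "finite (cosets B C)"
  proof (rule finite_cosets_separated[OF assms(2,3,4)])
    fix R assume "finite R" "R \<subseteq> B" "separated C R"
    then show "card R \<le> idx A C" using assms(5) by (intro low(2)) auto
  qed
  obtain R where R: "R \<subseteq> A" "separated B R" "finite R" "card R = idx A B"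
    using transversal_exists[OF assms(1,2,5) fAB] by metis
  obtain Q where Q: "Q \<subseteq> B" "separated C Q" "finite Q" "card Q = idx B C"
    using transversal_exists[OF assms(2,3,4) fBC] by metis
  have key: "r = r' \<and> q = q'" if "r \<in> R" "r' \<in> R" "q \<in> Q" "q' \<in> Q" "(r + q) - (r' + q') \<in> C" for r r' q q'
  proof -
    have "(r + q) - (r' + q') - (q - q') \<in> B"
      using that assms(4) Q(1) subgrp_diff[OF assms(2)] by blast
    then have "r - r' \<in> B" by (simp add: algebra_simps)
    then have "r = r'" using R(2) that by (auto simp: separated_def)
    then show ?thesis using that Q(2) by (auto simp: separated_def)
  qed
  have inj: "inj_on (\<lambda>(r, q). r + q) (R \<times> Q)"
    using key subgrp_zero[OF assms(3)] by (auto simp: inj_on_def)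
  have "card ((\<lambda>(r, q). r + q) ` (R \<times> Q)) \<le> idx A C"
  proof (rule low(2))
    show "(\<lambda>(r, q). r + q) ` (R \<times> Q) \<subseteq> A"
      using R(1) Q(1) assms(5) by (auto intro!: subgrp_add[OF assms(1)])
    show "separated C ((\<lambda>(r, q). r + q) ` (R \<times> Q))"
      unfolding separated_def using key by fastforce
  qed
  then show m: "idx A B * idx B C \<le> idx A C"
    using card_image[OF inj] R(4) Q(4) by (simp add: card_cartesian_product)
  show "idx A B \<le> idx A C"
    using m idx_pos[OF assms(2) fBC] by (metis le_trans mult.right_neutral mult_le_mono2)
qed

text \<open>Differences of elements of A' stay in A', so elements of A' that are incongruent modulo
  \<open>A' \<inter> B\<close> remain incongruent modulo B.\<close>

lemma finite_cosets_restrict: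
  assumes "subgrp A" "subgrp B" "B \<subseteq> A" "subgrp A'" "A' \<subseteq> A" "finite (cosets A B)"
  shows "finite (cosets A' (A' \<inter> B))" "idx A' (A' \<inter> B) \<le> idx A B"
proof -
  have sg: "subgrp (A' \<inter> B)" using assms by (auto simp: subgrp_def)
  have *: "card R \<le> idx A B" if "R \<subseteq> A'" "separated (A' \<inter> B) R" for R
  proof (rule separated_card_le(2)[OF assms(1-3,6)])
    show "R \<subseteq> A" using that assms by auto
    show "separated B R"
      using that subgrp_diff[OF assms(4)] unfolding separated_def by blast
  qed
  show "finite (cosets A' (A' \<inter> B))" "idx A' (A' \<inter> B) \<le> idx A B"
    using finite_cosets_separated[OF assms(4) sg _ *] by auto
qed

text \<open>Translation by x permutes the cosets. Let \<open>g r\<close> be the representative of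
  \<open>r + x\<close>; when \<open>(r + x) - g r\<close> is summed over a transversal, the
  representatives cancel and the index times x is left.\<close>

lemma idx_scaleR_mem:
  fixes A :: "'a::real_vector set"
  assumes "subgrp A" "subgrp B" "B \<subseteq> A" "finite (cosets A B)" "x \<in> A"
  shows "of_nat (idx A B) *\<^sub>R x \<in> B"
proof -
  obtain R where R: "R \<subseteq> A" "separated B R" "finite R" "card R = idx A B"
    "\<And>a. a \<in> A \<Longrightarrow> \<exists>r\<in>R. a - r \<in> B"
    using transversal_exists[OF assms(1-4)] by metis
  have "\<forall>r. r \<in> R \<longrightarrow> (\<exists>r'. r' \<in> R \<and> (r + x) - r' \<in> B)"
    using R(1,5) assms(5) subgrp_add[OF assms(1)] by blast
  then obtain g where g: "\<And>r. r \<in> R \<Longrightarrow> g r \<in> R" "\<And>r. r \<in> R \<Longrightarrow> (r + x) - g r \<in> B" by metis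
  have inj: "inj_on g R"
  proof (rule inj_onI)
    fix r r' assume r: "r \<in> R" "r' \<in> R" "g r = g r'"
    have "((r + x) - g r) - ((r' + x) - g r') \<in> B" using g(2) r subgrp_diff[OF assms(2)] by blast
    then have "r - r' \<in> B" using r by (simp add: algebra_simps)
    then show "r = r'" using R(2) r by (auto simp: separated_def)
  qed
  have "g ` R = R" using inj g(1) R(3) by (simp add: endo_inj_surj image_subsetI)
  then have "(\<Sum>r\<in>R. g r) = (\<Sum>r\<in>R. r)" using sum.reindex[OF inj, of "\<lambda>x. x"] by simp
  then have "(\<Sum>r\<in>R. (r + x) - g r) = of_nat (card R) *\<^sub>R x"
    by (simp add: sum.distrib sum_subtractf sum_constant_scaleR)
  moreover have "(\<Sum>r\<in>R. (r + x) - g r) \<in> B" using g(2) by (intro subgrp_sum[OF assms(2)])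
  ultimately show ?thesis using R(4) by simp
qed

section \<open>Integer vectors supported on a set of coordinates\<close>

text \<open>Spaces and lattices of lower dimension stay inside the one type \<open>real^'n\<close>,
  as vectors supported on a set J of coordinates. Induction on the dimension thus becomes induction
  on the finite set J.\<close>

definition supp_on :: "'n::finite set \<Rightarrow> (real^'n) set" where
  "supp_on J = {x. \<forall>i. i \<notin> J \<longrightarrow> x $ i = 0}"

definition ZJ :: "'n::finite set \<Rightarrow> (real^'n) set" where
  "ZJ J = {x. (\<forall>i. x $ i \<in> \<int>) \<and> (\<forall>i. i \<notin> J \<longrightarrow> x $ i = 0)}"

definition unit_cube :: "'n::finite set \<Rightarrow> (real^'n) set" where
  "unit_cube J = {x. (\<forall>i\<in>J. 0 \<le> x $ i \<and> x $ i < 1) \<and> (\<forall>i. i \<notin> J \<longrightarrow> x $ i = 0)}"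

definition proj_on :: "'n::finite set \<Rightarrow> real^'n \<Rightarrow> real^'n" where
  "proj_on J x = (\<chi> i. if i \<in> J then x $ i else 0)"

definition slice :: "'n \<Rightarrow> (real^'n::finite) set \<Rightarrow> (real^'n) set" where
  "slice j B = {x\<in>B. x $ j = 0}"

lemma slice_iff [simp]: "x \<in> slice j B \<longleftrightarrow> x \<in> B \<and> x $ j = 0"
  by (simp add: slice_def)

lemma proj_on_nth [simp]: "proj_on J x $ i = (if i \<in> J then x $ i else 0)"
  by (simp add: proj_on_def)

lemma subgrp_ZJ: "subgrp (ZJ J)"
  by (auto simp: subgrp_def ZJ_def)

lemma ZJ_mono: "I \<subseteq> J \<Longrightarrow> ZJ I \<subseteq> ZJ J"
  by (auto simp: ZJ_def)

lemma axis_in_ZJ: "j \<in> J \<Longrightarrow> axis j 1 \<in> ZJ J"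
  by (auto simp: ZJ_def axis_def)

text \<open>The generator is the least positive element: the remainder of any other element modulo
  it is again in G, and smaller.\<close>

lemma Ints_pos_generator:
  assumes sg: "\<And>x y. x \<in> G \<Longrightarrow> y \<in> G \<Longrightarrow> x - y \<in> G" and "0 \<in> G" "G \<subseteq> \<int>"
    and ex: "\<exists>x\<in>G. x \<noteq> (0::real)"
  obtains p :: nat where "p \<ge> 1" "real p \<in> G" "\<And>x. x \<in> G \<Longrightarrow> \<exists>k\<in>\<int>. x = k * real p"
proof -
  obtain x where x: "x \<in> G" "x \<noteq> 0" using ex by blast
  have neg: "- y \<in> G" if "y \<in> G" for y using sg[OF assms(2) that] by simp
  have "\<bar>x\<bar> \<in> G" using x neg by (auto simp: abs_if)
  moreover obtain z :: int where z: "x = of_int z" using x assms(3) by (auto elim: Ints_cases)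
  ultimately have "\<exists>p::nat. p \<ge> 1 \<and> real p \<in> G"
    using x by (intro exI[of _ "nat \<bar>z\<bar>"]) auto
  then have ex: "\<exists>p::nat. p \<ge> 1 \<and> real p \<in> G" .
  define p where "p = (LEAST p::nat. p \<ge> 1 \<and> real p \<in> G)"
  have p: "p \<ge> 1" "real p \<in> G" unfolding p_def using LeastI_ex[OF ex] by auto
  have least: "p \<le> q" if "q \<ge> 1" "real q \<in> G" for q unfolding p_def using that by (intro Least_le) auto
  have mul: "real k * real p \<in> G" for k :: nat
  proof (induction k)
    case (Suc k)
    then show ?case using sg[OF Suc neg[OF p(2)]] by (simp add: algebra_simps)
  qed (use assms(2) in simp)
  have mulz: "of_int k * real p \<in> G" for k :: int
  proof (cases "k \<ge> 0")
    case True then show ?thesis using mul[of "nat k"] by simp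
  next
    case False then show ?thesis using neg[OF mul[of "nat (-k)"]] by simp
  qed
  show thesis
  proof
    show "p \<ge> 1" "real p \<in> G" by fact+
    fix y assume y: "y \<in> G"
    then obtain z :: int where z: "y = of_int z" using assms(3) by (auto elim: Ints_cases)
    have "z mod int p = z - z div int p * int p" by (simp add: minus_div_mult_eq_mod)
    then have "(of_int (z mod int p) :: real) = of_int (z - z div int p * int p)" by presburger
    then have "of_int (z mod int p) = y - of_int (z div int p) * real p" unfolding z by simp
    then have r: "of_int (z mod int p) \<in> G" using sg[OF y mulz] by metis
    have b: "0 \<le> z mod int p" "z mod int p < int p" using p(1) by auto
    have "z mod int p = 0"
    proof (rule ccontr)
      assume "z mod int p \<noteq> 0"
      then have "nat (z mod int p) \<ge> 1" using b by linarith
      moreover have "real (nat (z mod int p)) \<in> G" using r b by simp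
      ultimately have "p \<le> nat (z mod int p)" using least by blast
      then show False using b by linarith
    qed
    then have "z = z div int p * int p" by auto
    then have "(of_int z :: real) = of_int (z div int p * int p)" by presburger
    then have "y = of_int (z div int p) * real p" unfolding z by simp
    then show "\<exists>k\<in>\<int>. y = k * real p" by auto
  qed
qed

text \<open>One step of the Hermite normal form.\<close>

lemma triangular_step:
  fixes B :: "(real^'n::finite) set"
  assumes j: "j \<notin> J" and B: "subgrp B" "B \<subseteq> ZJ (insert j J)"
    and fin: "finite (cosets (ZJ (insert j J)) B)"
  obtains p :: nat and z where "p \<ge> 1" "z \<in> B" "z $ j = real p"
    "\<And>x. x \<in> B \<Longrightarrow> \<exists>k\<in>\<int>. x $ j = k * real p"
    "subgrp (slice j B)" "slice j B \<subseteq> ZJ J"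
    "finite (cosets (ZJ J) (slice j B))"
    "idx (ZJ J) (slice j B) * p \<le> idx (ZJ (insert j J)) B"
proof -
  let ?A = "ZJ (insert j J)" and ?B' = "slice j B"
  have B': "?B' = ZJ J \<inter> B"
  proof (intro equalityI subsetI)
    fix x assume "x \<in> ?B'"
    then have "x \<in> B" "x $ j = 0" "x \<in> ZJ (insert j J)" using B(2) by auto
    then show "x \<in> ZJ J \<inter> B" unfolding ZJ_def by auto
  next
    fix x assume "x \<in> ZJ J \<inter> B"
    then show "x \<in> ?B'" using j by (auto simp: ZJ_def)
  qed
  have sgB': "subgrp ?B'" using B(1) by (auto simp: subgrp_def)
  have fin': "finite (cosets (ZJ J) ?B')"
    unfolding B' by (rule finite_cosets_restrict(1)[OF subgrp_ZJ B subgrp_ZJ ZJ_mono fin]) auto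
  define G where "G = (\<lambda>x. x $ j) ` B"
  \<comment> \<open>Finite index is what supplies an element of B with nonzero j-th
    coordinate.\<close>
  have "of_nat (idx ?A B) *\<^sub>R axis j 1 \<in> B"
    by (rule idx_scaleR_mem[OF subgrp_ZJ B fin]) (simp add: axis_in_ZJ)
  then have "(of_nat (idx ?A B) *\<^sub>R axis j 1) $ j \<in> G" unfolding G_def by (rule imageI)
  then have "real (idx ?A B) \<in> G" by simp
  then have Gex: "\<exists>x\<in>G. x \<noteq> 0" using idx_pos[OF subgrp_ZJ fin] by (intro bexI) auto
  have Gd: "x - y \<in> G" if xy: "x \<in> G" "y \<in> G" for x y
  proof -
    obtain a b where "a \<in> B" "b \<in> B" "x = a $ j" "y = b $ j" using xy unfolding G_def by blast
    then have "(a - b) $ j \<in> G" unfolding G_def by (intro imageI subgrp_diff[OF B(1)])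
    then show ?thesis using \<open>x = a $ j\<close> \<open>y = b $ j\<close> by simp
  qed
  have G0: "0 \<in> G"
    unfolding G_def using imageI[OF subgrp_zero[OF B(1)], of "\<lambda>x. x $ j"] by simp
  have GZ: "G \<subseteq> \<int>" using B(2) by (auto simp: G_def ZJ_def)
  obtain p :: nat where p: "p \<ge> 1" "real p \<in> G" "\<And>x. x \<in> G \<Longrightarrow> \<exists>k\<in>\<int>. x = k * real p"
    by (rule Ints_pos_generator[OF Gd G0 GZ Gex]) blast+
  obtain z where z: "z \<in> B" "z $ j = real p" using p(2) unfolding G_def by auto
  obtain R where R: "R \<subseteq> ZJ J" "separated ?B' R" "finite R" "card R = idx (ZJ J) ?B'"
    by (rule transversal_exists[OF subgrp_ZJ sgB' _ fin']) (use B' in blast)+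
  let ?f = "\<lambda>(r, t). r + of_nat t *\<^sub>R axis j 1"
  \<comment> \<open>The vectors \<open>r + t e_j\<close> with \<open>t < p\<close> are pairwise
    incongruent modulo B; they account for the factor p in the index.\<close>
  have key: "r = r' \<and> t = t'"
    if "r \<in> R" "r' \<in> R" "t < p" "t' < p" "(r + of_nat t *\<^sub>R axis j 1) - (r' + of_nat t' *\<^sub>R axis j 1) \<in> B"
    for r r' t t'
  proof -
    have rj: "r $ j = 0" "r' $ j = 0" using that R(1) j by (auto simp: ZJ_def)
    have "real t - real t' \<in> G"
      unfolding G_def using imageI[OF that(5), of "\<lambda>x. x $ j"] rj by simp
    then obtain k where k: "k \<in> \<int>" "real t - real t' = k * real p" using p(3) by blast
    then obtain k' :: int where k': "k = of_int k'" by (auto elim: Ints_cases)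
    have "int t - int t' = k' * int p" using k(2) unfolding k'
      by (metis of_int_diff of_int_eq_iff of_int_mult of_int_of_nat_eq)
    moreover have "\<bar>int t - int t'\<bar> < int p" using that by auto
    ultimately have "\<bar>k'\<bar> * int p < 1 * int p" by (simp add: abs_mult)
    then have "\<bar>k'\<bar> < 1" using p(1) by (subst (asm) mult_less_cancel_right) auto
    then have "t = t'" using \<open>int t - int t' = k' * int p\<close> by simp
    then show ?thesis using that R(2) rj by (auto simp: separated_def)
  qed
  have inj: "inj_on ?f (R \<times> {..<p})"
    using key subgrp_zero[OF B(1)] unfolding inj_on_def by fastforce
  have "card (?f ` (R \<times> {..<p})) \<le> idx ?A B"
  proof (rule separated_card_le(2)[OF subgrp_ZJ B fin])
    show "?f ` (R \<times> {..<p}) \<subseteq> ?A"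
    proof safe
      fix r t assume "r \<in> R"
      then have "r \<in> ?A" using R(1) ZJ_mono[of J "insert j J"] by auto
      then show "r + of_nat t *\<^sub>R axis j 1 \<in> ?A"
        by (intro subgrp_add[OF subgrp_ZJ] subgrp_of_nat_scaleR[OF subgrp_ZJ] axis_in_ZJ) auto
    qed
    show "separated B (?f ` (R \<times> {..<p}))"
      unfolding separated_def using key by fastforce
  qed
  then have le: "idx (ZJ J) ?B' * p \<le> idx ?A B"
    using card_image[OF inj] R(4) by (simp add: card_cartesian_product)
  have gen: "\<exists>k\<in>\<int>. x $ j = k * real p" if "x \<in> B" for x
    by (rule p(3)) (unfold G_def, rule imageI[OF that])
  have sub: "?B' \<subseteq> ZJ J" unfolding B' by blast
  show thesis
    by (rule that[of p z]) (fact p(1) z gen sgB' sub fin' le)+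
qed

text \<open>The integer \<open>L * (x - y)\<close> vanishes once its absolute value is below 1, so
  the floor of \<open>L * x\<close>, which takes L values, separates the points.\<close>

lemma card_unit_interval_steps:
  fixes D :: "real set"
  assumes "\<And>x. x \<in> D \<Longrightarrow> 0 \<le> x \<and> x < 1" "L \<ge> (1::nat)"
    "\<And>x y. x \<in> D \<Longrightarrow> y \<in> D \<Longrightarrow> real L * (x - y) \<in> \<int>"
  shows "finite D" "card D \<le> L"
proof -
  let ?f = "\<lambda>x. \<lfloor>real L * x\<rfloor>"
  have inj: "inj_on ?f D"
  proof (rule inj_onI)
    fix x y assume xy: "x \<in> D" "y \<in> D" "?f x = ?f y"
    then have "\<bar>real L * x - real L * y\<bar> < 1" by linarith
    then have "\<bar>real L * (x - y)\<bar> < 1" by (simp add: algebra_simps)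
    then have "real L * (x - y) = 0" using assms(3)[OF xy(1,2)] by (metis Ints_nonzero_abs_less1)
    then show "x = y" using assms(2) by simp
  qed
  have sub: "?f ` D \<subseteq> {0..<int L}"
  proof safe
    fix x assume "x \<in> D"
    then have "0 \<le> x" "x < 1" using assms(1) by auto
    then show "?f x \<in> {0..<int L}" using assms(2) by (auto simp: floor_less_iff)
  qed
  show "finite D" using inj sub by (meson finite_atLeastLessThan_int finite_imageD finite_subset)
  show "card D \<le> L" using card_image[OF inj] card_mono[OF _ sub] by simp
qed

lemma card_fibres_le:
  assumes "finite (f ` A)" "\<And>y. y \<in> f ` A \<Longrightarrow> finite {x\<in>A. f x = y}"
    "\<And>y. y \<in> f ` A \<Longrightarrow> card {x\<in>A. f x = y} \<le> (g y :: nat)"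
  shows "finite A" "card A \<le> (\<Sum>y\<in>f ` A. g y)"
proof -
  have A: "A = (\<Union>y\<in>f ` A. {x\<in>A. f x = y})" by auto
  show "finite A" by (subst A, rule finite_UN_I) (use assms in auto)
  have "card A \<le> (\<Sum>y\<in>f ` A. card {x\<in>A. f x = y})"
    by (subst A) (use assms(1) card_UN_le in blast)
  also have "\<dots> \<le> (\<Sum>y\<in>f ` A. g y)" by (intro sum_mono assms(3))
  finally show "card A \<le> (\<Sum>y\<in>f ` A. g y)" .
qed

text \<open>For \<open>k = 1\<close>: a finite abelian group has at most as many characters as elements.\<close>

lemma card_dual_le:
  fixes B :: "(real^'n::finite) set" and k :: nat
  assumes "finite J" "subgrp B" "B \<subseteq> ZJ J" "finite (cosets (ZJ J) B)" "U \<subseteq> unit_cube J" "k \<ge> 1"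
    "\<And>u v y. u \<in> U \<Longrightarrow> v \<in> U \<Longrightarrow> y \<in> B \<Longrightarrow> real k * ((u - v) \<bullet> y) \<in> \<int>"
  shows "finite U \<and> card U \<le> k ^ card J * idx (ZJ J) B"
  using assms
proof (induction J arbitrary: B U rule: finite_induct)
  case empty
  then have U: "U \<subseteq> {0}" by (auto simp: unit_cube_def vec_eq_iff)
  have "finite U" using finite_subset[OF U] by simp
  moreover have "card U \<le> 1" using card_mono[OF _ U] by simp
  moreover have "idx (ZJ {}) B \<ge> 1" by (rule idx_pos[OF subgrp_ZJ empty.prems(3)])
  ultimately show ?case by (auto intro: le_trans)
next
  case (insert j J)
  let ?B' = "slice j B"
  obtain p z where p: "p \<ge> 1" "z \<in> B" "z $ j = real p"
    and "\<And>x. x \<in> B \<Longrightarrow> \<exists>k\<in>\<int>. x $ j = k * real p"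
    and B': "subgrp ?B'" "?B' \<subseteq> ZJ J" "finite (cosets (ZJ J) ?B')"
    and le: "idx (ZJ J) ?B' * p \<le> idx (ZJ (insert j J)) B"
    by (rule triangular_step[OF insert.hyps(2) insert.prems(1-3)]) (rule that; assumption)
  have IH: "finite (proj_on J ` U) \<and> card (proj_on J ` U) \<le> k ^ card J * idx (ZJ J) ?B'"
  proof (rule insert.IH[OF B' _ insert.prems(5)])
    show "proj_on J ` U \<subseteq> unit_cube J" using insert.prems(4) by (auto simp: unit_cube_def)
    fix u v y assume u: "u \<in> proj_on J ` U" "v \<in> proj_on J ` U" and y: "y \<in> ?B'"
    have y0: "y $ i = 0" if "i \<notin> J" for i using y B'(2) that by (auto simp: ZJ_def)
    have *: "proj_on J a \<bullet> y = a \<bullet> y" for a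
      unfolding inner_vec_def by (intro sum.cong) (auto simp: y0)
    obtain u' v' where "u' \<in> U" "v' \<in> U" "u = proj_on J u'" "v = proj_on J v'" using u by auto
    then have "(u - v) \<bullet> y = (u' - v') \<bullet> y" by (simp add: inner_diff_left *)
    then show "real k * ((u - v) \<bullet> y) \<in> \<int>" using insert.prems(6)[of u' v' y] \<open>u' \<in> U\<close> \<open>v' \<in> U\<close> y by simp
  qed
  \<comment> \<open>Points of a fibre differ in the j-th coordinate only. Pairing their difference
    with z, whose j-th coordinate is p, shows that \<open>k * p\<close> times it is an
    integer.\<close>
  have fib: "finite {u\<in>U. proj_on J u = c} \<and> card {u\<in>U. proj_on J u = c} \<le> k * p" for c
  proof -
    let ?F = "{u\<in>U. proj_on J u = c}"
    have same: "u $ i = v $ i" if "u \<in> ?F" "v \<in> ?F" "i \<noteq> j" for u v i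
    proof (cases "i \<in> J")
      case True
      then have "u $ i = proj_on J u $ i" "v $ i = proj_on J v $ i" by auto
      moreover have "proj_on J u = proj_on J v" using that by simp
      ultimately show ?thesis by metis
    next
      case False
      have "u \<in> unit_cube (insert j J)" "v \<in> unit_cube (insert j J)" using that insert.prems(4) by auto
      then show ?thesis using False that(3) by (simp add: unit_cube_def)
    qed
    have inj: "inj_on (\<lambda>u. u $ j) ?F"
    proof (rule inj_onI)
      fix u v assume uv: "u \<in> ?F" "v \<in> ?F" "u $ j = v $ j"
      then have "u $ i = v $ i" for i using same[OF uv(1,2)] by (cases "i = j") auto
      then show "u = v" by (simp add: vec_eq_iff)
    qed
    let ?D = "(\<lambda>u. u $ j) ` ?F"
    have D01: "0 \<le> x \<and> x < 1" if "x \<in> ?D" for x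
      using that insert.prems(4) unfolding unit_cube_def by auto
    have kp: "1 \<le> k * p" using p(1) insert.prems(5) by auto
    have Dk: "real (k * p) * (x - y) \<in> \<int>" if xy: "x \<in> ?D" "y \<in> ?D" for x y
    proof -
        obtain u where u: "u \<in> ?F" "x = u $ j" using xy(1) by blast
        obtain v where v: "v \<in> ?F" "y = v $ j" using xy(2) by blast
        note uv = u(1) v(1) u(2) v(2)
        have "(u - v) \<bullet> z = (\<Sum>i\<in>UNIV. if i = j then (u $ j - v $ j) * real p else 0)"
          unfolding inner_vec_def
        proof (intro sum.cong refl)
          fix i show "(u - v) $ i \<bullet> z $ i = (if i = j then (u $ j - v $ j) * real p else 0)"
            using same[OF uv(1,2), of i] p(3) by auto
        qed
        then have *: "(u - v) \<bullet> z = (x - y) * real p" using uv(3,4) by simp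
        have "real k * ((u - v) \<bullet> z) \<in> \<int>" using uv(1,2) p(2) by (intro insert.prems(6)) auto
        then show ?thesis unfolding * by (simp add: algebra_simps)
    qed
    have D: "finite ?D" "card ?D \<le> k * p"
      using card_unit_interval_steps[OF D01 kp Dk] by blast+
    show ?thesis using D finite_imageD[OF D(1) inj] card_image[OF inj] by simp
  qed
  have "finite U" "card U \<le> (\<Sum>y\<in>proj_on J ` U. k * p)"
    using card_fibres_le[of "proj_on J" U "\<lambda>_. k * p"] IH fib by blast+
  moreover have "(\<Sum>y\<in>proj_on J ` U. k * p) \<le> k ^ card J * idx (ZJ J) ?B' * (k * p)"
    using IH by simp
  moreover have "k ^ card J * idx (ZJ J) ?B' * (k * p) \<le> k ^ card (insert j J) * idx (ZJ (insert j J)) B"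
    using le insert.hyps by (simp add: mult.assoc mult.left_commute)
  ultimately show ?case by linarith
qed

section \<open>Counting rational symmetric matrices by their denominators\<close>

definition prs :: "'n set \<Rightarrow> 'n uprod set" where
  "prs J = {p. set_uprod p \<subseteq> J}"

lemma Upair_in_prs [simp]: "Upair i j \<in> prs J \<longleftrightarrow> i \<in> J \<and> j \<in> J"
  by (simp add: prs_def)

lemma prs_empty [simp]: "prs {} = {}"
proof -
  have "p \<notin> prs {}" for p :: "'a uprod" by (cases p) simp
  then show ?thesis by blast
qed

text \<open>Row vector times symmetric matrix, restricted to the block J. A matrix is a function on
  unordered pairs, so its symmetry needs no hypothesis.\<close>

definition mulW :: "'n::finite set \<Rightarrow> real^'n \<Rightarrow> ('n uprod \<Rightarrow> real) \<Rightarrow> real^'n" where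
  "mulW J x w = (\<chi> i. if i \<in> J then \<Sum>l\<in>J. x $ l * w (Upair l i) else 0)"

definition cubeS :: "'n set \<Rightarrow> ('n uprod \<Rightarrow> real) set" where
  "cubeS J = {w. (\<forall>p\<in>prs J. 0 \<le> w p \<and> w p < 1) \<and> (\<forall>p. p \<notin> prs J \<longrightarrow> w p = 0)}"

definition HW :: "'n::finite set \<Rightarrow> (real^'n) set \<Rightarrow> (real^'n) set \<Rightarrow> ('n uprod \<Rightarrow> real) \<Rightarrow> (real^'n) set" where
  "HW J \<Gamma> \<Lambda> w = {x\<in>\<Gamma>. mulW J x w \<in> \<Lambda>}"

text \<open>\<Lambda> lies between \<open>ZJ J\<close> and the dual of \<Gamma>. The counting is
  done for all such pairs because removing a coordinate replaces \<Gamma> by a slice and \<Lambda>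
  by a projection; it is later applied to integer points of a subspace and restrictions of integer
  vectors to it.\<close>

definition paired :: "'n::finite set \<Rightarrow> (real^'n) set \<Rightarrow> (real^'n) set \<Rightarrow> bool" where
  "paired J \<Gamma> \<Lambda> \<longleftrightarrow> subgrp \<Gamma> \<and> \<Gamma> \<subseteq> ZJ J \<and> subgrp \<Lambda> \<and> \<Lambda> \<subseteq> supp_on J \<and> ZJ J \<subseteq> \<Lambda> \<and>
     (\<forall>l\<in>\<Lambda>. \<forall>x\<in>\<Gamma>. l \<bullet> x \<in> \<int>)"

text \<open>\<open>cubeS\<close> picks representatives modulo integral matrices, and the index of
  \<open>HW\<close> plays the role of the denominator of w.\<close>

definition WCset :: "'n::finite set \<Rightarrow> (real^'n) set \<Rightarrow> (real^'n) set \<Rightarrow> nat \<Rightarrow> ('n uprod \<Rightarrow> real) set" where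
  "WCset J \<Gamma> \<Lambda> N = {w\<in>cubeS J. finite (cosets (ZJ J) (HW J \<Gamma> \<Lambda> w)) \<and> idx (ZJ J) (HW J \<Gamma> \<Lambda> w) \<le> N}"

lemma mulW_nth: "mulW J x w $ i = (if i \<in> J then \<Sum>l\<in>J. x $ l * w (Upair l i) else 0)"
  by (simp add: mulW_def)

lemma mulW_diff: "mulW J (x - y) w = mulW J x w - mulW J y w"
  by (simp add: vec_eq_iff mulW_nth left_diff_distrib sum_subtractf)

lemma mulW_scaleR: "mulW J (c *\<^sub>R x) w = c *\<^sub>R mulW J x w"
  by (simp add: vec_eq_iff mulW_nth sum_distrib_left mult.assoc)

lemma mulW_zero [simp]: "mulW J 0 w = 0"
  by (simp add: vec_eq_iff mulW_nth)

lemma mulW_add: "mulW J (x + y) w = mulW J x w + mulW J y w"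
  by (simp add: vec_eq_iff mulW_nth distrib_right sum.distrib)

lemma mulW_in_supp: "mulW J x w \<in> supp_on J"
  by (simp add: supp_on_def mulW_nth)

lemma inner_supp_on:
  assumes "y \<in> supp_on J"
  shows "x \<bullet> y = (\<Sum>i\<in>J. x $ i * y $ i)"
proof -
  have "x \<bullet> y = (\<Sum>i\<in>UNIV. x $ i * y $ i)" by (simp add: inner_vec_def)
  also have "\<dots> = (\<Sum>i\<in>J. x $ i * y $ i)"
    using assms by (intro sum.mono_neutral_right) (auto simp: supp_on_def)
  finally show ?thesis .
qed

lemma ZJ_supp: "ZJ J \<subseteq> supp_on J"
  by (auto simp: ZJ_def supp_on_def)

lemma inner_mulW_swap:
  assumes "y \<in> supp_on J" "x \<in> supp_on J"
  shows "mulW J x w \<bullet> y = x \<bullet> mulW J y w"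
proof -
  have "mulW J x w \<bullet> y = (\<Sum>i\<in>J. \<Sum>l\<in>J. x $ l * w (Upair l i) * y $ i)"
    unfolding inner_supp_on[OF assms(1)] by (simp add: mulW_nth sum_distrib_right)
  also have "\<dots> = (\<Sum>l\<in>J. \<Sum>i\<in>J. x $ l * w (Upair l i) * y $ i)" by (rule sum.swap)
  also have "\<dots> = (\<Sum>l\<in>J. x $ l * (\<Sum>i\<in>J. y $ i * w (Upair i l)))"
  proof (intro sum.cong refl)
    fix l
    have "w (Upair l i) = w (Upair i l)" for i by (rule arg_cong[where f = w]) simp
    then show "(\<Sum>i\<in>J. x $ l * w (Upair l i) * y $ i) = x $ l * (\<Sum>i\<in>J. y $ i * w (Upair i l))"
      by (simp add: sum_distrib_left algebra_simps)
  qed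
  also have "\<dots> = x \<bullet> mulW J y w"
    unfolding inner_supp_on[OF mulW_in_supp] by (simp add: mulW_nth)
  finally show ?thesis .
qed

lemma subgrp_HW: "paired J \<Gamma> \<Lambda> \<Longrightarrow> subgrp (HW J \<Gamma> \<Lambda> w)"
  by (auto simp: paired_def HW_def subgrp_def mulW_diff)

lemma HW_subset: "HW J \<Gamma> \<Lambda> w \<subseteq> \<Gamma>"
  by (auto simp: HW_def)

text \<open>For x with \<open>x $ j = 0\<close> the pairing with l sees only the projection of l to
  J. This makes induction on J possible.\<close>

lemma paired_slice:
  assumes "paired (insert j J) \<Gamma> \<Lambda>" "j \<notin> J"
  shows "paired J (slice j \<Gamma>) (proj_on J ` \<Lambda>)"
proof -
  have G: "subgrp \<Gamma>" "\<Gamma> \<subseteq> ZJ (insert j J)" and L: "subgrp \<Lambda>" "ZJ (insert j J) \<subseteq> \<Lambda>"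
    and GL: "\<And>l x. l \<in> \<Lambda> \<Longrightarrow> x \<in> \<Gamma> \<Longrightarrow> l \<bullet> x \<in> \<int>"
    using assms(1) by (auto simp: paired_def)
  have "subgrp (slice j \<Gamma>)" using G(1) by (auto simp: subgrp_def)
  moreover have sl: "slice j \<Gamma> \<subseteq> ZJ J"
  proof
    fix x assume "x \<in> slice j \<Gamma>"
    then have "x \<in> ZJ (insert j J)" "x $ j = 0" using G(2) by auto
    then show "x \<in> ZJ J" by (auto simp: ZJ_def)
  qed
  moreover have "subgrp (proj_on J ` \<Lambda>)"
    unfolding subgrp_def
  proof (intro conjI ballI)
    show "0 \<in> proj_on J ` \<Lambda>"
      using subgrp_zero[OF L(1)] by (intro image_eqI[of _ _ 0]) (auto simp: vec_eq_iff)
    fix x y assume "x \<in> proj_on J ` \<Lambda>" "y \<in> proj_on J ` \<Lambda>"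
    then obtain a b where "a \<in> \<Lambda>" "b \<in> \<Lambda>" "x = proj_on J a" "y = proj_on J b" by blast
    then show "x - y \<in> proj_on J ` \<Lambda>"
      using subgrp_diff[OF L(1)] by (intro image_eqI[of _ _ "a - b"]) (auto simp: vec_eq_iff)
  qed
  moreover have "proj_on J ` \<Lambda> \<subseteq> supp_on J" by (auto simp: supp_on_def)
  moreover have "ZJ J \<subseteq> proj_on J ` \<Lambda>"
  proof
    fix x assume x: "x \<in> ZJ J"
    then have "x = proj_on J x" by (auto simp: ZJ_def vec_eq_iff)
    moreover have "x \<in> \<Lambda>" using x L(2) ZJ_mono[of J "insert j J"] by blast
    ultimately show "x \<in> proj_on J ` \<Lambda>" by (rule image_eqI)
  qed
  moreover have "l \<bullet> x \<in> \<int>" if l: "l \<in> proj_on J ` \<Lambda>" and x: "x \<in> slice j \<Gamma>" for l x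
  proof -
    obtain a where a: "a \<in> \<Lambda>" "l = proj_on J a" using l by blast
    have xs: "x \<in> supp_on J" using x sl ZJ_supp by blast
    have "l \<bullet> x = a \<bullet> x" unfolding a(2) inner_supp_on[OF xs] by (intro sum.cong) auto
    then show ?thesis using GL[OF a(1)] x by simp
  qed
  ultimately show ?thesis unfolding paired_def by blast
qed

section \<open>Removing the row and column of one index from a symmetric matrix\<close>

definition restrW :: "'n set \<Rightarrow> ('n uprod \<Rightarrow> real) \<Rightarrow> 'n uprod \<Rightarrow> real" where
  "restrW J w = (\<lambda>p. if p \<in> prs J then w p else 0)"

definition colW :: "'n::finite \<Rightarrow> 'n set \<Rightarrow> ('n uprod \<Rightarrow> real) \<Rightarrow> real^'n" where
  "colW j J w = (\<chi> i. if i \<in> J then w (Upair j i) else 0)"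

lemma mulW_restrW [simp]: "mulW J x (restrW J w) = mulW J x w"
  by (auto simp: vec_eq_iff mulW_nth restrW_def intro!: sum.cong)

lemma HW_restrW [simp]: "HW J \<Gamma> \<Lambda> (restrW J w) = HW J \<Gamma> \<Lambda> w"
  by (simp add: HW_def)

lemma mulW_insert_proj:
  assumes "j \<notin> J" "finite J"
  shows "proj_on J (mulW (insert j J) x w) = mulW J x w + x $ j *\<^sub>R colW j J w"
  using assms by (simp add: vec_eq_iff mulW_nth colW_def)

lemma mulW_insert_j:
  assumes "j \<notin> J" "finite J"
  shows "mulW (insert j J) x w $ j = x \<bullet> colW j J w + x $ j * w (Upair j j)"
proof -
  have c: "colW j J w \<in> supp_on J" by (simp add: supp_on_def colW_def)
  have "(\<Sum>l\<in>J. x $ l * w (Upair l j)) = (\<Sum>l\<in>J. x $ l * colW j J w $ l)"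
  proof (intro sum.cong refl)
    fix l assume "l \<in> J"
    have "w (Upair l j) = w (Upair j l)" by (rule arg_cong[where f = w]) simp
    then show "x $ l * w (Upair l j) = x $ l * colW j J w $ l" using \<open>l \<in> J\<close> by (simp add: colW_def)
  qed
  then show ?thesis using assms by (simp add: mulW_nth inner_supp_on[OF c])
qed

lemma mulW_split_diff:
  assumes "j \<notin> J" "finite J" "mulW J x w = mulW J x v" "x $ j *\<^sub>R colW j J w = x $ j *\<^sub>R colW j J v"
  shows "mulW (insert j J) x w - mulW (insert j J) x v =
    ((x \<bullet> colW j J w + x $ j * w (Upair j j)) - (x \<bullet> colW j J v + x $ j * v (Upair j j))) *\<^sub>R axis j 1"
    (is "?l = ?r")
proof -
  have "?l $ i = ?r $ i" for i
  proof (cases "i = j")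
    case True
    then show ?thesis by (simp add: mulW_insert_j[OF assms(1,2)])
  next
    case False
    show ?thesis
    proof (cases "i \<in> J")
      case True
      have "proj_on J (mulW (insert j J) x w) $ i = proj_on J (mulW (insert j J) x v) $ i"
        unfolding mulW_insert_proj[OF assms(1,2)] assms(3,4) ..
      then show ?thesis using True False by (simp add: axis_def)
    next
      case nJ: False
      then show ?thesis using False by (simp add: mulW_nth axis_def)
    qed
  qed
  then show ?thesis by (simp add: vec_eq_iff)
qed

text \<open>The x for which all coordinates of \<open>x W\<close> but the j-th satisfy the
  integrality condition. It lies between \<open>HW\<close> and \<Gamma>, depends on the block and
  the column of w but not on the corner \<open>w (Upair j j)\<close>, and its slice is the lattice
  of the block.\<close>

definition H1 :: "'n::finite \<Rightarrow> 'n set \<Rightarrow> (real^'n) set \<Rightarrow> (real^'n) set \<Rightarrow> ('n uprod \<Rightarrow> real) \<Rightarrow> (real^'n) set" where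
  "H1 j J \<Gamma> \<Lambda> w = {x\<in>\<Gamma>. mulW J x w + x $ j *\<^sub>R colW j J w \<in> proj_on J ` \<Lambda>}"

lemma H1_props:
  assumes "paired (insert j J) \<Gamma> \<Lambda>" "j \<notin> J" "finite J"
  shows "subgrp (H1 j J \<Gamma> \<Lambda> w)" "H1 j J \<Gamma> \<Lambda> w \<subseteq> \<Gamma>" "HW (insert j J) \<Gamma> \<Lambda> w \<subseteq> H1 j J \<Gamma> \<Lambda> w"
    "slice j (H1 j J \<Gamma> \<Lambda> w) = HW J (slice j \<Gamma>) (proj_on J ` \<Lambda>) w"
proof -
  have P: "subgrp \<Gamma>" "subgrp (proj_on J ` \<Lambda>)"
    using assms paired_slice[OF assms(1,2)] by (auto simp: paired_def)
  show "subgrp (H1 j J \<Gamma> \<Lambda> w)"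
    unfolding subgrp_def
  proof (intro conjI ballI)
    show "0 \<in> H1 j J \<Gamma> \<Lambda> w" using subgrp_zero[OF P(1)] subgrp_zero[OF P(2)] by (simp add: H1_def)
    fix x y assume xy: "x \<in> H1 j J \<Gamma> \<Lambda> w" "y \<in> H1 j J \<Gamma> \<Lambda> w"
    have "mulW J (x - y) w + (x - y) $ j *\<^sub>R colW j J w =
      (mulW J x w + x $ j *\<^sub>R colW j J w) - (mulW J y w + y $ j *\<^sub>R colW j J w)"
      by (simp add: mulW_diff scaleR_diff_left)
    also have "\<dots> \<in> proj_on J ` \<Lambda>" using xy subgrp_diff[OF P(2)] unfolding H1_def by blast
    finally show "x - y \<in> H1 j J \<Gamma> \<Lambda> w" using xy subgrp_diff[OF P(1)] unfolding H1_def by blast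
  qed
  show "H1 j J \<Gamma> \<Lambda> w \<subseteq> \<Gamma>" unfolding H1_def by blast
  show "HW (insert j J) \<Gamma> \<Lambda> w \<subseteq> H1 j J \<Gamma> \<Lambda> w"
    unfolding HW_def H1_def mulW_insert_proj[OF assms(2,3), symmetric] by blast
  show "slice j (H1 j J \<Gamma> \<Lambda> w) = HW J (slice j \<Gamma>) (proj_on J ` \<Lambda>) w"
    unfolding slice_def HW_def H1_def by auto
qed

text \<open>With the block fixed, the column is counted by \<open>card_dual_le\<close> against the
  lattice of the block. Its denominator divides both \<open>p * k\<close> and \<open>p * m\<close>,
  for two different reasons, whence the minimum. Given the column, the corner has at most
  \<open>p * p * m * k\<close> values.\<close>

lemma WC_fibre:
  fixes p m k :: nat
  assumes P: "paired (insert j J) \<Gamma> \<Lambda>" "j \<notin> J" "finite J"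
    and g: "g \<in> \<Gamma>" "g $ j = real p" and pos: "p \<ge> 1" "m \<ge> 1" "k \<ge> 1"
    and F: "\<And>w. w \<in> F \<Longrightarrow> w \<in> cubeS (insert j J)" "\<And>w. w \<in> F \<Longrightarrow> restrW J w = w'"
      "\<And>w. w \<in> F \<Longrightarrow> \<exists>x\<in>H1 j J \<Gamma> \<Lambda> w. x $ j = real (p * m)"
      "\<And>w x. w \<in> F \<Longrightarrow> x \<in> H1 j J \<Gamma> \<Lambda> w \<Longrightarrow> real k *\<^sub>R x \<in> HW (insert j J) \<Gamma> \<Lambda> w"
    and fin: "finite (cosets (ZJ J) (HW J (slice j \<Gamma>) (proj_on J ` \<Lambda>) w'))"
  shows "finite F \<and> card F \<le> idx (ZJ J) (HW J (slice j \<Gamma>) (proj_on J ` \<Lambda>) w') *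
     (p * min m k) ^ card J * (p * p * m * k)"
proof -
  let ?H = "HW J (slice j \<Gamma>) (proj_on J ` \<Lambda>) w'"
  have P': "paired J (slice j \<Gamma>) (proj_on J ` \<Lambda>)" by (rule paired_slice[OF P(1,2)])
  have sgH: "subgrp ?H" by (rule subgrp_HW[OF P'])
  have HZ: "?H \<subseteq> ZJ J" using HW_subset P' unfolding paired_def by blast
  have GL: "\<And>l x. l \<in> \<Lambda> \<Longrightarrow> x \<in> \<Gamma> \<Longrightarrow> l \<bullet> x \<in> \<int>" and sgL: "subgrp \<Lambda>" and sgG: "subgrp \<Gamma>"
    and GZ: "\<Gamma> \<subseteq> ZJ (insert j J)"
    using P(1) unfolding paired_def by blast+
  have GL': "\<And>l x. l \<in> proj_on J ` \<Lambda> \<Longrightarrow> x \<in> slice j \<Gamma> \<Longrightarrow> l \<bullet> x \<in> \<int>" and sgL': "subgrp (proj_on J ` \<Lambda>)"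
    and slZ: "slice j \<Gamma> \<subseteq> ZJ J"
    using P' unfolding paired_def by blast+
  have mw: "mulW J x w = mulW J x w'" if "w \<in> F" for x w
    using F(2)[OF that] mulW_restrW[of J x w] by simp
  have sym: "x \<bullet> colW j J w = colW j J w \<bullet> x" for x w by (rule inner_commute)
  have gax: "(c *\<^sub>R axis j 1) \<bullet> g = c * real p" for c
    by (simp add: inner_axis' g(2))
  have U: "colW j J ` F \<subseteq> unit_cube J"
  proof
    fix u assume "u \<in> colW j J ` F"
    then obtain w where "w \<in> F" "u = colW j J w" by blast
    then show "u \<in> unit_cube J" using F(1)[of w] by (auto simp: unit_cube_def colW_def cubeS_def)
  qed
  \<comment> \<open>A vector y of the block lattice has \<open>y $ j = 0\<close>, so it lies in
    \<open>H1\<close> for every w in F, and \<open>real k *\<^sub>R y\<close> is mapped into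
    \<Lambda> by both matrices. The two images differ by a multiple of \<open>axis j 1\<close>;
    pairing with g, whose j-th coordinate is p, yields the integer.\<close>
  have k1: "real (p * k) * ((u - v) \<bullet> y) \<in> \<int>"
    if uv: "u \<in> colW j J ` F" "v \<in> colW j J ` F" and y: "y \<in> ?H" for u v y
  proof -
    obtain w1 where w1: "w1 \<in> F" "u = colW j J w1" using uv(1) by blast
    obtain w2 where w2: "w2 \<in> F" "v = colW j J w2" using uv(2) by blast
    have yj: "y $ j = 0" and yG: "y \<in> \<Gamma>" and yL: "mulW J y w' \<in> proj_on J ` \<Lambda>"
      using y by (auto simp: HW_def)
    have yH: "y \<in> H1 j J \<Gamma> \<Lambda> w" if "w \<in> F" for w
      unfolding H1_def using yG yL yj mw[OF that] by simp
    have "mulW (insert j J) (real k *\<^sub>R y) w1 - mulW (insert j J) (real k *\<^sub>R y) w2 \<in> \<Lambda>"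
      using F(4)[OF w1(1) yH[OF w1(1)]] F(4)[OF w2(1) yH[OF w2(1)]] subgrp_diff[OF sgL]
      unfolding HW_def by blast
    also have "mulW (insert j J) (real k *\<^sub>R y) w1 - mulW (insert j J) (real k *\<^sub>R y) w2 =
      (real k * ((u - v) \<bullet> y)) *\<^sub>R axis j 1"
      by (subst mulW_split_diff[OF P(2,3)])
        (use yj mw[OF w1(1)] mw[OF w2(1)] w1 w2 in \<open>simp_all add: sym inner_diff_left algebra_simps\<close>)
    finally have "((real k * ((u - v) \<bullet> y)) *\<^sub>R axis j 1) \<bullet> g \<in> \<int>" using GL g(1) by blast
    then show ?thesis unfolding gax by (simp add: mult_ac)
  qed
  \<comment> \<open>Vectors of \<open>H1\<close> with j-th coordinate \<open>p * m\<close> express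
    \<open>p * m\<close> times a column up to the image of a block vector. The difference
    \<open>x1 - x2\<close> is moved to the other side of the symmetric block, where it pairs
    integrally with the image of y.\<close>
  have k2: "real (p * m) * ((u - v) \<bullet> y) \<in> \<int>"
    if uv: "u \<in> colW j J ` F" "v \<in> colW j J ` F" and y: "y \<in> ?H" for u v y
  proof -
    obtain w1 where w1: "w1 \<in> F" "u = colW j J w1" using uv(1) by blast
    obtain w2 where w2: "w2 \<in> F" "v = colW j J w2" using uv(2) by blast
    obtain x1 where x1: "x1 \<in> H1 j J \<Gamma> \<Lambda> w1" "x1 $ j = real (p * m)" using F(3)[OF w1(1)] by blast
    obtain x2 where x2: "x2 \<in> H1 j J \<Gamma> \<Lambda> w2" "x2 $ j = real (p * m)" using F(3)[OF w2(1)] by blast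
    have ys: "y \<in> slice j \<Gamma>" and yL: "mulW J y w' \<in> proj_on J ` \<Lambda>" using y by (auto simp: HW_def)
    have x12: "x1 - x2 \<in> slice j \<Gamma>"
      using x1 x2 subgrp_diff[OF sgG, of x1 x2] by (auto simp: H1_def)
    have a: "(mulW J x1 w' + real (p * m) *\<^sub>R u) \<bullet> y \<in> \<int>"
      using x1 GL'[OF _ ys] mw[OF w1(1)] w1(2) unfolding H1_def by auto
    have b: "(mulW J x2 w' + real (p * m) *\<^sub>R v) \<bullet> y \<in> \<int>"
      using x2 GL'[OF _ ys] mw[OF w2(1)] w2(2) unfolding H1_def by auto
    have "mulW J (x1 - x2) w' \<bullet> y = (x1 - x2) \<bullet> mulW J y w'"
      using x12 ys slZ ZJ_supp by (intro inner_mulW_swap) blast+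
    also have "\<dots> \<in> \<int>" using GL'[OF yL x12] by (simp add: inner_commute)
    finally have c: "mulW J (x1 - x2) w' \<bullet> y \<in> \<int>" .
    have "real (p * m) * ((u - v) \<bullet> y) = (mulW J x1 w' + real (p * m) *\<^sub>R u) \<bullet> y
      - (mulW J x2 w' + real (p * m) *\<^sub>R v) \<bullet> y - mulW J (x1 - x2) w' \<bullet> y"
      by (simp add: mulW_diff inner_diff_left inner_add_left algebra_simps)
    also have "\<dots> \<in> \<int>" by (rule Ints_diff[OF Ints_diff[OF a b] c])
    finally show ?thesis .
  qed
  have "finite (colW j J ` F) \<and> card (colW j J ` F) \<le> (p * min m k) ^ card J * idx (ZJ J) ?H"
  proof (cases "m \<le> k")
    case True
    then show ?thesis
      using card_dual_le[OF P(3) sgH HZ fin U _ k2] pos by simp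
  next
    case False
    then show ?thesis
      using card_dual_le[OF P(3) sgH HZ fin U _ k1] pos by simp
  qed
  note Uc = this
  \<comment> \<open>When block and column agree, one z lies in \<open>H1\<close> for both matrices,
    and the images of \<open>real k *\<^sub>R z\<close> differ by \<open>k * p * m\<close> times the
    difference of the corners along \<open>axis j 1\<close>; pairing with g adds the second factor
    p.\<close>
  have fib: "finite {w\<in>F. colW j J w = u} \<and> card {w\<in>F. colW j J w = u} \<le> p * p * m * k" for u
  proof -
    let ?G = "{w\<in>F. colW j J w = u}"
    have same: "w1 q = w2 q" if w: "w1 \<in> ?G" "w2 \<in> ?G" and q: "q \<noteq> Upair j j" for w1 w2 q
    proof (cases q)
      case (Upair a b)
      show ?thesis
      proof (cases "q \<in> prs (insert j J)")
        case False
        then show ?thesis using F(1)[of w1] F(1)[of w2] w by (auto simp: cubeS_def)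
      next
        case qi: True
        show ?thesis
        proof (cases "q \<in> prs J")
          case True
          then have "w1 q = restrW J w1 q" "w2 q = restrW J w2 q" by (auto simp: restrW_def)
          then show ?thesis using F(2)[of w1] F(2)[of w2] w by simp
        next
          case False
          then have "\<exists>i\<in>J. q = Upair j i" using qi q P(2) unfolding Upair by auto
          then obtain i where i: "i \<in> J" "q = Upair j i" by blast
          have "colW j J w1 $ i = colW j J w2 $ i" using w by simp
          then show ?thesis using i by (simp add: colW_def)
        qed
      qed
    qed
    have inj: "inj_on (\<lambda>w. w (Upair j j)) ?G"
    proof (rule inj_onI)
      fix w1 w2 assume w: "w1 \<in> ?G" "w2 \<in> ?G" "w1 (Upair j j) = w2 (Upair j j)"
      show "w1 = w2"
      proof
        fix q show "w1 q = w2 q" using same[OF w(1,2), of q] w(3) by (cases "q = Upair j j") auto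
      qed
    qed
    let ?D = "(\<lambda>w. w (Upair j j)) ` ?G"
    have D01: "0 \<le> x \<and> x < 1" if "x \<in> ?D" for x
    proof -
      obtain w where "w \<in> F" "x = w (Upair j j)" using \<open>x \<in> ?D\<close> by blast
      then show ?thesis using F(1)[of w] by (simp add: cubeS_def)
    qed
    have pk: "1 \<le> p * p * m * k" using pos by simp
    have Dk: "real (p * p * m * k) * (x - y) \<in> \<int>" if xy: "x \<in> ?D" "y \<in> ?D" for x y
    proof -
      obtain w1 where w1: "w1 \<in> ?G" "x = w1 (Upair j j)" using xy(1) by blast
      obtain w2 where w2: "w2 \<in> ?G" "y = w2 (Upair j j)" using xy(2) by blast
      have w1F: "w1 \<in> F" and w2F: "w2 \<in> F" and c: "colW j J w1 = u" "colW j J w2 = u"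
        using w1 w2 by blast+
      obtain z where z: "z \<in> H1 j J \<Gamma> \<Lambda> w1" "z $ j = real (p * m)" using F(3)[OF w1F] by blast
      then have z2: "z \<in> H1 j J \<Gamma> \<Lambda> w2" unfolding H1_def by (simp add: mw[OF w1F] mw[OF w2F] c)
      have "mulW (insert j J) (real k *\<^sub>R z) w1 - mulW (insert j J) (real k *\<^sub>R z) w2 \<in> \<Lambda>"
        using F(4)[OF w1F z(1)] F(4)[OF w2F z2] subgrp_diff[OF sgL] unfolding HW_def by blast
      also have "mulW (insert j J) (real k *\<^sub>R z) w1 - mulW (insert j J) (real k *\<^sub>R z) w2 =
        (real k * real (p * m) * (x - y)) *\<^sub>R axis j 1"
        by (subst mulW_split_diff[OF P(2,3)])
          (use z(2) mw[OF w1F] mw[OF w2F] c w1(2) w2(2) in \<open>simp_all add: algebra_simps\<close>)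
      finally have "((real k * real (p * m) * (x - y)) *\<^sub>R axis j 1) \<bullet> g \<in> \<int>" using GL g(1) by blast
      then show ?thesis unfolding gax by (simp add: mult_ac)
    qed
    have D: "finite ?D" "card ?D \<le> p * p * m * k"
      using card_unit_interval_steps[OF D01 pk Dk] by blast+
    show ?thesis using D finite_imageD[OF D(1) inj] card_image[OF inj] by simp
  qed
  have "finite F" "card F \<le> (\<Sum>u\<in>colW j J ` F. p * p * m * k)"
    using card_fibres_le[of "colW j J" F "\<lambda>_. p * p * m * k"] Uc fib by blast+
  moreover have "(\<Sum>u\<in>colW j J ` F. p * p * m * k) = card (colW j J ` F) * (p * p * m * k)" by simp
  moreover have "\<dots> \<le> (p * min m k) ^ card J * idx (ZJ J) ?H * (p * p * m * k)"
    using Uc by (intro mult_le_mono1) blast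
  ultimately have c: "finite F" "card F \<le> (p * min m k) ^ card J * idx (ZJ J) ?H * (p * p * m * k)"
    by linarith+
  have e: "idx (ZJ J) ?H * (p * min m k) ^ card J = (p * min m k) ^ card J * idx (ZJ J) ?H"
    by (rule mult.commute)
  show ?thesis unfolding e using c by (rule conjI)
qed

text \<open>The matrices are sorted by three data: m, where \<open>p * m\<close> generates the j-th
  coordinates of \<open>H1\<close>; k, the index of \<open>HW\<close> in \<open>H1\<close>; and the
  block. The tower law and \<open>triangular_step\<close> show that the index of the block lattice
  times \<open>p * m * k\<close> is at most N.\<close>

lemma WC_step:
  assumes P: "paired (insert j J) \<Gamma> \<Lambda>" "j \<notin> J" "finite J"
    and IH: "\<And>N. finite (WCset J (slice j \<Gamma>) (proj_on J ` \<Lambda>) N)"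
    and ne: "WCset (insert j J) \<Gamma> \<Lambda> N \<noteq> {}"
  obtains p :: nat where "p \<ge> 1" "finite (WCset (insert j J) \<Gamma> \<Lambda> N)"
    "card (WCset (insert j J) \<Gamma> \<Lambda> N) \<le> (\<Sum>m\<in>(if J = {} then {1} else {1..N}). \<Sum>k\<in>{1..N}.
      \<Sum>w\<in>WCset J (slice j \<Gamma>) (proj_on J ` \<Lambda>) (N div (p * m * k)).
        idx (ZJ J) (HW J (slice j \<Gamma>) (proj_on J ` \<Lambda>) w) * (p * min m k) ^ card J * (p * p * m * k))"
proof -
  let ?W = "WCset (insert j J) \<Gamma> \<Lambda> N" and ?Z = "ZJ (insert j J)" and ?H = "HW (insert j J) \<Gamma> \<Lambda>"
  let ?H1 = "H1 j J \<Gamma> \<Lambda>" and ?H' = "HW J (slice j \<Gamma>) (proj_on J ` \<Lambda>)"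
  let ?W' = "WCset J (slice j \<Gamma>) (proj_on J ` \<Lambda>)"
  have sgG: "subgrp \<Gamma>" and GZ: "\<Gamma> \<subseteq> ?Z" using P(1) by (auto simp: paired_def)
  have sgH: "subgrp (?H w)" for w by (rule subgrp_HW[OF P(1)])
  note H1 = H1_props[OF P]
  have HG: "?H w \<subseteq> \<Gamma>" for w by (rule HW_subset)
  have H1Z: "?H1 w \<subseteq> ?Z" for w using H1(2) GZ by (rule subset_trans)
  have WD: "w \<in> cubeS (insert j J)" "finite (cosets ?Z (?H w))" "idx ?Z (?H w) \<le> N" if "w \<in> ?W" for w
    using that by (auto simp: WCset_def)
  obtain w0 where "w0 \<in> ?W" using ne by blast
  have finG: "finite (cosets ?Z \<Gamma>)"
    by (rule finite_cosets_mono(1)[OF subgrp_ZJ sgG sgH HG GZ WD(2)[OF \<open>w0 \<in> ?W\<close>]])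
  obtain p g where p: "p \<ge> 1" "g \<in> \<Gamma>" "g $ j = real p"
    and gen: "\<And>x. x \<in> \<Gamma> \<Longrightarrow> \<exists>k\<in>\<int>. x $ j = k * real p"
    by (rule triangular_step[OF P(2) sgG GZ finG]) blast
  have ex: "\<exists>m. m \<ge> 1 \<and> (J = {} \<longrightarrow> m = 1) \<and> (\<exists>x\<in>?H1 w. x $ j = real (p * m)) \<and>
      finite (cosets (ZJ J) (?H' w)) \<and> idx (ZJ J) (?H' w) * (p * m) * idx (?H1 w) (?H w) \<le> N"
    if w: "w \<in> ?W" for w
  proof -
    note fm = finite_cosets_mono[OF subgrp_ZJ H1(1) sgH H1(3) H1Z WD(2)[OF w]]
    obtain P' z where z: "P' \<ge> 1" "z \<in> ?H1 w" "z $ j = real P'"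
      and f': "finite (cosets (ZJ J) (slice j (?H1 w)))"
      and le: "idx (ZJ J) (slice j (?H1 w)) * P' \<le> idx ?Z (?H1 w)"
      by (rule triangular_step[OF P(2) H1(1) H1Z fm(1)]) blast
    have "idx (ZJ J) (slice j (?H1 w)) * P' * idx (?H1 w) (?H w) \<le> idx ?Z (?H1 w) * idx (?H1 w) (?H w)"
      using le by (rule mult_le_mono1)
    also have "\<dots> \<le> idx ?Z (?H w)" by (rule fm(3))
    also have "\<dots> \<le> N" by (rule WD(3)[OF w])
    finally have le2: "idx (ZJ J) (?H' w) * P' * idx (?H1 w) (?H w) \<le> N" unfolding H1(4) .
    have "z \<in> \<Gamma>" using z(2) H1(2) by blast
    then obtain kz where kz: "kz \<in> \<int>" "z $ j = kz * real p" using gen by blast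
    then obtain kk :: int where kk: "kz = of_int kk" by (auto elim: Ints_cases)
    have "real P' = of_int kk * real p" using kz z(3) kk by simp
    moreover from this have "kk > 0" using z(1) p(1) by (smt (verit) mult_nonpos_nonneg of_int_le_0_iff of_nat_0_le_iff of_nat_1 of_nat_le_iff)
    ultimately have m: "P' = p * nat kk" "nat kk \<ge> 1"
      by (simp_all add: algebra_simps) (metis of_int_of_nat_eq of_nat_eq_iff of_nat_mult nat_0_le less_imp_le mult.commute of_nat_nat)
    show ?thesis
    \<comment> \<open>For empty J the condition defining \<open>H1\<close> is void and m = 1 can be
      chosen. If m ran freely, the double sum over m and k would lose a factor
      \<open>log N\<close>.\<close>
    proof (cases "J = {}")
      case True
      have "g \<in> ?H1 w"
      proof -
        have "mulW J g w + g $ j *\<^sub>R colW j J w = proj_on J 0"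
          unfolding True by (simp add: vec_eq_iff mulW_nth colW_def)
        moreover have "0 \<in> \<Lambda>" using P(1) subgrp_zero unfolding paired_def by blast
        ultimately show ?thesis using p(2) unfolding H1_def by blast
      qed
      moreover have "idx (ZJ J) (?H' w) * (p * 1) * idx (?H1 w) (?H w) \<le> idx (ZJ J) (?H' w) * P' * idx (?H1 w) (?H w)"
        using m by (intro mult_le_mono1 mult_le_mono2) simp
      moreover from this have "idx (ZJ J) (?H' w) * (p * 1) * idx (?H1 w) (?H w) \<le> N"
        using le2 by (rule le_trans)
      ultimately show ?thesis
        using p(3) f' unfolding H1(4) by (intro exI[of _ 1] conjI bexI[of _ g]) auto
    next
      case False
      then show ?thesis using m z f' le2 unfolding H1(4) by (intro exI[of _ "nat kk"] conjI bexI[of _ z]) auto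
    qed
  qed
  then obtain mm where mm: "\<And>w. w \<in> ?W \<Longrightarrow> mm w \<ge> 1 \<and> (J = {} \<longrightarrow> mm w = 1) \<and>
      (\<exists>x\<in>?H1 w. x $ j = real (p * mm w)) \<and> finite (cosets (ZJ J) (?H' w)) \<and>
      idx (ZJ J) (?H' w) * (p * mm w) * idx (?H1 w) (?H w) \<le> N" by metis
  define kap where "kap w = idx (?H1 w) (?H w)" for w
  have kap1: "kap w \<ge> 1" if "w \<in> ?W" for w
    unfolding kap_def by (rule idx_pos[OF H1(1)])
      (rule finite_cosets_mono(2)[OF subgrp_ZJ H1(1) sgH H1(3) H1Z WD(2)[OF that]])
  define f where "f w = ((mm w, kap w), restrW J w)" for w
  let ?M = "if J = {} then {1} else {1..N}"
  let ?S = "Sigma (?M \<times> {1..N}) (\<lambda>(m, k). ?W' (N div (p * m * k)))"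
  let ?g = "\<lambda>((m, k), w). idx (ZJ J) (?H' w) * (p * min m k) ^ card J * (p * p * m * k)"
  have fS: "f w \<in> ?S" if w: "w \<in> ?W" for w
  proof -
    have nu: "idx (ZJ J) (?H' w) \<ge> 1" using mm[OF w] idx_pos[OF subgrp_ZJ] by blast
    have le: "idx (ZJ J) (?H' w) * (p * mm w * kap w) \<le> N"
      using mm[OF w] unfolding kap_def by (simp add: mult_ac)
    have pos: "p * mm w * kap w \<ge> 1" using p(1) mm[OF w] kap1[OF w] by simp
    have "idx (ZJ J) (?H' w) \<le> N div (p * mm w * kap w)"
      using le pos by (simp add: less_eq_div_iff_mult_less_eq)
    moreover have "restrW J w \<in> cubeS J"
      using WD(1)[OF w] by (auto simp: cubeS_def restrW_def prs_def)
    ultimately have wW: "restrW J w \<in> ?W' (N div (p * mm w * kap w))"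
      using mm[OF w] by (simp add: WCset_def)
    have "p * mm w * kap w \<le> N" using le nu by (metis le_trans mult_le_mono1 mult_1)
    moreover have "mm w \<le> p * mm w * kap w" "kap w \<le> p * mm w * kap w" using p(1) mm[OF w] kap1[OF w] by auto
    ultimately have "mm w \<le> N" "kap w \<le> N" by linarith+
    then show ?thesis using wW mm[OF w] kap1[OF w] unfolding f_def by auto
  qed
  have finS: "finite ?S" by (intro finite_SigmaI) (auto intro: IH)
  have fW: "f ` ?W \<subseteq> ?S" using fS by blast
  have fib: "finite {w\<in>?W. f w = y} \<and> card {w\<in>?W. f w = y} \<le> ?g y" if y: "y \<in> f ` ?W" for y
  proof -
    obtain w1 where w1: "w1 \<in> ?W" "y = f w1" using y by blast
    obtain m k w' where ye: "y = ((m, k), w')" by (metis prod.exhaust)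
    have e1: "m = mm w1" "k = kap w1" "w' = restrW J w1" using w1(2) ye by (auto simp: f_def)
    have "finite {w\<in>?W. f w = y} \<and> card {w\<in>?W. f w = y} \<le> idx (ZJ J) (?H' w') * (p * min m k) ^ card J * (p * p * m * k)"
    proof (rule WC_fibre[OF P p(2,3) p(1)])
      show "m \<ge> 1" "k \<ge> 1" using e1 mm[OF w1(1)] kap1[OF w1(1)] by auto
      show "finite (cosets (ZJ J) (?H' w'))" using mm[OF w1(1)] e1 by simp
      fix w assume w: "w \<in> {w\<in>?W. f w = y}"
      then have wW: "w \<in> ?W" and e: "mm w = m" "kap w = k" "restrW J w = w'" using ye by (auto simp: f_def)
      show "w \<in> cubeS (insert j J)" by (rule WD(1)[OF wW])
      show "restrW J w = w'" by (rule e(3))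
      show "\<exists>x\<in>?H1 w. x $ j = real (p * m)" using mm[OF wW] e by blast
      fix x assume "x \<in> ?H1 w"
      then show "real k *\<^sub>R x \<in> ?H w" unfolding e(2)[symmetric] kap_def
        by (rule idx_scaleR_mem[OF H1(1) sgH H1(3) finite_cosets_mono(2)[OF subgrp_ZJ H1(1) sgH H1(3) H1Z WD(2)[OF wW]]])
    qed
    then show ?thesis using ye by simp
  qed
  have fin: "finite ?W" and le: "card ?W \<le> (\<Sum>y\<in>f ` ?W. ?g y)"
    using card_fibres_le[of f ?W ?g] finite_subset[OF fW finS] fib by blast+
  have "(\<Sum>y\<in>f ` ?W. ?g y) \<le> (\<Sum>y\<in>?S. ?g y)" by (rule sum_mono2[OF finS fW]) simp
  also have "\<dots> = (\<Sum>mk\<in>?M \<times> {1..N}. \<Sum>w\<in>(case mk of (m, k) \<Rightarrow> ?W' (N div (p * m * k))). ?g (mk, w))"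
    by (subst sum.Sigma) (use IH in auto)
  also have "\<dots> = (\<Sum>m\<in>?M. \<Sum>k\<in>{1..N}. \<Sum>w\<in>?W' (N div (p * m * k)). ?g ((m, k), w))"
    unfolding sum.cartesian_product by (rule sum.cong) auto
  finally show thesis using that[OF p(1) fin] le by simp
qed

text \<open>For \<open>a \<le> b\<close> the left side is \<open>1 / (a * b ^ (s + 1))\<close>, at
  most \<open>1 / (a * b ^ 2)\<close> because \<open>s \<ge> 1\<close>. Half a power passes from b
  to a, and the sums over both variables converge.\<close>

lemma min_power_le:
  fixes a b s :: nat
  assumes "a \<ge> 1" "b \<ge> 1" "s \<ge> 1"
  shows "real (min a b) ^ s / real (a * b) ^ (s + 1) \<le> real a powr (-3/2) * real b powr (-3/2)"
proof -
  have *: "real (min a b) ^ s / real (a * b) ^ (s + 1) \<le> real a powr (-3/2) * real b powr (-3/2)"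
    if ab: "a \<le> b" "a \<ge> 1" for a b :: nat
  proof -
    have pos: "real a > 0" "real b > 0" using ab by auto
    have "real (min a b) ^ s / real (a * b) ^ (s + 1) = 1 / (real a * real b ^ (s + 1))"
      using ab pos by (simp add: min_def power_mult_distrib field_simps)
    also have "\<dots> \<le> 1 / (real a * real b ^ 2)"
      using pos ab assms(3) by (intro divide_left_mono mult_left_mono power_increasing mult_pos_pos) auto
    also have "\<dots> = real a powr (-1) * real b powr (-2)"
      using pos by (simp add: powr_minus field_simps powr_numeral)
    also have "\<dots> = real a powr (-1) * (real b powr (-1/2) * real b powr (-3/2))"
      by (simp flip: powr_add)
    also have "\<dots> \<le> real a powr (-1) * (real a powr (-1/2) * real b powr (-3/2))"
      using pos ab by (intro mult_left_mono mult_right_mono powr_mono2') auto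
    also have "\<dots> = real a powr (-3/2) * real b powr (-3/2)"
      using powr_add[of "real a" "-1" "-1/2"] by simp
    finally show ?thesis .
  qed
  show ?thesis
  proof (cases "a \<le> b")
    case True then show ?thesis using *[of a b] assms by simp
  next
    case False then show ?thesis using *[of b a] assms by (simp add: min.commute mult.commute)
  qed
qed

lemma sum_powr_bounded:
  obtains S :: real where "S > 0" "\<And>N::nat. (\<Sum>m\<in>{1..N}. real m powr (-3/2)) \<le> S"
proof
  have sm: "summable (\<lambda>m::nat. real m powr (-3/2))" by (subst summable_real_powr_iff) simp
  show "(\<Sum>m\<in>{1..N}. real m powr (-3/2)) \<le> (\<Sum>m::nat. real m powr (-3/2)) + 1" for N :: nat
    using sum_le_suminf[OF sm, of "{1..N}"] by simp
  show "(\<Sum>m::nat. real m powr (-3/2)) + 1 > 0" using suminf_nonneg[OF sm] by simp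
qed

lemma WCset_0: "paired J \<Gamma> \<Lambda> \<Longrightarrow> WCset J \<Gamma> \<Lambda> 0 = {}"
  using idx_pos[OF subgrp_ZJ] by (fastforce simp: WCset_def)

lemma of_nat_div_le_real: "real (N div k) \<le> real N / real k"
  by (rule of_nat_div_le_of_nat)

text \<open>The powers of p cancel exactly: p to the \<open>s + 2\<close> from the summand against
  as many from the count and the index. The resulting constant is therefore independent of \<Gamma>
  and \<Lambda>.\<close>

lemma WC_aux:
  fixes p m k s N :: nat
  assumes "p \<ge> 1" "m \<ge> 1" "k \<ge> 1" "s \<ge> 1" "C \<ge> 0"
    and "finite W" "real (card W) \<le> C * real (N div (p * m * k)) ^ (s + 1)"
    "\<And>w. w \<in> W \<Longrightarrow> \<nu> w \<le> N div (p * m * k)"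
  shows "real (\<Sum>w\<in>W. \<nu> w * (p * min m k) ^ s * (p * p * m * k)) \<le>
    C * real N ^ (s + 2) * (real m powr (-3/2) * real k powr (-3/2))"
proof -
  let ?x = "N div (p * m * k)" and ?X = "real N / real (p * m * k)"
  have pos: "real p > 0" "real m > 0" "real k > 0" using assms by auto
  have X: "real ?x \<le> ?X" by (rule of_nat_div_le_real)
  have "(\<Sum>w\<in>W. \<nu> w * (p * min m k) ^ s * (p * p * m * k)) \<le> (\<Sum>w\<in>W. ?x * (p * min m k) ^ s * (p * p * m * k))"
    using assms(8) by (intro sum_mono mult_le_mono1) auto
  then have "real (\<Sum>w\<in>W. \<nu> w * (p * min m k) ^ s * (p * p * m * k)) \<le>
      real (\<Sum>w\<in>W. ?x * (p * min m k) ^ s * (p * p * m * k))" by (rule of_nat_mono)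
  also have "\<dots> = real (card W) * (real ?x * (real p * real (min m k)) ^ s * (real p * real p * real m * real k))" by simp
  also have "\<dots> \<le> (C * ?X ^ (s + 1)) * (?X * (real p * real (min m k)) ^ s * (real p * real p * real m * real k))"
  proof (intro mult_mono)
    show "real (card W) \<le> C * ?X ^ (s + 1)"
      using assms(7) power_mono[OF X, of "s + 1"] assms(5) by (meson mult_left_mono of_nat_0_le_iff order_trans)
  qed (use X assms(5) in auto)
  also have "\<dots> = C * real N ^ (s + 2) * (real (min m k) ^ s / real (m * k) ^ (s + 1))"
    using pos by (simp add: power_divide power_mult_distrib field_simps)
  also have "\<dots> \<le> C * real N ^ (s + 2) * (real m powr (-3/2) * real k powr (-3/2))"
    using min_power_le[OF assms(2-4)] assms(5) by (intro mult_left_mono) auto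
  finally show ?thesis .
qed

text \<open>C is chosen before \<Gamma> and \<Lambda>. The induction changes both in every step, and
  the application sums over infinitely many possible subspaces, so uniformity is essential.\<close>

theorem card_WCset_le:
  fixes J :: "'n::finite set"
  shows "\<exists>C>0. \<forall>\<Gamma> \<Lambda> N. paired J \<Gamma> \<Lambda> \<longrightarrow>
    finite (WCset J \<Gamma> \<Lambda> N) \<and> real (card (WCset J \<Gamma> \<Lambda> N)) \<le> C * real N ^ (card J + 1)"
  using finite[of J]
proof (induction J rule: finite_induct)
  case empty
  have "finite (WCset {} \<Gamma> \<Lambda> N) \<and> real (card (WCset {} \<Gamma> \<Lambda> N)) \<le> 1 * real N ^ (card ({}::'n set) + 1)"
    if P: "paired {} \<Gamma> \<Lambda>" for \<Gamma> \<Lambda> :: "(real^'n) set" and N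
  proof -
    have sub: "WCset {} \<Gamma> \<Lambda> N \<subseteq> {\<lambda>_. 0}" by (auto simp: WCset_def cubeS_def)
    then have "card (WCset {} \<Gamma> \<Lambda> N) \<le> 1" using card_mono[OF _ sub] by simp
    moreover have "card (WCset {} \<Gamma> \<Lambda> N) = 0" if "N = 0" using WCset_0[OF P] that by simp
    ultimately show ?thesis using finite_subset[OF sub] by (cases "N = 0") auto
  qed
  then show ?case by (intro exI[of _ 1]) auto
next
  case (insert j J)
  obtain C where C: "C > 0" "\<And>\<Gamma> \<Lambda> N. paired J \<Gamma> \<Lambda> \<Longrightarrow>
    finite (WCset J \<Gamma> \<Lambda> N) \<and> real (card (WCset J \<Gamma> \<Lambda> N)) \<le> C * real N ^ (card J + 1)"
    using insert.IH by blast
  obtain S :: real where S: "S > 0" "\<And>N::nat. (\<Sum>m\<in>{1..N}. real m powr (-3/2)) \<le> S"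
    using sum_powr_bounded by blast
  define D where "D = 1 + C * (S * S)"
  have D: "D \<ge> 1" "D \<ge> C * (S * S)" using C(1) S(1) by (auto simp: D_def)
  have "finite (WCset (insert j J) \<Gamma> \<Lambda> N) \<and>
      real (card (WCset (insert j J) \<Gamma> \<Lambda> N)) \<le> D * real N ^ (card (insert j J) + 1)"
    if P: "paired (insert j J) \<Gamma> \<Lambda>" for \<Gamma> \<Lambda> N
  proof (cases "WCset (insert j J) \<Gamma> \<Lambda> N = {}")
    case True then show ?thesis using D by simp
  next
    case False
    let ?W = "WCset (insert j J) \<Gamma> \<Lambda> N"
    let ?W' = "WCset J (slice j \<Gamma>) (proj_on J ` \<Lambda>)"
    let ?\<nu> = "\<lambda>w. idx (ZJ J) (HW J (slice j \<Gamma>) (proj_on J ` \<Lambda>) w)"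
    have P': "paired J (slice j \<Gamma>) (proj_on J ` \<Lambda>)" by (rule paired_slice[OF P insert.hyps(2)])
    note IH = C(2)[OF P']
    obtain p where p: "p \<ge> 1" and fin: "finite ?W" and
      le: "card ?W \<le> (\<Sum>m\<in>(if J = {} then {1} else {1..N}). \<Sum>k\<in>{1..N}.
        \<Sum>w\<in>?W' (N div (p * m * k)). ?\<nu> w * (p * min m k) ^ card J * (p * p * m * k))"
      by (rule WC_step[OF P insert.hyps(2,1) IH[THEN conjunct1] False])
    have \<nu>le: "?\<nu> w \<le> x" if "w \<in> ?W' x" for w x using that by (simp add: WCset_def)
    have "real (card ?W) \<le> D * real N ^ (card J + 2)"
    \<comment> \<open>In dimension one only m = 1 occurs and at most \<open>N div p\<close> values
      of k contribute, each at most \<open>N * p\<close>; this gives \<open>N * N\<close>.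
      \<open>min_power_le\<close> starts at \<open>s \<ge> 1\<close> and covers the other
      case.\<close>
    proof (cases "J = {}")
      case True
      have c1: "card (?W' x) \<le> 1" for x
      proof -
        have sub: "?W' x \<subseteq> {\<lambda>_. 0}" unfolding True by (auto simp: WCset_def cubeS_def)
        show ?thesis using card_mono[OF _ sub] by simp
      qed
      have in1: "(\<Sum>w\<in>?W' (N div (p * k)). ?\<nu> w * (p * p * k)) \<le> (if p * k \<le> N then N * p else 0)"
        if k: "k \<in> {1..N}" for k
      proof -
        have "(\<Sum>w\<in>?W' (N div (p * k)). ?\<nu> w * (p * p * k)) \<le> (\<Sum>w\<in>?W' (N div (p * k)). (N div (p * k)) * (p * p * k))"
          using \<nu>le by (intro sum_mono mult_le_mono1) auto
        also have "\<dots> = card (?W' (N div (p * k))) * ((N div (p * k)) * (p * p * k))" by simp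
        also have "\<dots> \<le> 1 * ((N div (p * k)) * (p * p * k))" by (rule mult_le_mono1[OF c1])
        also have "\<dots> = (N div (p * k)) * (p * k) * p" by (simp add: mult_ac)
        also have "\<dots> \<le> (if p * k \<le> N then N * p else 0)"
          using p k by (auto intro!: mult_le_mono1 simp: div_times_less_eq_dividend)
        finally show ?thesis .
      qed
      have "card ?W \<le> (\<Sum>k\<in>{1..N}. \<Sum>w\<in>?W' (N div (p * k)). ?\<nu> w * (p * p * k))"
        using le True by simp
      also have "\<dots> \<le> (\<Sum>k\<in>{1..N}. if p * k \<le> N then N * p else 0)" by (rule sum_mono[OF in1])
      also have "\<dots> = card {k\<in>{1..N}. p * k \<le> N} * (N * p)" by (simp add: sum.If_cases Int_def)
      also have "\<dots> \<le> (N div p) * (N * p)"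
      proof (rule mult_le_mono1)
        have "{k\<in>{1..N}. p * k \<le> N} \<subseteq> {1..N div p}"
          using p by (auto simp: less_eq_div_iff_mult_less_eq mult.commute)
        from card_mono[OF _ this] show "card {k\<in>{1..N}. p * k \<le> N} \<le> N div p" by simp
      qed
      also have "\<dots> = N * ((N div p) * p)" by (simp add: mult_ac)
      also have "\<dots> \<le> N * N" by (intro mult_le_mono2 div_times_less_eq_dividend)
      finally have "real (card ?W) \<le> real (N * N)" by (rule of_nat_mono)
      also have "\<dots> \<le> D * real N ^ (card J + 2)"
        using mult_right_mono[OF D(1), of "real N * real N"] True by (simp add: power2_eq_square)
      finally show ?thesis .
    next
      case False
      then have s1: "card J \<ge> 1" using insert.hyps(1) by (simp add: Suc_leI card_gt_0_iff)
      have "real (card ?W) \<le> real (\<Sum>m\<in>{1..N}. \<Sum>k\<in>{1..N}.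
        \<Sum>w\<in>?W' (N div (p * m * k)). ?\<nu> w * (p * min m k) ^ card J * (p * p * m * k))"
        using le False by (intro of_nat_mono) simp
      also have "\<dots> = (\<Sum>m\<in>{1..N}. \<Sum>k\<in>{1..N}.
        real (\<Sum>w\<in>?W' (N div (p * m * k)). ?\<nu> w * (p * min m k) ^ card J * (p * p * m * k)))"
        by (simp only: of_nat_sum)
      also have "\<dots> \<le> (\<Sum>m\<in>{1..N}. \<Sum>k\<in>{1..N}. C * real N ^ (card J + 2) * (real m powr (-3/2) * real k powr (-3/2)))"
      proof (intro sum_mono)
        fix m k assume mk: "m \<in> {1..N}" "k \<in> {1..N}"
        have m1: "1 \<le> m" and k1: "1 \<le> k" using mk by auto
        show "real (\<Sum>w\<in>?W' (N div (p * m * k)). ?\<nu> w * (p * min m k) ^ card J * (p * p * m * k)) \<le>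
          C * real N ^ (card J + 2) * (real m powr (-3/2) * real k powr (-3/2))"
          by (rule WC_aux[OF p m1 k1 s1 less_imp_le[OF C(1)] IH[THEN conjunct1] IH[THEN conjunct2]]) (rule \<nu>le)
      qed
      also have "\<dots> = C * real N ^ (card J + 2) * ((\<Sum>m\<in>{1..N}. real m powr (-3/2)) * (\<Sum>k\<in>{1..N}. real k powr (-3/2)))"
        by (simp only: sum_distrib_left[symmetric] sum_distrib_right[symmetric])
      also have "\<dots> \<le> C * real N ^ (card J + 2) * (S * S)"
        using C(1) S by (intro mult_left_mono mult_mono sum_nonneg) auto
      also have "\<dots> = C * (S * S) * real N ^ (card J + 2)" by (simp add: mult_ac)
      also have "\<dots> \<le> D * real N ^ (card J + 2)" using D(2) by (intro mult_right_mono) auto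
      finally show ?thesis .
    qed
    then show ?thesis using fin insert.hyps by simp
  qed
  then show ?case using D(1) by (intro exI[of _ D]) auto
qed

section \<open>Counting rational subspaces by their denominators\<close>

text \<open>Integer vectors x whose additional coordinates \<open>x \<bullet> V i\<close> are
  integers as well. If V describes a subspace over the coordinates J, these are the J-coordinates of
  its integer points, and the index of this lattice is the denominator of the subspace.\<close>

definition GV :: "'n::finite set \<Rightarrow> 'n set \<Rightarrow> ('n \<Rightarrow> real^'n) \<Rightarrow> (real^'n) set" where
  "GV J U V = {x\<in>ZJ J. \<forall>i\<in>U. x \<bullet> V i \<in> \<int>}"

definition VCset :: "'n::finite set \<Rightarrow> 'n set \<Rightarrow> nat \<Rightarrow> ('n \<Rightarrow> real^'n) set" where
  "VCset J U N = {V. (\<forall>i\<in>U. V i \<in> unit_cube J) \<and> (\<forall>i. i \<notin> U \<longrightarrow> V i = 0) \<and>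
     finite (cosets (ZJ J) (GV J U V)) \<and> idx (ZJ J) (GV J U V) \<le> N}"

lemma subgrp_GV: "subgrp (GV J U V)"
  by (auto simp: subgrp_def GV_def ZJ_def inner_diff_left)

lemma GV_subset: "GV J U V \<subseteq> ZJ J"
  by (auto simp: GV_def)

lemma GV_cong: "(\<And>i. i \<in> U \<Longrightarrow> V i = V' i) \<Longrightarrow> GV J U V = GV J U V'"
  by (auto simp: GV_def)

text \<open>The vectors \<open>V i\<close> are added one at a time. If the lattice shrinks by the
  index k, \<open>card_dual_le\<close> leaves at most \<open>k ^ s\<close> times the old index for
  the new vector. The clause for empty U is carried along because the general bound would turn the
  first step into a harmonic sum over k.\<close>

theorem card_VCset_le:
  fixes J U :: "'n::finite set"
  assumes "J \<noteq> {}"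
  shows "\<exists>C>0. \<forall>N. finite (VCset J U N) \<and> real (card (VCset J U N)) \<le> C * real N ^ (card J + card U) \<and>
    (U = {} \<longrightarrow> card (VCset J U N) \<le> 1)"
  using finite[of U]
proof (induction U rule: finite_induct)
  case empty
  have "finite (VCset J {} N) \<and> real (card (VCset J {} N)) \<le> 1 * real N ^ (card J + card ({}::'n set)) \<and>
    (({}::'n set) = {} \<longrightarrow> card (VCset J {} N) \<le> 1)" for N
  proof -
    have sub: "VCset J {} N \<subseteq> {\<lambda>_. 0}" by (auto simp: VCset_def)
    then have c: "card (VCset J {} N) \<le> 1" using card_mono[OF _ sub] by simp
    moreover have "VCset J {} N = {}" if "N = 0"
      using idx_pos[OF subgrp_ZJ] that by (fastforce simp: VCset_def)
    ultimately show ?thesis using finite_subset[OF sub] by (cases "N = 0") (auto intro: order_trans[of _ 1])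
  qed
  then show ?case by (intro exI[of _ 1]) auto
next
  case (insert i U)
  let ?s = "card J"
  have s1: "?s \<ge> 1" using assms by (simp add: Suc_leI card_gt_0_iff)
  obtain C where C: "C > 0" "\<And>N. finite (VCset J U N)"
    "\<And>N. real (card (VCset J U N)) \<le> C * real N ^ (card J + card U)"
    "\<And>N. U = {} \<Longrightarrow> card (VCset J U N) \<le> 1"
    using insert.IH by blast
  obtain S :: real where S: "S > 0" "\<And>N::nat. (\<Sum>m\<in>{1..N}. real m powr (-3/2)) \<le> S"
    using sum_powr_bounded by blast
  define D where "D = 1 + C * S"
  have D: "D \<ge> 1" "D \<ge> C * S" using C(1) S(1) by (auto simp: D_def)
  have main: "finite (VCset J (insert i U) N) \<and>
      real (card (VCset J (insert i U) N)) \<le> D * real N ^ (card J + card (insert i U))" for N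
  proof -
    let ?W = "VCset J (insert i U) N" and ?B = "GV J U" and ?B' = "GV J (insert i U)"
    have sub: "?B' V \<subseteq> ?B V" for V by (auto simp: GV_def)
    have WD: "finite (cosets (ZJ J) (?B' V))" "idx (ZJ J) (?B' V) \<le> N" "V i \<in> unit_cube J" if "V \<in> ?W" for V
      using that by (auto simp: VCset_def)
    define kap where "kap V = idx (?B V) (?B' V)" for V
    note fm = finite_cosets_mono[OF subgrp_ZJ subgrp_GV subgrp_GV sub GV_subset WD(1)]
    have kap1: "kap V \<ge> 1" if "V \<in> ?W" for V
      unfolding kap_def by (rule idx_pos[OF subgrp_GV fm(2)[OF that]])
    define f where "f V = (kap V, V(i := 0))" for V :: "'n \<Rightarrow> real^'n"
    let ?S = "Sigma {1..N} (\<lambda>k. VCset J U (N div k))"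
    let ?g = "\<lambda>(k, V). k ^ ?s * idx (ZJ J) (?B V)"
    have Beq: "?B (V(i := 0)) = ?B V" for V
      using insert.hyps by (intro GV_cong) auto
    have fS: "f V \<in> ?S" if V: "V \<in> ?W" for V
    proof -
      have le: "idx (ZJ J) (?B V) * kap V \<le> N"
        unfolding kap_def using fm(3)[OF V] WD(2)[OF V] by (rule le_trans)
      have nu: "idx (ZJ J) (?B V) \<ge> 1" by (rule idx_pos[OF subgrp_ZJ fm(1)[OF V]])
      have "idx (ZJ J) (?B V) \<le> N div kap V"
        using le kap1[OF V] by (simp add: less_eq_div_iff_mult_less_eq)
      moreover have "kap V \<le> N" using le nu by (metis le_trans mult_le_mono1 mult_1)
      ultimately show ?thesis
        using V kap1[OF V] fm(1)[OF V] insert.hyps unfolding f_def VCset_def by (auto simp: Beq)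
    qed
    have finS: "finite ?S" by (intro finite_SigmaI) (auto intro: C(2))
    have fW: "f ` ?W \<subseteq> ?S" using fS by blast
    have fib: "finite {V\<in>?W. f V = y} \<and> card {V\<in>?W. f V = y} \<le> ?g y" if y: "y \<in> f ` ?W" for y
    proof -
      obtain V1 where V1: "V1 \<in> ?W" "y = f V1" using y by blast
      obtain k V' where ye: "y = (k, V')" by (metis prod.exhaust)
      have e1: "k = kap V1" "V' = V1(i := 0)" using V1(2) ye by (auto simp: f_def)
      let ?F = "{V\<in>?W. f V = y}"
      have inj: "inj_on (\<lambda>V. V i) ?F"
      proof (rule inj_onI)
        fix V V2 assume "V \<in> ?F" "V2 \<in> ?F" "V i = V2 i"
        then have "V(i := 0) = V2(i := 0)" "V i = V2 i" by (auto simp: f_def)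
        then show "V = V2" by (metis fun_upd_triv fun_upd_upd)
      qed
      have Uc: "(\<lambda>V. V i) ` ?F \<subseteq> unit_cube J" using WD(3) by blast
      have k1: "k \<ge> 1" using e1 kap1[OF V1(1)] by simp
      have fB: "finite (cosets (ZJ J) (?B V'))" unfolding e1(2) Beq by (rule fm(1)[OF V1(1)])
      have dif: "real k * ((u - v) \<bullet> y') \<in> \<int>"
        if u: "u \<in> (\<lambda>V. V i) ` ?F" and v: "v \<in> (\<lambda>V. V i) ` ?F" and y': "y' \<in> ?B V'" for u v y'
      proof -
        \<comment> \<open>Multiplication by the index k maps the old lattice into the new one, on
          which pairing with \<open>V i\<close> is integral.\<close>
        have one: "real k * (y' \<bullet> V i) \<in> \<int>" if VF: "V \<in> ?F" for V
        proof -
          have VW: "V \<in> ?W" and e: "kap V = k" "V(i := 0) = V'" using VF ye by (auto simp: f_def)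
          have "y' \<in> ?B V" using y' unfolding e(2)[symmetric] Beq .
          then have "of_nat (kap V) *\<^sub>R y' \<in> ?B' V" unfolding kap_def
            by (rule idx_scaleR_mem[OF subgrp_GV subgrp_GV sub fm(2)[OF VW]])
          then show ?thesis unfolding e(1) by (simp add: GV_def)
        qed
        obtain V2 where V2: "V2 \<in> ?F" "u = V2 i" using u by blast
        obtain V3 where V3: "V3 \<in> ?F" "v = V3 i" using v by blast
        have "real k * ((u - v) \<bullet> y') = real k * (y' \<bullet> V2 i) - real k * (y' \<bullet> V3 i)"
          unfolding V2(2) V3(2) by (simp add: inner_diff_right inner_commute[of _ y'] right_diff_distrib)
        then show ?thesis using Ints_diff[OF one[OF V2(1)] one[OF V3(1)]] by simp
      qed
      have cd: "finite ((\<lambda>V. V i) ` ?F) \<and> card ((\<lambda>V. V i) ` ?F) \<le> k ^ ?s * idx (ZJ J) (?B V')"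
        by (rule card_dual_le[OF finite subgrp_GV GV_subset fB Uc k1 dif])
      show ?thesis using cd finite_imageD[OF _ inj] card_image[OF inj] ye by auto
    qed
    have fin: "finite ?W" and le: "card ?W \<le> (\<Sum>y\<in>f ` ?W. ?g y)"
      using card_fibres_le[of f ?W ?g] finite_subset[OF fW finS] fib by blast+
    have "(\<Sum>y\<in>f ` ?W. ?g y) \<le> (\<Sum>y\<in>?S. ?g y)" by (rule sum_mono2[OF finS fW]) simp
    also have "\<dots> = (\<Sum>k\<in>{1..N}. \<Sum>V\<in>VCset J U (N div k). ?g (k, V))"
      by (subst sum.Sigma) (use C(2) in auto)
    also have "\<dots> \<le> (\<Sum>k\<in>{1..N}. k ^ ?s * ((N div k) * card (VCset J U (N div k))))"
    proof (rule sum_mono)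
      fix k assume "k \<in> {1..N}"
      have "(\<Sum>V\<in>VCset J U (N div k). ?g (k, V)) \<le> (\<Sum>V\<in>VCset J U (N div k). k ^ ?s * (N div k))"
        by (intro sum_mono) (auto simp: VCset_def)
      then show "(\<Sum>V\<in>VCset J U (N div k). ?g (k, V)) \<le> k ^ ?s * ((N div k) * card (VCset J U (N div k)))"
        by (simp add: mult_ac)
    qed
    finally have le2: "card ?W \<le> (\<Sum>k\<in>{1..N}. k ^ ?s * ((N div k) * card (VCset J U (N div k))))"
      using le by (rule le_trans[rotated])
    have "real (card ?W) \<le> D * real N ^ (?s + card U + 1)"
    proof (cases "U = {}")
      case True
      have "(\<Sum>k\<in>{1..N}. k ^ ?s * ((N div k) * card (VCset J U (N div k)))) \<le> (\<Sum>k\<in>{1..N}. N ^ ?s)"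
      proof (rule sum_mono)
        fix k assume k: "k \<in> {1..N}"
        have "k ^ ?s * ((N div k) * card (VCset J U (N div k))) \<le> k ^ ?s * ((N div k) * 1)"
          by (intro mult_le_mono2 C(4) True)
        also have "\<dots> = k ^ (?s - 1) * (k * (N div k))" using s1 by (cases ?s) auto
        also have "\<dots> \<le> N ^ (?s - 1) * N" using k by (intro mult_le_mono power_mono) auto
        also have "\<dots> = N ^ ?s" using s1 by (cases ?s) auto
        finally show "k ^ ?s * ((N div k) * card (VCset J U (N div k))) \<le> N ^ ?s" .
      qed
      then have "card ?W \<le> N ^ (?s + 1)" using le2 by simp
      then have "real (card ?W) \<le> real (N ^ (?s + 1))" by (rule of_nat_mono)
      also have "\<dots> \<le> D * real (N ^ (?s + 1))" using D(1) by (intro mult_right_mono[of 1 D, simplified]) auto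
      finally show ?thesis using True by simp
    next
      case False
      then have u1: "card U \<ge> 1" using insert.hyps(1) by (simp add: Suc_leI card_gt_0_iff)
      have "real (card ?W) \<le> (\<Sum>k\<in>{1..N}. real (k ^ ?s * ((N div k) * card (VCset J U (N div k)))))"
        using of_nat_mono[OF le2] by (simp only: of_nat_sum)
      also have "\<dots> \<le> (\<Sum>k\<in>{1..N}. C * real N ^ (?s + card U + 1) * real k powr (-3/2))"
      proof (rule sum_mono)
        fix k assume k: "k \<in> {1..N}"
        let ?X = "real N / real k"
        have kp: "real k > 0" "real k \<ge> 1" using k by auto
        have X: "real (N div k) \<le> ?X" by (rule of_nat_div_le_real)
        have "real (k ^ ?s * ((N div k) * card (VCset J U (N div k)))) =
          real k ^ ?s * (real (N div k) * real (card (VCset J U (N div k))))" by simp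
        also have "\<dots> \<le> real k ^ ?s * (?X * (C * ?X ^ (?s + card U)))"
        proof (intro mult_left_mono mult_mono)
          show "real (card (VCset J U (N div k))) \<le> C * ?X ^ (?s + card U)"
            using C(3)[of "N div k"] power_mono[OF X, of "?s + card U"] C(1)
            by (meson less_imp_le mult_left_mono of_nat_0_le_iff order_trans)
        qed (use X in auto)
        also have "\<dots> = C * real N ^ (?s + card U + 1) * (1 / real k ^ (card U + 1))"
          using kp by (simp add: power_divide power_add field_simps)
        also have "\<dots> \<le> C * real N ^ (?s + card U + 1) * real k powr (-3/2)"
        proof (intro mult_left_mono)
          have "1 / real k ^ (card U + 1) \<le> 1 / real k ^ 2"
            using kp u1 by (intro divide_left_mono power_increasing) auto
          also have "\<dots> = real k powr (-2)" using kp by (simp add: powr_minus powr_numeral field_simps)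
          also have "\<dots> \<le> real k powr (-3/2)" using kp by (intro powr_mono) auto
          finally show "1 / real k ^ (card U + 1) \<le> real k powr (-3/2)" .
        qed (use C(1) in auto)
        finally show "real (k ^ ?s * ((N div k) * card (VCset J U (N div k)))) \<le>
          C * real N ^ (?s + card U + 1) * real k powr (-3/2)" .
      qed
      also have "\<dots> = C * real N ^ (?s + card U + 1) * (\<Sum>k\<in>{1..N}. real k powr (-3/2))"
        by (rule sum_distrib_left[symmetric])
      also have "\<dots> \<le> C * real N ^ (?s + card U + 1) * S"
        using C(1) S by (intro mult_left_mono) auto
      also have "\<dots> = C * S * real N ^ (?s + card U + 1)" by (simp add: mult_ac)
      also have "\<dots> \<le> D * real N ^ (?s + card U + 1)" using D(2) by (intro mult_right_mono) auto
      finally show ?thesis .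
    qed
    then show ?thesis using fin insert.hyps by simp
  qed
  then show ?case using D(1) by (intro exI[of _ D]) auto
qed

text \<open>Dyadic summation. The layer between \<open>R / 2\<close> and R contributes
  \<open>2 ^ q * C * R ^ (p - q)\<close>, half of the claim; the bound at \<open>R / 2\<close> is at
  most the other half because \<open>q < p\<close>.\<close>

lemma sum_inverse_power_le:
  fixes \<nu> :: "'a \<Rightarrow> nat" and C R :: real
  assumes fin: "finite A" and pos: "\<And>a. a \<in> A \<Longrightarrow> \<nu> a \<ge> 1" and C: "C \<ge> 0"
    and cnt: "\<And>x. real (card {a\<in>A. \<nu> a \<le> x}) \<le> C * real x ^ p" and pq: "q < p" and R: "R \<ge> 0"
  shows "(\<Sum>a\<in>{a\<in>A. real (\<nu> a) \<le> R}. 1 / real (\<nu> a) ^ q) \<le> 2 ^ (q + 1) * C * R ^ (p - q)"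
proof -
  let ?F = "\<lambda>R. \<Sum>a\<in>{a\<in>A. real (\<nu> a) \<le> R}. 1 / real (\<nu> a) ^ q"
  have "?F R \<le> 2 ^ (q + 1) * C * R ^ (p - q)" if "R < 2 ^ n" "R \<ge> 0" for n R
    using that
  proof (induction n arbitrary: R)
    case 0
    then have e: "{a\<in>A. real (\<nu> a) \<le> R} = {}" using pos by fastforce
    show ?case unfolding e using 0 C by simp
  next
    case (Suc n)
    show ?case
    proof (cases "R < 1")
      case True
      then have e: "{a\<in>A. real (\<nu> a) \<le> R} = {}" using pos by fastforce
      show ?thesis unfolding e using Suc.prems C by simp
    next
      case False
      then have R1: "R \<ge> 1" "R > 0" by auto
      let ?A1 = "{a\<in>A. real (\<nu> a) \<le> R / 2}" and ?A2 = "{a\<in>A. R / 2 < real (\<nu> a) \<and> real (\<nu> a) \<le> R}"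
      have un: "{a\<in>A. real (\<nu> a) \<le> R} = ?A1 \<union> ?A2" using R1 by auto
      have "?F R = ?F (R / 2) + (\<Sum>a\<in>?A2. 1 / real (\<nu> a) ^ q)"
        unfolding un by (rule sum.union_disjoint) (use fin in auto)
      moreover have "?F (R / 2) \<le> 2 ^ (q + 1) * C * (R / 2) ^ (p - q)"
        using Suc.prems by (intro Suc.IH) auto
      moreover have "\<dots> \<le> 2 ^ q * C * R ^ (p - q)"
      proof -
        have "(R / 2) ^ (p - q) = R ^ (p - q) / 2 ^ (p - q)" by (simp add: power_divide)
        also have "\<dots> \<le> R ^ (p - q) / 2 ^ 1"
          using pq R1 by (intro divide_left_mono power_increasing) auto
        finally have "2 ^ (q + 1) * C * (R / 2) ^ (p - q) \<le> 2 ^ (q + 1) * C * (R ^ (p - q) / 2 ^ 1)"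
          using C by (intro mult_left_mono) auto
        then show ?thesis by simp
      qed
      moreover have "(\<Sum>a\<in>?A2. 1 / real (\<nu> a) ^ q) \<le> 2 ^ q * C * R ^ (p - q)"
      proof -
        have "(\<Sum>a\<in>?A2. 1 / real (\<nu> a) ^ q) \<le> (\<Sum>a\<in>?A2. 1 / (R / 2) ^ q)"
          using R1 by (intro sum_mono divide_left_mono power_mono mult_pos_pos zero_less_power) auto
        also have "\<dots> = real (card ?A2) * (1 / (R / 2) ^ q)" by simp
        also have "\<dots> \<le> (C * R ^ p) * (1 / (R / 2) ^ q)"
        proof (intro mult_right_mono)
          have "?A2 \<subseteq> {a\<in>A. \<nu> a \<le> nat \<lfloor>R\<rfloor>}" using R1 by (auto simp: le_nat_floor)
          then have "card ?A2 \<le> card {a\<in>A. \<nu> a \<le> nat \<lfloor>R\<rfloor>}" using fin by (intro card_mono) auto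
          then have "real (card ?A2) \<le> C * real (nat \<lfloor>R\<rfloor>) ^ p" using cnt[of "nat \<lfloor>R\<rfloor>"] by linarith
          also have "\<dots> \<le> C * R ^ p" using R1 C by (intro mult_left_mono power_mono) auto
          finally show "real (card ?A2) \<le> C * R ^ p" .
        qed (use R1 in auto)
        also have "\<dots> = 2 ^ q * C * R ^ (p - q)"
          using R1 pq by (simp add: power_divide power_diff field_simps)
        finally show ?thesis .
      qed
      moreover have "2 ^ (q + 1) * C * R ^ (p - q) = 2 ^ q * C * R ^ (p - q) + 2 ^ q * C * R ^ (p - q)"
        by simp
      ultimately show ?thesis by linarith
    qed
  qed
  moreover obtain n :: nat where "R < 2 ^ n" using real_arch_pow[of 2 R] by auto
  ultimately show ?thesis using R by blast
qed

section \<open>Lebesgue measure on finite products and periodic functions\<close>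

abbreviation LB :: "'i set \<Rightarrow> ('i \<Rightarrow> real) measure" where
  "LB A \<equiv> Pi\<^sub>M A (\<lambda>_. lborel)"

interpretation lb: product_sigma_finite "\<lambda>_::'i. lborel :: real measure" ..

definition shf :: "'i set \<Rightarrow> ('i \<Rightarrow> real) \<Rightarrow> ('i \<Rightarrow> real) \<Rightarrow> 'i \<Rightarrow> real" where
  "shf A c x = (\<lambda>i\<in>A. x i + c i)"

definition cubeI :: "'i set \<Rightarrow> ('i \<Rightarrow> real) set" where
  "cubeI A = (\<Pi>\<^sub>E i\<in>A. {0..<1})"

definition intsE :: "'i set \<Rightarrow> ('i \<Rightarrow> real) set" where
  "intsE A = (\<Pi>\<^sub>E i\<in>A. \<int>)"

lemma shf_nth [simp]: "i \<in> A \<Longrightarrow> shf A c x i = x i + c i"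
  by (simp add: shf_def)

lemma space_LB: "space (LB A) = extensional A"
  by (simp add: space_PiM PiE_def)

lemma measurable_shf [measurable]: "shf A c \<in> measurable (LB A) (LB A)"
  unfolding shf_def by measurable

lemma cubeI_sets [measurable]: "finite A \<Longrightarrow> cubeI A \<in> sets (LB A)"
  unfolding cubeI_def by (rule sets_PiM_I_finite) auto

lemma countable_intsE: "finite A \<Longrightarrow> countable (intsE A)"
  unfolding intsE_def by (rule countable_PiE) (auto simp: Ints_def)

lemma distr_shf:
  assumes "finite A"
  shows "distr (LB A) (LB A) (shf A c) = LB A"
proof (rule lb.PiM_eqI[OF assms])
  fix B :: "'a \<Rightarrow> real set" assume B: "\<And>i. i \<in> A \<Longrightarrow> B i \<in> sets lborel"
  have pre: "shf A c -` (\<Pi>\<^sub>E i\<in>A. B i) \<inter> space (LB A) = (\<Pi>\<^sub>E i\<in>A. (\<lambda>y. c i + y) -` B i)"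
    unfolding shf_def space_LB
    by (auto simp: PiE_iff add.commute extensional_def)
  have "emeasure (distr (LB A) (LB A) (shf A c)) (\<Pi>\<^sub>E i\<in>A. B i) =
      emeasure (LB A) (\<Pi>\<^sub>E i\<in>A. (\<lambda>y. c i + y) -` B i)"
    using assms B by (subst emeasure_distr) (auto intro!: sets_PiM_I_finite simp: pre)
  also have "\<dots> = (\<Prod>i\<in>A. emeasure lborel ((\<lambda>y. c i + y) -` B i))"
    by (rule lb.emeasure_PiM[OF assms])
      (use B in \<open>auto intro!: measurable_sets_borel[where M = borel] borel_measurable_add\<close>)
  also have "\<dots> = (\<Prod>i\<in>A. emeasure lborel (B i))"
  proof (rule prod.cong[OF refl])
    fix i assume i: "i \<in> A"
    have "emeasure lborel (B i) = emeasure (distr lborel borel (\<lambda>y. c i + y)) (B i)"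
      by (simp only: lborel_distr_plus)
    also have "\<dots> = emeasure lborel ((\<lambda>y. c i + y) -` B i)"
      using B[OF i] by (subst emeasure_distr) auto
    finally show "emeasure lborel ((\<lambda>y. c i + y) -` B i) = emeasure lborel (B i)" ..
  qed
  finally show "emeasure (distr (LB A) (LB A) (shf A c)) (\<Pi>\<^sub>E i\<in>A. B i) = (\<Prod>i\<in>A. emeasure lborel (B i))" .
qed simp

lemma nn_integral_shf:
  assumes "finite A" and [measurable]: "f \<in> borel_measurable (LB A)"
  shows "(\<integral>\<^sup>+x. f (shf A c x) \<partial>LB A) = (\<integral>\<^sup>+x. f x \<partial>LB A)"
proof -
  have "(\<integral>\<^sup>+x. f x \<partial>LB A) = (\<integral>\<^sup>+x. f x \<partial>distr (LB A) (LB A) (shf A c))"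
    by (simp only: distr_shf[OF assms(1)])
  also have "\<dots> = (\<integral>\<^sup>+x. f (shf A c x) \<partial>LB A)" by (rule nn_integral_distr) auto
  finally show ?thesis ..
qed

lemma shf_shf: "shf A c (shf A d x) = shf A (\<lambda>i. c i + d i) x"
  by (auto simp: shf_def fun_eq_iff)

text \<open>The half-open unit cubes tile space: the only admissible z is minus the coordinatewise
  floor of \<open>x - c\<close>. It serves as a partition of unity on the torus.\<close>

lemma unique_int_shift:
  assumes "x \<in> extensional A"
  shows "(\<integral>\<^sup>+z. indicator (cubeI A) (shf A (\<lambda>i. z i - c i) x) \<partial>count_space (intsE A)) = (1::ennreal)"
proof -
  define z0 where "z0 = (\<lambda>i\<in>A. - of_int \<lfloor>x i - c i\<rfloor> :: real)"
  have z0: "z0 \<in> intsE A" by (auto simp: z0_def intsE_def)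
  have iff: "shf A (\<lambda>i. z i - c i) x \<in> cubeI A \<longleftrightarrow> z = z0" if z: "z \<in> intsE A" for z
  proof
    assume c: "shf A (\<lambda>i. z i - c i) x \<in> cubeI A"
    show "z = z0"
    proof
      fix i show "z i = z0 i"
      proof (cases "i \<in> A")
        case True
        then have b: "0 \<le> x i + (z i - c i)" "x i + (z i - c i) < 1"
          using c by (auto simp: cubeI_def shf_def PiE_iff)
        obtain k where k: "z i = of_int k" using z True by (auto simp: intsE_def PiE_iff elim: Ints_cases)
        have "\<lfloor>x i - c i\<rfloor> = - k" using b k by (intro floor_unique) auto
        then show ?thesis using k True by (simp add: z0_def)
      next
        case False
        then show ?thesis using z by (auto simp: z0_def intsE_def PiE_iff extensional_def)
      qed
    qed
  next
    assume "z = z0"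
    moreover have "0 \<le> x i - c i - of_int \<lfloor>x i - c i\<rfloor>" "x i - c i - of_int \<lfloor>x i - c i\<rfloor> < 1" for i
      by linarith+
    ultimately show "shf A (\<lambda>i. z i - c i) x \<in> cubeI A"
      by (auto simp: cubeI_def shf_def z0_def algebra_simps)
  qed
  have "(\<integral>\<^sup>+z. indicator (cubeI A) (shf A (\<lambda>i. z i - c i) x) \<partial>count_space (intsE A)) =
    (\<integral>\<^sup>+z. indicator {z0} z \<partial>count_space (intsE A))"
    using iff by (intro nn_integral_cong) (auto simp: indicator_def)
  also have "\<dots> = 1" using z0 by simp
  finally show ?thesis .
qed

text \<open>Both the tiling of space by the unit cube and the invariance of integrals of periodic functions
  follow by inserting the partition of unity into cubes and substituting.\<close>

lemma nn_integral_tile: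
  assumes A: "finite A" and [measurable]: "f \<in> borel_measurable (LB A)"
  shows "(\<integral>\<^sup>+x. f x \<partial>LB A) =
    (\<integral>\<^sup>+z. (\<integral>\<^sup>+x\<in>cubeI A. f (shf A (\<lambda>i. - z i) x) \<partial>LB A) \<partial>count_space (intsE A))"
proof -
  note [measurable] = cubeI_sets[OF A]
  have "(\<integral>\<^sup>+x. f x \<partial>LB A) =
    (\<integral>\<^sup>+x. (\<integral>\<^sup>+z. f x * indicator (cubeI A) (shf A (\<lambda>i. z i - 0) x) \<partial>count_space (intsE A)) \<partial>LB A)"
    by (intro nn_integral_cong, subst nn_integral_cmult) (simp_all only: unique_int_shift space_LB measurable_count_space_eq1, auto)
  also have "\<dots> = (\<integral>\<^sup>+z. (\<integral>\<^sup>+x. f x * indicator (cubeI A) (shf A (\<lambda>i. z i - 0) x) \<partial>LB A) \<partial>count_space (intsE A))"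
    by (rule nn_integral_count_space_nn_integral[OF countable_intsE[OF A]]) measurable
  also have "\<dots> = (\<integral>\<^sup>+z. (\<integral>\<^sup>+x\<in>cubeI A. f (shf A (\<lambda>i. - z i) x) \<partial>LB A) \<partial>count_space (intsE A))"
  proof (rule nn_integral_cong)
    fix z
    have "(\<integral>\<^sup>+x. f x * indicator (cubeI A) (shf A z x) \<partial>LB A) =
      (\<integral>\<^sup>+x. f (shf A (\<lambda>i. - z i) x) * indicator (cubeI A) (shf A z (shf A (\<lambda>i. - z i) x)) \<partial>LB A)"
      by (rule nn_integral_shf[OF A, symmetric]) measurable
    also have "\<dots> = (\<integral>\<^sup>+x\<in>cubeI A. f (shf A (\<lambda>i. - z i) x) \<partial>LB A)"
    proof (rule nn_integral_cong)
      fix x assume "x \<in> space (LB A)"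
      then have "shf A z (shf A (\<lambda>i. - z i) x) = x"
        by (auto simp: shf_shf) (auto simp: shf_def space_LB fun_eq_iff extensional_def)
      then show "f (shf A (\<lambda>i. - z i) x) * indicator (cubeI A) (shf A z (shf A (\<lambda>i. - z i) x)) =
        f (shf A (\<lambda>i. - z i) x) * indicator (cubeI A) x" by simp
    qed
    finally show "(\<integral>\<^sup>+x. f x * indicator (cubeI A) (shf A (\<lambda>i. z i - 0) x) \<partial>LB A) =
      (\<integral>\<^sup>+x\<in>cubeI A. f (shf A (\<lambda>i. - z i) x) \<partial>LB A)" by simp
  qed
  finally show ?thesis .
qed

lemma nn_integral_cube_shf:
  assumes A: "finite A" and [measurable]: "f \<in> borel_measurable (LB A)"
    and per: "\<And>z x. z \<in> intsE A \<Longrightarrow> x \<in> extensional A \<Longrightarrow> f (shf A z x) = f x"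
  shows "(\<integral>\<^sup>+x\<in>cubeI A. f (shf A c x) \<partial>LB A) = (\<integral>\<^sup>+x\<in>cubeI A. f x \<partial>LB A)"
proof -
  note [measurable] = cubeI_sets[OF A]
  have "(\<integral>\<^sup>+x\<in>cubeI A. f (shf A c x) \<partial>LB A) =
    (\<integral>\<^sup>+x. f (shf A c x) * indicator (cubeI A) (shf A (\<lambda>i. - c i) (shf A c x)) \<partial>LB A)"
  proof (rule nn_integral_cong)
    fix x assume "x \<in> space (LB A)"
    then have "shf A (\<lambda>i. - c i) (shf A c x) = x"
      by (auto simp: shf_shf) (auto simp: shf_def space_LB fun_eq_iff extensional_def)
    then show "f (shf A c x) * indicator (cubeI A) x =
      f (shf A c x) * indicator (cubeI A) (shf A (\<lambda>i. - c i) (shf A c x))" by simp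
  qed
  also have "\<dots> = (\<integral>\<^sup>+x. f x * indicator (cubeI A) (shf A (\<lambda>i. - c i) x) \<partial>LB A)"
    by (rule nn_integral_shf[OF A]) measurable
  also have "\<dots> = (\<integral>\<^sup>+z. (\<integral>\<^sup>+x\<in>cubeI A. f (shf A (\<lambda>i. - z i) x) *
      indicator (cubeI A) (shf A (\<lambda>i. - c i) (shf A (\<lambda>i. - z i) x)) \<partial>LB A) \<partial>count_space (intsE A))"
    by (rule nn_integral_tile[OF A]) measurable
  also have "\<dots> = (\<integral>\<^sup>+z. (\<integral>\<^sup>+x\<in>cubeI A. f x * indicator (cubeI A) (shf A (\<lambda>i. - z i - c i) x) \<partial>LB A) \<partial>count_space (intsE A))"
  proof (intro nn_integral_cong)
    fix z x assume z: "z \<in> space (count_space (intsE A))" and x: "x \<in> space (LB A)"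
    have "(\<lambda>i\<in>A. - z i) \<in> intsE A" using z by (auto simp: intsE_def PiE_iff)
    from per[OF this, of x] x have "f (shf A (\<lambda>i\<in>A. - z i) x) = f x" by (simp add: space_LB)
    moreover have "shf A (\<lambda>i\<in>A. - z i) x = shf A (\<lambda>i. - z i) x" by (auto simp: shf_def fun_eq_iff)
    moreover have "shf A (\<lambda>i. - c i) (shf A (\<lambda>i. - z i) x) = shf A (\<lambda>i. - z i - c i) x"
      by (simp add: shf_def fun_eq_iff)
    ultimately show "f (shf A (\<lambda>i. - z i) x) * indicator (cubeI A) (shf A (\<lambda>i. - c i) (shf A (\<lambda>i. - z i) x)) * indicator (cubeI A) x =
      f x * indicator (cubeI A) (shf A (\<lambda>i. - z i - c i) x) * indicator (cubeI A) x"
      by simp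
  qed
  also have "\<dots> = (\<integral>\<^sup>+x. (\<integral>\<^sup>+z. f x * indicator (cubeI A) (shf A (\<lambda>i. - z i - c i) x) * indicator (cubeI A) x \<partial>count_space (intsE A)) \<partial>LB A)"
    by (rule nn_integral_count_space_nn_integral[OF countable_intsE[OF A], symmetric]) measurable
  also have "\<dots> = (\<integral>\<^sup>+x\<in>cubeI A. f x \<partial>LB A)"
  proof (rule nn_integral_cong)
    fix x assume x: "x \<in> space (LB A)"
    have bij: "bij_betw (\<lambda>z. \<lambda>i\<in>A. - z i) (intsE A) (intsE A)"
      by (rule bij_betwI[where g = "\<lambda>z. \<lambda>i\<in>A. - z i"]) (auto simp: intsE_def PiE_iff extensional_def fun_eq_iff)
    have "(\<integral>\<^sup>+z. indicator (cubeI A) (shf A (\<lambda>i. - z i - c i) x) \<partial>count_space (intsE A)) =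
      (\<integral>\<^sup>+z. indicator (cubeI A) (shf A (\<lambda>i. (\<lambda>i\<in>A. - z i) i - c i) x) \<partial>count_space (intsE A))"
      by (intro nn_integral_cong arg_cong[where f = "indicator (cubeI A)"]) (auto simp: shf_def fun_eq_iff)
    also have "\<dots> = (\<integral>\<^sup>+z. indicator (cubeI A) (shf A (\<lambda>i. z i - c i) x) \<partial>count_space (intsE A))"
      by (rule nn_integral_bij_count_space[OF bij])
    also have "\<dots> = (1::ennreal)" using unique_int_shift x by (simp add: space_LB)
    finally have one: "(\<integral>\<^sup>+z. indicator (cubeI A) (shf A (\<lambda>i. - z i - c i) x) \<partial>count_space (intsE A)) = (1::ennreal)" .
    have "(\<integral>\<^sup>+z. f x * indicator (cubeI A) (shf A (\<lambda>i. - z i - c i) x) * indicator (cubeI A) x \<partial>count_space (intsE A)) =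
      (\<integral>\<^sup>+z. (f x * indicator (cubeI A) x) * indicator (cubeI A) (shf A (\<lambda>i. - z i - c i) x) \<partial>count_space (intsE A))"
      by (intro nn_integral_cong) (simp add: mult_ac)
    also have "\<dots> = f x * indicator (cubeI A) x * 1" unfolding one[symmetric] by (rule nn_integral_cmult) simp
    finally show "(\<integral>\<^sup>+z. f x * indicator (cubeI A) (shf A (\<lambda>i. - z i - c i) x) * indicator (cubeI A) x \<partial>count_space (intsE A)) =
      f x * indicator (cubeI A) x" by simp
  qed
  finally show ?thesis .
qed

lemma emeasure_cubeI: "finite A \<Longrightarrow> emeasure (LB A) (cubeI A) = 1"
  unfolding cubeI_def by (subst lb.emeasure_PiM) auto

lemma emeasure_abs_affine_le:
  fixes a b B :: real
  assumes "a \<noteq> 0" "B \<ge> 0"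
  shows "emeasure lborel {y. \<bar>a * y + b\<bar> \<le> B} = ennreal (2 * B / \<bar>a\<bar>)"
proof -
  have "\<bar>a * y + b\<bar> \<le> B \<longleftrightarrow> y \<in> {- b / a - B / \<bar>a\<bar> .. - b / a + B / \<bar>a\<bar>}" for y
  proof -
    have "\<bar>a * y + b\<bar> = \<bar>a\<bar> * \<bar>y - (- b / a)\<bar>"
      using assms(1) by (simp flip: abs_mult add: algebra_simps)
    then have "\<bar>a * y + b\<bar> \<le> B \<longleftrightarrow> \<bar>y - (- b / a)\<bar> \<le> B / \<bar>a\<bar>"
      using assms(1) by (simp add: pos_le_divide_eq mult.commute)
    also have "\<dots> \<longleftrightarrow> y \<in> {- b / a - B / \<bar>a\<bar> .. - b / a + B / \<bar>a\<bar>}" by auto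
    finally show ?thesis .
  qed
  then have "{y. \<bar>a * y + b\<bar> \<le> B} = {- b / a - B / \<bar>a\<bar> .. - b / a + B / \<bar>a\<bar>}" by blast
  then show ?thesis using assms by (simp add: emeasure_lborel_Icc_eq)
qed

section \<open>An integral over symmetric matrices\<close>

text \<open>The body consists of functions on J, so that its volume under \<open>LB J\<close> can be
  computed one coordinate at a time; \<open>KV\<close> is the same body in
  \<open>real^'n\<close>.\<close>

definition KY :: "'n set \<Rightarrow> real \<Rightarrow> real \<Rightarrow> ('n uprod \<Rightarrow> real) \<Rightarrow> ('n \<Rightarrow> real) set" where
  "KY J a b Y = {x\<in>extensional J. (\<forall>i\<in>J. \<bar>x i\<bar> \<le> a) \<and> (\<forall>i\<in>J. \<bar>\<Sum>l\<in>J. x l * Y (Upair l i)\<bar> \<le> b)}"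

definition gY :: "'n set \<Rightarrow> real \<Rightarrow> real \<Rightarrow> ('n uprod \<Rightarrow> real) \<Rightarrow> ennreal" where
  "gY J a b Y = emeasure (LB J) (KY J a b Y)"

lemma KY_sets [measurable]:
  assumes "finite J"
  shows "KY J a b Y \<in> sets (LB J)"
proof -
  have "KY J a b Y = {x\<in>space (LB J). (\<forall>i\<in>J. \<bar>x i\<bar> \<le> a) \<and> (\<forall>i\<in>J. \<bar>\<Sum>l\<in>J. x l * Y (Upair l i)\<bar> \<le> b)}"
    by (simp add: KY_def space_LB)
  also have "\<dots> \<in> sets (LB J)" using assms by measurable
  finally show ?thesis .
qed

lemma finite_prs [simp]: "finite J \<Longrightarrow> finite (prs J)"
proof -
  assume "finite J"
  have "prs J \<subseteq> (\<lambda>(i, j). Upair i j) ` (J \<times> J)"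
  proof
    fix p assume "p \<in> prs J"
    then show "p \<in> (\<lambda>(i, j). Upair i j) ` (J \<times> J)" by (cases p) force
  qed
  then show "finite (prs J)" using \<open>finite J\<close> finite_subset by blast
qed

lemma measurable_KY_pair:
  assumes "finite J"
  shows "(\<lambda>(Y, x). indicator (KY J a b Y) x :: ennreal) \<in> borel_measurable (LB (prs J) \<Otimes>\<^sub>M LB J)"
proof -
  have [measurable]: "(\<lambda>z. fst z (Upair l i)) \<in> borel_measurable (LB (prs J) \<Otimes>\<^sub>M LB J)" if "l \<in> J" "i \<in> J" for l i
    using that by (intro measurable_compose[OF measurable_fst] measurable_component_singleton[of _ _ "\<lambda>_. lborel", simplified]) auto
  have [measurable]: "(\<lambda>z. snd z i) \<in> borel_measurable (LB (prs J) \<Otimes>\<^sub>M LB J)" if "i \<in> J" for i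
    using that by (intro measurable_compose[OF measurable_snd] measurable_component_singleton[of _ _ "\<lambda>_. lborel", simplified]) auto
  have "{z\<in>space (LB (prs J) \<Otimes>\<^sub>M LB J). snd z \<in> KY J a b (fst z)} =
    {z\<in>space (LB (prs J) \<Otimes>\<^sub>M LB J). (\<forall>i\<in>J. \<bar>snd z i\<bar> \<le> a) \<and>
      (\<forall>i\<in>J. \<bar>\<Sum>l\<in>J. snd z l * fst z (Upair l i)\<bar> \<le> b)}"
    by (auto simp: KY_def space_pair_measure space_LB)
  also have "\<dots> \<in> sets (LB (prs J) \<Otimes>\<^sub>M LB J)" using assms by measurable
  finally have "(\<lambda>z. indicator {z\<in>space (LB (prs J) \<Otimes>\<^sub>M LB J). snd z \<in> KY J a b (fst z)} z :: ennreal)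
    \<in> borel_measurable (LB (prs J) \<Otimes>\<^sub>M LB J)" by simp
  also have "?this \<longleftrightarrow> ?thesis"
    by (intro measurable_cong) (auto simp: indicator_def split: prod.splits)
  finally show ?thesis .
qed

lemma gY_nn_integral: "finite J \<Longrightarrow> gY J a b Y = (\<integral>\<^sup>+x. indicator (KY J a b Y) x \<partial>LB J)"
  by (simp add: gY_def)

lemma measurable_gY:
  assumes "finite J"
  shows "gY J a b \<in> borel_measurable (LB (prs J))"
proof -
  interpret finite_product_sigma_finite "\<lambda>_. lborel :: real measure" J by standard fact
  have "(\<lambda>Y. \<integral>\<^sup>+x. indicator (KY J a b Y) x \<partial>LB J) \<in> borel_measurable (LB (prs J))"
    using borel_measurable_nn_integral[OF measurable_KY_pair[OF assms, of a b]] .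
  moreover have "gY J a b = (\<lambda>Y. \<integral>\<^sup>+x. indicator (KY J a b Y) x \<partial>LB J)"
    by (rule ext) (rule gY_nn_integral[OF assms])
  ultimately show ?thesis by (simp only:)
qed

lemma gY_le:
  assumes "finite J" "a \<ge> 0"
  shows "gY J a b Y \<le> ennreal ((2 * a) ^ card J)"
proof -
  have "gY J a b Y \<le> emeasure (LB J) (\<Pi>\<^sub>E i\<in>J. {- a..a})"
    unfolding gY_def using assms(1)
    by (intro emeasure_mono sets_PiM_I_finite) (auto simp: KY_def PiE_iff abs_le_iff minus_le_iff extensional_def)
  also have "\<dots> = (\<Prod>i\<in>J. ennreal (2 * a))"
    using assms by (subst lb.emeasure_PiM) auto
  also have "\<dots> = ennreal ((2 * a) ^ card J)"
    using assms(2) by (simp add: ennreal_power)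
  finally show ?thesis .
qed

text \<open>Subtracting one point of the fibre from all others cancels the contribution of the fixed
  coordinate y and leaves a point of the doubled body in dimension one less.\<close>

lemma KY_insert_fibre_le:
  assumes J: "finite J" "j \<notin> J"
  shows "emeasure (LB J) {x\<in>space (LB J). x(j := y) \<in> KY (insert j J) a b Y} \<le> gY J (2 * a) (2 * b) Y"
proof (cases "{x\<in>space (LB J). x(j := y) \<in> KY (insert j J) a b Y} = {}")
  case True then show ?thesis by (simp only: emeasure_empty zero_le)
next
  case False
  let ?F = "{x\<in>space (LB J). x(j := y) \<in> KY (insert j J) a b Y}"
  obtain x0 where x0: "x0 \<in> ?F" using False by blast
  have upd: "(\<Sum>l\<in>insert j J. (x(j := y)) l * Y (Upair l i)) = y * Y (Upair j i) + (\<Sum>l\<in>J. x l * Y (Upair l i))" for x i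
  proof -
    have "(\<Sum>l\<in>J. (x(j := y)) l * Y (Upair l i)) = (\<Sum>l\<in>J. x l * Y (Upair l i))"
      using J(2) by (intro sum.cong) auto
    then show ?thesis using J by simp
  qed
  have sub: "shf J (\<lambda>i. - x0 i) x \<in> KY J (2 * a) (2 * b) Y" if x: "x \<in> ?F" for x
    unfolding KY_def
  proof (safe intro!: ballI)
    show "shf J (\<lambda>i. - x0 i) x \<in> extensional J" by (simp add: shf_def)
    fix i assume i: "i \<in> J"
    then have ij: "i \<noteq> j" using J(2) by auto
    have xi: "\<bar>(x(j := y)) i\<bar> \<le> a" "\<bar>(x0(j := y)) i\<bar> \<le> a"
      "\<bar>\<Sum>l\<in>insert j J. (x(j := y)) l * Y (Upair l i)\<bar> \<le> b"
      "\<bar>\<Sum>l\<in>insert j J. (x0(j := y)) l * Y (Upair l i)\<bar> \<le> b"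
      using x x0 i by (auto simp: KY_def)
    show "\<bar>shf J (\<lambda>i. - x0 i) x i\<bar> \<le> 2 * a" using xi(1,2) ij i by (simp add: shf_def)
    have "(\<Sum>l\<in>J. shf J (\<lambda>i. - x0 i) x l * Y (Upair l i)) = (\<Sum>l\<in>J. x l * Y (Upair l i)) - (\<Sum>l\<in>J. x0 l * Y (Upair l i))"
      by (simp add: left_diff_distrib sum_subtractf)
    then show "\<bar>\<Sum>l\<in>J. shf J (\<lambda>i. - x0 i) x l * Y (Upair l i)\<bar> \<le> 2 * b"
      using xi(3,4) unfolding upd by linarith
  qed
  note [measurable] = KY_sets[OF J(1)]
  have "emeasure (LB J) ?F \<le> emeasure (LB J) {x\<in>space (LB J). shf J (\<lambda>i. - x0 i) x \<in> KY J (2 * a) (2 * b) Y}"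
  proof (rule emeasure_mono)
    show "?F \<subseteq> {x\<in>space (LB J). shf J (\<lambda>i. - x0 i) x \<in> KY J (2 * a) (2 * b) Y}" using sub by blast
  qed measurable
  also have "\<dots> = (\<integral>\<^sup>+x. indicator (KY J (2 * a) (2 * b) Y) (shf J (\<lambda>i. - x0 i) x) \<partial>LB J)"
    by (subst nn_integral_indicator[symmetric], measurable)
       (intro nn_integral_cong, simp add: indicator_def)
  also have "\<dots> = (\<integral>\<^sup>+x. indicator (KY J (2 * a) (2 * b) Y) x \<partial>LB J)"
    by (rule nn_integral_shf[OF J(1)]) measurable
  also have "\<dots> = gY J (2 * a) (2 * b) Y" by (simp add: gY_nn_integral[OF J(1)])
  finally show ?thesis .
qed

text \<open>The part of the body where \<open>\<bar>x j\<bar> \<le> t\<close> has volume at most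
  \<open>2 * t * g'\<close>, with \<open>g'\<close> the bound for the fibres. For a suitable t it is
  at most half the body, and on the rest the volume is at most
  \<open>4 * \<bar>x j\<bar> * g'\<close>. So powers of the volume can be traded for powers of
  \<open>x j\<close>.\<close>

lemma gY_power_le:
  assumes J: "finite J" "j \<notin> J" and ab: "a \<ge> 0" "n \<ge> 1"
  shows "gY (insert j J) a b Y ^ Suc n \<le>
    2 * (\<integral>\<^sup>+x. indicator (KY (insert j J) a b Y) x * (ennreal (4 * \<bar>x j\<bar>) * gY J (2 * a) (2 * b) Y) ^ n \<partial>LB (insert j J))"
proof -
  let ?J = "insert j J" and ?K = "KY (insert j J) a b Y"
  let ?g' = "gY J (2 * a) (2 * b) Y" and ?G = "gY (insert j J) a b Y"
  have fin: "finite ?J" using J by simp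
  note [measurable] = KY_sets[OF fin, of a b Y]
  have xj [measurable]: "(\<lambda>x. x j) \<in> borel_measurable (LB ?J)"
    using measurable_component_singleton[of j ?J "\<lambda>_. lborel :: real measure"] by simp
  have "?g' < \<infinity>" "?G < \<infinity>"
    using gY_le[OF J(1), of "2 * a" "2 * b" Y] gY_le[OF fin, of a b Y] ab by (auto intro: le_less_trans)
  then obtain g' G where g': "?g' = ennreal g'" "g' \<ge> 0" and G: "?G = ennreal G" "G \<ge> 0"
    by (cases ?g'; cases ?G) auto
  have h: "emeasure (LB ?J) {x\<in>space (LB ?J). x \<in> ?K \<and> \<bar>x j\<bar> \<le> t} \<le> ennreal (2 * t) * ?g'" if t: "t \<ge> 0" for t
  proof -
    have m: "{x\<in>space (LB ?J). x \<in> ?K \<and> \<bar>x j\<bar> \<le> t} \<in> sets (LB ?J)" by measurable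
    have "emeasure (LB ?J) {x\<in>space (LB ?J). x \<in> ?K \<and> \<bar>x j\<bar> \<le> t} =
      (\<integral>\<^sup>+x. indicator {x\<in>space (LB ?J). x \<in> ?K \<and> \<bar>x j\<bar> \<le> t} x \<partial>LB ?J)"
      using m by simp
    also have "\<dots> = (\<integral>\<^sup>+y. (\<integral>\<^sup>+x. indicator {x\<in>space (LB ?J). x \<in> ?K \<and> \<bar>x j\<bar> \<le> t} (x(j := y)) \<partial>LB J) \<partial>lborel)"
      using m by (intro lb.product_nn_integral_insert_rev[OF J]) measurable
    also have "\<dots> \<le> (\<integral>\<^sup>+y. ?g' * indicator {-t..t} y \<partial>lborel)"
    proof (rule nn_integral_mono)
      fix y :: real
      have mu: "(\<lambda>x. x(j := y)) \<in> measurable (LB J) (LB ?J)"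
        by (rule measurable_fun_upd[where J = J]) (auto simp: J)
      have ms: "{x\<in>space (LB J). x(j := y) \<in> ?K} \<in> sets (LB J)"
        using measurable_sets[OF mu, of ?K] KY_sets[OF fin, of a b Y] by (simp add: vimage_def Int_def conj_commute)
      have "(\<integral>\<^sup>+x. indicator {x\<in>space (LB ?J). x \<in> ?K \<and> \<bar>x j\<bar> \<le> t} (x(j := y)) \<partial>LB J) \<le>
        (\<integral>\<^sup>+x. indicator {x\<in>space (LB J). x(j := y) \<in> ?K} x * indicator {-t..t} y \<partial>LB J)"
        by (intro nn_integral_mono) (auto simp: indicator_def)
      also have "\<dots> = emeasure (LB J) {x\<in>space (LB J). x(j := y) \<in> ?K} * indicator {-t..t} y"
        using ms by (simp add: nn_integral_multc)
      also have "\<dots> \<le> ?g' * indicator {-t..t} y"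
        using KY_insert_fibre_le[OF J, of y a b Y] by (intro mult_right_mono) auto
      finally show "(\<integral>\<^sup>+x. indicator {x\<in>space (LB ?J). x \<in> ?K \<and> \<bar>x j\<bar> \<le> t} (x(j := y)) \<partial>LB J) \<le> ?g' * indicator {-t..t} y" .
    qed
    also have "\<dots> = ?g' * ennreal (2 * t)" using t by (simp add: nn_integral_cmult)
    finally show ?thesis by (simp add: mult.commute)
  qed
  show ?thesis
  proof (cases "g' = 0")
    case True
    have "?G = emeasure (LB ?J) {x\<in>space (LB ?J). x \<in> ?K \<and> \<bar>x j\<bar> \<le> a}"
      unfolding gY_def by (rule arg_cong[where f = "emeasure _"]) (auto simp: KY_def space_LB)
    also have "\<dots> \<le> 0" using h[of a] ab True g' by simp
    finally have "?G = 0" by simp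
    then show ?thesis by simp
  next
    case False
    then have g'p: "g' > 0" using g' by simp
    \<comment> \<open>Chosen so that \<open>2 * t * g' = G / 2\<close>.\<close>
    define t where "t = G / (4 * g')"
    have t: "t \<ge> 0" using G g'p by (simp add: t_def)
    let ?L = "{x\<in>space (LB ?J). x \<in> ?K \<and> \<bar>x j\<bar> > t}"
    have mL: "?L \<in> sets (LB ?J)" by measurable
    have "?G = emeasure (LB ?J) ({x\<in>space (LB ?J). x \<in> ?K \<and> \<bar>x j\<bar> \<le> t} \<union> ?L)"
      unfolding gY_def by (rule arg_cong[where f = "emeasure _"]) (auto simp: KY_def space_LB)
    also have "\<dots> \<le> emeasure (LB ?J) {x\<in>space (LB ?J). x \<in> ?K \<and> \<bar>x j\<bar> \<le> t} + emeasure (LB ?J) ?L"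
      by (rule emeasure_subadditive) measurable
    also have "\<dots> \<le> ennreal (2 * t) * ?g' + emeasure (LB ?J) ?L" by (intro add_right_mono h t)
    also have "ennreal (2 * t) * ?g' = ennreal (G / 2)"
      unfolding g' using t g'p by (simp flip: ennreal_mult add: t_def)
    finally have le: "ennreal G \<le> ennreal (G / 2) + emeasure (LB ?J) ?L" unfolding G(1) .
    have Lfin: "emeasure (LB ?J) ?L < \<infinity>"
    proof (rule le_less_trans)
      show "emeasure (LB ?J) ?L \<le> ?G" unfolding gY_def by (intro emeasure_mono) auto
    qed fact
    then obtain l where l: "emeasure (LB ?J) ?L = ennreal l" "l \<ge> 0"
      by (cases "emeasure (LB ?J) ?L") auto
    have "G \<le> G / 2 + l" using le l G by (simp flip: ennreal_plus)
    then have "ennreal G \<le> ennreal (2 * l)" by (intro ennreal_leI) simp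
    then have GL: "?G \<le> 2 * emeasure (LB ?J) ?L" unfolding G(1) l(1) using l(2) by (simp add: ennreal_mult)
    have "?G ^ Suc n = ?G * ?G ^ n" by simp
    also have "\<dots> \<le> (2 * emeasure (LB ?J) ?L) * ?G ^ n" by (intro mult_right_mono GL) auto
    also have "\<dots> = 2 * (\<integral>\<^sup>+x. indicator ?L x * ?G ^ n \<partial>LB ?J)"
      using mL by (simp add: nn_integral_multc mult.assoc)
    also have "\<dots> \<le> 2 * (\<integral>\<^sup>+x. indicator ?K x * (ennreal (4 * \<bar>x j\<bar>) * ?g') ^ n \<partial>LB ?J)"
    proof (intro mult_left_mono nn_integral_mono)
      fix x assume "x \<in> space (LB ?J)"
      show "indicator ?L x * ?G ^ n \<le> indicator ?K x * (ennreal (4 * \<bar>x j\<bar>) * ?g') ^ n"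
      proof (cases "x \<in> ?L")
        case True
        then have "G \<le> 4 * \<bar>x j\<bar> * g'" using g'p by (simp add: t_def pos_divide_less_eq mult_ac)
        then have "?G \<le> ennreal (4 * \<bar>x j\<bar>) * ?g'"
          unfolding G g' using g'(2) by (simp flip: ennreal_mult add: ennreal_leI)
        then have "?G ^ n \<le> (ennreal (4 * \<bar>x j\<bar>) * ?g') ^ n" by (intro power_mono) auto
        then show ?thesis using True by simp
      qed simp
    qed auto
    finally show ?thesis .
  qed
qed

text \<open>For i in J, row i of the condition contains a single entry of the new column and
  confines it to an interval of length \<open>2 * b / \<bar>x j\<bar>\<close>. Row j involves the
  whole column; it confines the corner once the other entries are fixed, so the corner is integrated
  innermost.\<close>

lemma KY_column_le:
  assumes J: "finite J" "j \<notin> J" and xj: "x j \<noteq> 0" and b: "b \<ge> 0"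
  shows "(\<integral>\<^sup>+v. indicator (KY (insert j J) a b (merge (prs J) (Upair j ` insert j J) (Y, v))) x
      \<partial>LB (Upair j ` insert j J)) \<le> ennreal (2 * b / \<bar>x j\<bar>) ^ Suc (card J)"
proof -
  let ?c = "Upair j ` J"
  have inj: "inj_on (Upair j) J" using J(2) by (auto simp: inj_on_def)
  have ins: "Upair j ` insert j J = insert (Upair j j) ?c" by simp
  have fc: "finite ?c" "Upair j j \<notin> ?c" using J by auto
  let ?M = "\<lambda>v. merge (prs J) (insert (Upair j j) ?c) (Y, v)"
  define r where "r i = (\<Sum>l\<in>J. x l * Y (Upair l i))" for i
  have M1: "?M v (Upair l i) = Y (Upair l i)" if "l \<in> J" "i \<in> J" for v l i
    using that by (simp add: merge_def)
  have M2: "?M v (Upair j i) = v (Upair j i)" if "i \<in> insert j J" for v i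
    using that J(2) by (auto simp: merge_def)
  have comm: "Upair l j = Upair j l" for l by simp
  define E where "E p = {y. \<bar>x j * y + r (inv_into J (Upair j) p)\<bar> \<le> b}" for p
  have emE: "emeasure lborel (E p) = ennreal (2 * b / \<bar>x j\<bar>)" for p
    unfolding E_def by (rule emeasure_abs_affine_le[OF xj b])
  have Eb [measurable]: "E p \<in> sets borel" for p unfolding E_def by measurable
  define T where "T v = {y. \<bar>x j * y + (\<Sum>l\<in>J. x l * v (Upair l j))\<bar> \<le> b}" for v
  have emT: "emeasure lborel (T v) = ennreal (2 * b / \<bar>x j\<bar>)" for v
    unfolding T_def by (rule emeasure_abs_affine_le[OF xj b])
  have Tb [measurable]: "T v \<in> sets borel" for v unfolding T_def by measurable
  have pw: "indicator (KY (insert j J) a b (?M (v(Upair j j := y)))) x \<le>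
    (\<Prod>p\<in>?c. indicator (E p) (v p)) * (indicator (T v) y :: ennreal)" for v y
  proof (cases "x \<in> KY (insert j J) a b (?M (v(Upair j j := y)))")
    case True
    let ?w = "?M (v(Upair j j := y))"
    have row: "\<bar>\<Sum>l\<in>insert j J. x l * ?w (Upair l i)\<bar> \<le> b" if "i \<in> insert j J" for i
      using True that unfolding KY_def by blast
    have "v p \<in> E p" if p: "p \<in> ?c" for p
    proof -
      obtain i where i: "i \<in> J" "p = Upair j i" using p by blast
      have "inv_into J (Upair j) p = i" unfolding i(2) by (rule inv_into_f_f[OF inj i(1)])
      moreover have "(\<Sum>l\<in>insert j J. x l * ?w (Upair l i)) = x j * v p + r i"
      proof -
        have "(\<Sum>l\<in>J. x l * ?w (Upair l i)) = r i"
          unfolding r_def using i(1) by (intro sum.cong) (auto simp: M1)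
        moreover have "?w (Upair j i) = v p" using i J(2) M2[of i "v(Upair j j := y)"] by auto
        ultimately show ?thesis using J by simp
      qed
      ultimately show ?thesis using row[of i] i(1) by (simp add: E_def)
    qed
    moreover have "y \<in> T v"
    proof -
      have "(\<Sum>l\<in>J. x l * ?w (Upair l j)) = (\<Sum>l\<in>J. x l * v (Upair l j))"
      proof (intro sum.cong refl)
        fix l assume l: "l \<in> J"
        then have "l \<noteq> j" using J(2) by auto
        then show "x l * ?w (Upair l j) = x l * v (Upair l j)"
          unfolding comm[of l] using M2[of l "v(Upair j j := y)"] l by simp
      qed
      moreover have "?w (Upair j j) = y" using M2[of j "v(Upair j j := y)"] by simp
      ultimately have "(\<Sum>l\<in>insert j J. x l * ?w (Upair l j)) = x j * y + (\<Sum>l\<in>J. x l * v (Upair l j))"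
        using J by simp
      then show ?thesis using row[of j] by (simp add: T_def)
    qed
    ultimately show ?thesis using True fc by (simp add: indicator_def)
  qed simp
  have meas: "(\<lambda>v. indicator (KY (insert j J) a b (?M v)) x :: ennreal) \<in> borel_measurable (LB (insert (Upair j j) ?c))"
  proof -
    have vm: "(\<lambda>v. ?M v (Upair l i)) \<in> borel_measurable (LB (insert (Upair j j) ?c))"
      if "l \<in> insert j J" "i \<in> insert j J" for l i
    proof (cases "l = j \<or> i = j")
      case True
      then have "\<exists>m\<in>insert j J. Upair l i = Upair j m" using that by auto
      then obtain m where m: "m \<in> insert j J" "Upair l i = Upair j m" by blast
      have "Upair j m \<in> insert (Upair j j) ?c" using m by blast
      then have "(\<lambda>v. v (Upair j m)) \<in> borel_measurable (LB (insert (Upair j j) ?c))"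
        using measurable_component_singleton[of "Upair j m" "insert (Upair j j) ?c" "\<lambda>_. lborel :: real measure"] by simp
      then show ?thesis unfolding m(2) using M2[OF m(1)] by simp
    next
      case False
      then show ?thesis using M1[of l i] that by simp
    qed
    have finI: "finite (insert j J)" using J(1) by simp
    have pm: "Measurable.pred (LB (insert (Upair j j) ?c)) (\<lambda>v. \<bar>\<Sum>l\<in>insert j J. x l * ?M v (Upair l i)\<bar> \<le> b)"
      if i: "i \<in> insert j J" for i
    proof -
      have [measurable]: "(\<lambda>v. \<Sum>l\<in>insert j J. x l * ?M v (Upair l i)) \<in> borel_measurable (LB (insert (Upair j j) ?c))"
        using i by (intro borel_measurable_sum borel_measurable_times borel_measurable_const vm)
      show ?thesis by measurable
    qed
    have [measurable]: "Measurable.pred (LB (insert (Upair j j) ?c))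
      (\<lambda>v. \<forall>i\<in>insert j J. \<bar>\<Sum>l\<in>insert j J. x l * ?M v (Upair l i)\<bar> \<le> b)"
      by (intro pred_intros_finite finI pm)
    have "(\<lambda>v. indicator (KY (insert j J) a b (?M v)) x :: ennreal) =
      (\<lambda>v. if x \<in> extensional (insert j J) \<and> (\<forall>i\<in>insert j J. \<bar>x i\<bar> \<le> a) \<and>
         (\<forall>i\<in>insert j J. \<bar>\<Sum>l\<in>insert j J. x l * ?M v (Upair l i)\<bar> \<le> b) then 1 else 0)"
      by (auto simp: KY_def indicator_def fun_eq_iff)
    also have "\<dots> \<in> borel_measurable (LB (insert (Upair j j) ?c))"
      by measurable
    finally show ?thesis .
  qed
  have "(\<integral>\<^sup>+v. indicator (KY (insert j J) a b (?M v)) x \<partial>LB (insert (Upair j j) ?c)) =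
    (\<integral>\<^sup>+v. (\<integral>\<^sup>+y. indicator (KY (insert j J) a b (?M (v(Upair j j := y)))) x \<partial>lborel) \<partial>LB ?c)"
    by (rule lb.product_nn_integral_insert[OF fc meas])
  also have "\<dots> \<le> (\<integral>\<^sup>+v. (\<integral>\<^sup>+y. (\<Prod>p\<in>?c. indicator (E p) (v p)) * indicator (T v) y \<partial>lborel) \<partial>LB ?c)"
    by (intro nn_integral_mono pw)
  also have "\<dots> = (\<integral>\<^sup>+v. (\<Prod>p\<in>?c. indicator (E p) (v p)) * ennreal (2 * b / \<bar>x j\<bar>) \<partial>LB ?c)"
    by (intro nn_integral_cong) (simp add: nn_integral_cmult emT)
  also have "\<dots> = (\<integral>\<^sup>+v. (\<Prod>p\<in>?c. indicator (E p) (v p)) \<partial>LB ?c) * ennreal (2 * b / \<bar>x j\<bar>)"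
    using fc(1) by (intro nn_integral_multc) measurable
  also have "(\<integral>\<^sup>+v. (\<Prod>p\<in>?c. indicator (E p) (v p)) \<partial>LB ?c) = (\<Prod>p\<in>?c. emeasure lborel (E p))"
    by (subst lb.product_nn_integral_prod[OF fc(1)]) simp_all
  also have "\<dots> * ennreal (2 * b / \<bar>x j\<bar>) = ennreal (2 * b / \<bar>x j\<bar>) ^ Suc (card J)"
    by (simp add: emE card_image[OF inj] mult.commute)
  finally show ?thesis unfolding ins .
qed

text \<open>In the new dimension s, \<open>gY_power_le\<close> produces the s-th power of
  \<open>\<bar>x j\<bar>\<close> and the integral over the s entries of column j produces the s-th
  power of its inverse. They cancel exactly at the moment \<open>s + 1\<close>, leaving the s-th
  power of the volume one dimension lower. The bound depends on a and b through \<open>a * b\<close>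
  only.\<close>

theorem nn_integral_gY_le:
  fixes J :: "'n set"
  assumes "finite J"
  shows "\<exists>C e. C \<ge> 0 \<and> (\<forall>a>0. \<forall>b>0.
    (\<integral>\<^sup>+Y. gY J a b Y ^ Suc (card J) \<partial>LB (prs J)) \<le> ennreal (C * (a * b) ^ e))"
  using assms
proof (induction J rule: finite_induct)
  case empty
  have "(\<integral>\<^sup>+Y. gY {} a b Y ^ Suc 0 \<partial>LB (prs ({}::'n set))) \<le> ennreal (1 * (a * b) ^ 0)"
    if "a > 0" for a b :: real
  proof -
    have "(\<integral>\<^sup>+Y. gY {} a b Y ^ Suc 0 \<partial>LB (prs ({}::'n set))) \<le> (\<integral>\<^sup>+Y. 1 \<partial>LB (prs ({}::'n set)))"
      using gY_le[of "{}" a b] that by (intro nn_integral_mono) simp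
    also have "\<dots> = 1" by (simp add: PiM_empty emeasure_count_space)
    finally show ?thesis by simp
  qed
  then show ?case by (intro exI[of _ 1] exI[of _ 0]) simp
next
  case (insert j J)
  obtain C e where C: "C \<ge> 0" and IH: "\<And>a b. a > 0 \<Longrightarrow> b > 0 \<Longrightarrow>
    (\<integral>\<^sup>+Y. gY J a b Y ^ Suc (card J) \<partial>LB (prs J)) \<le> ennreal (C * (a * b) ^ e)"
    using insert.IH by blast
  let ?J = "insert j J" and ?s = "Suc (card J)" and ?c = "Upair j ` insert j J"
  have fin: "finite ?J" using insert.hyps by simp
  have pr: "prs ?J = prs J \<union> ?c"
  proof (intro equalityI subsetI)
    fix p assume "p \<in> prs ?J" then show "p \<in> prs J \<union> ?c" by (cases p) auto
  next
    fix p assume "p \<in> prs J \<union> ?c" then show "p \<in> prs ?J" by (cases p) auto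
  qed
  have dis: "prs J \<inter> ?c = {}" using insert.hyps by auto
  have main: "(\<integral>\<^sup>+Y. gY ?J a b Y ^ Suc ?s \<partial>LB (prs ?J)) \<le> ennreal (2 * 16 ^ ?s * C * 4 ^ e * (a * b) ^ (?s + e))"
    if a: "a > 0" and b: "b > 0" for a b
  proof -
    let ?m = "\<lambda>Y v. merge (prs J) ?c (Y, v)"
    let ?g' = "gY J (2 * a) (2 * b)"
    note mg [measurable] = measurable_gY[OF insert.hyps(1), of "2 * a" "2 * b"]
    have inner: "(\<integral>\<^sup>+v. gY ?J a b (?m Y v) ^ Suc ?s \<partial>LB ?c) \<le> ennreal (2 * (16 * a * b) ^ ?s) * ?g' Y ^ ?s"
      if Y: "Y \<in> space (LB (prs J))" for Y
    proof -
      have gm: "?g' (?m Y v) = ?g' Y" for v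
      proof -
        have "KY J (2 * a) (2 * b) (?m Y v) = KY J (2 * a) (2 * b) Y"
          unfolding KY_def by (intro Collect_cong conj_cong refl ball_cong sum.cong arg_cong2[where f = "(\<le>)"] arg_cong[where f = abs]) (auto simp: merge_def)
        then show ?thesis by (simp add: gY_def)
      qed
      have mer: "(\<lambda>v. ?m Y v) \<in> measurable (LB ?c) (LB (prs ?J))"
        unfolding pr by (rule measurable_compose[OF measurable_Pair1'[OF Y] measurable_merge])
      have ind [measurable]: "(\<lambda>(v, x). indicator (KY ?J a b (?m Y v)) x :: ennreal) \<in> borel_measurable (LB ?c \<Otimes>\<^sub>M LB ?J)"
      proof -
        have "(\<lambda>z. (?m Y (fst z), snd z)) \<in> measurable (LB ?c \<Otimes>\<^sub>M LB ?J) (LB (prs ?J) \<Otimes>\<^sub>M LB ?J)"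
          by (intro measurable_Pair measurable_compose[OF measurable_fst mer] measurable_snd)
        from measurable_compose[OF this measurable_KY_pair[OF fin, of a b]] show ?thesis
          by (simp add: case_prod_beta)
      qed
      interpret c: finite_product_sigma_finite "\<lambda>_. lborel :: real measure" ?c by standard (use insert.hyps in simp)
      interpret JJ: finite_product_sigma_finite "\<lambda>_. lborel :: real measure" ?J by standard (rule fin)
      interpret P: pair_sigma_finite "LB ?c" "LB ?J" ..
      have xj [measurable]: "(\<lambda>x. x j) \<in> borel_measurable (LB ?J)"
        using measurable_component_singleton[of j ?J "\<lambda>_. lborel :: real measure"] by simp
      let ?h = "\<lambda>x. (ennreal (4 * \<bar>x j\<bar>) * ?g' Y) ^ ?s"
      have s1: "1 \<le> ?s" by simp
      have "(\<integral>\<^sup>+v. gY ?J a b (?m Y v) ^ Suc ?s \<partial>LB ?c) \<le>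
        (\<integral>\<^sup>+v. 2 * (\<integral>\<^sup>+x. indicator (KY ?J a b (?m Y v)) x * ?h x \<partial>LB ?J) \<partial>LB ?c)"
      proof (rule nn_integral_mono)
        fix v
        show "gY ?J a b (?m Y v) ^ Suc ?s \<le> 2 * (\<integral>\<^sup>+x. indicator (KY ?J a b (?m Y v)) x * ?h x \<partial>LB ?J)"
          using gY_power_le[OF insert.hyps less_imp_le[OF a] s1, of b "?m Y v"] unfolding gm .
      qed
      also have "\<dots> = 2 * (\<integral>\<^sup>+v. (\<integral>\<^sup>+x. indicator (KY ?J a b (?m Y v)) x * ?h x \<partial>LB ?J) \<partial>LB ?c)"
        by (rule nn_integral_cmult) measurable
      also have "(\<integral>\<^sup>+v. (\<integral>\<^sup>+x. indicator (KY ?J a b (?m Y v)) x * ?h x \<partial>LB ?J) \<partial>LB ?c) =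
        (\<integral>\<^sup>+x. (\<integral>\<^sup>+v. indicator (KY ?J a b (?m Y v)) x * ?h x \<partial>LB ?c) \<partial>LB ?J)"
        by (rule P.Fubini'[symmetric]) measurable
      also have "\<dots> \<le> (\<integral>\<^sup>+x. ennreal ((8 * b) ^ ?s) * ?g' Y ^ ?s * indicator (\<Pi>\<^sub>E i\<in>?J. {-a..a}) x \<partial>LB ?J)"
      proof (rule nn_integral_mono)
        fix x assume x: "x \<in> space (LB ?J)"
        have vind: "(\<lambda>v. indicator (KY ?J a b (?m Y v)) x :: ennreal) \<in> borel_measurable (LB ?c)"
          using measurable_compose[OF measurable_Pair2'[OF x] ind] by simp
        have e1: "(\<integral>\<^sup>+v. indicator (KY ?J a b (?m Y v)) x * ?h x \<partial>LB ?c) =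
          (\<integral>\<^sup>+v. indicator (KY ?J a b (?m Y v)) x \<partial>LB ?c) * ?h x"
          by (rule nn_integral_multc[OF vind])
        show "(\<integral>\<^sup>+v. indicator (KY ?J a b (?m Y v)) x * ?h x \<partial>LB ?c) \<le>
          ennreal ((8 * b) ^ ?s) * ?g' Y ^ ?s * indicator (\<Pi>\<^sub>E i\<in>?J. {-a..a}) x"
        proof (cases "x \<in> (\<Pi>\<^sub>E i\<in>?J. {-a..a})")
          case False
          have "x \<notin> KY ?J a b (?m Y v)" for v
            using False x by (auto simp: KY_def PiE_iff space_LB abs_le_iff minus_le_iff)
          then show ?thesis by simp
        next
          case True
          show ?thesis
          proof (cases "x j = 0")
            case True then show ?thesis unfolding e1 by simp
          next
            case False
            have "(\<integral>\<^sup>+v. indicator (KY ?J a b (?m Y v)) x \<partial>LB ?c) * ?h x \<le>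
              ennreal (2 * b / \<bar>x j\<bar>) ^ ?s * ?h x"
              by (rule mult_right_mono[OF KY_column_le[where x = x and j = j, OF insert.hyps False less_imp_le[OF b]]]) simp
            also have "\<dots> = (ennreal (2 * b / \<bar>x j\<bar>) * ennreal (4 * \<bar>x j\<bar>)) ^ ?s * ?g' Y ^ ?s"
              by (simp add: power_mult_distrib mult_ac del: power_Suc)
            also have "ennreal (2 * b / \<bar>x j\<bar>) * ennreal (4 * \<bar>x j\<bar>) = ennreal (8 * b)"
              using False b by (simp flip: ennreal_mult)
            also have "ennreal (8 * b) ^ ?s = ennreal ((8 * b) ^ ?s)" by (rule ennreal_power) (use b in simp)
            finally show ?thesis unfolding e1 using \<open>x \<in> (\<Pi>\<^sub>E i\<in>?J. {-a..a})\<close> by simp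
          qed
        qed
      qed
      also have "\<dots> = ennreal ((8 * b) ^ ?s) * ?g' Y ^ ?s * emeasure (LB ?J) (\<Pi>\<^sub>E i\<in>?J. {-a..a})"
        using fin by (intro nn_integral_cmult_indicator sets_PiM_I_finite) auto
      also have "emeasure (LB ?J) (\<Pi>\<^sub>E i\<in>?J. {-a..a}) = ennreal (2 * a) ^ ?s"
        using fin a insert.hyps by (subst lb.emeasure_PiM) auto
      also have "\<dots> = ennreal ((2 * a) ^ ?s)" by (rule ennreal_power) (use a in simp)
      finally have "(\<integral>\<^sup>+v. gY ?J a b (?m Y v) ^ Suc ?s \<partial>LB ?c) \<le>
        2 * (ennreal ((8 * b) ^ ?s) * ?g' Y ^ ?s * ennreal ((2 * a) ^ ?s))"
        by (simp add: mult_left_mono)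
      also have "\<dots> = (2 * (ennreal ((8 * b) ^ ?s) * ennreal ((2 * a) ^ ?s))) * ?g' Y ^ ?s"
        by (simp only: mult_ac)
      also have "2 * (ennreal ((8 * b) ^ ?s) * ennreal ((2 * a) ^ ?s)) = ennreal (2 * (16 * a * b) ^ ?s)"
      proof -
        have "16 * a * b = (8 * b) * (2 * a)" by simp
        then have "2 * (16 * a * b) ^ ?s = 2 * ((8 * b) ^ ?s * (2 * a) ^ ?s)"
          by (simp only: power_mult_distrib)
        moreover have "ennreal (2 * ((8 * b) ^ ?s * (2 * a) ^ ?s)) = 2 * (ennreal ((8 * b) ^ ?s) * ennreal ((2 * a) ^ ?s))"
          using a b by (simp only: ennreal_mult' ennreal_numeral zero_le_power zero_le_numeral less_imp_le mult_nonneg_nonneg)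
        ultimately show ?thesis by (simp only:)
      qed
      finally show ?thesis .
    qed
    have mG: "(\<lambda>Y. gY ?J a b Y ^ Suc ?s) \<in> borel_measurable (LB (prs J \<union> ?c))"
      using measurable_gY[OF fin, of a b] unfolding pr by measurable
    have "(\<integral>\<^sup>+Y. gY ?J a b Y ^ Suc ?s \<partial>LB (prs ?J)) =
      (\<integral>\<^sup>+Y. (\<integral>\<^sup>+v. gY ?J a b (?m Y v) ^ Suc ?s \<partial>LB ?c) \<partial>LB (prs J))"
      unfolding pr by (rule lb.product_nn_integral_fold[OF dis _ _ mG]) (use insert.hyps in auto)
    also have "\<dots> \<le> (\<integral>\<^sup>+Y. ennreal (2 * (16 * a * b) ^ ?s) * ?g' Y ^ ?s \<partial>LB (prs J))"
      by (intro nn_integral_mono inner)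
    also have "\<dots> = ennreal (2 * (16 * a * b) ^ ?s) * (\<integral>\<^sup>+Y. ?g' Y ^ ?s \<partial>LB (prs J))"
      by (rule nn_integral_cmult) measurable
    also have "\<dots> \<le> ennreal (2 * (16 * a * b) ^ ?s) * ennreal (C * (2 * a * (2 * b)) ^ e)"
      using IH[of "2 * a" "2 * b"] a b by (intro mult_left_mono) auto
    also have "\<dots> = ennreal (2 * (16 * a * b) ^ ?s * (C * (2 * a * (2 * b)) ^ e))"
      using a b C by (subst ennreal_mult) auto
    also have "2 * (16 * a * b) ^ ?s * (C * (2 * a * (2 * b)) ^ e) = 2 * 16 ^ ?s * C * 4 ^ e * (a * b) ^ (?s + e)"
    proof -
      have "16 * a * b = 16 * (a * b)" "2 * a * (2 * b) = 4 * (a * b)" by simp_all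
      then show ?thesis by (simp only: power_mult_distrib power_add) (simp only: mult_ac)
    qed
    finally show ?thesis .
  qed
  then have "2 * 16 ^ ?s * C * 4 ^ e \<ge> 0" using C by simp
  moreover have "card ?J = ?s" using insert.hyps by simp
  ultimately show ?case using main
    by (intro exI[of _ "2 * 16 ^ ?s * C * 4 ^ e"] exI[of _ "?s + e"] conjI allI impI) (simp_all only:)
qed

section \<open>Lattice points in a symmetric convex body\<close>

definition KV :: "'n::finite set \<Rightarrow> real \<Rightarrow> real \<Rightarrow> ('n uprod \<Rightarrow> real) \<Rightarrow> (real^'n) set" where
  "KV J a b Y = {x\<in>supp_on J. (\<forall>i\<in>J. \<bar>x $ i\<bar> \<le> a) \<and> (\<forall>i\<in>J. \<bar>mulW J x Y $ i\<bar> \<le> b)}"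

definition fnv :: "'n::finite set \<Rightarrow> real^'n \<Rightarrow> 'n \<Rightarrow> real" where
  "fnv J x = (\<lambda>i\<in>J. x $ i)"

definition vfn :: "'n::finite set \<Rightarrow> ('n \<Rightarrow> real) \<Rightarrow> real^'n" where
  "vfn J y = (\<chi> i. if i \<in> J then y i else 0)"

lemma vfn_nth [simp]: "vfn J y $ i = (if i \<in> J then y i else 0)"
  by (simp add: vfn_def)

lemma fnv_KY: "fnv J x \<in> KY J a b Y \<longleftrightarrow> (\<forall>i\<in>J. \<bar>x $ i\<bar> \<le> a) \<and> (\<forall>i\<in>J. \<bar>mulW J x Y $ i\<bar> \<le> b)"
proof -
  have "(\<Sum>l\<in>J. fnv J x l * Y (Upair l i)) = mulW J x Y $ i" if "i \<in> J" for i
    using that by (simp add: mulW_nth fnv_def)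
  then show ?thesis by (auto simp: KY_def fnv_def)
qed

lemma KV_add: "x \<in> KV J a b Y \<Longrightarrow> y \<in> KV J a' b' Y \<Longrightarrow> x + y \<in> KV J (a + a') (b + b') Y"
proof -
  assume x: "x \<in> KV J a b Y" and y: "y \<in> KV J a' b' Y"
  have tri: "\<bar>c\<bar> \<le> p \<Longrightarrow> \<bar>d\<bar> \<le> q \<Longrightarrow> \<bar>c + d\<bar> \<le> p + q" for c d p q :: real by linarith
  show "x + y \<in> KV J (a + a') (b + b') Y"
    using x y unfolding KV_def supp_on_def by (simp add: mulW_add tri)
qed

lemma KV_sum:
  assumes "finite I" "\<And>i. i \<in> I \<Longrightarrow> x i \<in> KV J a b Y" "\<And>i. i \<in> I \<Longrightarrow> \<bar>t i\<bar> \<le> 1"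
  shows "(\<Sum>i\<in>I. t i *\<^sub>R x i) \<in> KV J (real (card I) * a) (real (card I) * b) Y"
  using assms
proof (induction I rule: finite_induct)
  case empty
  then show ?case by (simp add: KV_def supp_on_def)
next
  case (insert i I)
  have "t i *\<^sub>R x i \<in> KV J a b Y"
  proof -
    have *: "\<bar>t i * c\<bar> \<le> d" if "\<bar>c\<bar> \<le> d" for c d
      using insert.prems(2)[of i] that by (simp add: abs_mult) (meson abs_ge_zero mult_left_le_one_le order_trans)
    show ?thesis using insert.prems(1)[of i] unfolding KV_def supp_on_def by (auto simp: mulW_scaleR intro!: *)
  qed
  then have "t i *\<^sub>R x i + (\<Sum>i\<in>I. t i *\<^sub>R x i) \<in> KV J (a + real (card I) * a) (b + real (card I) * b) Y"
    using insert by (intro KV_add) auto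
  then show ?case using insert.hyps by (simp add: algebra_simps)
qed

text \<open>A Blichfeldt argument. For every y and every r in R, a vector of H brings
  \<open>y + r\<close> into the body scaled by \<open>card J\<close>; adding a point p of P costs
  one more unit. Distinct pairs (p, r) give distinct integer translates of y in the scaled body, and
  averaging over y in the unit cube turns their number into its volume.\<close>

lemma lattice_points_separated:
  fixes J :: "'n::finite set"
  assumes H: "subgrp H" "H \<subseteq> ZJ J"
    and x: "\<And>i. i \<in> J \<Longrightarrow> x i \<in> H \<inter> KV J a b Y"
    and sp: "\<And>v. v \<in> supp_on J \<Longrightarrow> \<exists>t. v = (\<Sum>i\<in>J. t i *\<^sub>R x i)"
    and R: "finite R" "R \<subseteq> ZJ J" "separated H R" and P: "finite P" "P \<subseteq> H \<inter> KV J a b Y"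
  shows "of_nat (card P * card R) \<le> gY J ((real (card J) + 1) * a) ((real (card J) + 1) * b) Y"
proof -
  let ?A = "(real (card J) + 1) * a" and ?B = "(real (card J) + 1) * b"
  note [measurable] = KY_sets[OF finite[of J], of ?A ?B Y] cubeI_sets[OF finite[of J]]
  have count: "of_nat (card P * card R) \<le> (\<integral>\<^sup>+z. indicator (KY J ?A ?B Y) (shf J (\<lambda>i. - z i) y) \<partial>count_space (intsE J))"
    for y :: "'n \<Rightarrow> real"
  proof -
    have "\<exists>q. q \<in> H \<and> vfn J y + (r - q) \<in> KV J (real (card J) * a) (real (card J) * b) Y" if r: "r \<in> R" for r
    proof -
      have "vfn J y + r \<in> supp_on J" using r R(2) by (auto simp: supp_on_def ZJ_def)
      then obtain t where t: "vfn J y + r = (\<Sum>i\<in>J. t i *\<^sub>R x i)" using sp by blast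
      \<comment> \<open>Removing the integer parts leaves coefficients in [0, 1) of the
        \<open>card J\<close> vectors \<open>x i\<close>, to which \<open>KV_sum\<close>
        applies.\<close>
      define q where "q = (\<Sum>i\<in>J. of_int \<lfloor>t i\<rfloor> *\<^sub>R x i)"
      have "q \<in> H" unfolding q_def using x by (intro subgrp_sum[OF H(1)] subgrp_of_int_scaleR[OF H(1)]) auto
      moreover have "vfn J y + (r - q) = (\<Sum>i\<in>J. (t i - of_int \<lfloor>t i\<rfloor>) *\<^sub>R x i)"
        unfolding q_def using t by (simp add: scaleR_diff_left sum_subtractf algebra_simps)
      moreover have "(\<Sum>i\<in>J. (t i - of_int \<lfloor>t i\<rfloor>) *\<^sub>R x i) \<in> KV J (real (card J) * a) (real (card J) * b) Y"
        using x by (intro KV_sum) (auto simp: abs_le_iff, linarith+)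
      ultimately show ?thesis by metis
    qed
    then obtain q where q: "\<And>r. r \<in> R \<Longrightarrow> q r \<in> H"
      "\<And>r. r \<in> R \<Longrightarrow> vfn J y + (r - q r) \<in> KV J (real (card J) * a) (real (card J) * b) Y" by metis
    define h where "h = (\<lambda>(p, r). (\<lambda>i\<in>J. - ((p + (r - q r)) $ i)) :: 'n \<Rightarrow> real)"
    have PZ: "p + (r - q r) \<in> ZJ J" if "p \<in> P" "r \<in> R" for p r
      using that P(2) R(2) q(1)[OF that(2)] H(2) by (intro subgrp_add[OF subgrp_ZJ] subgrp_diff[OF subgrp_ZJ]) auto
    have inj: "inj_on h (P \<times> R)"
    proof (rule inj_onI, clarify)
      fix p r p' r' assume pr: "p \<in> P" "r \<in> R" "p' \<in> P" "r' \<in> R" "h (p, r) = h (p', r')"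
      have "(p + (r - q r)) $ i = (p' + (r' - q r')) $ i" for i
      proof (cases "i \<in> J")
        case True then show ?thesis using fun_cong[OF pr(5), of i] by (simp add: h_def)
      next
        case False then show ?thesis using PZ[OF pr(1,2)] PZ[OF pr(3,4)] by (simp add: ZJ_def)
      qed
      then have e: "p + (r - q r) = p' + (r' - q r')" by (simp only: vec_eq_iff) simp
      then have "r - r' = (p' - p) + (q r - q r')" by (simp add: algebra_simps)
      also have "\<dots> \<in> H" using pr P(2) q(1) by (intro subgrp_add[OF H(1)] subgrp_diff[OF H(1)]) auto
      finally have "r = r'" using R(3) pr unfolding separated_def by blast
      then show "p = p' \<and> r = r'" using e by simp
    qed
    have him: "h ` (P \<times> R) \<subseteq> intsE J"
    proof
      fix z assume "z \<in> h ` (P \<times> R)"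
      then obtain p r where pr: "p \<in> P" "r \<in> R" "z = h (p, r)" by blast
      show "z \<in> intsE J" using PZ[OF pr(1,2)] unfolding pr(3) h_def intsE_def ZJ_def by (auto simp del: vector_add_component vector_minus_component)
    qed
    have hK: "indicator (KY J ?A ?B Y) (shf J (\<lambda>i. - z i) y) = (1::ennreal)" if z: "z \<in> h ` (P \<times> R)" for z
    proof -
      obtain p r where pr: "p \<in> P" "r \<in> R" "z = h (p, r)" using z by blast
      have "p + (vfn J y + (r - q r)) \<in> KV J (a + real (card J) * a) (b + real (card J) * b) Y"
        using P(2) pr q(2) by (intro KV_add) auto
      then have "p + (vfn J y + (r - q r)) \<in> KV J ?A ?B Y" by (simp add: algebra_simps)
      then have "fnv J (p + (vfn J y + (r - q r))) \<in> KY J ?A ?B Y" unfolding fnv_KY KV_def by simp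
      moreover have "fnv J (p + (vfn J y + (r - q r))) = shf J (\<lambda>i. - z i) y"
        unfolding pr(3) h_def by (auto simp: fnv_def shf_def fun_eq_iff)
      ultimately show ?thesis by simp
    qed
    have "of_nat (card P * card R) = (of_nat (card (h ` (P \<times> R))) :: ennreal)"
      using card_image[OF inj] by (simp add: card_cartesian_product)
    also have "\<dots> = emeasure (count_space (intsE J)) (h ` (P \<times> R))"
      using him P(1) R(1) by (subst emeasure_count_space) auto
    also have "\<dots> = (\<integral>\<^sup>+z. indicator (h ` (P \<times> R)) z \<partial>count_space (intsE J))"
      using him by (intro nn_integral_indicator[symmetric]) simp
    also have "\<dots> \<le> (\<integral>\<^sup>+z. indicator (KY J ?A ?B Y) (shf J (\<lambda>i. - z i) y) \<partial>count_space (intsE J))"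
      using hK by (intro nn_integral_mono) (auto simp: indicator_def)
    finally show ?thesis .
  qed
  have "of_nat (card P * card R) = (\<integral>\<^sup>+y\<in>cubeI J. of_nat (card P * card R) \<partial>LB J)"
    by (subst nn_integral_cmult_indicator) (simp_all add: emeasure_cubeI cubeI_sets)
  also have "\<dots> \<le> (\<integral>\<^sup>+y. (\<integral>\<^sup>+z. indicator (KY J ?A ?B Y) (shf J (\<lambda>i. - z i) y) \<partial>count_space (intsE J)) * indicator (cubeI J) y \<partial>LB J)"
    by (intro nn_integral_mono mult_right_mono count) auto
  also have "\<dots> = (\<integral>\<^sup>+y. (\<integral>\<^sup>+z. indicator (KY J ?A ?B Y) (shf J (\<lambda>i. - z i) y) * indicator (cubeI J) y \<partial>count_space (intsE J)) \<partial>LB J)"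
    by (intro nn_integral_cong nn_integral_multc[symmetric]) simp
  also have "\<dots> = (\<integral>\<^sup>+z. (\<integral>\<^sup>+y. indicator (KY J ?A ?B Y) (shf J (\<lambda>i. - z i) y) * indicator (cubeI J) y \<partial>LB J) \<partial>count_space (intsE J))"
    by (rule nn_integral_count_space_nn_integral[OF countable_intsE[OF finite]]) measurable
  also have "\<dots> = (\<integral>\<^sup>+y. indicator (KY J ?A ?B Y) y \<partial>LB J)"
    by (rule nn_integral_tile[symmetric]) auto
  finally show ?thesis by (simp add: gY_def)
qed

text \<open>P = {0} bounds every separated set, hence the index is finite. With R a full
  transversal, the number of points times the index is then bounded by the volume.\<close>

lemma lattice_points_bound:
  fixes J :: "'n::finite set"
  assumes H: "subgrp H" "H \<subseteq> ZJ J" and a: "a \<ge> 0" "b \<ge> 0"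
    and x: "\<And>i. i \<in> J \<Longrightarrow> x i \<in> H \<inter> KV J a b Y"
    and sp: "\<And>v. v \<in> supp_on J \<Longrightarrow> \<exists>t. v = (\<Sum>i\<in>J. t i *\<^sub>R x i)"
  shows "finite (cosets (ZJ J) H)" "finite (H \<inter> KV J a b Y)"
    "of_nat (card (H \<inter> KV J a b Y) * idx (ZJ J) H) \<le> gY J ((real (card J) + 1) * a) ((real (card J) + 1) * b) Y"
proof -
  let ?A = "(real (card J) + 1) * a" and ?B = "(real (card J) + 1) * b"
  have key: "of_nat (card P * card R) \<le> gY J ?A ?B Y"
    if "finite R" "R \<subseteq> ZJ J" "separated H R" "finite P" "P \<subseteq> H \<inter> KV J a b Y" for R P
    using lattice_points_separated[OF H, of x a b Y R P] x sp that by blast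
  have z: "0 \<in> H \<inter> KV J a b Y" using subgrp_zero[OF H(1)] a by (simp add: KV_def supp_on_def)
  have "gY J ?A ?B Y \<le> ennreal ((2 * ?A) ^ card J)" using a by (intro gY_le) auto
  then have le: "c \<le> nat \<lfloor>(2 * ?A) ^ card J\<rfloor>" if "of_nat c \<le> gY J ?A ?B Y" for c
  proof -
    have "ennreal (real c) \<le> ennreal ((2 * ?A) ^ card J)"
      using that \<open>gY J ?A ?B Y \<le> _\<close> by (simp add: ennreal_of_nat_eq_real_of_nat order_trans)
    then have "real c \<le> (2 * ?A) ^ card J" using a by (simp add: ennreal_le_iff)
    then show ?thesis by (simp add: le_nat_floor)
  qed
  show fc: "finite (cosets (ZJ J) H)"
  proof (rule finite_cosets_separated[OF subgrp_ZJ H])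
    fix R assume R: "finite R" "R \<subseteq> ZJ J" "separated H R"
    show "card R \<le> nat \<lfloor>(2 * ?A) ^ card J\<rfloor>" using key[OF R, of "{0}"] z by (intro le) simp
  qed
  obtain R where R: "R \<subseteq> ZJ J" "separated H R" "finite R" "card R = idx (ZJ J) H"
    by (rule transversal_exists[OF subgrp_ZJ H fc])
  have R1: "card R \<ge> 1" using R(4) idx_pos[OF subgrp_ZJ fc] by simp
  show fP: "finite (H \<inter> KV J a b Y)"
  proof (rule ccontr)
    assume "infinite (H \<inter> KV J a b Y)"
    then obtain P where P: "P \<subseteq> H \<inter> KV J a b Y" "finite P" "card P = Suc (nat \<lfloor>(2 * ?A) ^ card J\<rfloor>)"
      using infinite_arbitrarily_large by meson
    have "card P * card R \<le> nat \<lfloor>(2 * ?A) ^ card J\<rfloor>" by (rule le[OF key[OF R(3,1,2) P(2,1)]])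
    moreover have "card P * 1 \<le> card P * card R" using R1 by (intro mult_le_mono2)
    ultimately show False using P(3) by simp
  qed
  show "of_nat (card (H \<inter> KV J a b Y) * idx (ZJ J) H) \<le> gY J ?A ?B Y"
    using key[OF R(3,1,2) fP] unfolding R(4) by simp
qed

section \<open>Independent tuples and adapted coordinates\<close>

definition indepF :: "'i set \<Rightarrow> ('i \<Rightarrow> 'v::real_vector) \<Rightarrow> bool" where
  "indepF I t \<longleftrightarrow> inj_on t I \<and> independent (t ` I)"

text \<open>Adding one point \<open>x0\<close> of S outside the span moves all points of S inside
  the span out of it, injectively and within \<open>S3\<close>.\<close>

lemma card_outside_span:
  fixes S S3 :: "'v::real_vector set"
  assumes "finite S3" "S \<subseteq> S3" "\<And>x y. x \<in> S \<Longrightarrow> y \<in> S \<Longrightarrow> x + y \<in> S3" "\<not> S \<subseteq> span A"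
  shows "card S \<le> 2 * card (S3 - span A)"
proof -
  obtain x0 where x0: "x0 \<in> S" "x0 \<notin> span A" using assms(4) by blast
  have fS: "finite S" using assms(1,2) finite_subset by blast
  have "card (S - span A) \<le> card (S3 - span A)" using assms by (intro card_mono) auto
  moreover have "card (S \<inter> span A) \<le> card (S3 - span A)"
  proof (rule card_inj_on_le)
    show "inj_on ((+) x0) (S \<inter> span A)" by simp
    show "(+) x0 ` (S \<inter> span A) \<subseteq> S3 - span A"
    proof safe
      fix y assume y: "y \<in> S" "y \<in> span A"
      show "x0 + y \<in> S3" by (rule assms(3)[OF x0(1) y(1)])
      assume "x0 + y \<in> span A"
      then have "(x0 + y) - y \<in> span A" using y(2) by (rule span_diff)
      then show False using x0(2) by simp
    qed
    show "finite (S3 - span A)" using assms(1) by simp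
  qed
  moreover have "card S = card (S \<inter> span A) + card (S - span A)"
    using fS by (subst card_Un_disjoint[symmetric]) (auto intro: arg_cong[where f = card])
  ultimately show ?thesis by linarith
qed

text \<open>Members are chosen one after another. While fewer than \<open>dim S\<close> are chosen,
  S is not contained in their span, so at least half as many choices as S has points remain in
  \<open>S3\<close>.\<close>

lemma card_indep_tuples:
  fixes S S3 :: "'v::euclidean_space set"
  assumes S: "finite S3" "S \<subseteq> S3" "\<And>x y. x \<in> S \<Longrightarrow> y \<in> S \<Longrightarrow> x + y \<in> S3"
    and I: "finite I" "card I \<le> dim S"
  shows "card S ^ card I \<le> 2 ^ card I * card {t\<in>(\<Pi>\<^sub>E i\<in>I. S3). indepF I t}"
  using I
proof (induction I rule: finite_induct)
  case empty
  have e: "{t\<in>(\<Pi>\<^sub>E i\<in>{}. S3). indepF {} t} = {\<lambda>_. undefined}" by (auto simp: indepF_def independent_empty)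
  show ?case unfolding e by simp
next
  case (insert i I)
  let ?T = "\<lambda>I. {t\<in>(\<Pi>\<^sub>E i\<in>I. S3). indepF I t}"
  have finT: "finite (?T I)" for I :: "'a set"
  proof (cases "finite I")
    case True then show ?thesis using S(1) by (intro finite_subset[OF _ finite_PiE[of I "\<lambda>_. S3"]]) auto
  next
    case False
    have "t \<notin> ?T I" for t
    proof
      assume t: "t \<in> ?T I"
      then have "t ` I \<subseteq> S3" by (auto simp: PiE_iff)
      then have "finite (t ` I)" using S(1) finite_subset by blast
      then show False using t False finite_imageD unfolding indepF_def by blast
    qed
    then have e: "?T I = {}" by blast
    show ?thesis unfolding e by simp
  qed
  let ?f = "\<lambda>(t, x). t(i := x)"
  let ?D = "Sigma (?T I) (\<lambda>t. S3 - span (t ` I))"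
  have inj: "inj_on ?f ?D"
  proof (rule inj_onI, clarify)
    fix t x t' x' assume t: "t \<in> (\<Pi>\<^sub>E i\<in>I. S3)" "t' \<in> (\<Pi>\<^sub>E i\<in>I. S3)" and e: "t(i := x) = t'(i := x')"
    have "t k = t' k" for k
    proof (cases "k = i")
      case True
      then show ?thesis using PiE_arb[OF t(1) insert.hyps(2)] PiE_arb[OF t(2) insert.hyps(2)] by simp
    next
      case False then show ?thesis using fun_cong[OF e, of k] by simp
    qed
    moreover have "x = x'" using fun_cong[OF e, of i] by simp
    ultimately show "t = t' \<and> x = x'" by auto
  qed
  have sub: "?f ` ?D \<subseteq> ?T (insert i I)"
  proof clarify
    fix t x assume t: "t \<in> (\<Pi>\<^sub>E i\<in>I. S3)" "indepF I t" and x: "x \<in> S3" "x \<notin> span (t ` I)"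
    have im: "(t(i := x)) ` insert i I = insert x (t ` I)" using insert.hyps by auto
    have ti: "(t(i := x)) ` I = t ` I" using insert.hyps by auto
    have "x \<notin> t ` I" using x(2) span_base[of x "t ` I"] by blast
    moreover have "inj_on (t(i := x)) I" using t(2) insert.hyps unfolding indepF_def by (auto simp: inj_on_def)
    ultimately have "inj_on (t(i := x)) (insert i I)" using insert.hyps ti by (simp add: inj_on_insert) 
    moreover have "independent (insert x (t ` I))" using t(2) x(2) unfolding indepF_def by (simp add: independent_insertI)
    ultimately have "indepF (insert i I) (t(i := x))" unfolding indepF_def im by blast
    moreover have "t(i := x) \<in> (\<Pi>\<^sub>E i\<in>insert i I. S3)" using t(1) x(1) by (simp add: PiE_fun_upd)
    ultimately show "t(i := x) \<in> (\<Pi>\<^sub>E i\<in>insert i I. S3) \<and> indepF (insert i I) (t(i := x))" by blast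
  qed
  have half: "card S \<le> 2 * card (S3 - span (t ` I))" if t: "t \<in> ?T I" for t
  proof (rule card_outside_span[OF S])
    show "\<not> S \<subseteq> span (t ` I)"
    proof
      assume "S \<subseteq> span (t ` I)"
      then have "dim S \<le> dim (t ` I)" by (rule dim_mono)
      also have "\<dots> = card (t ` I)" using t by (simp add: dim_eq_card_independent indepF_def)
      also have "\<dots> \<le> card I" using insert.hyps(1) by (rule card_image_le)
      finally show False using insert.prems insert.hyps by simp
    qed
  qed
  have "card S ^ card (insert i I) = card S ^ card I * card S" using insert.hyps by simp
  also have "\<dots> \<le> (2 ^ card I * card (?T I)) * card S" using insert by (intro mult_le_mono1) simp
  also have "\<dots> = 2 ^ card I * (\<Sum>t\<in>?T I. card S)" by simp
  also have "\<dots> \<le> 2 ^ card I * (\<Sum>t\<in>?T I. 2 * card (S3 - span (t ` I)))"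
    by (intro mult_le_mono2 sum_mono half)
  also have "\<dots> = 2 ^ card (insert i I) * card ?D"
    using insert.hyps finT S(1) by (subst card_SigmaI) (auto simp: sum_distrib_left mult_ac)
  also have "card ?D = card (?f ` ?D)" by (rule card_image[OF inj, symmetric])
  also have "\<dots> \<le> card (?T (insert i I))" by (rule card_mono[OF finT sub])
  finally show ?case by simp
qed

text \<open>Gaussian elimination with pivots of maximal size keeps all coefficients bounded.\<close>

lemma adapted_basis_exists:
  fixes A :: "'n::finite set"
  assumes "card A = m"
  shows "\<exists>C\<ge>0. \<forall>E. subspace E \<and> E \<subseteq> supp_on A \<longrightarrow>
    (\<exists>J b. J \<subseteq> A \<and> (\<forall>j\<in>J. b j \<in> E \<and> (\<forall>i\<in>J. b j $ i = (if i = j then 1 else 0)) \<and> (\<forall>i. \<bar>b j $ i\<bar> \<le> C)) \<and>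
      (\<forall>x\<in>E. x = (\<Sum>j\<in>J. x $ j *\<^sub>R b j)))"
  using assms
proof (induction m arbitrary: A)
  case 0
  then have "supp_on A = {0}" by (auto simp: supp_on_def vec_eq_iff)
  then show ?case by (intro exI[of _ 0] conjI allI impI exI[of _ "{}"]) auto
next
  case (Suc m)
  have "\<forall>j\<in>A. \<exists>C\<ge>0. \<forall>E. subspace E \<and> E \<subseteq> supp_on (A - {j}) \<longrightarrow>
    (\<exists>J b. J \<subseteq> A - {j} \<and> (\<forall>j\<in>J. b j \<in> E \<and> (\<forall>i\<in>J. b j $ i = (if i = j then 1 else 0)) \<and> (\<forall>i. \<bar>b j $ i\<bar> \<le> C)) \<and>
      (\<forall>x\<in>E. x = (\<Sum>j\<in>J. x $ j *\<^sub>R b j)))"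
    using Suc.prems by (intro ballI Suc.IH) simp
  from bchoice[OF this] obtain c where cc: "\<forall>j\<in>A. c j \<ge> (0::real) \<and> (\<forall>E. subspace E \<and> E \<subseteq> supp_on (A - {j}) \<longrightarrow>
    (\<exists>J b. J \<subseteq> A - {j} \<and> (\<forall>j'\<in>J. b j' \<in> E \<and> (\<forall>i\<in>J. b j' $ i = (if i = j' then 1 else 0)) \<and> (\<forall>i. \<bar>b j' $ i\<bar> \<le> c j)) \<and>
      (\<forall>x\<in>E. x = (\<Sum>j\<in>J. x $ j *\<^sub>R b j))))" by blast
  have c: "\<And>j. j \<in> A \<Longrightarrow> c j \<ge> (0::real)"
    "\<And>j E. j \<in> A \<Longrightarrow> subspace E \<Longrightarrow> E \<subseteq> supp_on (A - {j}) \<Longrightarrow>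
    (\<exists>J b. J \<subseteq> A - {j} \<and> (\<forall>j'\<in>J. b j' \<in> E \<and> (\<forall>i\<in>J. b j' $ i = (if i = j' then 1 else 0)) \<and> (\<forall>i. \<bar>b j' $ i\<bar> \<le> c j)) \<and>
      (\<forall>x\<in>E. x = (\<Sum>j\<in>J. x $ j *\<^sub>R b j)))"
    using cc by blast+
  \<comment> \<open>The pivot depends on E; adding the constants of all possible pivots gives one
    constant for every E.\<close>
  define M where "M = (\<Sum>j\<in>A. c j)"
  have M: "c j \<le> M" if "j \<in> A" for j
    unfolding M_def using that c(1) by (intro member_le_sum) auto
  have M0: "M \<ge> 0" unfolding M_def using c(1) by (intro sum_nonneg)
  define C where "C = 1 + M + real (card A) * M"
  have CM: "M \<le> C" "1 + real (card A) * M \<le> C" "C \<ge> 0" using M0 by (auto simp: C_def)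
  have "\<exists>J b. J \<subseteq> A \<and> (\<forall>j\<in>J. b j \<in> E \<and> (\<forall>i\<in>J. b j $ i = (if i = j then 1 else 0)) \<and> (\<forall>i. \<bar>b j $ i\<bar> \<le> C)) \<and>
      (\<forall>x\<in>E. x = (\<Sum>j\<in>J. x $ j *\<^sub>R b j))" if E: "subspace E" "E \<subseteq> supp_on A" for E
  proof (cases "E \<subseteq> {0}")
    case True
    then show ?thesis by (intro exI[of _ "{}"]) auto
  next
    case False
    then obtain v where v: "v \<in> E" "v \<noteq> 0" by auto
    have Ane: "A \<noteq> {}" using Suc.prems by auto
    have "\<exists>k\<in>A. \<forall>i\<in>A. \<bar>v $ i\<bar> \<le> \<bar>v $ k\<bar>"
    proof -
      have "finite ((\<lambda>i. \<bar>v $ i\<bar>) ` A)" "(\<lambda>i. \<bar>v $ i\<bar>) ` A \<noteq> {}" using Ane by auto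
      then have "Max ((\<lambda>i. \<bar>v $ i\<bar>) ` A) \<in> (\<lambda>i. \<bar>v $ i\<bar>) ` A" by (rule Max_in)
      then obtain k where "k \<in> A" "Max ((\<lambda>i. \<bar>v $ i\<bar>) ` A) = \<bar>v $ k\<bar>" by blast
      then show ?thesis by (intro bexI[of _ k] ballI) (auto simp flip: \<open>Max _ = _\<close> intro!: Max_ge)
    qed
    then obtain k where k: "k \<in> A" "\<And>i. i \<in> A \<Longrightarrow> \<bar>v $ i\<bar> \<le> \<bar>v $ k\<bar>" by meson
    have vk: "v $ k \<noteq> 0"
    proof
      assume z: "v $ k = 0"
      have "v $ i = 0" for i
      proof (cases "i \<in> A")
        case True then show ?thesis using k(2)[of i] z by simp
      next
        case False then show ?thesis using E(2) v(1) by (auto simp: supp_on_def)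
      qed
      then show False using v(2) by (simp add: vec_eq_iff)
    qed
    define u where "u = inverse (v $ k) *\<^sub>R v"
    have uE: "u \<in> E" unfolding u_def using E(1) v(1) by (rule subspace_scale)
    have uk: "u $ k = 1" using vk by (simp add: u_def)
    have u1: "\<bar>u $ i\<bar> \<le> 1" for i
    proof (cases "i \<in> A")
      case True then show ?thesis using k(2)[of i] vk by (simp add: u_def abs_mult field_simps)
    next
      case False then show ?thesis using E(2) uE by (auto simp: supp_on_def)
    qed
    let ?E = "{x\<in>E. x $ k = 0}"
    have sE: "subspace ?E" using E(1) unfolding subspace_def by auto
    have "?E \<subseteq> supp_on (A - {k})" using E(2) by (auto simp: supp_on_def)
    note cE = c(2)[OF k(1) sE this]
    obtain J where JJ: "\<exists>b. J \<subseteq> A - {k} \<and> (\<forall>j'\<in>J. b j' \<in> ?E \<and> (\<forall>i\<in>J. b j' $ i = (if i = j' then 1 else 0)) \<and> (\<forall>i. \<bar>b j' $ i\<bar> \<le> c k)) \<and>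
      (\<forall>x\<in>?E. x = (\<Sum>j\<in>J. x $ j *\<^sub>R b j))" using cE ..
    then obtain b where bb: "J \<subseteq> A - {k} \<and> (\<forall>j'\<in>J. b j' \<in> ?E \<and> (\<forall>i\<in>J. b j' $ i = (if i = j' then 1 else 0)) \<and> (\<forall>i. \<bar>b j' $ i\<bar> \<le> c k)) \<and>
      (\<forall>x\<in>?E. x = (\<Sum>j\<in>J. x $ j *\<^sub>R b j))" ..
    note J = bb[THEN conjunct1]
    note bj = bb[THEN conjunct2, THEN conjunct1, rule_format]
    have b: "\<And>j. j \<in> J \<Longrightarrow> b j \<in> ?E" "\<And>j i. j \<in> J \<Longrightarrow> i \<in> J \<Longrightarrow> b j $ i = (if i = j then 1 else 0)"
        "\<And>j i. j \<in> J \<Longrightarrow> \<bar>b j $ i\<bar> \<le> c k" using bj by auto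
    note ex = bb[THEN conjunct2, THEN conjunct2, rule_format]
    \<comment> \<open>Clears the coordinates of u in J. The k-th coordinate stays 1 since every
      \<open>b j\<close> vanishes there, and the entries grow to at most
      \<open>1 + real (card A) * M\<close> because those of u are at most 1.\<close>
    define w where "w = u - (\<Sum>j\<in>J. u $ j *\<^sub>R b j)"
    have kJ: "k \<notin> J" using J by auto
    have wE: "w \<in> E" unfolding w_def using b(1) uE by (intro subspace_diff[OF E(1)] subspace_sum[OF E(1)] subspace_scale[OF E(1)]) auto
    have wk: "w $ k = 1"
    proof -
      have "(\<Sum>j\<in>J. u $ j *\<^sub>R b j) $ k = 0" using b(1) by (simp add: sum.neutral)
      then show ?thesis unfolding w_def using uk by simp
    qed
    have wJ: "w $ i = 0" if i: "i \<in> J" for i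
    proof -
      have "(\<Sum>j\<in>J. u $ j *\<^sub>R b j) $ i = (\<Sum>j\<in>J. if j = i then u $ i else 0)"
        unfolding sum_component by (intro sum.cong refl) (auto simp: b(2)[OF _ i])
      then show ?thesis unfolding w_def using i by simp
    qed
    have wb: "\<bar>w $ i\<bar> \<le> C" for i
    proof -
      have "\<bar>(\<Sum>j\<in>J. u $ j *\<^sub>R b j) $ i\<bar> \<le> (\<Sum>j\<in>J. \<bar>u $ j * b j $ i\<bar>)"
        unfolding sum_component by (simp add: sum_abs)
      also have "\<dots> \<le> (\<Sum>j\<in>J. M)"
      proof (rule sum_mono)
        fix j assume j: "j \<in> J"
        have "\<bar>u $ j * b j $ i\<bar> \<le> 1 * c k"
          unfolding abs_mult using u1[of j] b(3)[OF j, of i] by (intro mult_mono) auto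
        then show "\<bar>u $ j * b j $ i\<bar> \<le> M" using M[OF k(1)] by simp
      qed
      also have "\<dots> \<le> real (card A) * M"
      proof -
        have "card J \<le> card A" using J by (intro card_mono) auto
        then show ?thesis using M0 by (simp add: mult_right_mono)
      qed
      finally show ?thesis using u1[of i] CM(2) unfolding w_def by (simp add: abs_le_iff)
    qed
    let ?b = "b(k := w)"
    have b': "\<And>j. j \<in> J \<Longrightarrow> ?b j = b j" using kJ by auto
    show ?thesis
    proof (intro exI[of _ "insert k J"] exI[of _ ?b] conjI ballI)
      show "insert k J \<subseteq> A" using J k(1) by auto
      fix j assume j: "j \<in> insert k J"
      show "?b j \<in> E" using j wE b(1) by auto
      show "\<forall>i. \<bar>?b j $ i\<bar> \<le> C"
      proof
        fix i
        show "\<bar>?b j $ i\<bar> \<le> C"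
        proof (cases "j = k")
          case True then show ?thesis using wb[of i] by simp
        next
          case False
          then have "\<bar>b j $ i\<bar> \<le> c k" using j by (intro b(3)) auto
          then show ?thesis using False M[OF k(1)] CM(1) by simp
        qed
      qed
      fix i assume i: "i \<in> insert k J"
      show "?b j $ i = (if i = j then 1 else 0)"
        using i j wk wJ b(1)[of j] b(2)[of j i] kJ by (cases "j = k"; cases "i = k") auto
    next
      fix x assume x: "x \<in> E"
      let ?y = "x - x $ k *\<^sub>R w"
      have "?y \<in> ?E" using x wE wk by (auto intro!: subspace_diff[OF E(1)] subspace_scale[OF E(1)])
      from ex[OF this] have "?y = (\<Sum>j\<in>J. x $ j *\<^sub>R b j)" by (simp add: wJ)
      then have "x = x $ k *\<^sub>R w + (\<Sum>j\<in>J. x $ j *\<^sub>R b j)" by (simp add: algebra_simps)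
      also have "(\<Sum>j\<in>J. x $ j *\<^sub>R b j) = (\<Sum>j\<in>J. x $ j *\<^sub>R ?b j)"
        by (rule sum.cong[OF refl]) (simp only: b')
      also have "x $ k *\<^sub>R w + \<dots> = (\<Sum>j\<in>insert k J. x $ j *\<^sub>R ?b j)"
        by (subst sum.insert[OF finite kJ]) simp
      finally show "x = (\<Sum>j\<in>insert k J. x $ j *\<^sub>R ?b j)" .
    qed
  qed
  then show ?case using CM(3) by (intro exI[of _ C]) blast
qed

text \<open>A subspace \<open>E\<close> is encoded by a set \<open>J\<close> of coordinates on it and the vectors \<open>V i\<close> that express
  the other coordinates through these. Then \<open>GV J (- J) V\<close> corresponds to the integer vectors in \<open>E\<close>, and
  \<open>PT J V\<close> is dual to the embedding \<open>extV J V\<close>.\<close>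

definition extV :: "'n::finite set \<Rightarrow> ('n \<Rightarrow> real^'n) \<Rightarrow> real^'n \<Rightarrow> real^'n" where
  "extV J V x = (\<chi> i. if i \<in> J then x $ i else x \<bullet> V i)"

definition PT :: "'n::finite set \<Rightarrow> ('n \<Rightarrow> real^'n) \<Rightarrow> real^'n \<Rightarrow> real^'n" where
  "PT J V k = (\<chi> j. if j \<in> J then k $ j + (\<Sum>i\<in>- J. k $ i * V i $ j) else 0)"

definition coordV :: "'n::finite set \<Rightarrow> real \<Rightarrow> ('n \<Rightarrow> real^'n) \<Rightarrow> bool" where
  "coordV J C V \<longleftrightarrow> (\<forall>i. V i \<in> supp_on J) \<and> (\<forall>i\<in>J. V i = 0) \<and> (\<forall>i j. \<bar>V i $ j\<bar> \<le> C)"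

lemma extV_nth: "extV J V x $ i = (if i \<in> J then x $ i else x \<bullet> V i)"
  by (simp add: extV_def)

lemma linear_extV: "linear (extV J V)"
  by (rule linearI) (auto simp: vec_eq_iff extV_nth inner_add_left)

lemma PT_nth: "PT J V k $ j = (if j \<in> J then k $ j + (\<Sum>i\<in>- J. k $ i * V i $ j) else 0)"
  by (simp add: PT_def)

lemma linear_PT: "linear (PT J V)"
  by (rule linearI) (auto simp: vec_eq_iff PT_nth algebra_simps sum.distrib sum_distrib_left)

lemma PT_supp: "PT J V k \<in> supp_on J"
  by (simp add: supp_on_def PT_nth)

lemma proj_extV [simp]: "x \<in> supp_on J \<Longrightarrow> proj_on J (extV J V x) = x"
  by (auto simp: vec_eq_iff extV_nth supp_on_def)

lemma inner_PT:
  assumes "x \<in> supp_on J" "\<And>i. V i \<in> supp_on J"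
  shows "x \<bullet> PT J V k = extV J V x \<bullet> k"
proof -
  have "extV J V x \<bullet> k = (\<Sum>i\<in>J. extV J V x $ i * k $ i) + (\<Sum>i\<in>- J. extV J V x $ i * k $ i)"
    unfolding inner_vec_def by (subst sum.union_disjoint[symmetric]) auto
  also have "(\<Sum>i\<in>J. extV J V x $ i * k $ i) = (\<Sum>i\<in>J. x $ i * k $ i)"
    by (intro sum.cong) (auto simp: extV_nth)
  also have "(\<Sum>i\<in>- J. extV J V x $ i * k $ i) = (\<Sum>i\<in>- J. (\<Sum>j\<in>J. x $ j * V i $ j) * k $ i)"
    by (intro sum.cong) (auto simp: extV_nth inner_supp_on[OF assms(2)])
  also have "\<dots> = (\<Sum>j\<in>J. x $ j * (\<Sum>i\<in>- J. k $ i * V i $ j))"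
    by (simp add: sum_distrib_left sum_distrib_right mult_ac) (rule sum.swap)
  finally show ?thesis
    unfolding inner_supp_on[OF PT_supp] by (simp add: PT_nth distrib_left sum.distrib)
qed

lemma extV_expand:
  assumes "x \<in> supp_on J" "\<And>i. V i \<in> supp_on J"
  shows "extV J V x = (\<Sum>i\<in>J. x $ i *\<^sub>R extV J V (axis i 1))"
proof -
  have x: "x = (\<Sum>i\<in>J. x $ i *\<^sub>R axis i 1)"
  proof -
    have "(\<Sum>i\<in>J. x $ i *\<^sub>R axis i 1) $ k = (\<Sum>i\<in>J. if i = k then x $ k else 0)" for k
      unfolding sum_component by (intro sum.cong) (auto simp: axis_def)
    then show ?thesis using assms(1) by (auto simp: vec_eq_iff supp_on_def)
  qed
  have "extV J V (\<Sum>i\<in>J. x $ i *\<^sub>R axis i 1) = (\<Sum>i\<in>J. x $ i *\<^sub>R extV J V (axis i 1))"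
    by (simp add: linear_sum[OF linear_extV] linear_scale[OF linear_extV])
  then show ?thesis using x by simp
qed

lemma dim_supp_on: "dim (supp_on J :: (real^'n::finite) set) = card J"
  unfolding supp_on_def using dim_substandard_cart[of J, where 'a = real] by (simp add: dim_vec_eq)

lemma adapted_coordinates_exist:
  obtains C :: real where "C \<ge> 0"
    "\<And>E :: (real^'n::finite) set. subspace E \<Longrightarrow> \<exists>J V. coordV J C V \<and> E = extV J V ` supp_on J \<and> card J = dim E"
proof -
  obtain C :: real where C: "C \<ge> 0" "\<forall>E. subspace E \<and> E \<subseteq> supp_on (UNIV :: 'n set) \<longrightarrow>
    (\<exists>J b. J \<subseteq> UNIV \<and> (\<forall>j\<in>J. b j \<in> E \<and> (\<forall>i\<in>J. b j $ i = (if i = j then 1 else 0)) \<and> (\<forall>i. \<bar>b j $ i\<bar> \<le> C)) \<and>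
      (\<forall>x\<in>E. x = (\<Sum>j\<in>J. x $ j *\<^sub>R b j)))"
    using adapted_basis_exists[of "UNIV :: 'n set", OF refl] by auto
  show thesis
  proof (rule that[OF C(1)])
    fix E :: "(real^'n) set" assume E: "subspace E"
    have Es: "E \<subseteq> supp_on UNIV" by (auto simp: supp_on_def)
    note ex_E = C(2)[THEN spec, THEN mp, OF conjI[OF E Es]]
    obtain J where J: "\<exists>b. J \<subseteq> UNIV \<and> (\<forall>j\<in>J. b j \<in> E \<and> (\<forall>i\<in>J. b j $ i = (if i = j then 1 else 0)) \<and> (\<forall>i. \<bar>b j $ i\<bar> \<le> C)) \<and>
      (\<forall>x\<in>E. x = (\<Sum>j\<in>J. x $ j *\<^sub>R b j))" using ex_E ..
    then obtain b where Jb: "J \<subseteq> UNIV \<and> (\<forall>j\<in>J. b j \<in> E \<and> (\<forall>i\<in>J. b j $ i = (if i = j then 1 else 0)) \<and> (\<forall>i. \<bar>b j $ i\<bar> \<le> C)) \<and>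
      (\<forall>x\<in>E. x = (\<Sum>j\<in>J. x $ j *\<^sub>R b j))" ..
    note b = Jb[THEN conjunct2, THEN conjunct1] and ex = Jb[THEN conjunct2, THEN conjunct2]
    \<comment> \<open>The transposed basis: \<open>V i\<close> collects the i-th coordinates of all
      the \<open>b j\<close>.\<close>
    define V where "V i = (\<chi> j. if j \<in> J \<and> i \<notin> J then b j $ i else 0)" for i
    have Vn: "V i $ j = (if j \<in> J \<and> i \<notin> J then b j $ i else 0)" for i j by (simp add: V_def)
    have Vs: "V i \<in> supp_on J" for i by (auto simp: supp_on_def Vn)
    have cV: "coordV J C V" unfolding coordV_def using Vs b C(1) by (auto simp: Vn vec_eq_iff)
    have eb: "extV J V x = (\<Sum>j\<in>J. x $ j *\<^sub>R b j)" for x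
    proof -
      have "extV J V x $ i = (\<Sum>j\<in>J. x $ j *\<^sub>R b j) $ i" for i
      proof (cases "i \<in> J")
        case True
        have "(\<Sum>j\<in>J. x $ j *\<^sub>R b j) $ i = (\<Sum>j\<in>J. if j = i then x $ i else 0)"
          unfolding sum_component by (intro sum.cong refl) (use b True in auto)
        then show ?thesis using True by (simp add: extV_nth)
      next
        case False
        then show ?thesis by (simp add: extV_nth inner_supp_on[OF Vs] Vn)
      qed
      then show ?thesis by (simp add: vec_eq_iff)
    qed
    have EE: "E = extV J V ` supp_on J"
    proof (intro equalityI subsetI)
      fix x assume x: "x \<in> E"
      have "extV J V (proj_on J x) = (\<Sum>j\<in>J. x $ j *\<^sub>R b j)" unfolding eb by (intro sum.cong) auto
      then have "x = extV J V (proj_on J x)" using ex x by auto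
      moreover have "proj_on J x \<in> supp_on J" by (simp add: supp_on_def)
      ultimately show "x \<in> extV J V ` supp_on J" by (rule image_eqI)
    next
      fix x assume "x \<in> extV J V ` supp_on J"
      then obtain y where "x = extV J V y" by blast
      then show "x \<in> E" unfolding eb using b by (auto intro!: subspace_sum[OF E] subspace_scale[OF E])
    qed
    have sub: "subspace (supp_on J)" by (auto simp: subspace_def supp_on_def)
    have "inj_on (extV J V) (span (supp_on J))"
      unfolding span_eq_iff[THEN iffD2, OF sub] by (metis inj_onI proj_extV)
    then have "dim E = dim (supp_on J)" unfolding EE by (rule dim_image_eq[OF linear_extV])
    also have "\<dots> = card J" by (rule dim_supp_on)
    finally have "card J = dim E" ..
    with cV EE show "\<exists>J V. coordV J C V \<and> E = extV J V ` supp_on J \<and> card J = dim E" by blast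
  qed
qed

section \<open>Restricting a symmetric matrix to a subspace\<close>

definition sym_of :: "('n \<Rightarrow> 'n \<Rightarrow> 'c) \<Rightarrow> 'n uprod \<Rightarrow> 'c" where
  "sym_of q p = (case (SOME (i, j). Upair i j = p) of (i, j) \<Rightarrow> q i j)"

text \<open>\<open>SOME\<close> may return the two indices in either order, which is harmless
  exactly when q is symmetric at them.\<close>

lemma sym_of_Upair:
  assumes "q i j = q j i"
  shows "sym_of q (Upair i j) = q i j"
proof -
  obtain k l where kl: "(SOME (k, l). Upair k l = Upair i j) = (k, l)" by fastforce
  have "case (SOME (k, l). Upair k l = Upair i j) of (k, l) \<Rightarrow> Upair k l = Upair i j"
    by (rule someI[of _ "(i, j)"]) simp
  then have "Upair k l = Upair i j" unfolding kl by simp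
  then show ?thesis using assms unfolding sym_of_def kl by auto
qed

text \<open>The Gram matrix, in the basis \<open>extV J V (axis i 1)\<close>, of the quadratic form
  w restricted to the subspace: the restriction of X to \<open>E\<close> in the overview.\<close>

definition projE :: "'n::finite set \<Rightarrow> ('n \<Rightarrow> real^'n) \<Rightarrow> ('n uprod \<Rightarrow> real) \<Rightarrow> 'n uprod \<Rightarrow> real" where
  "projE J V w = (\<lambda>p\<in>prs J. sym_of (\<lambda>i j. extV J V (axis j 1) \<bullet> mulW UNIV (extV J V (axis i 1)) w) p)"

lemma projE_Upair:
  assumes "i \<in> J" "j \<in> J"
  shows "projE J V w (Upair i j) = extV J V (axis j 1) \<bullet> mulW UNIV (extV J V (axis i 1)) w"
proof -
  have U: "z \<in> supp_on UNIV" for z :: "real^'n" by (simp add: supp_on_def)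
  let ?q = "\<lambda>i j. extV J V (axis j 1) \<bullet> mulW UNIV (extV J V (axis i 1)) w"
  have sw: "?q i j = ?q j i"
    using inner_mulW_swap[OF U U, of "extV J V (axis i 1)" w "extV J V (axis j 1)"] by (simp add: inner_commute)
  show ?thesis unfolding projE_def using assms by (simp add: sym_of_Upair[of ?q, OF sw])
qed

lemma mulW_sum_left: "finite I \<Longrightarrow> mulW J (\<Sum>i\<in>I. f i) w = (\<Sum>i\<in>I. mulW J (f i) w)"
  by (induction I rule: finite_induct) (auto simp: mulW_add)

lemma mulW_projE:
  assumes "x \<in> supp_on J" "\<And>i. V i \<in> supp_on J"
  shows "mulW J x (projE J V w) = PT J V (mulW UNIV (extV J V x) w)"
proof -
  have "mulW J x (projE J V w) $ j = PT J V (mulW UNIV (extV J V x) w) $ j" for j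
  proof (cases "j \<in> J")
    case True
    have ax: "axis j 1 \<in> supp_on J" using True by (auto simp: supp_on_def axis_def)
    have "mulW J x (projE J V w) $ j = (\<Sum>i\<in>J. x $ i * (extV J V (axis j 1) \<bullet> mulW UNIV (extV J V (axis i 1)) w))"
      using True by (simp add: mulW_nth projE_Upair)
    also have "\<dots> = extV J V (axis j 1) \<bullet> mulW UNIV (\<Sum>i\<in>J. x $ i *\<^sub>R extV J V (axis i 1)) w"
      by (simp add: mulW_sum_left mulW_scaleR inner_sum_right)
    also have "\<dots> = extV J V (axis j 1) \<bullet> mulW UNIV (extV J V x) w" by (simp only: extV_expand[OF assms])
    also have "\<dots> = axis j 1 \<bullet> PT J V (mulW UNIV (extV J V x) w)" by (rule inner_PT[OF ax assms(2), symmetric])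
    also have "\<dots> = PT J V (mulW UNIV (extV J V x) w) $ j" by (simp add: inner_axis')
    finally show ?thesis .
  next
    case False then show ?thesis by (simp add: mulW_nth PT_nth)
  qed
  then show ?thesis by (simp add: vec_eq_iff)
qed

lemma mulW_eq_imp_eq:
  assumes "\<And>x. x \<in> supp_on J \<Longrightarrow> mulW J x w = mulW J x v" "p \<in> prs J"
  shows "w p = v p"
proof (cases p)
  case (Upair i j)
  then have ij: "i \<in> J" "j \<in> J" using assms(2) by auto
  have ax: "axis i 1 \<in> supp_on J" using ij by (auto simp: supp_on_def axis_def)
  have "mulW J (axis i 1) u $ j = u (Upair i j)" for u
  proof -
    have "mulW J (axis i 1) u $ j = (\<Sum>l\<in>J. if l = i then u (Upair i j) else 0)"
      unfolding mulW_nth using ij by (simp add: axis_def if_distrib[where f = "\<lambda>x. x * _"] cong: if_cong)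
    then show ?thesis using ij by simp
  qed
  then show ?thesis using assms(1)[OF ax] Upair by metis
qed

text \<open>Isotropy of the set of short vectors turns the linear relation \<open>k = - h W\<close> on it into a
  symmetric matrix.\<close>

lemma symmetric_matrix_exists:
  fixes J :: "'n::finite set"
  assumes V: "\<And>i. V i \<in> supp_on J"
    and S: "S \<subseteq> extV J V ` supp_on J" "\<And>h g. h \<in> S \<Longrightarrow> g \<in> S \<Longrightarrow> h \<bullet> kk g = g \<bullet> kk h"
    and t: "\<And>i. i \<in> J \<Longrightarrow> t i \<in> S" "indepF J t"
  obtains W where "\<And>h. h \<in> S \<Longrightarrow> mulW J (proj_on J h) W = - PT J V (kk h)" "\<And>p. p \<notin> prs J \<Longrightarrow> W p = 0"
    "\<And>v. v \<in> supp_on J \<Longrightarrow> \<exists>c. v = (\<Sum>i\<in>J. c i *\<^sub>R proj_on J (t i))"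
    "indepF J (\<lambda>i. proj_on J (t i))"
proof -
  have lp: "linear (proj_on J :: real^'n \<Rightarrow> _)" by (rule linearI) (auto simp: vec_eq_iff)
  have ext: "extV J V (proj_on J h) = h" "proj_on J h \<in> supp_on J" if "h \<in> S" for h
    using S(1) that by (auto simp: supp_on_def)
  have sub: "subspace (supp_on J)" by (auto simp: subspace_def supp_on_def)
  define E where "E = extV J V ` supp_on J"
  have sE: "subspace E" unfolding E_def by (rule linear_subspace_image[OF linear_extV sub])
  have injE: "inj_on (proj_on J) E" unfolding E_def by (rule inj_onI) auto
  define x where "x i = proj_on J (t i)" for i
  have tE: "t ` J \<subseteq> E" using t(1) S(1) E_def by blast
  have spE: "span (t ` J) \<subseteq> E" by (rule span_minimal[OF tE sE])
  have xi: "inj_on x J"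
    unfolding x_def
  proof (rule inj_onI)
    fix i k assume ik: "i \<in> J" "k \<in> J" "proj_on J (t i) = proj_on J (t k)"
    then have "t i = t k" using inj_onD[OF injE ik(3)] tE by blast
    then show "i = k" using t(2) ik unfolding indepF_def by (meson inj_onD)
  qed
  have ix: "independent (x ` J)"
  proof -
    have "independent (proj_on J ` t ` J)"
      using t(2) by (intro linear_independent_injective_image[OF lp] inj_on_subset[OF injE spE]) (simp add: indepF_def)
    then show ?thesis by (simp add: image_image x_def)
  qed
  have dimJ: "dim (supp_on J) = card J" by (rule dim_supp_on)
  have xs: "x ` J \<subseteq> supp_on J" unfolding x_def by (auto simp: supp_on_def)
  have spx: "span (x ` J) = supp_on J"
  proof (rule antisym)
    show "span (x ` J) \<subseteq> supp_on J" by (rule span_minimal[OF xs sub])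
    show "supp_on J \<subseteq> span (x ` J)"
      using card_ge_dim_independent[OF xs ix] dimJ card_image[OF xi] by simp
  qed
  have expand: "\<exists>c. v = (\<Sum>i\<in>J. c i *\<^sub>R x i)" if v: "v \<in> supp_on J" for v
  proof -
    have "v \<in> span (x ` J)" using v spx by simp
    then obtain u where "v = (\<Sum>y\<in>x ` J. u y *\<^sub>R y)" using span_finite[of "x ` J"] by auto
    then have "v = (\<Sum>i\<in>J. u (x i) *\<^sub>R x i)" by (simp add: sum.reindex[OF xi])
    then show ?thesis by (intro exI[of _ "\<lambda>i. u (x i)"])
  qed
  \<comment> \<open>The map is prescribed on the basis \<open>x i\<close> only. That it has the
    required value at every other h in S is deduced below from the symmetry of the pairing.\<close>
  obtain f where f: "linear f" "\<forall>y\<in>x ` J. f y = - PT J V (kk (t (inv_into J x y)))"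
    using linear_independent_extend[OF ix, of "\<lambda>y. - PT J V (kk (t (inv_into J x y)))"] by blast
  have fx: "f (x i) = - PT J V (kk (t i))" if "i \<in> J" for i
    using f(2) that xi by auto
  have fs: "f y \<in> supp_on J" if y: "y \<in> supp_on J" for y
  proof -
    obtain c where "y = (\<Sum>i\<in>J. c i *\<^sub>R x i)" using expand[OF y] by blast
    then have "f y = (\<Sum>i\<in>J. c i *\<^sub>R f (x i))" by (simp add: linear_sum[OF f(1)] linear_scale[OF f(1)])
    also have "\<dots> \<in> supp_on J"
      by (intro subspace_sum[OF sub] subspace_scale[OF sub]) (simp add: fx subspace_neg[OF sub PT_supp])
    finally show ?thesis .
  qed
  have xt: "x i \<bullet> PT J V k = t i \<bullet> k" if "i \<in> J" for i k
    using inner_PT[of "x i" J V k] V ext[OF t(1)[OF that]] unfolding x_def by simp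
  have symb: "x i \<bullet> f (x j) = x j \<bullet> f (x i)" if "i \<in> J" "j \<in> J" for i j
    using S(2)[OF t(1)[OF that(1)] t(1)[OF that(2)]] that by (simp add: fx xt)
  have sym: "u \<bullet> f v = v \<bullet> f u" if u: "u \<in> supp_on J" and v: "v \<in> supp_on J" for u v
  proof -
    obtain c where c: "u = (\<Sum>i\<in>J. c i *\<^sub>R x i)" using expand[OF u] by blast
    obtain d where d: "v = (\<Sum>i\<in>J. d i *\<^sub>R x i)" using expand[OF v] by blast
    have "u \<bullet> f v = (\<Sum>i\<in>J. \<Sum>j\<in>J. c i * d j * (x i \<bullet> f (x j)))"
      unfolding c d by (simp add: linear_sum[OF f(1)] linear_scale[OF f(1)] inner_sum_left inner_sum_right sum_distrib_left mult_ac) (rule sum.swap)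
    also have "\<dots> = (\<Sum>i\<in>J. \<Sum>j\<in>J. c i * d j * (x j \<bullet> f (x i)))"
      by (intro sum.cong refl) (simp add: symb)
    also have "\<dots> = (\<Sum>j\<in>J. \<Sum>i\<in>J. c i * d j * (x j \<bullet> f (x i)))" by (rule sum.swap)
    also have "\<dots> = v \<bullet> f u"
      unfolding c d by (simp add: linear_sum[OF f(1)] linear_scale[OF f(1)] inner_sum_left inner_sum_right sum_distrib_left mult_ac) (rule sum.swap)
    finally show ?thesis .
  qed
  have axs: "axis l 1 \<in> supp_on J" if "l \<in> J" for l using that by (auto simp: supp_on_def axis_def)
  define q where "q l m = (if l \<in> J \<and> m \<in> J then f (axis l 1) $ m else 0)" for l m
  have qs: "q l m = q m l" for l m
    using sym[OF axs axs, of l m] by (auto simp: q_def inner_axis')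
  define W where "W p = (if p \<in> prs J then sym_of q p else 0)" for p
  have WU: "W (Upair l m) = f (axis l 1) $ m" if "l \<in> J" "m \<in> J" for l m
    unfolding W_def using that by (simp add: sym_of_Upair[where q = q, OF qs]) (simp add: q_def)
  have mW: "mulW J y W = f y" if y: "y \<in> supp_on J" for y
  proof -
    have ye: "y = (\<Sum>l\<in>J. y $ l *\<^sub>R axis l 1)"
    proof -
      have "(\<Sum>i\<in>J. y $ i *\<^sub>R axis i 1) $ k = (\<Sum>i\<in>J. if i = k then y $ k else 0)" for k
        unfolding sum_component by (intro sum.cong) (auto simp: axis_def)
      then show ?thesis using y by (auto simp: vec_eq_iff supp_on_def)
    qed
    have "f y = (\<Sum>l\<in>J. y $ l *\<^sub>R f (axis l 1))"
      by (subst ye) (simp add: linear_sum[OF f(1)] linear_scale[OF f(1)])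
    then have "f y $ m = (\<Sum>l\<in>J. y $ l * f (axis l 1) $ m)" for m by (simp add: sum_component)
    then have "mulW J y W $ m = f y $ m" for m
      using fs[OF y] by (auto simp: mulW_nth WU supp_on_def)
    then show ?thesis by (simp add: vec_eq_iff)
  qed
  show thesis
  proof (rule that[of W])
    show "mulW J (proj_on J h) W = - PT J V (kk h)" if h: "h \<in> S" for h
    proof -
      let ?y = "proj_on J h"
      have ys: "?y \<in> supp_on J" using ext[OF h] by simp
      \<comment> \<open>The error at h is orthogonal to every \<open>x i\<close> by isotropy. It
        lies in \<open>supp_on J\<close>, which the \<open>x i\<close> span, so it is orthogonal to
        itself.\<close>
      have orth: "x i \<bullet> (f ?y + PT J V (kk h)) = 0" if i: "i \<in> J" for i
      proof -
        have "x i \<bullet> f ?y = ?y \<bullet> f (x i)" using xs i by (intro sym ys) auto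
        also have "\<dots> = - (h \<bullet> kk (t i))" using inner_PT[OF ys V] ext[OF h] by (simp add: fx[OF i])
        also have "\<dots> = - (t i \<bullet> kk h)" using S(2)[OF h t(1)[OF i]] by simp
        finally show ?thesis by (simp add: inner_add_right xt[OF i])
      qed
      have ds: "f ?y + PT J V (kk h) \<in> supp_on J" using fs[OF ys] PT_supp by (rule subspace_add[OF sub])
      obtain c where c: "f ?y + PT J V (kk h) = (\<Sum>i\<in>J. c i *\<^sub>R x i)" using expand[OF ds] by blast
      have "(f ?y + PT J V (kk h)) \<bullet> (f ?y + PT J V (kk h)) = (\<Sum>i\<in>J. c i * (x i \<bullet> (f ?y + PT J V (kk h))))"
        by (subst (1) c) (simp add: inner_sum_left)
      also have "\<dots> = 0" using orth by simp
      finally have "f ?y + PT J V (kk h) = 0" by simp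
      then show ?thesis unfolding mW[OF ys] by (simp add: eq_neg_iff_add_eq_0)
    qed
    show "W p = 0" if "p \<notin> prs J" for p using that by (simp add: W_def)
    show "\<exists>c. v = (\<Sum>i\<in>J. c i *\<^sub>R proj_on J (t i))" if "v \<in> supp_on J" for v
      using expand[OF that] unfolding x_def .
    show "indepF J (\<lambda>i. proj_on J (t i))" using xi ix unfolding indepF_def x_def by simp
  qed
qed

text \<open>Adding \<open>Zsh J V d y\<close> to the matrix does not change its restriction to \<open>E\<close> as a quadratic form, but
  moves the image of \<open>extV J V x\<close> by \<open>x \<bullet> d\<close> times a vector that depends on \<open>y\<close> only.\<close>

definition Zsh :: "'n::finite set \<Rightarrow> ('n \<Rightarrow> real^'n) \<Rightarrow> real^'n \<Rightarrow> ('n \<Rightarrow> real) \<Rightarrow> 'n uprod \<Rightarrow> real" where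
  "Zsh J V d y = sym_of (\<lambda>l m.
     if l \<in> J \<and> m \<in> J then - (\<Sum>i\<in>- J. y i * (d $ l * V i $ m + d $ m * V i $ l))
     else if l \<in> J then d $ l * y m else if m \<in> J then d $ m * y l else 0)"

definition shv :: "'n::finite set \<Rightarrow> ('n \<Rightarrow> real^'n) \<Rightarrow> ('n \<Rightarrow> real) \<Rightarrow> real^'n" where
  "shv J V y = (\<chi> l. if l \<in> J then - (\<Sum>i\<in>- J. y i * V i $ l) else y l)"

lemma Zsh_Upair: "Zsh J V d y (Upair l m) =
    (if l \<in> J \<and> m \<in> J then - (\<Sum>i\<in>- J. y i * (d $ l * V i $ m + d $ m * V i $ l))
     else if l \<in> J then d $ l * y m else if m \<in> J then d $ m * y l else 0)"
  unfolding Zsh_def by (rule sym_of_Upair) (simp add: add.commute)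

lemma mulW_Zsh:
  assumes x: "x \<in> supp_on J" and V: "\<And>i. V i \<in> supp_on J" and d: "d \<in> supp_on J"
  shows "mulW UNIV (extV J V x) (Zsh J V d y) = (x \<bullet> d) *\<^sub>R shv J V y"
proof -
  have split: "(\<Sum>l\<in>UNIV. F l) = (\<Sum>l\<in>J. F l) + (\<Sum>l\<in>- J. F l)" for F :: "'a \<Rightarrow> real"
    by (subst sum.union_disjoint[symmetric]) auto
  have xd: "x \<bullet> d = (\<Sum>l\<in>J. x $ l * d $ l)" by (rule inner_supp_on[OF d])
  have xV: "x \<bullet> V i = (\<Sum>l\<in>J. x $ l * V i $ l)" for i by (rule inner_supp_on[OF V])
  have "mulW UNIV (extV J V x) (Zsh J V d y) $ m = ((x \<bullet> d) *\<^sub>R shv J V y) $ m" for m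
  proof (cases "m \<in> J")
    case False
    have "mulW UNIV (extV J V x) (Zsh J V d y) $ m = (\<Sum>l\<in>J. x $ l * (d $ l * y m)) + (\<Sum>l\<in>- J. 0)"
      unfolding mulW_nth split using False by (auto simp: Zsh_Upair extV_nth intro!: arg_cong2[where f = "(+)"] sum.cong)
    also have "\<dots> = (x \<bullet> d) * y m" unfolding xd by (simp add: sum_distrib_right mult.assoc)
    finally show ?thesis using False by (simp add: shv_def)
  next
    case True
    let ?A = "\<Sum>i\<in>- J. y i * V i $ m" and ?B = "\<Sum>i\<in>- J. y i * (x \<bullet> V i)"
    have "mulW UNIV (extV J V x) (Zsh J V d y) $ m =
      (\<Sum>l\<in>J. x $ l * - (\<Sum>i\<in>- J. y i * (d $ l * V i $ m + d $ m * V i $ l))) + (\<Sum>l\<in>- J. (x \<bullet> V l) * (d $ m * y l))"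
      unfolding mulW_nth split using True by (auto simp: Zsh_Upair extV_nth intro!: arg_cong2[where f = "(+)"] sum.cong)
    also have "(\<Sum>l\<in>- J. (x \<bullet> V l) * (d $ m * y l)) = d $ m * ?B" by (simp add: sum_distrib_left mult_ac)
    also have "(\<Sum>l\<in>J. x $ l * - (\<Sum>i\<in>- J. y i * (d $ l * V i $ m + d $ m * V i $ l))) =
      - (\<Sum>l\<in>J. x $ l * d $ l * ?A + d $ m * (\<Sum>i\<in>- J. y i * (x $ l * V i $ l)))"
      by (simp add: sum_negf sum_distrib_left algebra_simps sum.distrib sum_subtractf)
    also have "\<dots> = - ((x \<bullet> d) * ?A + d $ m * (\<Sum>l\<in>J. \<Sum>i\<in>- J. y i * (x $ l * V i $ l)))"
      unfolding xd by (simp only: sum.distrib sum_distrib_right[symmetric] sum_distrib_left[symmetric])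
    also have "(\<Sum>l\<in>J. \<Sum>i\<in>- J. y i * (x $ l * V i $ l)) = ?B"
      unfolding xV sum_distrib_left by (rule sum.swap)
    finally show ?thesis using True by (simp add: shv_def)
  qed
  then show ?thesis by (simp add: vec_eq_iff)
qed

lemma PT_shv: "PT J V (shv J V y) = 0"
  by (auto simp: vec_eq_iff PT_nth shv_def)

lemma mulW_add_right: "mulW J x (\<lambda>p. w p + v p) = mulW J x w + mulW J x v"
  by (auto simp: vec_eq_iff mulW_nth distrib_left sum.distrib)

lemma projE_add: "p \<in> prs J \<Longrightarrow> projE J V (\<lambda>p. w p + v p) p = projE J V w p + projE J V v p"
proof (cases p)
  case (Upair i j)
  then show "p \<in> prs J \<Longrightarrow> ?thesis" by (simp add: projE_Upair mulW_add_right inner_add_right)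
qed

text \<open>\<open>PT\<close> annihilates \<open>shv\<close>, and a matrix on J is determined by its
  action on \<open>supp_on J\<close>.\<close>

lemma projE_Zsh:
  assumes V: "\<And>i. V i \<in> supp_on J" and d: "d \<in> supp_on J" and p: "p \<in> prs J"
  shows "projE J V (Zsh J V d y) p = 0"
proof (rule mulW_eq_imp_eq[OF _ p, of "projE J V (Zsh J V d y)" "\<lambda>_. 0"])
  fix x assume x: "x \<in> supp_on J"
  have "mulW J x (projE J V (Zsh J V d y)) = PT J V ((x \<bullet> d) *\<^sub>R shv J V y)"
    unfolding mulW_projE[OF x V] mulW_Zsh[OF x V d] ..
  also have "\<dots> = 0" unfolding linear_scale[OF linear_PT] PT_shv by simp
  finally show "mulW J x (projE J V (Zsh J V d y)) = mulW J x (\<lambda>_. 0)" by (simp add: vec_eq_iff mulW_nth)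
qed

section \<open>Averaging over translations of the torus\<close>

lemma prs_UNIV [simp]: "prs UNIV = UNIV"
  by (auto simp: prs_def)

lemma countable_ZJ: "countable (ZJ J)"
proof -
  have "ZJ J \<subseteq> (\<lambda>f. \<chi> i. f i) ` (\<Pi>\<^sub>E i\<in>UNIV. \<int>)"
  proof
    fix x assume "x \<in> ZJ J"
    then show "x \<in> (\<lambda>f. \<chi> i. f i) ` (\<Pi>\<^sub>E i\<in>UNIV. \<int>)"
      by (intro image_eqI[of _ _ "\<lambda>i. x $ i"]) (auto simp: ZJ_def)
  qed
  moreover have "countable ((\<lambda>f. \<chi> i. f i) ` (\<Pi>\<^sub>E i\<in>(UNIV::'a set). (\<int>::real set)))"
    by (intro countable_image countable_PiE) (auto simp: Ints_def)
  ultimately show ?thesis by (rule countable_subset)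
qed

lemma finite_int_box: "finite {x\<in>ZJ J. \<forall>i. \<bar>x $ i\<bar> \<le> c}"
proof -
  have "{x\<in>ZJ J. \<forall>i. \<bar>x $ i\<bar> \<le> c} \<subseteq> (\<lambda>f. \<chi> i. real_of_int (f i)) ` (\<Pi>\<^sub>E i\<in>UNIV. {- \<lfloor>c\<rfloor>..\<lfloor>c\<rfloor>})"
  proof
    fix x assume x: "x \<in> {x\<in>ZJ J. \<forall>i. \<bar>x $ i\<bar> \<le> c}"
    have e: "real_of_int \<lfloor>x $ i\<rfloor> = x $ i" for i using x by (auto simp: ZJ_def)
    have "\<bar>\<lfloor>x $ i\<rfloor>\<bar> \<le> \<lfloor>c\<rfloor>" for i
    proof -
      have "real_of_int \<bar>\<lfloor>x $ i\<rfloor>\<bar> \<le> c" using x unfolding of_int_abs e[of i] by simp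
      then show ?thesis by (simp only: le_floor_iff)
    qed
    then have "\<lfloor>x $ i\<rfloor> \<in> {- \<lfloor>c\<rfloor>..\<lfloor>c\<rfloor>}" for i by (simp add: abs_le_iff minus_le_iff)
    then show "x \<in> (\<lambda>f. \<chi> i. real_of_int (f i)) ` (\<Pi>\<^sub>E i\<in>UNIV. {- \<lfloor>c\<rfloor>..\<lfloor>c\<rfloor>})"
      by (intro image_eqI[of _ _ "\<lambda>i. \<lfloor>x $ i\<rfloor>"]) (auto simp: e vec_eq_iff)
  qed
  then show ?thesis by (rule finite_subset) (intro finite_imageI finite_PiE; simp)
qed

text \<open>Each coordinate is within \<beta> of an integer. The explicit integer vector makes
  invariance under integer translations, and measurability as a countable union, immediate.\<close>

definition good :: "real \<Rightarrow> real^'n::finite \<Rightarrow> bool" where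
  "good \<beta> \<alpha> \<longleftrightarrow> (\<exists>k\<in>ZJ UNIV. \<forall>i. \<bar>\<alpha> $ i + k $ i\<bar> \<le> \<beta>)"

lemma good_shift: "m \<in> ZJ UNIV \<Longrightarrow> good \<beta> (\<alpha> + m) \<longleftrightarrow> good \<beta> \<alpha>"
proof -
  have *: "good \<beta> \<alpha>" if "m \<in> ZJ UNIV" "good \<beta> (\<alpha> + m)" for m \<alpha> :: "real^'a"
  proof -
    obtain k where k: "k \<in> ZJ UNIV" "\<forall>i. \<bar>(\<alpha> + m) $ i + k $ i\<bar> \<le> \<beta>"
      using \<open>good \<beta> (\<alpha> + m)\<close> unfolding good_def by blast
    then show ?thesis unfolding good_def
      using subgrp_add[OF subgrp_ZJ \<open>m \<in> ZJ UNIV\<close> k(1)] by (intro bexI[of _ "m + k"]) (auto simp: add.assoc)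
  qed
  assume m: "m \<in> ZJ UNIV"
  then have m': "- m \<in> ZJ UNIV" by (rule subgrp_minus[OF subgrp_ZJ])
  show ?thesis using *[OF m, of \<alpha>] *[OF m', of "\<alpha> + m"] by auto
qed

text \<open>The integer shifts k of the coordinates outside J for which \<open>shv J V\<close> of k
  is again an integer vector. This lattice is dual to \<open>GV J (- J) V\<close>.\<close>

definition BV :: "'n::finite set \<Rightarrow> ('n \<Rightarrow> real^'n) \<Rightarrow> (real^'n) set" where
  "BV J V = {k\<in>ZJ (- J). \<forall>l\<in>J. (\<Sum>i\<in>- J. k $ i * V i $ l) \<in> \<int>}"

lemma subgrp_BV: "subgrp (BV J V)"
  by (auto simp: subgrp_def BV_def ZJ_def left_diff_distrib sum_subtractf)

text \<open>The index q of \<open>GV\<close> clears the denominators of V, so every vector is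
  congruent modulo \<open>BV\<close> to one with entries between 0 and q. For the inequality, the
  fractional parts of \<open>x \<bullet> V i\<close> for x in a transversal of \<open>GV\<close> are
  distinct characters of \<open>ZJ (- J)\<close> trivial on \<open>BV\<close>;
  \<open>card_dual_le\<close> with k = 1 counts them.\<close>

lemma idx_BV:
  fixes J :: "'n::finite set"
  assumes V: "\<And>i. V i \<in> supp_on J" and fin: "finite (cosets (ZJ J) (GV J (- J) V))"
  shows "finite (cosets (ZJ (- J)) (BV J V))" "idx (ZJ J) (GV J (- J) V) \<le> idx (ZJ (- J)) (BV J V)"
proof -
  let ?G = "GV J (- J) V" and ?B = "BV J V"
  let ?q = "idx (ZJ J) ?G"
  have q1: "?q \<ge> 1" by (rule idx_pos[OF subgrp_ZJ fin])
  have qV: "real ?q * V i $ l \<in> \<int>" if "l \<in> J" "i \<notin> J" for i l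
  proof -
    have "of_nat ?q *\<^sub>R axis l 1 \<in> ?G"
      by (rule idx_scaleR_mem[OF subgrp_ZJ subgrp_GV GV_subset fin axis_in_ZJ[OF that(1)]])
    then have "(of_nat ?q *\<^sub>R axis l 1) \<bullet> V i \<in> \<int>" using that(2) by (auto simp: GV_def)
    then show ?thesis by (simp add: inner_axis')
  qed
  show fB: "finite (cosets (ZJ (- J)) ?B)"
  proof (rule finite_cosets_covering[OF subgrp_ZJ subgrp_BV _ finite_int_box[of "- J" "real ?q"]])
    show "?B \<subseteq> ZJ (- J)" by (auto simp: BV_def)
    show "{x\<in>ZJ (- J). \<forall>i. \<bar>x $ i\<bar> \<le> real ?q} \<subseteq> ZJ (- J)" by blast
    fix a :: "real^'n" assume a: "a \<in> ZJ (- J)"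
    define c :: "real^'n" where "c = (\<chi> i. of_int \<lfloor>a $ i / real ?q\<rfloor>)"
    define r where "r = a - real ?q *\<^sub>R c"
    have c: "c \<in> ZJ (- J)" using a by (auto simp: c_def ZJ_def)
    have r: "r \<in> ZJ (- J)" unfolding r_def by (intro subgrp_diff[OF subgrp_ZJ a] subgrp_of_nat_scaleR[OF subgrp_ZJ c])
    have "0 \<le> r $ i \<and> r $ i \<le> real ?q" for i
    proof -
      have fl: "of_int \<lfloor>x\<rfloor> \<le> x" "x \<le> of_int \<lfloor>x\<rfloor> + 1" for x :: real by linarith+
      have qpos: "real ?q > 0" using q1 by linarith
      note fl[of "a $ i / real ?q"]
      then have "of_int \<lfloor>a $ i / real ?q\<rfloor> * real ?q \<le> a $ i" "a $ i \<le> (of_int \<lfloor>a $ i / real ?q\<rfloor> + 1) * real ?q"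
        by (simp_all only: pos_le_divide_eq[OF qpos] pos_divide_le_eq[OF qpos])
      then show ?thesis by (simp add: r_def c_def algebra_simps)
    qed
    then have "\<bar>r $ i\<bar> \<le> real ?q" for i by (auto simp: abs_le_iff intro: order_trans[OF _ of_nat_0_le_iff])
    then have rm: "r \<in> {x\<in>ZJ (- J). \<forall>i. \<bar>x $ i\<bar> \<le> real ?q}" using r by blast
    have "a - r \<in> ?B"
    proof -
      have e: "a - r = real ?q *\<^sub>R c" by (simp add: r_def)
      have "(\<Sum>i\<in>- J. (real ?q *\<^sub>R c) $ i * V i $ l) \<in> \<int>" if l: "l \<in> J" for l
      proof (rule Ints_sum)
        fix i assume i: "i \<in> - J"
        have "c $ i \<in> \<int>" using c by (simp add: ZJ_def)
        then have "c $ i * (real ?q * V i $ l) \<in> \<int>" using qV[OF l, of i] i by (meson ComplD Ints_mult)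
        then show "(real ?q *\<^sub>R c) $ i * V i $ l \<in> \<int>" by (simp add: mult_ac)
      qed
      then show ?thesis unfolding BV_def e using subgrp_of_nat_scaleR[OF subgrp_ZJ c] by blast
    qed
    then show "\<exists>r\<in>{x\<in>ZJ (- J). \<forall>i. \<bar>x $ i\<bar> \<le> real ?q}. a - r \<in> ?B" using rm by blast
  qed
  obtain Q where Q: "Q \<subseteq> ZJ J" "separated ?G Q" "finite Q" "card Q = ?q"
    by (rule transversal_exists[OF subgrp_ZJ subgrp_GV GV_subset fin])
  define c where "c x = (\<chi> i. if i \<in> J then 0 else frac (x \<bullet> V i))" for x
  have inj: "inj_on c Q"
  proof (rule inj_onI)
    fix x y assume xy: "x \<in> Q" "y \<in> Q" "c x = c y"
    have "(x - y) \<bullet> V i \<in> \<int>" if "i \<in> - J" for i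
    proof -
      have "c x $ i = c y $ i" using xy by simp
      then have "frac (x \<bullet> V i) = frac (y \<bullet> V i)" using that by (simp add: c_def)
      then have "x \<bullet> V i - y \<bullet> V i = of_int (\<lfloor>x \<bullet> V i\<rfloor> - \<lfloor>y \<bullet> V i\<rfloor>)" by (simp add: frac_def)
      then show ?thesis by (simp add: inner_diff_left)
    qed
    moreover have "x - y \<in> ZJ J" using xy Q(1) by (intro subgrp_diff[OF subgrp_ZJ]) auto
    ultimately have "x - y \<in> ?G" by (auto simp: GV_def)
    then show "x = y" using Q(2) xy unfolding separated_def by blast
  qed
  have "finite (c ` Q) \<and> card (c ` Q) \<le> 1 ^ card (- J) * idx (ZJ (- J)) ?B"
  proof (rule card_dual_le[OF finite subgrp_BV _ fB])
    show "?B \<subseteq> ZJ (- J)" by (auto simp: BV_def)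
    show "c ` Q \<subseteq> unit_cube (- J)" by (auto simp: unit_cube_def c_def frac_lt_1)
    show "1 \<le> (1::nat)" by simp
    have one: "c x \<bullet> k \<in> \<int>" if x: "x \<in> Q" and k: "k \<in> ?B" for x k
    proof -
      have ks: "k \<in> supp_on (- J)" and kZ: "\<And>i. k $ i \<in> \<int>" using k by (auto simp: BV_def ZJ_def supp_on_def)
      have xs: "x \<bullet> V i = (\<Sum>l\<in>J. x $ l * V i $ l)" for i by (rule inner_supp_on[OF V])
      have "c x \<bullet> k = (\<Sum>i\<in>- J. (x \<bullet> V i) * k $ i) - (\<Sum>i\<in>- J. of_int \<lfloor>x \<bullet> V i\<rfloor> * k $ i)"
        unfolding inner_supp_on[OF ks] by (simp add: c_def frac_def left_diff_distrib sum_subtractf)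
      also have "(\<Sum>i\<in>- J. (x \<bullet> V i) * k $ i) = (\<Sum>l\<in>J. x $ l * (\<Sum>i\<in>- J. k $ i * V i $ l))"
        unfolding xs by (simp add: sum_distrib_left sum_distrib_right mult_ac) (rule sum.swap)
      also have "\<dots> - (\<Sum>i\<in>- J. of_int \<lfloor>x \<bullet> V i\<rfloor> * k $ i) \<in> \<int>"
      proof (rule Ints_diff)
        have "x $ l \<in> \<int>" for l using x Q(1) by (auto simp: ZJ_def)
        then show "(\<Sum>l\<in>J. x $ l * (\<Sum>i\<in>- J. k $ i * V i $ l)) \<in> \<int>"
          using k unfolding BV_def by (intro Ints_sum) (rule Ints_mult; blast)
        show "(\<Sum>i\<in>- J. of_int \<lfloor>x \<bullet> V i\<rfloor> * k $ i) \<in> \<int>"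
          by (intro Ints_sum Ints_mult kZ Ints_of_int)
      qed
      finally show ?thesis .
    qed
    fix u v y assume "u \<in> c ` Q" "v \<in> c ` Q" "y \<in> ?B"
    then obtain x x' where "x \<in> Q" "x' \<in> Q" "u = c x" "v = c x'" by blast
    then show "real 1 * ((u - v) \<bullet> y) \<in> \<int>"
      using Ints_diff[OF one[OF \<open>x \<in> Q\<close> \<open>y \<in> ?B\<close>] one[OF \<open>x' \<in> Q\<close> \<open>y \<in> ?B\<close>]] by (simp add: inner_diff_left)
  qed
  then show "?q \<le> idx (ZJ (- J)) ?B" using card_image[OF inj] Q(4) by simp
qed

lemma measurable_good:
  assumes [measurable]: "\<And>l. (\<lambda>x. f x $ l) \<in> borel_measurable M"
  shows "Measurable.pred M (\<lambda>x. good \<beta> (f x))"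
proof -
  have e: "{x\<in>space M. good \<beta> (f x)} = (\<Union>k\<in>ZJ UNIV. {x\<in>space M. \<forall>l. \<bar>f x $ l + k $ l\<bar> \<le> \<beta>})"
    unfolding good_def by blast
  show ?thesis unfolding pred_def e
    by (rule sets.countable_UN'[OF countable_ZJ], rule image_subsetI) measurable
qed

lemma LB_component: "i \<in> A \<Longrightarrow> (\<lambda>w. w i) \<in> borel_measurable (LB A)"
  using measurable_component_singleton[of i A "\<lambda>_. lborel :: real measure"] by simp

lemma measurable_shv_nth:
  assumes "\<And>i. i \<in> - J \<Longrightarrow> (\<lambda>z. f z i) \<in> borel_measurable M"
  shows "(\<lambda>z. shv J V (f z) $ l) \<in> borel_measurable M"
  unfolding shv_def using assms
  by (cases "l \<in> J") (auto intro!: borel_measurable_sum borel_measurable_times borel_measurable_uminus)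

text \<open>For each y at most one \<kappa> in R can be good, because the \<open>x i\<close> detect
  any difference as an integer smaller than 1. Where one is good, y lies in an integer translate of
  a box of side \<open>2 * \<beta>\<close>, so all of R together costs no more than the volume of
  this one box.\<close>

lemma nn_integral_good_le:
  fixes J :: "'n::finite set"
  assumes V: "\<And>i. V i \<in> supp_on J"
    and x: "\<And>i. i \<in> J \<Longrightarrow> x i \<in> GV J (- J) V" "\<And>i l. i \<in> J \<Longrightarrow> \<bar>x i $ l\<bar> \<le> a"
    and sp: "\<And>v. v \<in> supp_on J \<Longrightarrow> \<exists>c. v = (\<Sum>i\<in>J. c i *\<^sub>R x i)"
    and b: "\<beta> \<ge> 0" "2 * \<beta> < 1" "real (card J) * (2 * \<beta> * a) < 1"
    and R: "finite R" "R \<subseteq> ZJ (- J)" "separated (BV J V) R"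
  shows "(\<Sum>\<kappa>\<in>R. \<integral>\<^sup>+y\<in>cubeI (- J). indicator {y. good \<beta> (\<alpha> + shv J V (\<lambda>i. y i + \<kappa> $ i))} y \<partial>LB (- J))
    \<le> ennreal ((2 * \<beta>) ^ card (- J))" (is "?lhs \<le> _")
proof -
  let ?U = "- J"
  have uniq: "\<kappa> = \<kappa>'" if k: "\<kappa> \<in> R" "\<kappa>' \<in> R" and g: "good \<beta> (\<alpha> + shv J V (\<lambda>i. y i + \<kappa> $ i))"
    "good \<beta> (\<alpha> + shv J V (\<lambda>i. y i + \<kappa>' $ i))" for \<kappa> \<kappa>' and y :: "'n \<Rightarrow> real"
  proof -
    obtain k1 where k1: "k1 \<in> ZJ UNIV" "\<And>i. \<bar>(\<alpha> + shv J V (\<lambda>i. y i + \<kappa> $ i)) $ i + k1 $ i\<bar> \<le> \<beta>"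
      using g(1) unfolding good_def by blast
    obtain k2 where k2: "k2 \<in> ZJ UNIV" "\<And>i. \<bar>(\<alpha> + shv J V (\<lambda>i. y i + \<kappa>' $ i)) $ i + k2 $ i\<bar> \<le> \<beta>"
      using g(2) unfolding good_def by blast
    define dk where "dk = \<kappa> - \<kappa>'"
    have dkZ: "dk \<in> ZJ ?U" unfolding dk_def using R(2) k by (intro subgrp_diff[OF subgrp_ZJ]) auto
    \<comment> \<open>The failure of \<open>dk\<close> to lie in \<open>BV\<close>. Its pairings
      with the \<open>x i\<close> are integers since these lie in \<open>GV\<close>, and smaller
      than 1 since its entries are at most \<open>2 * \<beta>\<close>; so \<gamma> vanishes.\<close>
    define \<gamma> where "\<gamma> = (\<chi> l. if l \<in> J then (\<Sum>i\<in>?U. dk $ i * V i $ l) - (k1 $ l - k2 $ l) else 0)"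
    have gs: "\<gamma> \<in> supp_on J" by (simp add: supp_on_def \<gamma>_def)
    have gl: "\<bar>\<gamma> $ l\<bar> \<le> 2 * \<beta>" for l
    proof (cases "l \<in> J")
      case True
      have "\<gamma> $ l = ((\<alpha> + shv J V (\<lambda>i. y i + \<kappa>' $ i)) $ l + k2 $ l) - ((\<alpha> + shv J V (\<lambda>i. y i + \<kappa> $ i)) $ l + k1 $ l)"
        using True by (simp add: \<gamma>_def shv_def dk_def algebra_simps sum.distrib sum_subtractf)
      then show ?thesis using k1(2)[of l] k2(2)[of l] by linarith
    qed (use b in \<open>simp add: \<gamma>_def\<close>)
    have k12: "k2 $ i - k1 $ i = dk $ i" if i: "i \<in> ?U" for i
    proof -
      have e: "(k1 $ i - k2 $ i) + dk $ i = ((\<alpha> + shv J V (\<lambda>i. y i + \<kappa> $ i)) $ i + k1 $ i) - ((\<alpha> + shv J V (\<lambda>i. y i + \<kappa>' $ i)) $ i + k2 $ i)"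
        using i by (simp add: shv_def dk_def)
      have "\<bar>(k1 $ i - k2 $ i) + dk $ i\<bar> < 1" unfolding e using k1(2)[of i] k2(2)[of i] b by linarith
      moreover have "(k1 $ i - k2 $ i) + dk $ i \<in> \<int>" using k1(1) k2(1) dkZ by (auto simp: ZJ_def)
      ultimately have "(k1 $ i - k2 $ i) + dk $ i = 0" by (metis Ints_nonzero_abs_less1)
      then show ?thesis by simp
    qed
    have orth: "x i \<bullet> \<gamma> = 0" if i: "i \<in> J" for i
    proof -
      have xZ: "x i \<in> ZJ J" "\<And>m. m \<in> ?U \<Longrightarrow> x i \<bullet> V m \<in> \<int>" using x(1)[OF i] by (auto simp: GV_def)
      have "x i \<bullet> \<gamma> = (\<Sum>l\<in>J. x i $ l * (\<Sum>m\<in>?U. dk $ m * V m $ l)) - (\<Sum>l\<in>J. x i $ l * (k1 $ l - k2 $ l))"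
        unfolding inner_supp_on[OF gs] by (simp add: \<gamma>_def right_diff_distrib sum_subtractf)
      also have "(\<Sum>l\<in>J. x i $ l * (\<Sum>m\<in>?U. dk $ m * V m $ l)) = (\<Sum>m\<in>?U. dk $ m * (x i \<bullet> V m))"
        unfolding inner_supp_on[OF V] by (simp add: sum_distrib_left mult_ac) (rule sum.swap)
      also have "\<dots> - (\<Sum>l\<in>J. x i $ l * (k1 $ l - k2 $ l)) \<in> \<int>"
        using xZ dkZ k1(1) k2(1) by (intro Ints_diff Ints_sum Ints_mult) (auto simp: ZJ_def)
      finally have "x i \<bullet> \<gamma> \<in> \<int>" .
      moreover have "\<bar>x i \<bullet> \<gamma>\<bar> < 1"
      proof -
        have "\<bar>x i \<bullet> \<gamma>\<bar> \<le> (\<Sum>l\<in>J. \<bar>x i $ l * \<gamma> $ l\<bar>)" unfolding inner_supp_on[OF gs] by (rule sum_abs)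
        also have "\<dots> \<le> (\<Sum>l\<in>J. a * (2 * \<beta>))"
          unfolding abs_mult using x(2)[OF i] gl by (intro sum_mono mult_mono) (auto intro: order_trans[OF abs_ge_zero])
        also have "\<dots> = real (card J) * (2 * \<beta> * a)" by simp
        finally show ?thesis using b(3) by linarith
      qed
      ultimately show ?thesis by (metis Ints_nonzero_abs_less1)
    qed
    obtain c where c: "\<gamma> = (\<Sum>i\<in>J. c i *\<^sub>R x i)" using sp[OF gs] by blast
    have "\<gamma> \<bullet> \<gamma> = (\<Sum>i\<in>J. c i * (x i \<bullet> \<gamma>))" by (subst (1) c) (simp add: inner_sum_left)
    also have "\<dots> = 0" using orth by simp
    finally have g0: "\<gamma> = 0" by simp
    have "(\<Sum>i\<in>?U. dk $ i * V i $ l) \<in> \<int>" if l: "l \<in> J" for l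
    proof -
      have "\<gamma> $ l = 0" using g0 by simp
      then have "(\<Sum>i\<in>?U. dk $ i * V i $ l) = k1 $ l - k2 $ l" using l by (simp add: \<gamma>_def)
      then show ?thesis using k1(1) k2(1) by (auto simp: ZJ_def)
    qed
    then have "dk \<in> BV J V" using dkZ by (auto simp: BV_def)
    then show "\<kappa> = \<kappa>'" using R(3) k unfolding separated_def dk_def by blast
  qed
  \<comment> \<open>Only the coordinates outside J are used: there \<open>shv\<close> is the bare
    shift y.\<close>
  define Box where "Box = (\<Pi>\<^sub>E i\<in>?U. {y. \<bar>1 * y + \<alpha> $ i\<bar> \<le> \<beta>})"
  have Bs [measurable]: "Box \<in> sets (LB ?U)" unfolding Box_def by (rule sets_PiM_I_finite) auto
  note [measurable] = cubeI_sets[OF finite[of ?U]]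
  have pw: "(\<Sum>\<kappa>\<in>R. indicator {y. good \<beta> (\<alpha> + shv J V (\<lambda>i. y i + \<kappa> $ i))} y) \<le>
    (\<integral>\<^sup>+z. indicator Box (shf ?U (\<lambda>i. - z i) y) \<partial>count_space (intsE ?U))" (is "?s \<le> ?i") for y
  proof (cases "\<exists>\<kappa>\<in>R. good \<beta> (\<alpha> + shv J V (\<lambda>i. y i + \<kappa> $ i))")
    case False
    then have "?s = 0" by (intro sum.neutral) auto
    then show ?thesis by simp
  next
    case True
    then obtain \<kappa> where k: "\<kappa> \<in> R" "good \<beta> (\<alpha> + shv J V (\<lambda>i. y i + \<kappa> $ i))" by blast
    then obtain k1 where k1: "k1 \<in> ZJ UNIV" "\<And>i. \<bar>(\<alpha> + shv J V (\<lambda>i. y i + \<kappa> $ i)) $ i + k1 $ i\<bar> \<le> \<beta>"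
      unfolding good_def by blast
    have "?s = (\<Sum>\<kappa>'\<in>R. if \<kappa>' = \<kappa> then 1 else 0)"
    proof (intro sum.cong refl)
      fix \<kappa>' assume "\<kappa>' \<in> R"
      have "good \<beta> (\<alpha> + shv J V (\<lambda>i. y i + \<kappa>' $ i)) \<longleftrightarrow> \<kappa>' = \<kappa>"
        using uniq[OF k(1) \<open>\<kappa>' \<in> R\<close> k(2)] k(2) by blast
      then show "indicator {y. good \<beta> (\<alpha> + shv J V (\<lambda>i. y i + \<kappa>' $ i))} y = (if \<kappa>' = \<kappa> then 1 else (0::ennreal))"
        unfolding indicator_def mem_Collect_eq by (rule ssubst) simp
    qed
    then have s1: "?s = 1" using k(1) R(1) by simp
    define z where "z = (\<lambda>i\<in>?U. - (\<kappa> $ i + k1 $ i))"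
    have z: "z \<in> intsE ?U" using k(1) R(2) k1(1) by (auto simp: z_def intsE_def ZJ_def)
    have "\<bar>y i + (\<kappa> $ i + k1 $ i) + \<alpha> $ i\<bar> \<le> \<beta>" if "i \<notin> J" for i
      using k1(2)[of i] that by (simp add: shv_def algebra_simps)
    then have "shf ?U (\<lambda>i. - z i) y \<in> Box"
      by (auto simp: Box_def shf_def z_def Pi_iff algebra_simps)
    then have "indicator {z} z' \<le> (indicator Box (shf ?U (\<lambda>i. - z' i) y) :: ennreal)" for z' by (auto simp: indicator_def)
    then have "(\<integral>\<^sup>+z'. indicator {z} z' \<partial>count_space (intsE ?U)) \<le> ?i" by (intro nn_integral_mono)
    then show ?thesis using s1 z by simp
  qed
  have gm: "Measurable.pred (LB ?U) (\<lambda>y. good \<beta> (\<alpha> + shv J V (\<lambda>i. y i + \<kappa> $ i)))" for \<kappa>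
  proof -
    have "(\<lambda>y. (\<alpha> + shv J V (\<lambda>i. y i + \<kappa> $ i)) $ l) \<in> borel_measurable (LB ?U)" for l
      unfolding vector_add_component
      by (intro borel_measurable_add borel_measurable_const measurable_shv_nth LB_component) auto
    then show ?thesis by (rule measurable_good)
  qed
  have "?lhs = (\<integral>\<^sup>+y. (\<Sum>\<kappa>\<in>R. indicator {y. good \<beta> (\<alpha> + shv J V (\<lambda>i. y i + \<kappa> $ i))} y * indicator (cubeI ?U) y) \<partial>LB ?U)"
    using gm by (intro nn_integral_sum[symmetric]) (auto intro!: borel_measurable_times_ennreal borel_measurable_indicator' simp: pred_def)
  also have "\<dots> \<le> (\<integral>\<^sup>+y. (\<integral>\<^sup>+z. indicator Box (shf ?U (\<lambda>i. - z i) y) * indicator (cubeI ?U) y \<partial>count_space (intsE ?U)) \<partial>LB ?U)"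
    by (intro nn_integral_mono) (simp add: sum_distrib_right[symmetric] nn_integral_multc mult_right_mono[OF pw])
  also have "\<dots> = (\<integral>\<^sup>+z. (\<integral>\<^sup>+y. indicator Box (shf ?U (\<lambda>i. - z i) y) * indicator (cubeI ?U) y \<partial>LB ?U) \<partial>count_space (intsE ?U))"
    by (rule nn_integral_count_space_nn_integral[OF countable_intsE[OF finite]]) measurable
  also have "\<dots> = (\<integral>\<^sup>+y. indicator Box y \<partial>LB ?U)"
    by (rule nn_integral_tile[symmetric]) auto
  also have "\<dots> = emeasure (LB ?U) Box" by simp
  also have "\<dots> = (\<Prod>i\<in>?U. emeasure lborel {y. \<bar>1 * y + \<alpha> $ i\<bar> \<le> \<beta>})"
    unfolding Box_def by (rule lb.emeasure_PiM) auto
  also have "\<dots> = (\<Prod>i\<in>?U. ennreal (2 * \<beta>))"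
    using b by (intro prod.cong refl) (subst emeasure_abs_affine_le, auto)
  also have "\<dots> = ennreal ((2 * \<beta>) ^ card ?U)" using b by (simp add: ennreal_power)
  finally show ?thesis .
qed

section \<open>Decoupling and unfolding\<close>

lemma measurable_count_space_integral:
  assumes A: "countable A" and m: "\<And>z. z \<in> A \<Longrightarrow> f z \<in> borel_measurable N"
  shows "(\<lambda>x. \<integral>\<^sup>+z. f z x \<partial>count_space A) \<in> borel_measurable N"
proof -
  interpret sigma_finite_measure "count_space A" by (rule sigma_finite_measure_count_space_countable[OF A])
  have "(\<lambda>p. f (fst p) (snd p)) \<in> borel_measurable (count_space A \<Otimes>\<^sub>M N)"
    by (rule measurable_pair_measure_countable1[OF A]) (simp add: m)
  then have "(\<lambda>(x, z). f z x) \<in> borel_measurable (N \<Otimes>\<^sub>M count_space A)"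
    by (subst measurable_pair_swap_iff) (simp add: case_prod_beta)
  then show ?thesis by (rule borel_measurable_nn_integral)
qed

lemma shf_UNIV: "shf UNIV c w = (\<lambda>p. w p + c p)"
  by (simp add: shf_def restrict_UNIV)

lemma measurable_mulW_nth:
  assumes "\<And>p. (\<lambda>z. f z p) \<in> borel_measurable M"
  shows "(\<lambda>z. mulW UNIV v (f z) $ l) \<in> borel_measurable M"
  unfolding mulW_nth using assms by (auto intro!: borel_measurable_sum borel_measurable_times)

lemma extV_GV_ZJ: "x \<in> GV J (- J) V \<Longrightarrow> extV J V x \<in> ZJ UNIV"
  by (auto simp: GV_def ZJ_def extV_nth)

lemma mulW_intsE_ZJ: "x \<in> ZJ UNIV \<Longrightarrow> z \<in> intsE UNIV \<Longrightarrow> mulW UNIV x z \<in> ZJ UNIV"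
  by (auto simp: ZJ_def mulW_nth intsE_def intro!: Ints_sum Ints_mult)

text \<open>A member of the dual basis. Shifting the matrix by \<open>Zsh\<close> along d moves the
  image of \<open>x j\<close> and of no other \<open>x i\<close>.\<close>

lemma dual_vector_exists:
  assumes ind: "indepF J x" and xs: "\<And>i. i \<in> J \<Longrightarrow> x i \<in> supp_on J" and j: "j \<in> J"
  obtains d where "d \<in> supp_on J" "x j \<bullet> d = 1" "\<And>i. i \<in> J \<Longrightarrow> i \<noteq> j \<Longrightarrow> x i \<bullet> d = 0"
proof -
  have ix: "independent (x ` J)" and xi: "inj_on x J" using ind by (auto simp: indepF_def)
  obtain f :: "real^'a \<Rightarrow> real" where f: "linear f" "\<forall>v\<in>x ` J. f v = (if v = x j then 1 else 0)"
    using linear_independent_extend[OF ix, of "\<lambda>v. if v = x j then 1 else 0"] by blast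
  define d where "d = (\<chi> l. if l \<in> J then f (axis l 1) else 0)"
  have ds: "d \<in> supp_on J" by (simp add: supp_on_def d_def)
  have fd: "v \<bullet> d = f v" if "v \<in> supp_on J" for v
  proof -
    have v: "v = (\<Sum>i\<in>J. v $ i *\<^sub>R axis i 1)"
    proof -
      have "(\<Sum>i\<in>J. v $ i *\<^sub>R axis i 1) $ k = (\<Sum>i\<in>J. if i = k then v $ k else 0)" for k
        unfolding sum_component by (intro sum.cong) (auto simp: axis_def)
      then show ?thesis using that by (auto simp: vec_eq_iff supp_on_def)
    qed
    have "f v = f (\<Sum>i\<in>J. v $ i *\<^sub>R axis i 1)" using v by simp
    also have "\<dots> = (\<Sum>i\<in>J. v $ i * f (axis i 1))" by (simp add: linear_sum[OF f(1)] linear_scale[OF f(1)])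
    also have "\<dots> = v \<bullet> d" unfolding inner_supp_on[OF ds] by (simp add: d_def)
    finally show ?thesis ..
  qed
  show thesis
  proof (rule that[OF ds])
    show "x j \<bullet> d = 1" using f(2) j fd[OF xs[OF j]] by simp
    fix i assume "i \<in> J" "i \<noteq> j"
    moreover from this have "x i \<noteq> x j" using xi j by (auto dest: inj_onD)
    ultimately show "x i \<bullet> d = 0" using f(2) fd[OF xs] by simp
  qed
qed

text \<open>The conditions \<open>good\<close> are removed one at a time. A translation by
  \<open>Zsh\<close> along the dual vector of \<open>x j\<close> changes neither F nor the other
  conditions, so averaging over such translations replaces the condition on \<open>x j\<close> by
  its mean, which \<open>nn_integral_good_le\<close> bounds by the volume of the box over the index
  of \<open>BV\<close>.\<close>

lemma cross_bound:
  fixes J :: "'n::finite set" and F :: "('n uprod \<Rightarrow> real) \<Rightarrow> ennreal"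
  assumes V: "\<And>i. V i \<in> supp_on J"
    and x: "\<And>i. i \<in> J \<Longrightarrow> x i \<in> GV J (- J) V" "\<And>i l. i \<in> J \<Longrightarrow> \<bar>x i $ l\<bar> \<le> a"
    and sp: "\<And>v. v \<in> supp_on J \<Longrightarrow> \<exists>c. v = (\<Sum>i\<in>J. c i *\<^sub>R x i)"
    and ind: "indepF J x"
    and b: "\<beta> \<ge> 0" "2 * \<beta> < 1" "real (card J) * (2 * \<beta> * a) < 1"
    and fin: "finite (cosets (ZJ (- J)) (BV J V))"
    and F: "F \<in> borel_measurable (LB UNIV)" "\<And>w z. z \<in> intsE UNIV \<Longrightarrow> F (\<lambda>p. w p + z p) = F w"
      "\<And>w d y. d \<in> supp_on J \<Longrightarrow> F (\<lambda>p. w p + Zsh J V d y p) = F w"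
    and I: "I \<subseteq> J"
  shows "(\<integral>\<^sup>+w\<in>cubeI UNIV. F w * (\<Prod>i\<in>I. indicator {w. good \<beta> (mulW UNIV (extV J V (x i)) w)} w) \<partial>LB UNIV) *
      of_nat (idx (ZJ (- J)) (BV J V)) ^ card I \<le>
    ennreal ((2 * \<beta>) ^ card (- J)) ^ card I * (\<integral>\<^sup>+w\<in>cubeI UNIV. F w \<partial>LB UNIV)"
proof -
  let ?D = "of_nat (idx (ZJ (- J)) (BV J V)) :: ennreal" and ?K = "ennreal ((2 * \<beta>) ^ card (- J))"
  let ?al = "\<lambda>i w. mulW UNIV (extV J V (x i)) w"
  let ?g = "\<lambda>i w. indicator {w. good \<beta> (?al i w)} w :: ennreal"
  note [measurable] = F(1) cubeI_sets[OF finite]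
  have xs: "x i \<in> supp_on J" if "i \<in> J" for i using x(1)[OF that] GV_subset ZJ_supp by blast
  have cU: "(\<lambda>w. w p) \<in> borel_measurable (LB UNIV)" for p :: "'n uprod" by (rule LB_component) simp
  have gm [measurable]: "?g i \<in> borel_measurable (LB UNIV)" for i
  proof -
    have "Measurable.pred (LB UNIV) (\<lambda>w. good \<beta> (?al i w))"
      by (intro measurable_good measurable_mulW_nth cU)
    then show ?thesis by measurable
  qed
  have gper: "?g i (\<lambda>p. w p + z p) = ?g i w" if "i \<in> J" "z \<in> intsE UNIV" for i w z
    using good_shift[OF mulW_intsE_ZJ[OF extV_GV_ZJ[OF x(1)[OF that(1)]] that(2)], of \<beta> "?al i w"]
    unfolding indicator_def mem_Collect_eq mulW_add_right by simp
  obtain R where R: "R \<subseteq> ZJ (- J)" "separated (BV J V) R" "finite R" "card R = idx (ZJ (- J)) (BV J V)"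
    by (rule transversal_exists[OF subgrp_ZJ subgrp_BV _ fin]) (auto simp: BV_def)
  have "finite I" by simp
  then show ?thesis using I
  proof (induction I rule: finite_induct)
    case empty
    then show ?case by simp
  next
    case (insert j I)
    define G where "G w = F w * (\<Prod>i\<in>I. ?g i w)" for w
    have IJ: "I \<subseteq> J" and j: "j \<in> J" using insert.prems by auto
    have [measurable]: "G \<in> borel_measurable (LB UNIV)"
      unfolding G_def by (intro borel_measurable_times_ennreal borel_measurable_prod_ennreal F(1) gm)
    obtain d where d: "d \<in> supp_on J" "x j \<bullet> d = 1" "\<And>i. i \<in> J \<Longrightarrow> i \<noteq> j \<Longrightarrow> x i \<bullet> d = 0"
      using dual_vector_exists[OF ind xs j] by blast
    have alZ: "?al i (\<lambda>p. w p + Zsh J V d y p) = ?al i w + (x i \<bullet> d) *\<^sub>R shv J V y" if "i \<in> J" for i w y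
      unfolding mulW_add_right mulW_Zsh[OF xs[OF that] V d(1)] ..
    have Gz: "G (\<lambda>p. w p + Zsh J V d y p) = G w" for w y
    proof -
      have "?g i (\<lambda>p. w p + Zsh J V d y p) = ?g i w" if "i \<in> I" for i
      proof -
        have "i \<in> J" "i \<noteq> j" using that IJ insert.hyps by auto
        then show ?thesis unfolding indicator_def mem_Collect_eq using d(3) by (simp add: alZ)
      qed
      then show ?thesis unfolding G_def F(3)[OF d(1)] by simp
    qed
    have Gper: "G (\<lambda>p. w p + z p) = G w" if "z \<in> intsE UNIV" for w z
    proof -
      have "?g i (\<lambda>p. w p + z p) = ?g i w" if "i \<in> I" for i
        using gper[OF subsetD[OF IJ that] \<open>z \<in> intsE UNIV\<close>] .
      then show ?thesis unfolding G_def F(2)[OF that] by simp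
    qed
    define P where "P \<kappa> w y \<longleftrightarrow> good \<beta> (?al j w + shv J V (\<lambda>i. y i + \<kappa> $ i))" for \<kappa> :: "real^'n" and w y
    have Pm: "Measurable.pred (LB UNIV \<Otimes>\<^sub>M LB (- J)) (\<lambda>z. P \<kappa> (fst z) (snd z))" for \<kappa>
    proof -
      have a1: "(\<lambda>z. shv J V (\<lambda>i. snd z i + \<kappa> $ i) $ l) \<in> borel_measurable (LB UNIV \<Otimes>\<^sub>M LB (- J))" for l
        by (intro measurable_shv_nth borel_measurable_add measurable_compose[OF measurable_snd LB_component]) auto
      have a2: "(\<lambda>z. ?al j (fst z) $ l) \<in> borel_measurable (LB UNIV \<Otimes>\<^sub>M LB (- J))" for l
        by (intro measurable_mulW_nth measurable_compose[OF measurable_fst cU])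
      have "(\<lambda>z. (?al j (fst z) + shv J V (\<lambda>i. snd z i + \<kappa> $ i)) $ l) \<in> borel_measurable (LB UNIV \<Otimes>\<^sub>M LB (- J))" for l
        unfolding vector_add_component by (rule borel_measurable_add[OF a2 a1])
      then show ?thesis unfolding P_def by (rule measurable_good)
    qed
    define L where "L = (\<integral>\<^sup>+w\<in>cubeI UNIV. G w * ?g j w \<partial>LB UNIV)"
    define H where "H \<kappa> z = (G (fst z) * indicator (cubeI UNIV) (fst z)) *
      (indicator {z. P \<kappa> (fst z) (snd z)} z * indicator (cubeI (- J)) (snd z))" for \<kappa> z
    have Hm: "H \<kappa> \<in> borel_measurable (LB UNIV \<Otimes>\<^sub>M LB (- J))" for \<kappa>
    proof -
      note [measurable] = Pm[of \<kappa>]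
      show ?thesis unfolding H_def by measurable
    qed
    \<comment> \<open>The integrand is periodic, so its integral over the cube is the same after
      translation by \<open>Zsh\<close>, for every y and \<kappa>.\<close>
    have Leq: "L * indicator (cubeI (- J)) y = (\<integral>\<^sup>+w. H \<kappa> (w, y) \<partial>LB UNIV)" for \<kappa> y
    proof -
      let ?Z = "Zsh J V d (\<lambda>i. y i + \<kappa> $ i)"
      have "L = (\<integral>\<^sup>+w\<in>cubeI UNIV. G (shf UNIV ?Z w) * ?g j (shf UNIV ?Z w) \<partial>LB UNIV)"
        unfolding L_def
        by (rule nn_integral_cube_shf[where f = "\<lambda>w. G w * ?g j w", symmetric, OF finite])
          (measurable, simp add: shf_UNIV Gper gper[OF j] del: indicator_simps)
      also have "\<dots> = (\<integral>\<^sup>+w. G w * indicator (cubeI UNIV) w * indicator {z. P \<kappa> (fst z) (snd z)} (w, y) \<partial>LB UNIV)"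
      proof (rule nn_integral_cong)
        fix w :: "'n uprod \<Rightarrow> real"
        have "?g j (shf UNIV ?Z w) = indicator {z. P \<kappa> (fst z) (snd z)} (w, y)"
          unfolding indicator_def mem_Collect_eq shf_UNIV alZ[OF j] d(2) P_def by simp
        then show "G (shf UNIV ?Z w) * ?g j (shf UNIV ?Z w) * indicator (cubeI UNIV) w =
          G w * indicator (cubeI UNIV) w * indicator {z. P \<kappa> (fst z) (snd z)} (w, y)"
          unfolding shf_UNIV Gz by (simp only: mult_ac)
      qed
      finally have Lint: "L = (\<integral>\<^sup>+w. G w * indicator (cubeI UNIV) w * indicator {z. P \<kappa> (fst z) (snd z)} (w, y) \<partial>LB UNIV)" .
      have meas: "(\<lambda>w. G w * indicator (cubeI UNIV) w * indicator {z. P \<kappa> (fst z) (snd z)} (w, y)) \<in> borel_measurable (LB UNIV)"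
        if y: "y \<in> space (LB (- J))"
      proof -
        note [measurable] = Pm[of \<kappa>]
        have "(\<lambda>z. indicator {z. P \<kappa> (fst z) (snd z)} z :: ennreal) \<in> borel_measurable (LB UNIV \<Otimes>\<^sub>M LB (- J))"
          by measurable
        from measurable_compose[OF measurable_Pair2'[OF y] this] show ?thesis by measurable
      qed
      show ?thesis
      proof (cases "y \<in> space (LB (- J))")
        case True
        show ?thesis unfolding Lint H_def fst_conv snd_conv mult.assoc[symmetric]
          by (rule nn_integral_multc[symmetric, OF meas[OF True]])
      next
        case False
        then have "y \<notin> cubeI (- J)" by (auto simp: cubeI_def space_LB PiE_iff)
        then show ?thesis by (simp add: H_def)
      qed
    qed
    interpret c: finite_product_sigma_finite "\<lambda>_. lborel :: real measure" "UNIV :: 'n uprod set" by standard simp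
    interpret JJ: finite_product_sigma_finite "\<lambda>_. lborel :: real measure" "- J" by standard simp
    interpret P: pair_sigma_finite "LB (UNIV :: 'n uprod set)" "LB (- J)" ..
    \<comment> \<open>The index enters as the number of terms: L is summed over the transversal R
      and averaged over y before the integrals are exchanged.\<close>
    have main: "L * ?D \<le> ?K * (\<integral>\<^sup>+w\<in>cubeI UNIV. G w \<partial>LB UNIV)"
    proof -
      have "L * ?D = (\<Sum>\<kappa>\<in>R. L)" using R(4) by (simp add: mult.commute)
      also have "\<dots> = (\<Sum>\<kappa>\<in>R. \<integral>\<^sup>+y. L * indicator (cubeI (- J)) y \<partial>LB (- J))"
        by (simp add: nn_integral_cmult_indicator emeasure_cubeI)
      also have "\<dots> = (\<Sum>\<kappa>\<in>R. \<integral>\<^sup>+y. (\<integral>\<^sup>+w. H \<kappa> (w, y) \<partial>LB UNIV) \<partial>LB (- J))" unfolding Leq[symmetric] ..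
      also have "\<dots> = (\<Sum>\<kappa>\<in>R. \<integral>\<^sup>+w. (\<integral>\<^sup>+y. H \<kappa> (w, y) \<partial>LB (- J)) \<partial>LB UNIV)"
      proof (intro sum.cong refl)
        fix \<kappa> have "(\<lambda>(w, y). H \<kappa> (w, y)) \<in> borel_measurable (LB UNIV \<Otimes>\<^sub>M LB (- J))" using Hm[of \<kappa>] by simp
        from P.Fubini'[OF this] show "(\<integral>\<^sup>+y. (\<integral>\<^sup>+w. H \<kappa> (w, y) \<partial>LB UNIV) \<partial>LB (- J)) = (\<integral>\<^sup>+w. (\<integral>\<^sup>+y. H \<kappa> (w, y) \<partial>LB (- J)) \<partial>LB UNIV)" .
      qed
      also have "\<dots> = (\<integral>\<^sup>+w. (\<Sum>\<kappa>\<in>R. \<integral>\<^sup>+y. H \<kappa> (w, y) \<partial>LB (- J)) \<partial>LB UNIV)"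
        by (rule nn_integral_sum[symmetric]) (rule JJ.borel_measurable_nn_integral, simp add: Hm case_prod_eta)
      also have "\<dots> \<le> (\<integral>\<^sup>+w. (G w * indicator (cubeI UNIV) w) * ?K \<partial>LB UNIV)"
      proof (rule nn_integral_mono)
        fix w :: "'n uprod \<Rightarrow> real" assume w: "w \<in> space (LB UNIV)"
        have ym: "(\<lambda>y. indicator {y. P \<kappa> w y} y * indicator (cubeI (- J)) y :: ennreal) \<in> borel_measurable (LB (- J))" for \<kappa>
        proof -
          note [measurable] = Pm[of \<kappa>]
          have "(\<lambda>z. indicator {z. P \<kappa> (fst z) (snd z)} z :: ennreal) \<in> borel_measurable (LB UNIV \<Otimes>\<^sub>M LB (- J))"
            by measurable
          from measurable_compose[OF measurable_Pair1'[OF w] this]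
          have [measurable]: "(\<lambda>y. indicator {y. P \<kappa> w y} y :: ennreal) \<in> borel_measurable (LB (- J))"
            by (simp add: indicator_def)
          show ?thesis by measurable
        qed
        have "(\<integral>\<^sup>+y. H \<kappa> (w, y) \<partial>LB (- J)) = (G w * indicator (cubeI UNIV) w) * (\<integral>\<^sup>+y\<in>cubeI (- J). indicator {y. P \<kappa> w y} y \<partial>LB (- J))" for \<kappa>
        proof -
          have "H \<kappa> (w, y) = (G w * indicator (cubeI UNIV) w) * (indicator {y. P \<kappa> w y} y * indicator (cubeI (- J)) y)" for y
            by (simp add: H_def indicator_def)
          then show ?thesis using nn_integral_cmult[OF ym[of \<kappa>], of "G w * indicator (cubeI UNIV) w"] by simp
        qed
        then have "(\<Sum>\<kappa>\<in>R. \<integral>\<^sup>+y. H \<kappa> (w, y) \<partial>LB (- J)) =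
          (G w * indicator (cubeI UNIV) w) * (\<Sum>\<kappa>\<in>R. \<integral>\<^sup>+y\<in>cubeI (- J). indicator {y. P \<kappa> w y} y \<partial>LB (- J))"
          by (simp add: sum_distrib_left)
        also have "\<dots> \<le> (G w * indicator (cubeI UNIV) w) * ?K"
          unfolding P_def by (intro mult_left_mono nn_integral_good_le[OF V x sp b R(3,1,2)]) simp_all
        finally show "(\<Sum>\<kappa>\<in>R. \<integral>\<^sup>+y. H \<kappa> (w, y) \<partial>LB (- J)) \<le> (G w * indicator (cubeI UNIV) w) * ?K" .
      qed
      also have "\<dots> = ?K * (\<integral>\<^sup>+w\<in>cubeI UNIV. G w \<partial>LB UNIV)" by (subst nn_integral_multc) (simp_all add: mult.commute)
      finally show ?thesis .
    qed
    have IH: "(\<integral>\<^sup>+w\<in>cubeI UNIV. G w \<partial>LB UNIV) * ?D ^ card I \<le> ?K ^ card I * (\<integral>\<^sup>+w\<in>cubeI UNIV. F w \<partial>LB UNIV)"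
      using insert.IH[OF IJ] unfolding G_def .
    have "(\<integral>\<^sup>+w\<in>cubeI UNIV. F w * (\<Prod>i\<in>insert j I. ?g i w) \<partial>LB UNIV) = L"
      unfolding L_def G_def prod.insert[OF insert.hyps] by (simp only: mult_ac)
    moreover have "L * ?D ^ card (insert j I) = (L * ?D) * ?D ^ card I"
      using insert.hyps by (simp add: mult_ac)
    moreover have "\<dots> \<le> (?K * (\<integral>\<^sup>+w\<in>cubeI UNIV. G w \<partial>LB UNIV)) * ?D ^ card I"
      by (rule mult_right_mono[OF main]) simp
    moreover have "\<dots> = ?K * ((\<integral>\<^sup>+w\<in>cubeI UNIV. G w \<partial>LB UNIV) * ?D ^ card I)" by (simp only: mult.assoc)
    moreover have "\<dots> \<le> ?K * (?K ^ card I * (\<integral>\<^sup>+w\<in>cubeI UNIV. F w \<partial>LB UNIV))"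
      by (rule mult_left_mono[OF IH]) simp
    moreover have "\<dots> = ?K ^ card (insert j I) * (\<integral>\<^sup>+w\<in>cubeI UNIV. F w \<partial>LB UNIV)"
      using insert.hyps by (simp add: mult_ac)
    ultimately show ?case by (simp only:)
  qed
qed

section \<open>Unfolding an integral over the torus\<close>

lemma projE_restrW:
  assumes V: "\<And>i. V i \<in> supp_on J" and p: "p \<in> prs J"
  shows "projE J V (restrW J v) p = v p"
proof (rule mulW_eq_imp_eq[OF _ p])
  fix x assume x: "x \<in> supp_on J"
  have "mulW UNIV (extV J V x) (restrW J v) $ m = mulW J x v $ m" for m
  proof -
    have "mulW UNIV (extV J V x) (restrW J v) $ m = (\<Sum>l\<in>UNIV. if l \<in> J then (if m \<in> J then x $ l * v (Upair l m) else 0) else 0)"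
      unfolding mulW_nth by (auto simp: restrW_def extV_nth intro!: sum.cong)
    also have "\<dots> = (\<Sum>l\<in>J. if m \<in> J then x $ l * v (Upair l m) else 0)"
      by (simp add: sum.If_cases)
    also have "\<dots> = mulW J x v $ m" unfolding mulW_nth by simp
    finally show ?thesis .
  qed
  then have e: "mulW UNIV (extV J V x) (restrW J v) = mulW J x v" by (simp add: vec_eq_iff)
  have "PT J V y = y" if "y \<in> supp_on J" for y
    using that by (auto simp: vec_eq_iff PT_nth supp_on_def)
  then show "mulW J x (projE J V (restrW J v)) = mulW J x v"
    unfolding mulW_projE[OF x V] e using mulW_in_supp by blast
qed

lemma projE_extensional: "projE J V w \<in> extensional (prs J)"
  by (simp add: projE_def)

lemma projE_add_fun: "projE J V (\<lambda>p. w p + v p) = shf (prs J) (projE J V v) (projE J V w)"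
proof
  fix p show "projE J V (\<lambda>p. w p + v p) p = shf (prs J) (projE J V v) (projE J V w) p"
    using projE_add[of p J V w v] projE_extensional[of J V] by (cases "p \<in> prs J") (auto simp: extensional_def shf_def)
qed

lemma measurable_projE: "projE J V \<in> measurable (LB UNIV) (LB (prs J))"
proof -
  have "(\<lambda>w. sym_of (\<lambda>i j. extV J V (axis j 1) \<bullet> mulW UNIV (extV J V (axis i 1)) w) p) \<in> borel_measurable (LB UNIV)" for p
    unfolding sym_of_def inner_vec_def
    by (cases "SOME (i, j). Upair i j = p")
      (auto intro!: borel_measurable_sum borel_measurable_times measurable_mulW_nth LB_component)
  then show ?thesis unfolding projE_def by (intro measurable_restrict) simp
qed

text \<open>A periodization: \<Phi> is summed over all translates of the restricted matrix by
  \<open>W + z\<close>, with W in \<W> and z integral. The function \<Phi> may depend on W.\<close>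

definition unf :: "'n::finite set \<Rightarrow> ('n \<Rightarrow> real^'n) \<Rightarrow> ('n uprod \<Rightarrow> real) set \<Rightarrow>
    (('n uprod \<Rightarrow> real) \<Rightarrow> ('n uprod \<Rightarrow> real) \<Rightarrow> ennreal) \<Rightarrow> ('n uprod \<Rightarrow> real) \<Rightarrow> ennreal" where
  "unf J V \<W> \<Phi> w = (\<Sum>W\<in>\<W>. \<integral>\<^sup>+z. \<Phi> W (shf (prs J) (\<lambda>p. - W p - z p) (projE J V w)) \<partial>count_space (intsE (prs J)))"

lemma measurable_unf:
  assumes "\<And>W. W \<in> \<W> \<Longrightarrow> \<Phi> W \<in> borel_measurable (LB (prs J))"
  shows "unf J V \<W> \<Phi> \<in> borel_measurable (LB UNIV)"
  unfolding unf_def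
  by (intro borel_measurable_sum measurable_count_space_integral countable_intsE finite_prs finite
      measurable_compose[OF measurable_projE] measurable_compose[OF measurable_shf] assms)

lemma unf_Zsh:
  assumes V: "\<And>i. V i \<in> supp_on J" and d: "d \<in> supp_on J"
  shows "unf J V \<W> \<Phi> (\<lambda>p. w p + Zsh J V d y p) = unf J V \<W> \<Phi> w"
proof -
  have "projE J V (\<lambda>p. w p + Zsh J V d y p) p = projE J V w p" for p
    using projE_extensional[of J V w] projE_Zsh[OF V d, of p]
    unfolding projE_add_fun by (cases "p \<in> prs J") (auto simp: shf_def extensional_def)
  then have "projE J V (\<lambda>p. w p + Zsh J V d y p) = projE J V w" by blast
  then show ?thesis unfolding unf_def by simp
qed

text \<open>The restriction of an integral matrix m to the subspace need not be integral in the
  coordinates J. Subtracting it permutes the classes W modulo 1, which is why \<W> must be closed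
  under this operation; the integer parts are absorbed by a shift of z.\<close>

lemma unf_periodic:
  assumes fin: "finite \<W>" and sub: "\<W> \<subseteq> cubeS J"
    and cl: "\<And>W m. W \<in> \<W> \<Longrightarrow> m \<in> intsE UNIV \<Longrightarrow> restrW J (\<lambda>p. frac (W p - projE J V m p)) \<in> \<W>"
      "\<And>W m. W \<in> \<W> \<Longrightarrow> m \<in> intsE UNIV \<Longrightarrow> \<Phi> (restrW J (\<lambda>p. frac (W p - projE J V m p))) = \<Phi> W"
    and m: "m \<in> intsE UNIV"
  shows "unf J V \<W> \<Phi> (\<lambda>p. w p + m p) = unf J V \<W> \<Phi> w"
proof -
  define \<pi> where "\<pi> W = restrW J (\<lambda>p. frac (W p - projE J V m p))" for W
  have inj: "inj_on \<pi> \<W>"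
  proof (rule inj_onI)
    fix W W' assume W: "W \<in> \<W>" "W' \<in> \<W>" "\<pi> W = \<pi> W'"
    show "W = W'"
    proof
      fix p show "W p = W' p"
      proof (cases "p \<in> prs J")
        case True
        have "\<pi> W p = \<pi> W' p" using W(3) by simp
        then have "frac (W p - projE J V m p) = frac (W' p - projE J V m p)" using True by (simp add: \<pi>_def restrW_def)
        then have "W p - W' p = of_int (\<lfloor>W p - projE J V m p\<rfloor> - \<lfloor>W' p - projE J V m p\<rfloor>)" by (simp add: frac_def)
        then have "W p - W' p \<in> \<int>" by simp
        moreover have "\<bar>W p - W' p\<bar> < 1" 
        proof -
          have "0 \<le> W p" "W p < 1" "0 \<le> W' p" "W' p < 1" using W sub True by (auto simp: cubeS_def)
          then show ?thesis by linarith
        qed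
        ultimately show ?thesis using Ints_nonzero_abs_less1[of "W p - W' p"] by simp
      next
        case False
        then have "W p = 0" "W' p = 0" using W(1,2) sub unfolding cubeS_def by blast+
        then show ?thesis by simp
      qed
    qed
  qed
  have "\<pi> ` \<W> \<subseteq> \<W>" using cl(1)[OF _ m] unfolding \<pi>_def by blast
  then have bij: "bij_betw \<pi> \<W> \<W>" unfolding bij_betw_def using inj endo_inj_surj[OF fin] by blast
  let ?Y = "projE J V w" and ?I = "intsE (prs J)"
  have "(\<integral>\<^sup>+z. \<Phi> W (shf (prs J) (\<lambda>p. - W p - z p) (shf (prs J) (projE J V m) ?Y)) \<partial>count_space ?I) =
    (\<integral>\<^sup>+z. \<Phi> (\<pi> W) (shf (prs J) (\<lambda>p. - \<pi> W p - z p) ?Y) \<partial>count_space ?I)" if W: "W \<in> \<W>" for W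
  proof -
    define \<zeta> where "\<zeta> p = (of_int \<lfloor>W p - projE J V m p\<rfloor> :: real)" for p
    let ?s = "\<lambda>z. \<lambda>p\<in>prs J. z p + \<zeta> p"
    have b: "bij_betw ?s ?I ?I"
      by (rule bij_betwI[where g = "\<lambda>z. \<lambda>p\<in>prs J. z p - \<zeta> p"])
        (auto simp: intsE_def PiE_iff extensional_def fun_eq_iff \<zeta>_def)
    have "shf (prs J) (\<lambda>p. - W p - z p) (shf (prs J) (projE J V m) ?Y) = shf (prs J) (\<lambda>p. - \<pi> W p - ?s z p) ?Y" for z
      unfolding shf_shf by (auto simp: shf_def \<pi>_def restrW_def \<zeta>_def frac_def fun_eq_iff)
    then have "(\<integral>\<^sup>+z. \<Phi> W (shf (prs J) (\<lambda>p. - W p - z p) (shf (prs J) (projE J V m) ?Y)) \<partial>count_space ?I) =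
      (\<integral>\<^sup>+z. \<Phi> (\<pi> W) (shf (prs J) (\<lambda>p. - \<pi> W p - ?s z p) ?Y) \<partial>count_space ?I)"
      using cl(2)[OF W m] unfolding \<pi>_def by simp
    also have "\<dots> = (\<integral>\<^sup>+z. \<Phi> (\<pi> W) (shf (prs J) (\<lambda>p. - \<pi> W p - z p) ?Y) \<partial>count_space ?I)"
      by (rule nn_integral_bij_count_space[OF b, where f = "\<lambda>z. \<Phi> (\<pi> W) (shf (prs J) (\<lambda>p. - \<pi> W p - z p) ?Y)"])
    finally show ?thesis .
  qed
  then show ?thesis unfolding unf_def projE_add_fun
    using sum.reindex_bij_betw[OF bij, of "\<lambda>W. \<integral>\<^sup>+z. \<Phi> W (shf (prs J) (\<lambda>p. - W p - z p) ?Y) \<partial>count_space ?I"] by simp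
qed

text \<open>\<open>projE\<close> does not carry the unit cube to a unit cube, so the cubes cannot be
  tiled directly. Instead the integral is averaged over translations of w by
  \<open>restrW J v\<close>, which shift \<open>projE J V w\<close> by exactly v; for fixed w, the
  sum over z and the average over v form a full integral over \<open>LB (prs J)\<close>.\<close>

lemma unf_integral:
  assumes V: "\<And>i. V i \<in> supp_on J"
    and \<Phi>: "\<And>W. W \<in> \<W> \<Longrightarrow> \<Phi> W \<in> borel_measurable (LB (prs J))"
    and per: "\<And>w m. m \<in> intsE UNIV \<Longrightarrow> unf J V \<W> \<Phi> (\<lambda>p. w p + m p) = unf J V \<W> \<Phi> w"
  shows "(\<integral>\<^sup>+w\<in>cubeI UNIV. unf J V \<W> \<Phi> w \<partial>LB UNIV) = (\<Sum>W\<in>\<W>. \<integral>\<^sup>+Y. \<Phi> W Y \<partial>LB (prs J))"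
proof -
  let ?f = "unf J V \<W> \<Phi>" and ?S = "\<Sum>W\<in>\<W>. \<integral>\<^sup>+Y. \<Phi> W Y \<partial>LB (prs J)"
  let ?I = "intsE (prs J)" and ?C = "cubeI (prs J)" and ?B = "LB (prs J)"
  have fp: "finite (prs J)" by simp
  note [measurable] = measurable_unf[of \<W> \<Phi> J V, OF \<Phi>] cubeI_sets[OF fp] cubeI_sets[OF finite[of "UNIV :: 'a uprod set"]]
  define L where "L = (\<integral>\<^sup>+w\<in>cubeI UNIV. ?f w \<partial>LB UNIV)"
  define H where "H z = ?f (\<lambda>p. fst z p + restrW J (snd z) p) * (indicator (cubeI UNIV) (fst z) * indicator ?C (snd z))" for z
  have "(\<lambda>z. (\<lambda>p\<in>UNIV. fst z p + restrW J (snd z) p)) \<in> measurable (LB UNIV \<Otimes>\<^sub>M ?B) (LB UNIV)"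
  proof (rule measurable_restrict)
    fix p :: "'a uprod"
    have f: "(\<lambda>z. fst z p) \<in> borel_measurable (LB UNIV \<Otimes>\<^sub>M ?B)"
      by (intro measurable_compose[OF measurable_fst LB_component]) simp
    have g: "(\<lambda>z. restrW J (snd z) p) \<in> borel_measurable (LB UNIV \<Otimes>\<^sub>M ?B)"
      unfolding restrW_def
      by (cases "p \<in> prs J") (simp_all add: measurable_compose[OF measurable_snd LB_component])
    show "(\<lambda>z. fst z p + restrW J (snd z) p) \<in> measurable (LB UNIV \<Otimes>\<^sub>M ?B) lborel"
      using borel_measurable_add[OF f g] by (simp only: measurable_lborel1 measurable_lborel2)
  qed
  then have [measurable]: "(\<lambda>z. (\<lambda>p. fst z p + restrW J (snd z) p)) \<in> measurable (LB UNIV \<Otimes>\<^sub>M ?B) (LB UNIV)"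
    by (simp add: restrict_UNIV)
  have indC: "indicator ?C \<in> borel_measurable ?B" by measurable
  have Hm: "H \<in> borel_measurable (LB UNIV \<Otimes>\<^sub>M ?B)" unfolding H_def by measurable
  interpret c: finite_product_sigma_finite "\<lambda>_. lborel :: real measure" "UNIV :: 'a uprod set" by standard simp
  interpret JJ: finite_product_sigma_finite "\<lambda>_. lborel :: real measure" "prs J" by standard simp
  interpret P: pair_sigma_finite "LB (UNIV :: 'a uprod set)" "?B" ..
  have Leq: "L * indicator ?C v = (\<integral>\<^sup>+w. H (w, v) \<partial>LB UNIV)" if v: "v \<in> space ?B" for v
  proof -
    have "L = (\<integral>\<^sup>+w\<in>cubeI UNIV. ?f (shf UNIV (restrW J v) w) \<partial>LB UNIV)"
      unfolding L_def by (rule nn_integral_cube_shf[symmetric]) (simp_all add: shf_UNIV per)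
    also have "\<dots> * indicator ?C v = (\<integral>\<^sup>+w. ?f (shf UNIV (restrW J v) w) * indicator (cubeI UNIV) w * indicator ?C v \<partial>LB UNIV)"
      by (rule nn_integral_multc[symmetric]) measurable
    finally show ?thesis by (simp add: H_def shf_UNIV mult.assoc)
  qed
  have inner: "(\<integral>\<^sup>+v. H (w, v) \<partial>?B) = ?S * indicator (cubeI UNIV) w" for w
  proof -
    let ?Y = "projE J V w"
    define \<Psi> where "\<Psi> W v = \<Phi> W (shf (prs J) (\<lambda>p. ?Y p - W p) v)" for W v
    have \<Psi>m [measurable]: "\<Psi> W \<in> borel_measurable ?B" if "W \<in> \<W>" for W
      unfolding \<Psi>_def by (rule measurable_compose[OF measurable_shf \<Phi>[OF that]])
    have fe: "?f (\<lambda>p. w p + restrW J v p) = (\<Sum>W\<in>\<W>. \<integral>\<^sup>+z. \<Psi> W (shf (prs J) (\<lambda>i. - z i) v) \<partial>count_space ?I)" for v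
    proof -
      have "projE J V (\<lambda>p. w p + restrW J v p) = shf (prs J) v ?Y"
        unfolding projE_add_fun by (auto simp: shf_def fun_eq_iff projE_restrW[OF V])
      then have "shf (prs J) (\<lambda>p. - W p - z p) (projE J V (\<lambda>p. w p + restrW J v p)) =
          shf (prs J) (\<lambda>p. ?Y p - W p) (shf (prs J) (\<lambda>i. - z i) v)" for W z
        by (auto simp: shf_def fun_eq_iff)
      then show ?thesis unfolding unf_def \<Psi>_def by simp
    qed
    have zm: "(\<lambda>v. \<Psi> W (shf (prs J) (\<lambda>i. - z i) v)) \<in> borel_measurable ?B" if "W \<in> \<W>" for W z
      by (rule measurable_compose[OF measurable_shf \<Psi>m[OF that]])
    have zi: "(\<lambda>v. \<integral>\<^sup>+z. \<Psi> W (shf (prs J) (\<lambda>i. - z i) v) \<partial>count_space ?I) \<in> borel_measurable ?B" if "W \<in> \<W>" for W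
      by (rule measurable_count_space_integral[OF countable_intsE[OF fp] zm[OF that]])
    have one: "(\<integral>\<^sup>+v. (\<integral>\<^sup>+z. \<Psi> W (shf (prs J) (\<lambda>i. - z i) v) \<partial>count_space ?I) * indicator ?C v \<partial>?B) = (\<integral>\<^sup>+Y. \<Phi> W Y \<partial>?B)" if W: "W \<in> \<W>" for W
    proof -
      have "(\<integral>\<^sup>+v. (\<integral>\<^sup>+z. \<Psi> W (shf (prs J) (\<lambda>i. - z i) v) \<partial>count_space ?I) * indicator ?C v \<partial>?B) =
        (\<integral>\<^sup>+v. (\<integral>\<^sup>+z. \<Psi> W (shf (prs J) (\<lambda>i. - z i) v) * indicator ?C v \<partial>count_space ?I) \<partial>?B)"
        by (simp add: nn_integral_multc)
      also have "\<dots> = (\<integral>\<^sup>+z. (\<integral>\<^sup>+v. \<Psi> W (shf (prs J) (\<lambda>i. - z i) v) * indicator ?C v \<partial>?B) \<partial>count_space ?I)"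
        by (intro nn_integral_count_space_nn_integral[OF countable_intsE[OF fp]] borel_measurable_times_ennreal zm[OF W] indC)
      also have "\<dots> = (\<integral>\<^sup>+v. \<Psi> W v \<partial>?B)" by (rule nn_integral_tile[OF fp \<Psi>m[OF W], symmetric])
      also have "\<dots> = (\<integral>\<^sup>+Y. \<Phi> W Y \<partial>?B)" unfolding \<Psi>_def by (rule nn_integral_shf[OF fp \<Phi>[OF W]])
      finally show ?thesis .
    qed
    have "(\<integral>\<^sup>+v. H (w, v) \<partial>?B) =
      (\<integral>\<^sup>+v. (\<Sum>W\<in>\<W>. (\<integral>\<^sup>+z. \<Psi> W (shf (prs J) (\<lambda>i. - z i) v) \<partial>count_space ?I) * indicator ?C v) * indicator (cubeI UNIV) w \<partial>?B)"
      unfolding H_def fst_conv snd_conv fe sum_distrib_right[symmetric] by (simp only: mult_ac)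
    also have "\<dots> = (\<integral>\<^sup>+v. (\<Sum>W\<in>\<W>. (\<integral>\<^sup>+z. \<Psi> W (shf (prs J) (\<lambda>i. - z i) v) \<partial>count_space ?I) * indicator ?C v) \<partial>?B) * indicator (cubeI UNIV) w"
      using zi by (intro nn_integral_multc borel_measurable_sum borel_measurable_times_ennreal indC) auto
    also have "(\<integral>\<^sup>+v. (\<Sum>W\<in>\<W>. (\<integral>\<^sup>+z. \<Psi> W (shf (prs J) (\<lambda>i. - z i) v) \<partial>count_space ?I) * indicator ?C v) \<partial>?B) =
      (\<Sum>W\<in>\<W>. \<integral>\<^sup>+v. (\<integral>\<^sup>+z. \<Psi> W (shf (prs J) (\<lambda>i. - z i) v) \<partial>count_space ?I) * indicator ?C v \<partial>?B)"
      using zi by (intro nn_integral_sum borel_measurable_times_ennreal indC) auto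
    also have "\<dots> = ?S" by (intro sum.cong refl one)
    finally show ?thesis .
  qed
  have "L = (\<integral>\<^sup>+v. L * indicator ?C v \<partial>?B)" by (simp add: nn_integral_cmult_indicator emeasure_cubeI)
  also have "\<dots> = (\<integral>\<^sup>+v. (\<integral>\<^sup>+w. H (w, v) \<partial>LB UNIV) \<partial>?B)" by (intro nn_integral_cong Leq)
  also have "\<dots> = (\<integral>\<^sup>+w. (\<integral>\<^sup>+v. H (w, v) \<partial>?B) \<partial>LB UNIV)" by (rule P.Fubini') (simp add: Hm case_prod_eta)
  also have "\<dots> = ?S" unfolding inner by (simp add: nn_integral_cmult_indicator emeasure_cubeI)
  finally show ?thesis unfolding L_def .
qed

section \<open>Matrices with many short vectors\<close>

definition SX :: "('n::finite uprod \<Rightarrow> real) \<Rightarrow> real \<Rightarrow> real \<Rightarrow> (real^'n) set" where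
  "SX w a b = {h\<in>ZJ UNIV. (\<forall>i. \<bar>h $ i\<bar> \<le> a) \<and> good b (mulW UNIV h w)}"

definition GL :: "'n::finite set \<Rightarrow> ('n \<Rightarrow> real^'n) \<Rightarrow> ('n uprod \<Rightarrow> real) \<Rightarrow> (real^'n) set" where
  "GL J V W = HW J (GV J (- J) V) (PT J V ` ZJ UNIV) W"

definition nH :: "'n::finite set \<Rightarrow> ('n \<Rightarrow> real^'n) \<Rightarrow> ('n uprod \<Rightarrow> real) \<Rightarrow> nat" where
  "nH J V W = idx (ZJ J) (GL J V W)"

definition nV :: "'n::finite set \<Rightarrow> ('n \<Rightarrow> real^'n) \<Rightarrow> nat" where
  "nV J V = idx (ZJ J) (GV J (- J) V)"

definition WV :: "'n::finite set \<Rightarrow> ('n \<Rightarrow> real^'n) \<Rightarrow> nat \<Rightarrow> ('n uprod \<Rightarrow> real) set" where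
  "WV J V N = WCset J (GV J (- J) V) (PT J V ` ZJ UNIV) N"

definition VVs :: "'n::finite set \<Rightarrow> real \<Rightarrow> nat \<Rightarrow> ('n \<Rightarrow> real^'n) set" where
  "VVs J C N = {V. coordV J C V \<and> finite (cosets (ZJ J) (GV J (- J) V)) \<and> nV J V \<le> N}"

definition Tup :: "'n::finite set \<Rightarrow> ('n \<Rightarrow> real^'n) \<Rightarrow> real \<Rightarrow> ('n \<Rightarrow> real^'n) set" where
  "Tup J V a = {x\<in>(\<Pi>\<^sub>E i\<in>J. {y\<in>GV J (- J) V. \<forall>l. \<bar>y $ l\<bar> \<le> a}).
     indepF J x \<and> (\<forall>v\<in>supp_on J. \<exists>c. v = (\<Sum>i\<in>J. c i *\<^sub>R x i))}"

text \<open>The enlargement by \<open>real (card J) + 1\<close> is the loss in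
  \<open>lattice_points_bound\<close>.\<close>

definition gK :: "'n set \<Rightarrow> real \<Rightarrow> real \<Rightarrow> ('n uprod \<Rightarrow> real) \<Rightarrow> ennreal" where
  "gK J a b Y = gY J ((real (card J) + 1) * a) ((real (card J) + 1) * b) Y"

text \<open>Indicator that all \<open>x i\<close> are lattice points for W in the body of Y. The
  second clause records that the body has room for T points modulo the lattice; it cuts the later
  sums off at indices \<open>g / T\<close>.\<close>

definition Phi :: "'n::finite set \<Rightarrow> ('n \<Rightarrow> real^'n) \<Rightarrow> real \<Rightarrow> real \<Rightarrow> real \<Rightarrow> ('n \<Rightarrow> real^'n) \<Rightarrow>
    ('n uprod \<Rightarrow> real) \<Rightarrow> ('n uprod \<Rightarrow> real) \<Rightarrow> ennreal" where
  "Phi J V a b T x W Y = indicator {Y. (\<forall>i\<in>J. x i \<in> GL J V W \<inter> KV J a b Y) \<and>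
     ennreal T * of_nat (nH J V W) \<le> gK J a b Y} Y"

lemma finite_SX: "finite (SX w a b)"
  by (rule finite_subset[OF _ finite_int_box[of UNIV a]]) (auto simp: SX_def)

lemma coordV_supp: "coordV J C V \<Longrightarrow> V i \<in> supp_on J"
  by (auto simp: coordV_def)

lemma PT_ZJ:
  assumes "k \<in> ZJ J"
  shows "PT J V k = k"
proof -
  have "(\<Sum>i\<in>- J. k $ i * V i $ j) = 0" for j
    by (rule sum.neutral) (use assms in \<open>simp add: ZJ_def\<close>)
  then show ?thesis using assms by (simp add: vec_eq_iff PT_nth ZJ_def)
qed

lemma paired_GV:
  assumes V: "\<And>i. V i \<in> supp_on J"
  shows "paired J (GV J (- J) V) (PT J V ` ZJ UNIV)"
proof -
  have "subgrp (PT J V ` ZJ UNIV)"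
  proof -
    have "PT J V 0 = 0" by (rule linear_0[OF linear_PT])
    then have "0 \<in> PT J V ` ZJ UNIV" using subgrp_zero[OF subgrp_ZJ] by (metis imageI)
    moreover have "PT J V x - PT J V y \<in> PT J V ` ZJ UNIV" if "x \<in> ZJ UNIV" "y \<in> ZJ UNIV" for x y
      using subgrp_diff[OF subgrp_ZJ that] by (simp add: linear_diff[OF linear_PT, symmetric])
    ultimately show ?thesis unfolding subgrp_def by blast
  qed
  moreover have "ZJ J \<subseteq> PT J V ` ZJ UNIV"
  proof
    fix k assume k: "k \<in> ZJ J"
    then have "k \<in> ZJ UNIV" using ZJ_mono[of J UNIV] by blast
    then show "k \<in> PT J V ` ZJ UNIV" using PT_ZJ[OF k, of V] by (metis imageI)
  qed
  moreover have "l \<bullet> x \<in> \<int>" if l: "l \<in> PT J V ` ZJ UNIV" and x: "x \<in> GV J (- J) V" for l x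
  proof -
    obtain k where k: "k \<in> ZJ UNIV" "l = PT J V k" using l by blast
    have "x \<in> supp_on J" using x GV_subset ZJ_supp by blast
    then have "l \<bullet> x = extV J V x \<bullet> k" unfolding k(2) using inner_PT[of x J V k] V by (simp add: inner_commute)
    also have "\<dots> \<in> \<int>" using extV_GV_ZJ[OF x] k(1) by (auto simp: inner_vec_def ZJ_def intro!: Ints_sum Ints_mult)
    finally show ?thesis .
  qed
  moreover have "PT J V ` ZJ UNIV \<subseteq> supp_on J" by (rule image_subsetI) (rule PT_supp)
  ultimately show ?thesis unfolding paired_def
    by (intro conjI ballI subgrp_GV GV_subset) assumption+
qed

lemma abs_inner_le:
  fixes x y :: "real^'n::finite"
  assumes "\<And>i. \<bar>x $ i\<bar> \<le> a" "\<And>i. \<bar>y $ i\<bar> \<le> b"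
  shows "\<bar>x \<bullet> y\<bar> \<le> real CARD('n) * (a * b)"
proof -
  have "\<bar>x \<bullet> y\<bar> \<le> (\<Sum>i\<in>UNIV. \<bar>x $ i\<bar> * \<bar>y $ i\<bar>)"
    unfolding inner_vec_def abs_mult[symmetric] by (simp add: sum_abs)
  also have "\<dots> \<le> (\<Sum>i\<in>(UNIV :: 'n set). a * b)"
    using assms by (intro sum_mono mult_mono) (auto intro: order_trans[OF abs_ge_zero])
  finally show ?thesis by simp
qed

text \<open>Converts many short vectors into a nonzero term of a periodized sum, for each of many
  tuples at once. J and V encode the span of the short vectors, W and z are the fractional and
  integer parts of the matrix from \<open>symmetric_matrix_exists\<close>, and the tuples come from
  \<open>card_indep_tuples\<close>.\<close>

lemma many_points_witness:
  fixes w :: "'n::finite uprod \<Rightarrow> real"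
  assumes C: "C \<ge> 0" "\<And>E :: (real^'n) set. subspace E \<Longrightarrow> \<exists>J V. coordV J C V \<and> E = extV J V ` supp_on J \<and> card J = dim E"
    and ab: "a > 0" "b > 0" "8 * (real CARD('n) * (a * b)) < 1" and T: "T \<ge> 2" "T \<le> real (card (SX w a b))"
  defines "b' \<equiv> (1 + real CARD('n) * C) * (2 * b)"
  shows "\<exists>J V. J \<noteq> {} \<and> coordV J C V \<and> (\<exists>TT W z. TT \<subseteq> Tup J V (2 * a) \<and> (T / 2) ^ card J \<le> real (card TT) \<and>
     TT \<noteq> {} \<and> W \<in> cubeS J \<and> finite (cosets (ZJ J) (GL J V W)) \<and> z \<in> intsE (prs J) \<and>
     (\<forall>x\<in>TT. (\<forall>i\<in>J. good (2 * b) (mulW UNIV (extV J V (x i)) w)) \<and>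
       Phi J V (2 * a) b' T x W (shf (prs J) (\<lambda>p. - W p - z p) (projE J V w)) = 1))"
proof -
  let ?S = "SX w a b" and ?S' = "SX w (2 * a) (2 * b)"
  have dimS: "dim (span ?S) = dim ?S" by simp
  obtain J V where JV: "coordV J C V" "span ?S = extV J V ` supp_on J" "card J = dim (span ?S)"
    using C(2)[OF subspace_span[of ?S]] by blast
  have V: "V i \<in> supp_on J" for i by (rule coordV_supp[OF JV(1)])
  have Jne: "J \<noteq> {}"
  proof
    assume "J = {}"
    then have "supp_on J = {0}" by (auto simp: supp_on_def vec_eq_iff)
    then have "span ?S = {0}" unfolding JV(2) by (simp add: linear_0[OF linear_extV])
    then have "?S \<subseteq> {0}" using span_superset by blast
    then have "card ?S \<le> 1" by (metis card.empty card_insert_disjoint card_mono empty_iff finite.emptyI finite.insertI One_nat_def)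
    then show False using T by simp
  qed
  \<comment> \<open>The radii are doubled because \<open>card_indep_tuples\<close> needs sums of two
    short vectors; the intersection with the span keeps all tuples in the same subspace.\<close>
  define S2 where "S2 = ?S' \<inter> span ?S"
  have fS2: "finite S2" unfolding S2_def using finite_SX by blast
  have sub: "?S \<subseteq> S2"
  proof
    fix h assume h: "h \<in> ?S"
    then obtain k where "h \<in> ZJ UNIV" "\<And>i. \<bar>h $ i\<bar> \<le> a" "k \<in> ZJ UNIV" "\<And>i. \<bar>mulW UNIV h w $ i + k $ i\<bar> \<le> b"
      unfolding SX_def good_def by blast
    moreover have "\<bar>u\<bar> \<le> c \<Longrightarrow> \<bar>u\<bar> \<le> 2 * c" for u c :: real by linarith
    ultimately have "h \<in> ?S'" unfolding SX_def good_def by blast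
    then show "h \<in> S2" unfolding S2_def using h span_superset by blast
  qed
  have add: "h + g \<in> S2" if hg: "h \<in> ?S" "g \<in> ?S" for h g
  proof -
    obtain k where k: "h \<in> ZJ UNIV" "\<And>i. \<bar>h $ i\<bar> \<le> a" "k \<in> ZJ UNIV" "\<And>i. \<bar>mulW UNIV h w $ i + k $ i\<bar> \<le> b"
      using hg(1) unfolding SX_def good_def by blast
    obtain l where l: "g \<in> ZJ UNIV" "\<And>i. \<bar>g $ i\<bar> \<le> a" "l \<in> ZJ UNIV" "\<And>i. \<bar>mulW UNIV g w $ i + l $ i\<bar> \<le> b"
      using hg(2) unfolding SX_def good_def by blast
    have "h + g \<in> ZJ UNIV" "k + l \<in> ZJ UNIV" using subgrp_add[OF subgrp_ZJ] k l by blast+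
    moreover have "\<bar>(h + g) $ i\<bar> \<le> 2 * a" for i using k(2)[of i] l(2)[of i] unfolding vector_add_component by linarith
    moreover have "\<bar>mulW UNIV (h + g) w $ i + (k + l) $ i\<bar> \<le> 2 * b" for i
      using k(4)[of i] l(4)[of i] unfolding mulW_add vector_add_component by linarith
    ultimately have "h + g \<in> ?S'" unfolding SX_def good_def by blast
    then show ?thesis unfolding S2_def using hg by (simp add: span_add span_base)
  qed
  have "\<forall>h\<in>?S'. \<exists>k. k \<in> ZJ UNIV \<and> (\<forall>i. \<bar>mulW UNIV h w $ i + k $ i\<bar> \<le> 2 * b)"
    unfolding SX_def good_def by blast
  then obtain kk where kk: "\<forall>h\<in>?S'. kk h \<in> ZJ UNIV \<and> (\<forall>i. \<bar>mulW UNIV h w $ i + kk h $ i\<bar> \<le> 2 * b)"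
    by (rule bchoice[THEN exE])
  have hZ: "h \<in> ZJ UNIV" "\<And>i. \<bar>h $ i\<bar> \<le> 2 * a" "kk h \<in> ZJ UNIV" "\<And>i. \<bar>mulW UNIV h w $ i + kk h $ i\<bar> \<le> 2 * b"
    if "h \<in> S2" for h using that kk unfolding S2_def SX_def by blast+
  \<comment> \<open>The two pairings with the matrix cancel, so the difference is an integer of size
    at most \<open>2 * (n * (2 * a) * (2 * b))\<close>. This is the origin of the hypothesis
    \<open>8 * (n * (a * b)) < 1\<close>.\<close>
  have iso: "h \<bullet> kk g = g \<bullet> kk h" if hg: "h \<in> S2" "g \<in> S2" for h g
  proof -
    have U: "y \<in> supp_on UNIV" for y :: "real^'n" by (simp add: supp_on_def)
    have sw: "h \<bullet> mulW UNIV g w = g \<bullet> mulW UNIV h w" using inner_mulW_swap[OF U U, of h w g] by (simp add: inner_commute)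
    have e: "h \<bullet> kk g - g \<bullet> kk h = h \<bullet> (mulW UNIV g w + kk g) - g \<bullet> (mulW UNIV h w + kk h)"
      unfolding inner_add_right sw by simp
    have "\<bar>h \<bullet> (mulW UNIV g w + kk g)\<bar> \<le> real CARD('n) * (2 * a * (2 * b))"
      by (rule abs_inner_le[OF hZ(2)[OF hg(1)]]) (simp add: hZ(4)[OF hg(2)])
    moreover have "\<bar>g \<bullet> (mulW UNIV h w + kk h)\<bar> \<le> real CARD('n) * (2 * a * (2 * b))"
      by (rule abs_inner_le[OF hZ(2)[OF hg(2)]]) (simp add: hZ(4)[OF hg(1)])
    ultimately have "\<bar>h \<bullet> kk g - g \<bullet> kk h\<bar> \<le> 8 * (real CARD('n) * (a * b))" unfolding e by (simp add: mult_ac)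
    then have "\<bar>h \<bullet> kk g - g \<bullet> kk h\<bar> < 1" using ab(3) by linarith
    moreover have "h \<bullet> kk g - g \<bullet> kk h \<in> \<int>"
      using hZ(1,3)[OF hg(1)] hZ(1,3)[OF hg(2)] by (auto simp: inner_vec_def ZJ_def intro!: Ints_sum Ints_mult Ints_diff)
    ultimately have "h \<bullet> kk g - g \<bullet> kk h = 0" by (metis Ints_nonzero_abs_less1)
    then show ?thesis by simp
  qed
  have S2E: "S2 \<subseteq> extV J V ` supp_on J" unfolding S2_def JV(2) by blast
  define TT where "TT = {t\<in>(\<Pi>\<^sub>E i\<in>J. S2). indepF J t}"
  have cT: "card ?S ^ card J \<le> 2 ^ card J * card TT"
    unfolding TT_def by (rule card_indep_tuples[OF fS2 sub add finite]) (simp_all add: JV(3) dimS)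
  then have "real (card ?S) ^ card J \<le> 2 ^ card J * real (card TT)" by (simp only: of_nat_le_iff[where 'a = real, symmetric] of_nat_mult of_nat_power of_nat_numeral)
  moreover have "T ^ card J \<le> real (card ?S) ^ card J" using T by (intro power_mono) auto
  ultimately have cT': "(T / 2) ^ card J \<le> real (card TT)" by (simp add: power_divide divide_le_eq mult.commute)
  moreover have "(T / 2) ^ card J > 0" using T by simp
  ultimately have "card TT > 0" by linarith
  then obtain t0 where t0: "t0 \<in> TT" by (auto simp: card_gt_0_iff)
  have TTD: "t i \<in> S2" "indepF J t" if "t \<in> TT" "i \<in> J" for t i using that by (auto simp: TT_def)
  have TTi: "indepF J t" if "t \<in> TT" for t using that by (simp add: TT_def)
  \<comment> \<open>Built from one tuple \<open>t0\<close>, but its defining identity holds on all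
    of \<open>S2\<close>, so the same matrix serves every tuple.\<close>
  obtain Wt where Wt: "\<And>h. h \<in> S2 \<Longrightarrow> mulW J (proj_on J h) Wt = - PT J V (kk h)" "\<And>p. p \<notin> prs J \<Longrightarrow> Wt p = 0"
    by (rule symmetric_matrix_exists[OF V S2E iso TTD(1)[OF t0] TTi[OF t0]]) blast+
  have ind: "indepF J (\<lambda>i. proj_on J (t i))" and spn: "\<And>v. v \<in> supp_on J \<Longrightarrow> \<exists>c. v = (\<Sum>i\<in>J. c i *\<^sub>R proj_on J (t i))"
    if "t \<in> TT" for t
    using symmetric_matrix_exists[OF V S2E iso TTD(1)[OF that] TTi[OF that]] by blast+
  \<comment> \<open>The class of \<open>Wt\<close> modulo 1 in the unit cube, as \<open>WV\<close>
    and \<open>unf\<close> expect; the integer part becomes z.\<close>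
  define W0 where "W0 = restrW J (\<lambda>p. frac (Wt p))"
  define z where "z = (\<lambda>p\<in>prs J. of_int \<lfloor>Wt p\<rfloor> :: real)"
  have W0c: "W0 \<in> cubeS J" by (auto simp: W0_def restrW_def cubeS_def frac_lt_1)
  have zI: "z \<in> intsE (prs J)" by (auto simp: z_def intsE_def)
  have W0z: "Wt p = W0 p + z p" if "p \<in> prs J" for p
    using that by (simp add: W0_def z_def restrW_def frac_def)
  define Y where "Y = shf (prs J) (\<lambda>p. - W0 p - z p) (projE J V w)"
  let ?H = "GL J V W0" and ?K = "KV J (2 * a) b' Y"
  have pr: "paired J (GV J (- J) V) (PT J V ` ZJ UNIV)" by (rule paired_GV[OF V])
  have H: "subgrp ?H" "?H \<subseteq> ZJ J" unfolding GL_def using subgrp_HW[OF pr] HW_subset GV_subset by blast+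
  have ext: "extV J V (proj_on J h) = h" "proj_on J h \<in> supp_on J" if "h \<in> S2" for h
    using S2E that by (auto simp: supp_on_def)
  have b'0: "b' \<ge> 0" unfolding b'_def using C(1) ab by simp
  have gvm: "proj_on J h \<in> GV J (- J) V" if h: "h \<in> S2" for h
  proof -
    have "proj_on J h \<bullet> V i \<in> \<int>" if "i \<in> - J" for i
    proof -
      have "extV J V (proj_on J h) $ i = proj_on J h \<bullet> V i" using that by (simp add: extV_nth)
      then have "proj_on J h \<bullet> V i = h $ i" unfolding ext(1)[OF h] ..
      then show ?thesis using hZ(1)[OF h] unfolding ZJ_def by simp
    qed
    moreover have "proj_on J h \<in> ZJ J" using hZ(1)[OF h] by (auto simp: ZJ_def)
    ultimately show ?thesis by (simp add: GV_def)
  qed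
  have mem: "proj_on J h \<in> ?H \<inter> ?K" if h: "h \<in> S2" for h
  proof -
    let ?x = "proj_on J h"
    have sm: "mulW J ?x Wt = mulW J ?x W0 + mulW J ?x z"
    proof -
      have "?x $ l * Wt (Upair l i) = ?x $ l * W0 (Upair l i) + ?x $ l * z (Upair l i)" if "l \<in> J" "i \<in> J" for l i
        using W0z[of "Upair l i"] that by (simp add: distrib_left)
      then show ?thesis by (simp add: vec_eq_iff mulW_nth sum.distrib)
    qed
    have zZ: "mulW J ?x z \<in> ZJ J"
      using hZ(1)[OF h] by (auto simp: ZJ_def mulW_nth z_def intro!: Ints_sum Ints_mult)
    have "mulW J ?x W0 = PT J V (- kk h - mulW J ?x z)"
      using sm unfolding Wt(1)[OF h] linear_diff[OF linear_PT] linear_neg[OF linear_PT] PT_ZJ[OF zZ] by (simp add: algebra_simps)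
    moreover have "- kk h - mulW J ?x z \<in> ZJ UNIV"
      using zZ ZJ_mono[of J UNIV] hZ(3)[OF h] by (intro subgrp_diff[OF subgrp_ZJ] subgrp_minus[OF subgrp_ZJ]) auto
    ultimately have "mulW J ?x W0 \<in> PT J V ` ZJ UNIV" by blast
    then have xH: "?x \<in> ?H" unfolding GL_def HW_def using gvm[OF h] by blast
    define e where "e = mulW UNIV h w + kk h"
    have eb: "\<bar>e $ i\<bar> \<le> 2 * b" for i unfolding e_def using hZ(4)[OF h] by simp
    have "mulW J ?x Y = PT J V e"
    proof -
      have "mulW J ?x Y = mulW J ?x (projE J V w) - mulW J ?x Wt"
      proof -
        have "?x $ l * Y (Upair l i) = ?x $ l * projE J V w (Upair l i) - ?x $ l * Wt (Upair l i)" if "l \<in> J" "i \<in> J" for l i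
          using W0z[of "Upair l i"] that by (simp add: Y_def algebra_simps)
        then show ?thesis by (simp add: vec_eq_iff mulW_nth sum_subtractf)
      qed
      also have "\<dots> = PT J V (mulW UNIV h w) + PT J V (kk h)"
        unfolding mulW_projE[OF ext(2)[OF h] V] ext(1)[OF h] Wt(1)[OF h] by simp
      finally show ?thesis unfolding e_def linear_add[OF linear_PT] .
    qed
    \<comment> \<open>The factor \<open>1 + n * C\<close> in \<open>b'\<close> bounds
      \<open>PT J V\<close> in the sup norm when the entries of V are at most C.\<close>
    moreover have "\<bar>PT J V e $ j\<bar> \<le> b'" for j
    proof (cases "j \<in> J")
      case True
      have "\<bar>\<Sum>i\<in>- J. e $ i * V i $ j\<bar> \<le> (\<Sum>i\<in>- J. 2 * b * C)"
        using eb JV(1) ab(2) unfolding coordV_def by (intro order_trans[OF sum_abs] sum_mono) (auto simp: abs_mult intro!: mult_mono)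
      also have "\<dots> \<le> real CARD('n) * (2 * b * C)" using C(1) ab by (simp add: card_mono mult_right_mono)
      finally have "\<bar>e $ j + (\<Sum>i\<in>- J. e $ i * V i $ j)\<bar> \<le> 2 * b + real CARD('n) * (2 * b * C)" using eb[of j] by linarith
      then show ?thesis using True by (simp add: PT_nth b'_def algebra_simps)
    qed (use b'0 in \<open>simp add: PT_nth\<close>)
    ultimately have "?x \<in> ?K" unfolding KV_def using ext(2)[OF h] hZ(2)[OF h] by auto
    then show ?thesis using xH by blast
  qed
  have a2: "0 \<le> 2 * a" using ab by simp
  note lpb = lattice_points_bound[OF H a2 b'0, of "\<lambda>i. proj_on J (t0 i)" Y, OF mem[OF TTD(1)[OF t0]] spn[OF t0]]
  have fin: "finite (cosets (ZJ J) ?H)" by (rule lpb(1))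
  have fHK: "finite (?H \<inter> ?K)" by (rule lpb(2))
  have gb: "of_nat (card (?H \<inter> ?K) * nH J V W0) \<le> gK J (2 * a) b' Y"
    unfolding nH_def gK_def by (rule lpb(3))
  \<comment> \<open>On the subspace the coordinates J determine a vector, so all T short vectors
    give different lattice points in the body, and the volume bound yields the second clause of
    \<open>Phi\<close>.\<close>
  have "card ?S \<le> card (?H \<inter> ?K)"
  proof (rule card_inj_on_le[OF _ _ fHK])
    show "inj_on (proj_on J) ?S" using ext(1) sub by (intro inj_on_inverseI[of _ "extV J V"]) blast
    show "proj_on J ` ?S \<subseteq> ?H \<inter> ?K" using mem sub by blast
  qed
  then have "T * real (nH J V W0) \<le> real (card (?H \<inter> ?K) * nH J V W0)"
    using T(2) by (simp add: mult_right_mono)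
  then have "ennreal (T * real (nH J V W0)) \<le> of_nat (card (?H \<inter> ?K) * nH J V W0)"
    unfolding ennreal_of_nat_eq_real_of_nat by (rule ennreal_leI)
  then have TnH: "ennreal T * of_nat (nH J V W0) \<le> gK J (2 * a) b' Y"
    using gb T(1) by (simp add: ennreal_mult ennreal_of_nat_eq_real_of_nat)
  define PP where "PP t = (\<lambda>i\<in>J. proj_on J (t i))" for t
  have "inj_on PP TT"
  proof (rule inj_onI)
    fix t u assume tu: "t \<in> TT" "u \<in> TT" "PP t = PP u"
    show "t = u"
    proof (rule PiE_ext[of t J "\<lambda>_. S2" u])
      show "t \<in> (\<Pi>\<^sub>E i\<in>J. S2)" "u \<in> (\<Pi>\<^sub>E i\<in>J. S2)" using tu by (auto simp: TT_def)
      fix i assume i: "i \<in> J"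
      have "proj_on J (t i) = proj_on J (u i)" using fun_cong[OF tu(3), of i] i by (simp add: PP_def)
      then have "extV J V (proj_on J (t i)) = extV J V (proj_on J (u i))" by (rule arg_cong)
      then show "t i = u i" unfolding ext(1)[OF TTD(1)[OF tu(1) i]] ext(1)[OF TTD(1)[OF tu(2) i]] .
    qed
  qed
  then have cP: "(T / 2) ^ card J \<le> real (card (PP ` TT))" using cT' by (simp add: card_image)
  have sP: "PP ` TT \<subseteq> Tup J V (2 * a)"
  proof (rule image_subsetI)
    fix t assume t: "t \<in> TT"
    have "PP t \<in> (\<Pi>\<^sub>E i\<in>J. {y\<in>GV J (- J) V. \<forall>l. \<bar>y $ l\<bar> \<le> 2 * a})"
      using gvm[OF TTD(1)[OF t]] hZ(2)[OF TTD(1)[OF t]] a2 unfolding PP_def by (intro restrict_PiE_iff[THEN iffD2]) auto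
    moreover have "indepF J (PP t)" using ind[OF t] unfolding indepF_def PP_def by (simp add: inj_on_def)
    moreover have "\<exists>c. v = (\<Sum>i\<in>J. c i *\<^sub>R PP t i)" if "v \<in> supp_on J" for v
      using spn[OF t that] unfolding PP_def by simp
    ultimately show "PP t \<in> Tup J V (2 * a)" unfolding Tup_def by blast
  qed
  have gP: "(\<forall>i\<in>J. good (2 * b) (mulW UNIV (extV J V (PP t i)) w)) \<and> Phi J V (2 * a) b' T (PP t) W0 Y = 1" if t: "t \<in> TT" for t
  proof
    show "\<forall>i\<in>J. good (2 * b) (mulW UNIV (extV J V (PP t i)) w)"
    proof
      fix i assume i: "i \<in> J"
      have "t i \<in> ?S'" using TTD(1)[OF t i] unfolding S2_def by blast
      then have "good (2 * b) (mulW UNIV (t i) w)" by (simp add: SX_def)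
      then show "good (2 * b) (mulW UNIV (extV J V (PP t i)) w)" using ext(1)[OF TTD(1)[OF t i]] i by (simp add: PP_def)
    qed
    have "\<forall>i\<in>J. PP t i \<in> ?H \<inter> ?K" using mem[OF TTD(1)[OF t]] by (simp add: PP_def)
    then show "Phi J V (2 * a) b' T (PP t) W0 Y = 1" unfolding Phi_def using TnH by (simp add: indicator_def)
  qed
  have neP: "PP ` TT \<noteq> {}" using t0 by blast
  have "\<forall>x\<in>PP ` TT. (\<forall>i\<in>J. good (2 * b) (mulW UNIV (extV J V (x i)) w)) \<and> Phi J V (2 * a) b' T x W0 Y = 1"
    by (rule ballI, erule imageE) (use gP in simp)
  note all = this[unfolded Y_def]
  show ?thesis
    by (rule exI[of _ J], rule exI[of _ V], intro conjI Jne JV(1), rule exI[of _ "PP ` TT"], rule exI[of _ W0],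
        rule exI[of _ z], intro conjI sP cP neP W0c fin zI all)
qed

section \<open>The measure of matrices with many short vectors\<close>

lemma card_add_Compl: "card J + card (- J) = CARD('n)" for J :: "'n::finite set"
proof -
  have "card (J \<union> - J) = card J + card (- J)" by (rule card_Un_disjoint) auto
  then show ?thesis by (simp add: Compl_partition)
qed

lemma finite_Tup: "finite (Tup J V a)"
proof (rule finite_subset)
  show "Tup J V a \<subseteq> (\<Pi>\<^sub>E i\<in>J. {y\<in>ZJ J. \<forall>l. \<bar>y $ l\<bar> \<le> a})"
  proof
    fix x assume "x \<in> Tup J V a"
    then have "x \<in> (\<Pi>\<^sub>E i\<in>J. {y\<in>GV J (- J) V. \<forall>l. \<bar>y $ l\<bar> \<le> a})" unfolding Tup_def by blast
    then show "x \<in> (\<Pi>\<^sub>E i\<in>J. {y\<in>ZJ J. \<forall>l. \<bar>y $ l\<bar> \<le> a})"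
      by (rule subsetD[OF PiE_mono, rotated]) (use GV_subset in blast)
  qed
  show "finite (\<Pi>\<^sub>E i\<in>J. {y\<in>ZJ J. \<forall>l. \<bar>y $ l\<bar> \<le> a})" by (rule finite_PiE) (simp_all add: finite_int_box)
qed

lemma gK_le:
  assumes "finite J" "a \<ge> 0"
  shows "gK J a b Y = ennreal (enn2real (gK J a b Y))"
    "enn2real (gK J a b Y) \<le> (2 * ((real (card J) + 1) * a)) ^ card J"
proof -
  have le: "gK J a b Y \<le> ennreal ((2 * ((real (card J) + 1) * a)) ^ card J)"
    unfolding gK_def using assms by (intro gY_le) auto
  then show "gK J a b Y = ennreal (enn2real (gK J a b Y))" using ennreal_less_top le_less_trans by (metis ennreal_enn2real)
  show "enn2real (gK J a b Y) \<le> (2 * ((real (card J) + 1) * a)) ^ card J"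
    using enn2real_mono[OF le] assms(2) by simp
qed

lemma subgrp_GL:
  assumes "\<And>i. V i \<in> supp_on J"
  shows "subgrp (GL J V W)" "GL J V W \<subseteq> GV J (- J) V" "GL J V W \<subseteq> ZJ J"
proof -
  show "subgrp (GL J V W)" unfolding GL_def by (rule subgrp_HW[OF paired_GV[of V J, OF assms]])
  show G: "GL J V W \<subseteq> GV J (- J) V" unfolding GL_def by (rule HW_subset)
  show "GL J V W \<subseteq> ZJ J" using G GV_subset by (rule subset_trans)
qed

lemma nH_ge:
  assumes V: "\<And>i. V i \<in> supp_on J" and fin: "finite (cosets (ZJ J) (GL J V W))"
  shows "nH J V W \<ge> 1" "nV J V \<le> nH J V W" "finite (cosets (ZJ J) (GV J (- J) V))" "nV J V \<ge> 1"
proof -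
  show "nH J V W \<ge> 1" unfolding nH_def by (rule idx_pos[OF subgrp_ZJ fin])
  note m = finite_cosets_mono[OF subgrp_ZJ subgrp_GV subgrp_GL(1)[where V = V, OF V] subgrp_GL(2)[where V = V, OF V] GV_subset fin]
  show "nV J V \<le> nH J V W" unfolding nV_def nH_def by (rule m(4))
  show f: "finite (cosets (ZJ J) (GV J (- J) V))" by (rule m(1))
  show "nV J V \<ge> 1" unfolding nV_def by (rule idx_pos[OF subgrp_ZJ f])
qed

text \<open>A single tuple with \<open>Phi = 1\<close> provides a spanning set of short lattice
  points, hence \<open>lattice_points_bound\<close> applies: each member has at most
  \<open>g / nH\<close> choices.\<close>

lemma sum_Phi_le:
  fixes J :: "'n::finite set"
  assumes V: "\<And>i. V i \<in> supp_on J" and ab: "a \<ge> 0" "b \<ge> 0" "T \<ge> 0" and fin: "finite (cosets (ZJ J) (GL J V W))"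
  shows "(\<Sum>x\<in>Tup J V a'. Phi J V a b T x W Y) \<le>
    ennreal (if T * real (nH J V W) \<le> enn2real (gK J a b Y) then (enn2real (gK J a b Y) / real (nH J V W)) ^ card J else 0)"
proof -
  let ?g = "enn2real (gK J a b Y)" and ?H = "GL J V W" and ?K = "KV J a b Y"
  define X where "X = {x\<in>Tup J V a'. (\<forall>i\<in>J. x i \<in> ?H \<inter> ?K) \<and> ennreal T * of_nat (nH J V W) \<le> gK J a b Y}"
  have "(\<Sum>x\<in>Tup J V a'. Phi J V a b T x W Y) = (\<Sum>x\<in>Tup J V a'. if x \<in> X then 1 else 0)"
    by (intro sum.cong refl) (simp add: Phi_def X_def indicator_def)
  also have "\<dots> = of_nat (card X)"
  proof -
    have "Tup J V a' \<inter> X = X" unfolding X_def by blast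
    then show ?thesis by (simp add: sum.If_cases[OF finite_Tup] Int_def[symmetric])
  qed
  finally have sumX: "(\<Sum>x\<in>Tup J V a'. Phi J V a b T x W Y) = of_nat (card X)" .
  show ?thesis
  proof (cases "X = {}")
    case True
    then show ?thesis unfolding sumX by simp
  next
    case False
    then obtain x0 where x0: "x0 \<in> X" by blast
    have ge: "gK J a b Y = ennreal ?g" using ab by (intro gK_le(1)) simp_all
    have "ennreal T * of_nat (nH J V W) \<le> gK J a b Y" using x0 by (simp add: X_def)
    then have "ennreal (T * real (nH J V W)) \<le> ennreal ?g"
      using ge ab(3) by (simp add: ennreal_mult ennreal_of_nat_eq_real_of_nat)
    then have Tg: "T * real (nH J V W) \<le> ?g" by (subst (asm) ennreal_le_iff) simp_all
    have x0p: "x0 i \<in> ?H \<inter> ?K" if "i \<in> J" for i using x0 that unfolding X_def by blast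
    have x0s: "\<exists>c. v = (\<Sum>i\<in>J. c i *\<^sub>R x0 i)" if "v \<in> supp_on J" for v using x0 that unfolding X_def Tup_def by blast
    note l = lattice_points_bound[OF subgrp_GL(1)[where V = V, OF V] subgrp_GL(3)[where V = V, OF V] ab(1,2) x0p x0s]
    have fHK: "finite (?H \<inter> ?K)" by (rule l(2))
    have "of_nat (card (?H \<inter> ?K) * nH J V W) \<le> gK J a b Y" unfolding nH_def gK_def by (rule l(3))
    then have "ennreal (real (card (?H \<inter> ?K) * nH J V W)) \<le> ennreal ?g"
      using ge by (simp only: ennreal_of_nat_eq_real_of_nat)
    then have "real (card (?H \<inter> ?K) * nH J V W) \<le> ?g" by (subst (asm) ennreal_le_iff) simp_all
    moreover have n1: "nH J V W \<ge> 1" by (rule nH_ge[OF V fin])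
    ultimately have cHK: "real (card (?H \<inter> ?K)) \<le> ?g / real (nH J V W)" by (simp add: pos_le_divide_eq)
    have "X \<subseteq> (\<Pi>\<^sub>E i\<in>J. ?H \<inter> ?K)" unfolding X_def Tup_def PiE_def Pi_def by blast
    then have "card X \<le> card (\<Pi>\<^sub>E i\<in>J. ?H \<inter> ?K)" by (intro card_mono finite_PiE) (simp_all add: fHK)
    also have "\<dots> = card (?H \<inter> ?K) ^ card J" by (simp add: card_PiE)
    finally have "real (card X) \<le> real (card (?H \<inter> ?K)) ^ card J" by (simp only: of_nat_le_iff of_nat_power[symmetric])
    also have "\<dots> \<le> (?g / real (nH J V W)) ^ card J" by (intro power_mono cHK) simp
    finally show ?thesis unfolding sumX using Tg by (simp add: ennreal_of_nat_eq_real_of_nat ennreal_leI)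
  qed
qed

text \<open>The translation changes \<open>x W\<close> by the image under \<open>PT\<close> of an
  integer vector, and taking fractional parts changes it by a vector of \<open>ZJ J\<close>; both
  belong to the target lattice.\<close>

lemma GL_frac:
  assumes V: "\<And>i. V i \<in> supp_on J" and m: "m \<in> intsE UNIV"
  shows "GL J V (restrW J (\<lambda>p. frac (W p - projE J V m p))) = GL J V W"
proof -
  let ?G = "GV J (- J) V" and ?L = "PT J V ` ZJ UNIV"
  have pr: "paired J ?G ?L" by (rule paired_GV[OF V])
  have sL: "subgrp ?L" and ZL: "ZJ J \<subseteq> ?L" using pr unfolding paired_def by blast+
  have iff: "mulW J x (restrW J (\<lambda>p. frac (W p - projE J V m p))) \<in> ?L \<longleftrightarrow> mulW J x W \<in> ?L" if x: "x \<in> ?G" for x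
  proof -
    define fl where "fl p = (of_int \<lfloor>W p - projE J V m p\<rfloor> :: real)" for p
    define d where "d = mulW J x (projE J V m) + mulW J x fl"
    have xZ: "x \<in> ZJ J" using x GV_subset by blast
    have xs: "x \<in> supp_on J" using xZ ZJ_supp by blast
    have e: "mulW J x (restrW J (\<lambda>p. frac (W p - projE J V m p))) = mulW J x W - d"
      unfolding mulW_restrW d_def
      by (simp add: vec_eq_iff mulW_nth frac_def fl_def[symmetric] right_diff_distrib sum_subtractf)
    have "mulW J x (projE J V m) \<in> ?L"
      unfolding mulW_projE[OF xs V] using mulW_intsE_ZJ[OF extV_GV_ZJ[OF x] m] by blast
    moreover have "mulW J x fl \<in> ZJ J" using xZ by (auto simp: ZJ_def mulW_nth fl_def intro!: Ints_sum Ints_mult)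
    ultimately have d: "d \<in> ?L" unfolding d_def using subgrp_add[OF sL] ZL by blast
    show ?thesis unfolding e using subgrp_diff[OF sL _ d, of "mulW J x W"] subgrp_add[OF sL _ d, of "mulW J x W - d"] by auto
  qed
  show ?thesis unfolding GL_def HW_def by (rule Collect_cong) (use iff in blast)
qed

lemma finite_WV:
  assumes "\<And>i. V i \<in> supp_on J"
  shows "finite (WV J V N)"
proof -
  obtain C where "\<forall>\<Gamma> \<Lambda> N. paired J \<Gamma> \<Lambda> \<longrightarrow>
    finite (WCset J \<Gamma> \<Lambda> N) \<and> real (card (WCset J \<Gamma> \<Lambda> N)) \<le> C * real N ^ (card J + 1)"
    using card_WCset_le[of J] by blast
  then show ?thesis unfolding WV_def using paired_GV[of V J, OF assms] by simp
qed

lemma WV_iff: "W \<in> WV J V N \<longleftrightarrow> W \<in> cubeS J \<and> finite (cosets (ZJ J) (GL J V W)) \<and> nH J V W \<le> N"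
  by (simp add: WV_def WCset_def GL_def nH_def)

lemma WV_closed:
  assumes V: "\<And>i. V i \<in> supp_on J" and m: "m \<in> intsE UNIV" and W: "W \<in> WV J V N"
  shows "restrW J (\<lambda>p. frac (W p - projE J V m p)) \<in> WV J V N"
proof -
  have "restrW J (\<lambda>p. frac (W p - projE J V m p)) \<in> cubeS J" by (auto simp: cubeS_def restrW_def frac_lt_1)
  then show ?thesis using W unfolding WV_iff nH_def GL_frac[OF V m] by blast
qed

text \<open>V splits into its fractional part, counted by \<open>card_VCset_le\<close>, and its
  integer part, for which boundedness of V leaves a fixed finite number of choices.\<close>

lemma finite_card_VVs_le:
  fixes J :: "'n::finite set"
  assumes "J \<noteq> {}" "C \<ge> 0"
  shows "\<exists>K>0. \<forall>N. finite (VVs J C N) \<and> real (card (VVs J C N)) \<le> K * real N ^ CARD('n) \<and>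
    (- J = {} \<longrightarrow> card (VVs J C N) \<le> 1)"
proof -
  obtain C1 where C1: "C1 > 0" "\<forall>N. finite (VCset J (- J) N) \<and> real (card (VCset J (- J) N)) \<le> C1 * real N ^ (card J + card (- J)) \<and>
      (- J = {} \<longrightarrow> card (VCset J (- J) N) \<le> 1)"
    using card_VCset_le[OF assms(1), of "- J"] by blast
  have cc: "card J + card (- J) = CARD('n)" by (rule card_add_Compl)
  let ?B = "{k\<in>ZJ J. \<forall>i. \<bar>k $ i\<bar> \<le> C + 1}"
  let ?F = "\<Pi>\<^sub>E i\<in>(UNIV :: 'n set). ?B"
  have fF: "finite ?F" by (rule finite_PiE) (simp_all add: finite_int_box)
  define fr :: "('n \<Rightarrow> real^'n) \<Rightarrow> 'n \<Rightarrow> real^'n" where "fr V i = (\<chi> l. frac (V i $ l))" for V i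
  define fl :: "('n \<Rightarrow> real^'n) \<Rightarrow> 'n \<Rightarrow> real^'n" where "fl V i = (\<chi> l. of_int \<lfloor>V i $ l\<rfloor>)" for V i
  have sum: "V i = fr V i + fl V i" for V i by (simp add: vec_eq_iff fr_def fl_def frac_def)
  have inj: "inj_on (\<lambda>V. (fr V, fl V)) A" for A
  proof (rule inj_onI)
    fix V V' assume "(fr V, fl V) = (fr V', fl V')"
    then have "fr V = fr V'" "fl V = fl V'" by auto
    then show "V = V'" using sum[of V] sum[of V'] by (intro ext) (simp only:)
  qed
  have into: "(\<lambda>V. (fr V, fl V)) ` VVs J C N \<subseteq> VCset J (- J) N \<times> ?F" for N
  proof (rule image_subsetI)
    fix V assume "V \<in> VVs J C N"
    then have V: "\<And>i. V i \<in> supp_on J" "\<And>i. i \<in> J \<Longrightarrow> V i = 0" "\<And>i l. \<bar>V i $ l\<bar> \<le> C"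
      and fi: "finite (cosets (ZJ J) (GV J (- J) V))" "nV J V \<le> N"
      unfolding VVs_def coordV_def by blast+
    have V0: "V i $ l = 0" if "l \<notin> J" for i l using V(1)[of i] that by (simp add: supp_on_def)
    have "fr V i \<in> unit_cube J" for i by (simp add: unit_cube_def fr_def frac_lt_1 V0)
    moreover have "fr V i = 0" if "i \<notin> - J" for i using V(2) that by (simp add: fr_def vec_eq_iff)
    moreover have G: "GV J (- J) (fr V) = GV J (- J) V"
    proof -
      have "x \<bullet> fr V i \<in> \<int> \<longleftrightarrow> x \<bullet> V i \<in> \<int>" if x: "x \<in> ZJ J" for x i
      proof -
        have "x \<bullet> fl V i \<in> \<int>" using x by (auto simp: inner_vec_def ZJ_def fl_def intro!: Ints_sum Ints_mult)
        moreover have "x \<bullet> V i = x \<bullet> fr V i + x \<bullet> fl V i" by (subst sum) (rule inner_add_right)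
        ultimately show ?thesis by (metis Ints_add Ints_diff add_diff_cancel_right')
      qed
      then show ?thesis unfolding GV_def by blast
    qed
    ultimately have "fr V \<in> VCset J (- J) N" using fi by (simp add: VCset_def nV_def G)
    moreover have "fl V \<in> ?F"
    proof -
      have "fl V i \<in> ZJ J" for i by (simp add: ZJ_def fl_def V0)
      moreover have "\<bar>fl V i $ l\<bar> \<le> C + 1" for i l
        using V(3)[of i l] by (simp add: fl_def) linarith
      ultimately show ?thesis by (simp add: PiE_iff)
    qed
    ultimately show "(fr V, fl V) \<in> VCset J (- J) N \<times> ?F" by blast
  qed
  have fin: "finite (VVs J C N)" for N
    using inj_on_finite[OF inj into] C1(2) fF by blast
  have crd: "card (VVs J C N) \<le> card (VCset J (- J) N) * card ?F" for N
    using card_inj_on_le[OF inj into] C1(2) fF by (simp add: card_cartesian_product)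
  have F0: "real (card ?F) \<ge> 0" by simp
  have "real (card (VVs J C N)) \<le> (C1 * (real (card ?F) + 1)) * real N ^ CARD('n)" for N
  proof -
    have "real (card (VVs J C N)) \<le> real (card (VCset J (- J) N)) * real (card ?F)"
      using crd[of N] by (simp only: of_nat_mult[symmetric] of_nat_le_iff)
    also have "\<dots> \<le> (C1 * real N ^ CARD('n)) * (real (card ?F) + 1)"
      using C1 unfolding cc by (intro mult_mono) auto
    finally show ?thesis by (simp add: mult_ac)
  qed
  moreover have "card (VVs J C N) \<le> 1" if "- J = {}" for N
  proof -
    have "VVs J C N \<subseteq> {\<lambda>_. 0}"
      using that by (auto simp: VVs_def coordV_def fun_eq_iff)
    then show ?thesis by (metis card_mono card.empty card_insert_disjoint empty_iff finite.emptyI finite.insertI One_nat_def)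
  qed
  ultimately show ?thesis using fin C1(1) F0 by (intro exI[of _ "C1 * (real (card ?F) + 1)"]) auto
qed

text \<open>Two applications of \<open>sum_inverse_power_le\<close>. The counts
  \<open>N ^ (s + 1)\<close> of matrices and \<open>N ^ n\<close> of subspaces, weighted by inverse
  s-th powers, give R and \<open>R ^ u\<close>. Since \<open>nV \<le> nH\<close>, the inner sum is
  empty for subspaces of index above R.\<close>

lemma V_W_sum_le:
  fixes J :: "'n::finite set"
  assumes J: "J \<noteq> {}" and C: "C \<ge> 0"
  shows "\<exists>K\<ge>0. \<forall>N R. R \<ge> 0 \<longrightarrow>
    (\<Sum>V\<in>VVs J C N. 1 / real (nV J V) ^ card J * (\<Sum>W\<in>{W\<in>WV J V N. real (nH J V W) \<le> R}. 1 / real (nH J V W) ^ card J))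
      \<le> K * R ^ Suc (card (- J))"
proof -
  let ?s = "card J" and ?u = "card (- J)"
  have cc: "?s + ?u = CARD('n)" by (rule card_add_Compl)
  obtain C1 where C1: "C1 > 0" "\<forall>\<Gamma> \<Lambda> N. paired J \<Gamma> \<Lambda> \<longrightarrow>
      finite (WCset J \<Gamma> \<Lambda> N) \<and> real (card (WCset J \<Gamma> \<Lambda> N)) \<le> C1 * real N ^ (?s + 1)"
    using card_WCset_le[of J] by blast
  obtain C2 where C2: "C2 > 0" "\<forall>N. finite (VVs J C N) \<and> real (card (VVs J C N)) \<le> C2 * real N ^ CARD('n) \<and>
    (- J = {} \<longrightarrow> card (VVs J C N) \<le> 1)"
    using finite_card_VVs_le[OF J C] by blast
  let ?K1 = "2 ^ (?s + 1) * C1" and ?K2 = "2 ^ (?s + 1) * C2 + 1"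
  have main: "(\<Sum>V\<in>VVs J C N. 1 / real (nV J V) ^ ?s * (\<Sum>W\<in>{W\<in>WV J V N. real (nH J V W) \<le> R}. 1 / real (nH J V W) ^ ?s))
      \<le> (?K1 * ?K2) * R ^ Suc ?u" if R: "R \<ge> 0" for N R
  proof -
    let ?A = "VVs J C N"
    have fA: "finite ?A" using C2(2) by blast
    have Vs: "V i \<in> supp_on J" if "V \<in> ?A" for V i using that coordV_supp unfolding VVs_def by blast
    have nV1: "nV J V \<ge> 1" if "V \<in> ?A" for V
      unfolding nV_def by (rule idx_pos[OF subgrp_ZJ]) (use that in \<open>simp add: VVs_def\<close>)
    have inner: "(\<Sum>W\<in>{W\<in>WV J V N. real (nH J V W) \<le> R}. 1 / real (nH J V W) ^ ?s) \<le> (if real (nV J V) \<le> R then ?K1 * R else 0)"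
      if V: "V \<in> ?A" for V
    proof (cases "real (nV J V) \<le> R")
      case True
      have pr: "paired J (GV J (- J) V) (PT J V ` ZJ UNIV)" by (rule paired_GV[OF Vs[OF V]])
      have "(\<Sum>W\<in>{W\<in>WV J V N. real (nH J V W) \<le> R}. 1 / real (nH J V W) ^ ?s) \<le> 2 ^ (?s + 1) * C1 * R ^ (?s + 1 - ?s)"
      proof (rule sum_inverse_power_le)
        show "finite (WV J V N)" by (rule finite_WV[OF Vs[OF V]])
        show "1 \<le> nH J V W" if "W \<in> WV J V N" for W
        proof -
          have "finite (cosets (ZJ J) (GL J V W))" using that by (simp add: WV_iff)
          from nH_ge(1)[where V = V, OF Vs[OF V] this] show ?thesis .
        qed
        show "real (card {W\<in>WV J V N. nH J V W \<le> x}) \<le> C1 * real x ^ (?s + 1)" for x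
        proof -
          have fx: "finite (WV J V x)" "real (card (WV J V x)) \<le> C1 * real x ^ (?s + 1)"
            using C1(2)[rule_format, OF pr, of x] unfolding WV_def by simp_all
          have "{W\<in>WV J V N. nH J V W \<le> x} \<subseteq> WV J V x" by (auto simp: WV_iff)
          then have "card {W\<in>WV J V N. nH J V W \<le> x} \<le> card (WV J V x)" by (rule card_mono[OF fx(1)])
          then show ?thesis using fx(2) by linarith
        qed
      qed (use C1(1) R in auto)
      then show ?thesis using True by simp
    next
      case False
      have "{W\<in>WV J V N. real (nH J V W) \<le> R} = {}"
      proof -
        have "\<not> real (nH J V W) \<le> R" if "W \<in> WV J V N" for W
        proof -
          have "finite (cosets (ZJ J) (GL J V W))" using that by (simp add: WV_iff)
          from nH_ge(2)[where V = V, OF Vs[OF V] this] have "nV J V \<le> nH J V W" .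
          then show ?thesis using False by linarith
        qed
        then show ?thesis by simp
      qed
      then have "(\<Sum>W\<in>{W\<in>WV J V N. real (nH J V W) \<le> R}. 1 / real (nH J V W) ^ ?s) = 0"
        by (simp only: sum.empty)
      then show ?thesis using False by simp
    qed
    have outer: "(\<Sum>V\<in>{V\<in>?A. real (nV J V) \<le> R}. 1 / real (nV J V) ^ ?s) \<le> ?K2 * R ^ ?u"
    \<comment> \<open>If J is everything, both exponents equal s and dyadic summation would cost a
      logarithm; but then V = 0 is the only possibility.\<close>
    proof (cases "- J = {}")
      case True
      have "(\<Sum>V\<in>{V\<in>?A. real (nV J V) \<le> R}. 1 / real (nV J V) ^ ?s) \<le> (\<Sum>V\<in>{V\<in>?A. real (nV J V) \<le> R}. 1)"
        using nV1 by (intro sum_mono) (simp add: divide_le_eq_1 one_le_power Suc_le_eq)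
      also have "\<dots> \<le> real (card ?A)" using fA by (simp add: card_mono)
      also have "\<dots> \<le> 1" using C2(2)[rule_format, of N] True by simp
      also have "\<dots> \<le> ?K2 * R ^ ?u" unfolding True using C2(1) by simp
      finally show ?thesis .
    next
      case False
      then have u: "?u \<ge> 1" by (simp add: Suc_le_eq card_gt_0_iff)
      have "(\<Sum>V\<in>{V\<in>?A. real (nV J V) \<le> R}. 1 / real (nV J V) ^ ?s) \<le> 2 ^ (?s + 1) * C2 * R ^ (CARD('n) - ?s)"
      proof (rule sum_inverse_power_le[OF fA nV1])
        show "real (card {V\<in>?A. nV J V \<le> x}) \<le> C2 * real x ^ CARD('n)" for x
        proof -
          have fx: "finite (VVs J C x)" "real (card (VVs J C x)) \<le> C2 * real x ^ CARD('n)"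
            using C2(2) by blast+
          have "{V\<in>?A. nV J V \<le> x} \<subseteq> VVs J C x" by (auto simp: VVs_def)
          then have "card {V\<in>?A. nV J V \<le> x} \<le> card (VVs J C x)" by (rule card_mono[OF fx(1)])
          then show ?thesis using fx(2) by linarith
        qed
        show "?s < CARD('n)" using cc u by linarith
      qed (use C2(1) R in auto)
      also have "CARD('n) - ?s = ?u" using cc by linarith
      also have "2 ^ (?s + 1) * C2 * R ^ ?u \<le> ?K2 * R ^ ?u" using R by (intro mult_right_mono) auto
      finally show ?thesis .
    qed
    have "(\<Sum>V\<in>?A. 1 / real (nV J V) ^ ?s * (\<Sum>W\<in>{W\<in>WV J V N. real (nH J V W) \<le> R}. 1 / real (nH J V W) ^ ?s)) \<le>
      (\<Sum>V\<in>?A. 1 / real (nV J V) ^ ?s * (if real (nV J V) \<le> R then ?K1 * R else 0))"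
      using inner by (intro sum_mono mult_left_mono) auto
    also have "\<dots> = (\<Sum>V\<in>?A. if real (nV J V) \<le> R then 1 / real (nV J V) ^ ?s * (?K1 * R) else 0)"
      by (intro sum.cong) auto
    also have "\<dots> = (\<Sum>V\<in>{V\<in>?A. real (nV J V) \<le> R}. 1 / real (nV J V) ^ ?s * (?K1 * R))"
      by (rule sum.inter_filter[OF fA, symmetric])
    also have "\<dots> = (\<Sum>V\<in>{V\<in>?A. real (nV J V) \<le> R}. 1 / real (nV J V) ^ ?s) * (?K1 * R)"
      by (rule sum_distrib_right[symmetric])
    also have "\<dots> \<le> (?K2 * R ^ ?u) * (?K1 * R)" using C1(1) R by (intro mult_right_mono outer) auto
    finally show ?thesis by (simp add: mult_ac)
  qed
  have "?K1 * ?K2 \<ge> 0" using C1(1) C2(1) by simp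
  then show ?thesis using main by blast
qed

section \<open>The integral for a fixed set of coordinates\<close>

lemma measurable_gK: "gK J a b \<in> borel_measurable (LB (prs J))" for J :: "'n::finite set"
  unfolding gK_def by (rule measurable_gY) simp

lemma measurable_Phi: "Phi J V a b T x W \<in> borel_measurable (LB (prs J))" for J :: "'n::finite set"
proof -
  note [measurable] = measurable_gK[of J a b]
  have [measurable]: "(\<lambda>Y. mulW J v Y $ k) \<in> borel_measurable (LB (prs J))" for v k
    unfolding mulW_nth by (cases "k \<in> J") (auto intro!: borel_measurable_sum borel_measurable_times LB_component)
  have "Measurable.pred (LB (prs J)) (\<lambda>Y. (\<forall>i\<in>J. x i \<in> GL J V W \<inter> KV J a b Y) \<and>
     ennreal T * of_nat (nH J V W) \<le> gK J a b Y)"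
    unfolding KV_def Int_iff mem_Collect_eq by measurable
  then show ?thesis unfolding Phi_def[abs_def] by measurable
qed

definition hh :: "'n::finite set \<Rightarrow> ('n \<Rightarrow> real^'n) \<Rightarrow> real \<Rightarrow> real \<Rightarrow> real \<Rightarrow> ('n uprod \<Rightarrow> real) \<Rightarrow>
    ('n uprod \<Rightarrow> real) \<Rightarrow> real" where
  "hh J V a b T W Y = (if T * real (nH J V W) \<le> enn2real (gK J a b Y)
     then (enn2real (gK J a b Y) / real (nH J V W)) ^ card J else 0)"

lemma measurable_hh: "hh J V a b T W \<in> borel_measurable (LB (prs J))" for J :: "'n::finite set"
proof -
  note [measurable] = measurable_gK[of J a b]
  show ?thesis unfolding hh_def[abs_def] by measurable
qed

lemma hh_nonneg: "hh J V a b T W Y \<ge> 0"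
  by (simp add: hh_def)

lemma measurable_good_tuple:
  "(\<lambda>w. \<Prod>i\<in>I. indicator {w. good \<beta> (mulW UNIV (x i) w)} w :: ennreal) \<in> borel_measurable (LB UNIV)"
  for I :: "'n::finite set"
proof (rule borel_measurable_prod_ennreal)
  fix i
  have "Measurable.pred (LB UNIV) (\<lambda>w. good \<beta> (mulW UNIV (x i) w))"
    by (intro measurable_good measurable_mulW_nth LB_component) simp
  then show "(\<lambda>w. indicator {w. good \<beta> (mulW UNIV (x i) w)} w :: ennreal) \<in> borel_measurable (LB UNIV)" by measurable
qed

text \<open>\<open>cross_bound\<close> removes the \<open>card J\<close> closeness conditions, each
  for \<open>(4 * b) ^ u\<close> over the index of \<open>BV\<close>, which \<open>idx_BV\<close>
  bounds below by \<open>nV\<close>. Then \<open>unf_integral\<close> unfolds what is left.\<close>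

lemma tuple_integral_le:
  fixes J :: "'n::finite set"
  assumes V: "V \<in> VVs J C N" and x: "x \<in> Tup J V (2 * a)"
    and ab: "a \<ge> 1" "b > 0" "8 * (real CARD('n) * (a * b)) < 1"
  shows "(\<integral>\<^sup>+w\<in>cubeI UNIV. unf J V (WV J V N) (Phi J V (2 * a) b' T x) w *
      (\<Prod>i\<in>J. indicator {w. good (2 * b) (mulW UNIV (extV J V (x i)) w)} w) \<partial>LB UNIV) \<le>
    ennreal (((4 * b) ^ card (- J)) ^ card J / real (nV J V) ^ card J) *
      (\<Sum>W\<in>WV J V N. \<integral>\<^sup>+Y. Phi J V (2 * a) b' T x W Y \<partial>LB (prs J))" (is "?X \<le> _ * ?I")
proof -
  let ?s = "card J" and ?u = "card (- J)"
  have Vs: "V i \<in> supp_on J" for i using V coordV_supp unfolding VVs_def by blast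
  have fG: "finite (cosets (ZJ J) (GV J (- J) V))" using V by (simp add: VVs_def)
  note B = idx_BV[where V = V, OF Vs fG]
  have nV1: "nV J V \<ge> 1" unfolding nV_def by (rule idx_pos[OF subgrp_ZJ fG])
  let ?D = "idx (ZJ (- J)) (BV J V)"
  have x1: "x i \<in> GV J (- J) V" "\<bar>x i $ l\<bar> \<le> 2 * a" if "i \<in> J" for i l
    using x that unfolding Tup_def by (auto simp: PiE_iff)
  have x2: "indepF J x" "\<And>v. v \<in> supp_on J \<Longrightarrow> \<exists>c. v = (\<Sum>i\<in>J. c i *\<^sub>R x i)"
    using x unfolding Tup_def by blast+
  have n1: "real CARD('n) \<ge> 1" by (simp add: Suc_le_eq)
  \<comment> \<open>Here \<open>a \<ge> 1\<close> matters: smallness of \<open>a * b\<close> forces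
    b itself to be small.\<close>
  have b1: "b \<le> a * b" using ab by simp
  also have "\<dots> \<le> real CARD('n) * (a * b)" using mult_right_mono[OF n1, of "a * b"] ab by simp
  finally have b4: "2 * (2 * b) < 1" using ab(3) ab(2) by linarith
  have "real (card J) * (a * b) \<le> real CARD('n) * (a * b)"
    using ab by (intro mult_right_mono) (auto intro: card_mono)
  then have b5: "real (card J) * (2 * (2 * b) * (2 * a)) < 1" using ab(3) by (simp add: mult_ac)
  have cl: "Phi J V (2 * a) b' T x (restrW J (\<lambda>p. frac (W p - projE J V m p))) = Phi J V (2 * a) b' T x W"
    if "m \<in> intsE UNIV" for W m
    unfolding Phi_def nH_def GL_frac[where V = V, OF Vs that] ..
  have per: "unf J V (WV J V N) (Phi J V (2 * a) b' T x) (\<lambda>p. w p + m p) = unf J V (WV J V N) (Phi J V (2 * a) b' T x) w"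
    if m: "m \<in> intsE UNIV" for w m
  proof (rule unf_periodic[OF finite_WV[OF Vs] _ _ _ m])
    show "WV J V N \<subseteq> cubeS J" by (auto simp: WV_iff)
    show "restrW J (\<lambda>p. frac (W p - projE J V m' p)) \<in> WV J V N" if "W \<in> WV J V N" "m' \<in> intsE UNIV" for W m'
      by (rule WV_closed[OF Vs that(2,1)])
    show "Phi J V (2 * a) b' T x (restrW J (\<lambda>p. frac (W p - projE J V m' p))) = Phi J V (2 * a) b' T x W"
      if "W \<in> WV J V N" "m' \<in> intsE UNIV" for W m' by (rule cl[OF that(2)])
  qed
  have b0: "0 \<le> 2 * b" using ab by simp
  have "?X * of_nat ?D ^ ?s \<le> ennreal ((2 * (2 * b)) ^ ?u) ^ ?s * (\<integral>\<^sup>+w\<in>cubeI UNIV. unf J V (WV J V N) (Phi J V (2 * a) b' T x) w \<partial>LB UNIV)"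
    by (rule cross_bound[OF Vs x1 x2(2,1) b0 b4 b5 B(1) _ per _ subset_refl])
      (simp_all add: measurable_unf measurable_Phi unf_Zsh Vs)
  also have "(\<integral>\<^sup>+w\<in>cubeI UNIV. unf J V (WV J V N) (Phi J V (2 * a) b' T x) w \<partial>LB UNIV) = ?I"
    by (rule unf_integral[OF Vs _ per]) (simp_all add: measurable_Phi)
  finally have main: "?X * of_nat ?D ^ ?s \<le> ennreal ((4 * b) ^ ?u) ^ ?s * ?I" by simp
  have nD: "real (nV J V) \<le> real ?D" using B(2) by (simp add: nV_def)
  have one: "1 \<le> of_nat ?D ^ ?s * ennreal (1 / real (nV J V) ^ ?s)"
  proof -
    have "of_nat ?D ^ ?s * ennreal (1 / real (nV J V) ^ ?s) = ennreal (real ?D ^ ?s * (1 / real (nV J V) ^ ?s))"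
      by (subst ennreal_mult) (simp_all add: ennreal_power ennreal_of_nat_eq_real_of_nat)
    moreover have "real ?D ^ ?s * (1 / real (nV J V) ^ ?s) \<ge> 1"
      using nV1 power_mono[OF nD, of ?s] by (simp add: le_divide_eq)
    ultimately show ?thesis by (simp add: ennreal_ge_1)
  qed
  have "?X = ?X * 1" by simp
  also have "\<dots> \<le> ?X * (of_nat ?D ^ ?s * ennreal (1 / real (nV J V) ^ ?s))" by (rule mult_left_mono[OF one]) simp
  also have "\<dots> = (?X * of_nat ?D ^ ?s) * ennreal (1 / real (nV J V) ^ ?s)" by (simp only: mult.assoc)
  also have "\<dots> \<le> (ennreal ((4 * b) ^ ?u) ^ ?s * ?I) * ennreal (1 / real (nV J V) ^ ?s)" by (rule mult_right_mono[OF main]) simp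
  also have "\<dots> = (ennreal ((4 * b) ^ ?u) ^ ?s * ennreal (1 / real (nV J V) ^ ?s)) * ?I" by (simp only: mult_ac)
  also have "ennreal ((4 * b) ^ ?u) ^ ?s * ennreal (1 / real (nV J V) ^ ?s) = ennreal (((4 * b) ^ ?u) ^ ?s / real (nV J V) ^ ?s)"
    using ab by (simp add: ennreal_power ennreal_mult[symmetric])
  finally show ?thesis .
qed

text \<open>Pointwise in Y, summing over tuples, matrices and subspaces gives
  \<open>g ^ s * (g / T) ^ (u + 1)\<close>. The factor \<open>g ^ u\<close> is replaced by its
  maximum, to be balanced against \<open>b ^ (u * s)\<close>; the other \<open>g ^ (s + 1)\<close>
  is the moment of \<open>nn_integral_gY_le\<close>. The prefactor \<open>(2 / T) ^ s\<close>
  completes the exponent of T.\<close>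

lemma fixed_support_bound:
  fixes J :: "'n::finite set"
  assumes J: "J \<noteq> {}" and C: "C \<ge> 0"
  shows "\<exists>K\<ge>0. \<forall>a b T N. 1 \<le> a \<longrightarrow> 0 < b \<longrightarrow> 8 * (real CARD('n) * (a * b)) < 1 \<longrightarrow> 1 \<le> T \<longrightarrow>
    ennreal ((2 / T) ^ card J) * (\<Sum>V\<in>VVs J C N. \<Sum>x\<in>Tup J V (2 * a).
      \<integral>\<^sup>+w\<in>cubeI UNIV. unf J V (WV J V N) (Phi J V (2 * a) ((1 + real CARD('n) * C) * (2 * b)) T x) w *
        (\<Prod>i\<in>J. indicator {w. good (2 * b) (mulW UNIV (extV J V (x i)) w)} w) \<partial>LB UNIV)
    \<le> ennreal (K / T ^ (CARD('n) + 1))"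
proof -
  let ?s = "card J" and ?u = "card (- J)" and ?n = "real CARD('n)"
  have cc: "?s + ?u = CARD('n)" by (rule card_add_Compl)
  obtain K0 where K0: "K0 \<ge> 0" "\<forall>N R. R \<ge> 0 \<longrightarrow>
    (\<Sum>V\<in>VVs J C N. 1 / real (nV J V) ^ ?s * (\<Sum>W\<in>{W\<in>WV J V N. real (nH J V W) \<le> R}. 1 / real (nH J V W) ^ ?s))
      \<le> K0 * R ^ Suc ?u" using V_W_sum_le[OF J C] by blast
  obtain K1 e where K1: "K1 \<ge> 0" "\<forall>a>0. \<forall>b>0. (\<integral>\<^sup>+Y. gY J a b Y ^ Suc ?s \<partial>LB (prs J)) \<le> ennreal (K1 * (a * b) ^ e)"
    using nn_integral_gY_le[OF finite[of J]] by blast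
  define c where "c = 1 + ?n * C"
  have c1: "c \<ge> 1" using C by (simp add: c_def)
  \<comment> \<open>The value of \<open>(4 * b) ^ (u * s)\<close> times the maximum of
    \<open>g ^ u\<close> at \<open>a * b = 1\<close>.\<close>
  define L where "L = (16 * (real ?s + 1)) ^ (?u * ?s)"
  define K where "K = 2 ^ ?s * (L * K0 * (K1 * ((real ?s + 1) ^ 2 * 4 * c) ^ e))"
  have Kn: "K \<ge> 0" using K0(1) K1(1) c1 by (simp add: K_def L_def)
  have "ennreal ((2 / T) ^ ?s) * (\<Sum>V\<in>VVs J C N. \<Sum>x\<in>Tup J V (2 * a).
      \<integral>\<^sup>+w\<in>cubeI UNIV. unf J V (WV J V N) (Phi J V (2 * a) (c * (2 * b)) T x) w *
        (\<Prod>i\<in>J. indicator {w. good (2 * b) (mulW UNIV (extV J V (x i)) w)} w) \<partial>LB UNIV)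
    \<le> ennreal (K / T ^ (CARD('n) + 1))" (is "_ * ?L \<le> _")
    if a: "1 \<le> a" and b: "0 < b" and ab: "8 * (?n * (a * b)) < 1" and T: "1 \<le> T" for a b T :: real and N
  proof -
    define b' where "b' = c * (2 * b)"
    have b': "b' > 0" using c1 b by (simp add: b'_def)
    have n1: "?n \<ge> 1" by (simp add: Suc_le_eq)
    have ab0: "a * b > 0" using a b by simp
    have "a * b \<le> ?n * (a * b)" using n1 ab0 by (simp add: mult_le_cancel_right1)
    then have ab1: "a * b \<le> 1" using ab by linarith
    define gr where "gr Y = enn2real (gK J (2 * a) b' Y)" for Y
    define M where "M = (2 * ((real ?s + 1) * (2 * a))) ^ ?s"
    have gr: "gK J (2 * a) b' Y = ennreal (gr Y)" "gr Y \<le> M" "gr Y \<ge> 0" for Y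
      using gK_le[of J "2 * a" b' Y] a unfolding gr_def M_def by simp_all
    have M0: "M \<ge> 0" using a by (simp add: M_def)
    let ?q = "((4 * b) ^ ?u) ^ ?s"
    have q0: "?q \<ge> 0" using b by simp
    have fV: "finite (VVs J C N)" using finite_card_VVs_le[OF J C] by blast
    have Vs: "V i \<in> supp_on J" if "V \<in> VVs J C N" for V i using that coordV_supp unfolding VVs_def by blast
    have VL: "(\<Sum>x\<in>Tup J V (2 * a).
      \<integral>\<^sup>+w\<in>cubeI UNIV. unf J V (WV J V N) (Phi J V (2 * a) b' T x) w *
        (\<Prod>i\<in>J. indicator {w. good (2 * b) (mulW UNIV (extV J V (x i)) w)} w) \<partial>LB UNIV) \<le>
      (\<integral>\<^sup>+Y. ennreal (?q / real (nV J V) ^ ?s * (\<Sum>W\<in>WV J V N. hh J V (2 * a) b' T W Y)) \<partial>LB (prs J))"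
      (is "?lv \<le> _") if V: "V \<in> VVs J C N" for V
    proof -
      let ?Q = "ennreal (?q / real (nV J V) ^ ?s)"
      have "?lv \<le> (\<Sum>x\<in>Tup J V (2 * a). ?Q * (\<Sum>W\<in>WV J V N. \<integral>\<^sup>+Y. Phi J V (2 * a) b' T x W Y \<partial>LB (prs J)))"
        by (intro sum_mono tuple_integral_le[OF V _ a b ab])
      also have "\<dots> = ?Q * (\<Sum>W\<in>WV J V N. \<Sum>x\<in>Tup J V (2 * a). \<integral>\<^sup>+Y. Phi J V (2 * a) b' T x W Y \<partial>LB (prs J))"
        unfolding sum_distrib_left[symmetric] by (subst sum.swap) (rule refl)
      also have "\<dots> = ?Q * (\<Sum>W\<in>WV J V N. \<integral>\<^sup>+Y. (\<Sum>x\<in>Tup J V (2 * a). Phi J V (2 * a) b' T x W Y) \<partial>LB (prs J))"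
        by (subst nn_integral_sum) (simp_all add: measurable_Phi)
      also have "\<dots> \<le> ?Q * (\<Sum>W\<in>WV J V N. \<integral>\<^sup>+Y. ennreal (hh J V (2 * a) b' T W Y) \<partial>LB (prs J))"
      proof (intro mult_left_mono sum_mono nn_integral_mono)
        fix W Y assume W: "W \<in> WV J V N"
        have "finite (cosets (ZJ J) (GL J V W))" using W by (simp add: WV_iff)
        then show "(\<Sum>x\<in>Tup J V (2 * a). Phi J V (2 * a) b' T x W Y) \<le> ennreal (hh J V (2 * a) b' T W Y)"
          unfolding hh_def using a b' T by (intro sum_Phi_le[where V = V, OF Vs[OF V]]) auto
      qed simp
      also have "\<dots> = (\<integral>\<^sup>+Y. ?Q * (\<Sum>W\<in>WV J V N. ennreal (hh J V (2 * a) b' T W Y)) \<partial>LB (prs J))"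
        using measurable_hh[of J V "2 * a" b' T]
        by (subst nn_integral_cmult) (auto simp: nn_integral_sum)
      also have "\<dots> = (\<integral>\<^sup>+Y. ennreal (?q / real (nV J V) ^ ?s * (\<Sum>W\<in>WV J V N. hh J V (2 * a) b' T W Y)) \<partial>LB (prs J))"
      proof (rule nn_integral_cong)
        fix Y
        have "(\<Sum>W\<in>WV J V N. ennreal (hh J V (2 * a) b' T W Y)) = ennreal (\<Sum>W\<in>WV J V N. hh J V (2 * a) b' T W Y)"
          by (rule sum_ennreal) (rule hh_nonneg)
        then show "?Q * (\<Sum>W\<in>WV J V N. ennreal (hh J V (2 * a) b' T W Y)) =
          ennreal (?q / real (nV J V) ^ ?s * (\<Sum>W\<in>WV J V N. hh J V (2 * a) b' T W Y))"
          by (subst ennreal_mult) (use q0 in \<open>simp_all only: sum_nonneg hh_nonneg zero_le_divide_iff zero_le_power of_nat_0_le_iff simp_thms\<close>)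
      qed
      finally show ?thesis .
    qed
    have "?L \<le> (\<Sum>V\<in>VVs J C N. \<integral>\<^sup>+Y. ennreal (?q / real (nV J V) ^ ?s * (\<Sum>W\<in>WV J V N. hh J V (2 * a) b' T W Y)) \<partial>LB (prs J))"
      unfolding b'_def[symmetric] by (intro sum_mono VL)
    also have "\<dots> = (\<integral>\<^sup>+Y. (\<Sum>V\<in>VVs J C N. ennreal (?q / real (nV J V) ^ ?s * (\<Sum>W\<in>WV J V N. hh J V (2 * a) b' T W Y))) \<partial>LB (prs J))"
    proof (rule nn_integral_sum[symmetric])
      fix V
      have [measurable]: "(\<lambda>Y. \<Sum>W\<in>WV J V N. hh J V (2 * a) b' T W Y) \<in> borel_measurable (LB (prs J))"
        by (intro borel_measurable_sum measurable_hh)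
      show "(\<lambda>Y. ennreal (?q / real (nV J V) ^ ?s * (\<Sum>W\<in>WV J V N. hh J V (2 * a) b' T W Y))) \<in> borel_measurable (LB (prs J))"
        by measurable
    qed
    also have "\<dots> \<le> (\<integral>\<^sup>+Y. ennreal (?q * K0 * M ^ ?u / T ^ Suc ?u) * gK J (2 * a) b' Y ^ Suc ?s \<partial>LB (prs J))"
    proof (rule nn_integral_mono)
      fix Y
      have hs: "(\<Sum>W\<in>WV J V N. hh J V (2 * a) b' T W Y) =
        gr Y ^ ?s * (\<Sum>W\<in>{W\<in>WV J V N. real (nH J V W) \<le> gr Y / T}. 1 / real (nH J V W) ^ ?s)" if V: "V \<in> VVs J C N" for V
      proof -
        have hhd: "hh J V (2 * a) b' T W Y = (if T * real (nH J V W) \<le> gr Y then (gr Y / real (nH J V W)) ^ ?s else 0)" for W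
          unfolding hh_def gr_def ..
        have iff: "T * r \<le> g \<longleftrightarrow> r \<le> g / T" for r g :: real using T by (simp add: pos_le_divide_eq mult.commute)
        have "(\<Sum>W\<in>WV J V N. hh J V (2 * a) b' T W Y) =
          (\<Sum>W\<in>WV J V N. if real (nH J V W) \<le> gr Y / T then gr Y ^ ?s * (1 / real (nH J V W) ^ ?s) else 0)"
          unfolding hhd iff by (intro sum.cong refl) (simp add: power_divide)
        also have "\<dots> = (\<Sum>W\<in>{W\<in>WV J V N. real (nH J V W) \<le> gr Y / T}. gr Y ^ ?s * (1 / real (nH J V W) ^ ?s))"
          by (rule sum.inter_filter[symmetric, OF finite_WV[OF Vs[OF V]]])
        finally show ?thesis by (simp only: sum_distrib_left)
      qed
      have "(\<Sum>V\<in>VVs J C N. ennreal (?q / real (nV J V) ^ ?s * (\<Sum>W\<in>WV J V N. hh J V (2 * a) b' T W Y))) =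
        ennreal (\<Sum>V\<in>VVs J C N. ?q / real (nV J V) ^ ?s * (\<Sum>W\<in>WV J V N. hh J V (2 * a) b' T W Y))"
        using q0 by (intro sum_ennreal) (simp add: sum_nonneg hh_nonneg)
      also have "(\<Sum>V\<in>VVs J C N. ?q / real (nV J V) ^ ?s * (\<Sum>W\<in>WV J V N. hh J V (2 * a) b' T W Y)) =
        ?q * gr Y ^ ?s * (\<Sum>V\<in>VVs J C N. 1 / real (nV J V) ^ ?s * (\<Sum>W\<in>{W\<in>WV J V N. real (nH J V W) \<le> gr Y / T}. 1 / real (nH J V W) ^ ?s))"
        unfolding sum_distrib_left[of "?q * gr Y ^ ?s"] by (intro sum.cong refl) (simp add: hs)
      also have "\<dots> \<le> ?q * gr Y ^ ?s * (K0 * (gr Y / T) ^ Suc ?u)"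
        using K0(2)[rule_format, of "gr Y / T" N] gr(3)[of Y] T q0 by (intro mult_left_mono) auto
      also have "\<dots> = ?q * K0 * gr Y ^ ?u / T ^ Suc ?u * gr Y ^ Suc ?s" by (simp add: power_divide)
      also have "\<dots> \<le> ?q * K0 * M ^ ?u / T ^ Suc ?u * gr Y ^ Suc ?s"
        using q0 K0(1) T gr(2,3)[of Y] by (intro mult_right_mono divide_right_mono mult_left_mono power_mono) auto
      finally have "(\<Sum>V\<in>VVs J C N. ennreal (?q / real (nV J V) ^ ?s * (\<Sum>W\<in>WV J V N. hh J V (2 * a) b' T W Y))) \<le>
        ennreal (?q * K0 * M ^ ?u / T ^ Suc ?u * gr Y ^ Suc ?s)" by (simp only: ennreal_leI)
      also have "\<dots> = ennreal (?q * K0 * M ^ ?u / T ^ Suc ?u) * gK J (2 * a) b' Y ^ Suc ?s"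
      proof -
        have "ennreal (gr Y ^ Suc ?s) = gK J (2 * a) b' Y ^ Suc ?s" unfolding gr(1) by (rule ennreal_power[OF gr(3), symmetric])
        moreover have "?q * K0 * M ^ ?u / T ^ Suc ?u \<ge> 0"
          using b q0 K0(1) M0 T by (intro divide_nonneg_nonneg mult_nonneg_nonneg zero_le_power) auto
        ultimately show ?thesis using gr(3)[of Y] by (subst ennreal_mult) (simp_all only: zero_le_power)
      qed
      finally show "(\<Sum>V\<in>VVs J C N. ennreal (?q / real (nV J V) ^ ?s * (\<Sum>W\<in>WV J V N. hh J V (2 * a) b' T W Y))) \<le>
        ennreal (?q * K0 * M ^ ?u / T ^ Suc ?u) * gK J (2 * a) b' Y ^ Suc ?s" .
    qed
    also have "\<dots> = ennreal (?q * K0 * M ^ ?u / T ^ Suc ?u) * (\<integral>\<^sup>+Y. gK J (2 * a) b' Y ^ Suc ?s \<partial>LB (prs J))"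
      by (intro nn_integral_cmult borel_measurable_power_ennreal measurable_gK)
    also have "\<dots> \<le> ennreal (?q * K0 * M ^ ?u / T ^ Suc ?u) * ennreal (K1 * ((real ?s + 1) * (2 * a) * ((real ?s + 1) * b')) ^ e)"
      unfolding gK_def using a b' by (intro mult_left_mono K1(2)[rule_format]) auto
    also have "\<dots> \<le> ennreal (L * K0 / T ^ Suc ?u) * ennreal (K1 * ((real ?s + 1) ^ 2 * 4 * c) ^ e)"
    proof (rule mult_mono)
      have "?q * M ^ ?u = ((16 * (real ?s + 1)) * (a * b)) ^ (?u * ?s)"
      proof -
        have "?q * M ^ ?u = (4 * b) ^ (?u * ?s) * (2 * ((real ?s + 1) * (2 * a))) ^ (?u * ?s)"
          unfolding M_def power_mult[symmetric] by (simp add: mult.commute)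
        also have "\<dots> = ((4 * b) * (2 * ((real ?s + 1) * (2 * a)))) ^ (?u * ?s)" by (rule power_mult_distrib[symmetric])
        also have "(4 * b) * (2 * ((real ?s + 1) * (2 * a))) = (16 * (real ?s + 1)) * (a * b)" by (simp add: algebra_simps)
        finally show ?thesis .
      qed
      also have "\<dots> \<le> L" unfolding L_def using ab0 ab1 by (intro power_mono) (simp_all add: mult_left_le)
      finally have "?q * M ^ ?u \<le> L" .
      then have "(?q * M ^ ?u) * K0 \<le> L * K0" using K0(1) by (rule mult_right_mono)
      then have "?q * K0 * M ^ ?u / T ^ Suc ?u \<le> L * K0 / T ^ Suc ?u"
        using T by (intro divide_right_mono) (simp_all add: mult_ac)
      then show "ennreal (?q * K0 * M ^ ?u / T ^ Suc ?u) \<le> ennreal (L * K0 / T ^ Suc ?u)" by (rule ennreal_leI)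
      have "(real ?s + 1) * (2 * a) * ((real ?s + 1) * b') = (real ?s + 1) ^ 2 * 4 * c * (a * b)"
        unfolding b'_def by (simp add: power2_eq_square algebra_simps)
      also have "\<dots> \<le> (real ?s + 1) ^ 2 * 4 * c" using ab0 ab1 c1 by (intro mult_left_le) auto
      finally have "((real ?s + 1) * (2 * a) * ((real ?s + 1) * b')) ^ e \<le> ((real ?s + 1) ^ 2 * 4 * c) ^ e"
        using a b' by (intro power_mono) auto
      then have "K1 * ((real ?s + 1) * (2 * a) * ((real ?s + 1) * b')) ^ e \<le> K1 * ((real ?s + 1) ^ 2 * 4 * c) ^ e"
        using K1(1) by (rule mult_left_mono)
      then show "ennreal (K1 * ((real ?s + 1) * (2 * a) * ((real ?s + 1) * b')) ^ e) \<le> ennreal (K1 * ((real ?s + 1) ^ 2 * 4 * c) ^ e)"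
        by (rule ennreal_leI)
    qed simp_all
    finally have "ennreal ((2 / T) ^ ?s) * ?L \<le>
      ennreal ((2 / T) ^ ?s) * (ennreal (L * K0 / T ^ Suc ?u) * ennreal (K1 * ((real ?s + 1) ^ 2 * 4 * c) ^ e))"
      by (rule mult_left_mono) simp
    also have "\<dots> = ennreal ((2 / T) ^ ?s * (L * K0 / T ^ Suc ?u * (K1 * ((real ?s + 1) ^ 2 * 4 * c) ^ e)))"
    proof -
      have "L * K0 / T ^ Suc ?u \<ge> 0" using T K0(1) by (simp add: L_def)
      moreover have "K1 * ((real ?s + 1) ^ 2 * 4 * c) ^ e \<ge> 0" using K1(1) c1 by simp
      moreover have "(2 / T) ^ ?s \<ge> 0" using T by simp
      ultimately show ?thesis by (simp only: ennreal_mult mult_nonneg_nonneg)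
    qed
    also have "(2 / T) ^ ?s * (L * K0 / T ^ Suc ?u * (K1 * ((real ?s + 1) ^ 2 * 4 * c) ^ e)) = K / T ^ (CARD('n) + 1)"
    proof -
      have "T ^ (CARD('n) + 1) = T ^ ?s * T ^ Suc ?u" unfolding cc[symmetric] by (simp add: power_add)
      then show ?thesis by (simp only: K_def power_divide) simp
    qed
    finally show ?thesis .
  qed
  then show ?thesis using Kn unfolding c_def by blast
qed

section \<open>Combining all sets of coordinates\<close>

lemma card_SX_eq:
  "real (card (SX w a b)) = (\<Sum>h\<in>{h\<in>ZJ UNIV. \<forall>i. \<bar>h $ i\<bar> \<le> a}. indicator {w. good b (mulW UNIV h w)} w)"
proof -
  let ?B = "{h\<in>ZJ UNIV. \<forall>i. \<bar>h $ i\<bar> \<le> a}"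
  have "(\<Sum>h\<in>?B. indicator {w. good b (mulW UNIV h w)} w :: real) = (\<Sum>h\<in>?B. if good b (mulW UNIV h w) then 1 else 0)"
    by (simp only: indicator_def of_bool_def mem_Collect_eq)
  also have "\<dots> = (\<Sum>h\<in>{h\<in>?B. good b (mulW UNIV h w)}. 1)" by (rule sum.inter_filter[symmetric, OF finite_int_box])
  also have "{h\<in>?B. good b (mulW UNIV h w)} = SX w a b" unfolding SX_def by blast
  finally show ?thesis by simp
qed

lemma sets_many_SX: "{w\<in>cubeI (UNIV :: 'a::finite uprod set). T \<le> real (card (SX w a b))} \<in> sets (LB UNIV)"
proof -
  have "(\<lambda>w. indicator {w. good b (mulW UNIV h w)} w :: real) \<in> borel_measurable (LB UNIV)" for h :: "real^'a"
  proof -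
    have "Measurable.pred (LB UNIV) (\<lambda>w. good b (mulW UNIV h w))"
      by (intro measurable_good measurable_mulW_nth LB_component) simp
    then show ?thesis by (intro borel_measurable_indicator') (simp add: pred_def)
  qed
  then have "(\<lambda>w. real (card (SX w a b))) \<in> borel_measurable (LB (UNIV :: 'a uprod set))"
    unfolding card_SX_eq by (intro borel_measurable_sum)
  then have "{w\<in>space (LB UNIV). T \<le> real (card (SX w a b))} \<in> sets (LB (UNIV :: 'a uprod set))"
    by (rule borel_measurable_le[OF borel_measurable_const])
  then have "cubeI UNIV \<inter> {w\<in>space (LB UNIV). T \<le> real (card (SX w a b))} \<in> sets (LB (UNIV :: 'a uprod set))"
    by (intro sets.Int cubeI_sets) simp
  moreover have "cubeI (UNIV :: 'a uprod set) \<inter> {w\<in>space (LB UNIV). T \<le> real (card (SX w a b))} = {w\<in>cubeI UNIV. T \<le> real (card (SX w a b))}"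
    by (auto simp: space_LB)
  ultimately show ?thesis by (simp only:)
qed

text \<open>A Markov argument: at each w of the set the sum over J, V and tuples, weighted by
  \<open>(2 / T) ^ card J\<close>, is at least 1, since \<open>many_points_witness\<close> yields
  \<open>(T / 2) ^ card J\<close> tuples for one J and V.\<close>

theorem emeasure_many_SX_le:
  shows "\<exists>C>0. \<forall>a b T. 0 < a \<longrightarrow> 0 < b \<longrightarrow> 8 * (real CARD('n::finite) * (a * b)) < 1 \<longrightarrow> 1 \<le> T \<longrightarrow>
    emeasure (LB UNIV) {w\<in>cubeI (UNIV :: 'n uprod set). T \<le> real (card (SX w a b))} \<le> ennreal (C / T ^ (CARD('n) + 1))"
proof -
  obtain C :: real where C: "C \<ge> 0" "\<And>E :: (real^'n) set. subspace E \<Longrightarrow> \<exists>J V. coordV J C V \<and> E = extV J V ` supp_on J \<and> card J = dim E"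
    by (rule adapted_coordinates_exist) blast
  let ?n = "real CARD('n)" and ?c = "1 + real CARD('n) * C"
  let ?f = "\<lambda>J N a b T V x w. unf J V (WV J V N) (Phi J V (2 * a) (?c * (2 * b)) T x) w *
        (\<Prod>i\<in>J. indicator {w. good (2 * b) (mulW UNIV (extV J V (x i)) w)} w)"
  let ?Q = "\<lambda>J K. K \<ge> 0 \<and> (\<forall>a b T N. 1 \<le> a \<longrightarrow> 0 < b \<longrightarrow> 8 * (?n * (a * b)) < 1 \<longrightarrow> 1 \<le> T \<longrightarrow>
    ennreal ((2 / T) ^ card J) * (\<Sum>V\<in>VVs J C N. \<Sum>x\<in>Tup J V (2 * a). \<integral>\<^sup>+w\<in>cubeI UNIV. ?f J N a b T V x w \<partial>LB UNIV)
    \<le> ennreal (K / T ^ (CARD('n) + 1)))"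
  have "\<forall>J\<in>{J :: 'n set. J \<noteq> {}}. \<exists>K. ?Q J K"
  proof
    fix J :: "'n set" assume "J \<in> {J. J \<noteq> {}}"
    then have "J \<noteq> {}" by simp
    from fixed_support_bound[OF this C(1)] show "\<exists>K. ?Q J K" .
  qed
  from bchoice[OF this] obtain K where KK: "\<forall>J\<in>{J :: 'n set. J \<noteq> {}}. ?Q J (K J)" ..
  have Kq: "?Q J (K J)" if "J \<noteq> {}" for J :: "'n set" by (rule bspec[OF KK]) (use that in simp)
  note K = Kq[THEN conjunct1] Kq[THEN conjunct2, rule_format]
  let ?Js = "{J :: 'n set. J \<noteq> {}}"
  \<comment> \<open>The first summand makes the bound trivial for \<open>T < 2\<close>, the unit
    cube having measure 1.\<close>
  define Kt where "Kt = 2 ^ (CARD('n) + 1) + (\<Sum>J\<in>?Js. K J)"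
  have sK: "(\<Sum>J\<in>?Js. K J) \<ge> 0" using K(1) by (intro sum_nonneg) auto
  then have Kt0: "Kt > 0" unfolding Kt_def by (simp add: add_pos_nonneg)
  have "emeasure (LB UNIV) {w\<in>cubeI (UNIV :: 'n uprod set). T \<le> real (card (SX w a b))} \<le> ennreal (Kt / T ^ (CARD('n) + 1))"
    if a: "0 < a" and b: "0 < b" and ab: "8 * (?n * (a * b)) < 1" and T: "1 \<le> T" for a b T :: real
  proof -
    let ?A = "{w\<in>cubeI (UNIV :: 'n uprod set). T \<le> real (card (SX w a b))}"
    consider "T < 2" | "T \<ge> 2" "a < 1" | "T \<ge> 2" "a \<ge> 1" by linarith
    then show ?thesis
    proof cases
      case 1
      have "emeasure (LB UNIV) ?A \<le> emeasure (LB UNIV) (cubeI (UNIV :: 'n uprod set))"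
        by (rule emeasure_mono) (auto simp: cubeI_sets)
      also have "\<dots> = ennreal 1" by (simp add: emeasure_cubeI)
      also have "\<dots> \<le> ennreal (Kt / T ^ (CARD('n) + 1))"
      proof (rule ennreal_leI)
        have "T ^ (CARD('n) + 1) \<le> 2 ^ (CARD('n) + 1)" using 1 T by (intro power_mono) auto
        also have "\<dots> \<le> Kt" using sK unfolding Kt_def by linarith
        finally show "1 \<le> Kt / T ^ (CARD('n) + 1)" using T by (simp add: le_divide_eq)
      qed
      finally show ?thesis .
    next
      \<comment> \<open>For \<open>a < 1\<close> the zero vector is the only integer vector of size
        at most a.\<close>
      case 2
      have "SX w a b \<subseteq> {0}" for w :: "'n uprod \<Rightarrow> real"
      proof
        fix h assume "h \<in> SX w a b"
        then have "h $ i \<in> \<int>" "\<bar>h $ i\<bar> < 1" for i using 2 unfolding SX_def ZJ_def by (auto intro: le_less_trans)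
        then have "h $ i = 0" for i using Ints_nonzero_abs_less1 by blast
        then show "h \<in> {0}" by (simp add: vec_eq_iff)
      qed
      then have c1: "card (SX w a b) \<le> 1" for w :: "'n uprod \<Rightarrow> real"
        using card_mono[of "{0 :: real^'n}" "SX w a b"] by simp
      have "\<not> T \<le> real (card (SX w a b))" for w :: "'n uprod \<Rightarrow> real"
        proof -
          have "real (card (SX w a b)) \<le> 1" using c1[of w] by simp
          then show ?thesis using 2 by linarith
        qed
      then have eA: "?A = {}" by simp
      show ?thesis unfolding eA by simp
    next
      case 3
      define bd where "bd J = (2 * ((real (card J) + 1) * (2 * a))) ^ card J" for J :: "'n set"
      have bd0: "bd J \<ge> 0" for J using a by (simp add: bd_def)
      \<comment> \<open>A crude bound for every volume, hence for every index that can occur. It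
        only makes the sums over V and W finite; the estimate does not depend on N.\<close>
      define N where "N = nat \<lceil>\<Sum>J\<in>UNIV. bd J\<rceil>"
      have bdN: "bd J \<le> real N" for J :: "'n set"
      proof -
        have "bd J \<le> (\<Sum>J\<in>UNIV. bd J)" by (rule member_le_sum) (simp_all add: bd0)
        then show ?thesis unfolding N_def by linarith
      qed
      have fm: "(\<lambda>w. ?f J N a b T V x w * indicator (cubeI UNIV) w) \<in> borel_measurable (LB UNIV)" for J :: "'n set" and V x
        by (intro borel_measurable_times_ennreal measurable_unf measurable_good_tuple measurable_Phi borel_measurable_indicator cubeI_sets) simp
      let ?F = "\<lambda>w. \<Sum>J\<in>?Js. ennreal ((2 / T) ^ card J) * (\<Sum>V\<in>VVs J C N. \<Sum>x\<in>Tup J V (2 * a). ?f J N a b T V x w * indicator (cubeI UNIV) w)"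
      have pw: "indicator ?A w \<le> ?F w" for w
      proof (cases "w \<in> ?A")
        case True
        then have w: "w \<in> cubeI UNIV" "T \<le> real (card (SX w a b))" by auto
        note ex = many_points_witness[OF C a b ab 3(1) w(2)]
        from ex obtain J where "\<exists>V. J \<noteq> {} \<and> coordV J C V \<and> (\<exists>TT W z. TT \<subseteq> Tup J V (2 * a) \<and> (T / 2) ^ card J \<le> real (card TT) \<and>
           TT \<noteq> {} \<and> W \<in> cubeS J \<and> finite (cosets (ZJ J) (GL J V W)) \<and> z \<in> intsE (prs J) \<and>
           (\<forall>x\<in>TT. (\<forall>i\<in>J. good (2 * b) (mulW UNIV (extV J V (x i)) w)) \<and>
             Phi J V (2 * a) (?c * (2 * b)) T x W (shf (prs J) (\<lambda>p. - W p - z p) (projE J V w)) = 1))" ..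
        then obtain V where JV: "J \<noteq> {} \<and> coordV J C V \<and> (\<exists>TT W z. TT \<subseteq> Tup J V (2 * a) \<and> (T / 2) ^ card J \<le> real (card TT) \<and>
           TT \<noteq> {} \<and> W \<in> cubeS J \<and> finite (cosets (ZJ J) (GL J V W)) \<and> z \<in> intsE (prs J) \<and>
           (\<forall>x\<in>TT. (\<forall>i\<in>J. good (2 * b) (mulW UNIV (extV J V (x i)) w)) \<and>
             Phi J V (2 * a) (?c * (2 * b)) T x W (shf (prs J) (\<lambda>p. - W p - z p) (projE J V w)) = 1))" ..
        then have J: "J \<noteq> {}" and cV: "coordV J C V" by blast+
        from JV obtain TT W z where TT: "TT \<subseteq> Tup J V (2 * a)" "(T / 2) ^ card J \<le> real (card TT)" "TT \<noteq> {}"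
          and W: "W \<in> cubeS J" "finite (cosets (ZJ J) (GL J V W))" "z \<in> intsE (prs J)"
          and g: "\<And>x i. x \<in> TT \<Longrightarrow> i \<in> J \<Longrightarrow> good (2 * b) (mulW UNIV (extV J V (x i)) w)"
          and ph: "\<And>x. x \<in> TT \<Longrightarrow> Phi J V (2 * a) (?c * (2 * b)) T x W (shf (prs J) (\<lambda>p. - W p - z p) (projE J V w)) = 1"
          by (elim conjE exE) blast
        have Vs: "V i \<in> supp_on J" for i by (rule coordV_supp[OF cV])
        obtain x0 where x0: "x0 \<in> TT" using TT(3) by blast
        have "nH J V W \<le> N"
        proof -
          let ?Y = "shf (prs J) (\<lambda>p. - W p - z p) (projE J V w)"
          have "ennreal T * of_nat (nH J V W) \<le> gK J (2 * a) (?c * (2 * b)) ?Y"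
            using ph[OF x0] unfolding Phi_def by (simp add: indicator_def split: if_splits)
          also have "\<dots> \<le> ennreal (bd J)"
          proof -
            have a2: "0 \<le> 2 * a" using a by simp
            note gl = gK_le[OF finite[of J] a2, of "?c * (2 * b)" ?Y]
            show ?thesis unfolding bd_def by (subst gl(1)) (rule ennreal_leI[OF gl(2)])
          qed
          finally have "ennreal (T * real (nH J V W)) \<le> ennreal (bd J)"
            using T by (simp add: ennreal_mult ennreal_of_nat_eq_real_of_nat)
          then have "T * real (nH J V W) \<le> bd J" by (subst (asm) ennreal_le_iff) (simp_all add: bd0)
          moreover have "1 * real (nH J V W) \<le> T * real (nH J V W)" using T by (intro mult_right_mono) auto
          ultimately have "real (nH J V W) \<le> real N" using bdN[of J] by linarith
          then show ?thesis by simp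
        qed
        then have WW: "W \<in> WV J V N" using W by (simp add: WV_iff)
        note nh = nH_ge[where V = V, OF Vs W(2)]
        have VV: "V \<in> VVs J C N" unfolding VVs_def using cV nh(3) order_trans[OF nh(2) \<open>nH J V W \<le> N\<close>] by simp
        have f1: "1 \<le> ?f J N a b T V x w * indicator (cubeI UNIV) w" if x: "x \<in> TT" for x
        proof -
          have "1 = Phi J V (2 * a) (?c * (2 * b)) T x W (shf (prs J) (\<lambda>p. - W p - z p) (projE J V w))" using ph[OF x] by simp
          also have "\<dots> \<le> (\<integral>\<^sup>+z. Phi J V (2 * a) (?c * (2 * b)) T x W (shf (prs J) (\<lambda>p. - W p - z p) (projE J V w)) \<partial>count_space (intsE (prs J)))"
            by (rule nn_integral_ge_point[OF W(3)])
          also have "\<dots> \<le> unf J V (WV J V N) (Phi J V (2 * a) (?c * (2 * b)) T x) w"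
            unfolding unf_def by (rule member_le_sum[OF WW]) (simp_all add: finite_WV[where V = V, OF Vs])
          finally have u: "1 \<le> unf J V (WV J V N) (Phi J V (2 * a) (?c * (2 * b)) T x) w" .
          have "(\<Prod>i\<in>J. indicator {w. good (2 * b) (mulW UNIV (extV J V (x i)) w)} w) = (1 :: ennreal)"
            using g[OF x] by (intro prod.neutral) (simp add: indicator_def)
          then show ?thesis using u w(1) by simp
        qed
        have tw: "1 \<le> ennreal ((2 / T) ^ card J) * of_nat (card TT)"
        proof -
          have "(2 / T) ^ card J * (T / 2) ^ card J = 1" using T by (simp add: power_mult_distrib[symmetric])
          moreover have "(2 / T) ^ card J * (T / 2) ^ card J \<le> (2 / T) ^ card J * real (card TT)"
            using T by (intro mult_left_mono TT(2)) auto
          ultimately have "1 \<le> (2 / T) ^ card J * real (card TT)" by linarith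
          then have "1 \<le> ennreal ((2 / T) ^ card J * real (card TT))" by (simp only: ennreal_ge_1)
          then show ?thesis using T by (simp add: ennreal_mult ennreal_of_nat_eq_real_of_nat)
        qed
        have fV: "finite (VVs J C N)" using finite_card_VVs_le[OF J C(1)] by blast
        have "of_nat (card TT) = (\<Sum>x\<in>TT. 1 :: ennreal)" by simp
        also have "\<dots> \<le> (\<Sum>x\<in>TT. ?f J N a b T V x w * indicator (cubeI UNIV) w)" by (intro sum_mono f1)
        also have "\<dots> \<le> (\<Sum>x\<in>Tup J V (2 * a). ?f J N a b T V x w * indicator (cubeI UNIV) w)"
          by (rule sum_mono2[OF finite_Tup TT(1)]) simp
        also have "\<dots> \<le> (\<Sum>V\<in>VVs J C N. \<Sum>x\<in>Tup J V (2 * a). ?f J N a b T V x w * indicator (cubeI UNIV) w)"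
          by (rule member_le_sum[OF VV _ fV, where f = "\<lambda>V. \<Sum>x\<in>Tup J V (2 * a). ?f J N a b T V x w * indicator (cubeI UNIV) w"]) simp
        finally have "ennreal ((2 / T) ^ card J) * of_nat (card TT) \<le> ennreal ((2 / T) ^ card J) *
          (\<Sum>V\<in>VVs J C N. \<Sum>x\<in>Tup J V (2 * a). ?f J N a b T V x w * indicator (cubeI UNIV) w)"
          by (rule mult_left_mono) simp
        also have "\<dots> \<le> ?F w"
          by (rule member_le_sum[of J ?Js "\<lambda>J. ennreal ((2 / T) ^ card J) * (\<Sum>V\<in>VVs J C N. \<Sum>x\<in>Tup J V (2 * a). ?f J N a b T V x w * indicator (cubeI UNIV) w)"])
            (simp_all add: J)
        finally have "1 \<le> ?F w" using tw by (rule order_trans[rotated])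
        then show ?thesis using True by (simp add: indicator_def)
      qed simp
      have "emeasure (LB UNIV) ?A = (\<integral>\<^sup>+w. indicator ?A w \<partial>LB UNIV)"
        by (rule nn_integral_indicator[symmetric, OF sets_many_SX])
      also have "\<dots> \<le> (\<integral>\<^sup>+w. ?F w \<partial>LB UNIV)" by (intro nn_integral_mono pw)
      also have "\<dots> = (\<Sum>J\<in>?Js. \<integral>\<^sup>+w. ennreal ((2 / T) ^ card J) * (\<Sum>V\<in>VVs J C N. \<Sum>x\<in>Tup J V (2 * a). ?f J N a b T V x w * indicator (cubeI UNIV) w) \<partial>LB UNIV)"
        by (rule nn_integral_sum) (intro borel_measurable_times_ennreal borel_measurable_const borel_measurable_sum fm)
      also have "\<dots> = (\<Sum>J\<in>?Js. ennreal ((2 / T) ^ card J) * (\<Sum>V\<in>VVs J C N. \<Sum>x\<in>Tup J V (2 * a). \<integral>\<^sup>+w\<in>cubeI UNIV. ?f J N a b T V x w \<partial>LB UNIV))"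
      proof (intro sum.cong refl)
        fix J :: "'n set"
        have "(\<integral>\<^sup>+w. ennreal ((2 / T) ^ card J) * (\<Sum>V\<in>VVs J C N. \<Sum>x\<in>Tup J V (2 * a). ?f J N a b T V x w * indicator (cubeI UNIV) w) \<partial>LB UNIV) =
          ennreal ((2 / T) ^ card J) * (\<integral>\<^sup>+w. (\<Sum>V\<in>VVs J C N. \<Sum>x\<in>Tup J V (2 * a). ?f J N a b T V x w * indicator (cubeI UNIV) w) \<partial>LB UNIV)"
          by (rule nn_integral_cmult) (intro borel_measurable_sum fm)
        also have "(\<integral>\<^sup>+w. (\<Sum>V\<in>VVs J C N. \<Sum>x\<in>Tup J V (2 * a). ?f J N a b T V x w * indicator (cubeI UNIV) w) \<partial>LB UNIV) =
          (\<Sum>V\<in>VVs J C N. \<integral>\<^sup>+w. (\<Sum>x\<in>Tup J V (2 * a). ?f J N a b T V x w * indicator (cubeI UNIV) w) \<partial>LB UNIV)"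
          by (rule nn_integral_sum) (intro borel_measurable_sum fm)
        also have "\<dots> = (\<Sum>V\<in>VVs J C N. \<Sum>x\<in>Tup J V (2 * a). \<integral>\<^sup>+w\<in>cubeI UNIV. ?f J N a b T V x w \<partial>LB UNIV)"
          by (intro sum.cong refl nn_integral_sum fm)
        finally show "(\<integral>\<^sup>+w. ennreal ((2 / T) ^ card J) * (\<Sum>V\<in>VVs J C N. \<Sum>x\<in>Tup J V (2 * a). ?f J N a b T V x w * indicator (cubeI UNIV) w) \<partial>LB UNIV) =
          ennreal ((2 / T) ^ card J) * (\<Sum>V\<in>VVs J C N. \<Sum>x\<in>Tup J V (2 * a). \<integral>\<^sup>+w\<in>cubeI UNIV. ?f J N a b T V x w \<partial>LB UNIV)" .
      qed
      also have "\<dots> \<le> (\<Sum>J\<in>?Js. ennreal (K J / T ^ (CARD('n) + 1)))"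
        by (rule sum_mono, rule K(2)) (use 3 b ab T in simp_all)
      also have "\<dots> = ennreal (\<Sum>J\<in>?Js. K J / T ^ (CARD('n) + 1))" using K(1) T by (intro sum_ennreal) simp
      also have "\<dots> \<le> ennreal (Kt / T ^ (CARD('n) + 1))"
        unfolding sum_divide_distrib[symmetric] Kt_def using T by (intro ennreal_leI divide_right_mono) auto
      finally show ?thesis .
    qed
  qed
  then show ?thesis using Kt0 by blast
qed

section \<open>Finite differences of Schwartz functions\<close>

definition dif :: "'v::real_vector \<Rightarrow> ('v \<Rightarrow> complex) \<Rightarrow> 'v \<Rightarrow> complex" where
  "dif c F = (\<lambda>v. F (v + c) - F v)"

text \<open>All derivatives up to order k exist and have the same majorant W. With one majorant for
  all orders, the product rule costs just a factor \<open>2 ^ k\<close>.\<close>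

primrec dcl :: "nat \<Rightarrow> (real \<Rightarrow> complex) \<Rightarrow> (real \<Rightarrow> real) \<Rightarrow> bool" where
  "dcl 0 \<phi> W = (\<forall>t. norm (\<phi> t) \<le> W t)"
| "dcl (Suc k) \<phi> W = ((\<forall>t. norm (\<phi> t) \<le> W t) \<and>
     (\<exists>\<phi>'. (\<forall>t. (\<phi> has_vector_derivative \<phi>' t) (at t)) \<and> dcl k \<phi>' W))"

definition om :: "real^'n::finite \<Rightarrow> real" where
  "om x = (\<Prod>i\<in>UNIV. 1 / (1 + \<bar>x $ i\<bar>) ^ 2)"

text \<open>The fourth powers are what two factors of \<open>rho\<close> need in order to split into
  \<open>om\<close> of the difference and \<open>om\<close> of one argument; \<open>om\<close>, with
  its squares, is still summable over a lattice.\<close>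

definition rho :: "real^'n::finite \<Rightarrow> real" where
  "rho x = (\<Prod>i\<in>UNIV. 1 / (1 + \<bar>x $ i\<bar>) ^ 4)"

lemma om_nonneg: "om x \<ge> 0" unfolding om_def by (intro prod_nonneg) simp

lemma rho_nonneg: "rho x \<ge> 0" unfolding rho_def by (intro prod_nonneg) simp

text \<open>Peetre's inequality in each coordinate: \<open>1 + \<bar>a - b\<bar> \<le> (1 +
  \<bar>a\<bar>) * (1 + \<bar>b\<bar>)\<close>.\<close>

lemma rho_mult_le: "rho u * rho v \<le> om (u - v) * om v"
proof -
  have "1 / (1 + \<bar>a\<bar>) ^ 4 * (1 / (1 + \<bar>b\<bar>) ^ 4) \<le> 1 / (1 + \<bar>a - b\<bar>) ^ 2 * (1 / (1 + \<bar>b\<bar>) ^ 2)" for a b :: real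
  proof -
    have "(1 + \<bar>a\<bar>) * (1 + \<bar>b\<bar>) = 1 + \<bar>a\<bar> + \<bar>b\<bar> + \<bar>a\<bar> * \<bar>b\<bar>" by (simp add: algebra_simps)
    moreover have "0 \<le> \<bar>a\<bar> * \<bar>b\<bar>" by simp
    ultimately have "1 + \<bar>a - b\<bar> \<le> (1 + \<bar>a\<bar>) * (1 + \<bar>b\<bar>)" by linarith
    then have "(1 + \<bar>a - b\<bar>) ^ 2 \<le> ((1 + \<bar>a\<bar>) * (1 + \<bar>b\<bar>)) ^ 2" by (intro power_mono) auto
    then have "(1 + \<bar>a - b\<bar>) ^ 2 * (1 + \<bar>b\<bar>) ^ 2 \<le> ((1 + \<bar>a\<bar>) * (1 + \<bar>b\<bar>)) ^ 2 * (1 + \<bar>b\<bar>) ^ 2"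
      by (rule mult_right_mono) simp
    also have "\<dots> = (1 + \<bar>a\<bar>) ^ 2 * (1 + \<bar>b\<bar>) ^ 4" by (simp add: power_mult_distrib power_add[symmetric])
    also have "\<dots> \<le> (1 + \<bar>a\<bar>) ^ 4 * (1 + \<bar>b\<bar>) ^ 4"
      by (intro mult_right_mono power_increasing) auto
    finally have "(1 + \<bar>a - b\<bar>) ^ 2 * (1 + \<bar>b\<bar>) ^ 2 \<le> (1 + \<bar>a\<bar>) ^ 4 * (1 + \<bar>b\<bar>) ^ 4" .
    moreover have "0 < (1 + \<bar>a - b\<bar>) ^ 2 * (1 + \<bar>b\<bar>) ^ 2" by (intro mult_pos_pos zero_less_power) auto
    ultimately have "1 / ((1 + \<bar>a\<bar>) ^ 4 * (1 + \<bar>b\<bar>) ^ 4) \<le> 1 / ((1 + \<bar>a - b\<bar>) ^ 2 * (1 + \<bar>b\<bar>) ^ 2)"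
      by (intro divide_left_mono mult_pos_pos) auto
    then show ?thesis by simp
  qed
  from this have "(\<Prod>i\<in>UNIV. 1 / (1 + \<bar>u $ i\<bar>) ^ 4 * (1 / (1 + \<bar>v $ i\<bar>) ^ 4)) \<le>
      (\<Prod>i\<in>UNIV. 1 / (1 + \<bar>u $ i - v $ i\<bar>) ^ 2 * (1 / (1 + \<bar>v $ i\<bar>) ^ 2))"
    by (intro prod_mono conjI) auto
  then show ?thesis unfolding rho_def om_def vector_minus_component by (simp only: prod.distrib)
qed

lemma om_shift_le:
  fixes v :: "real^'n::finite"
  assumes "\<And>i. \<bar>c $ i\<bar> \<le> p"
  shows "om (v + c) \<le> (1 + p) ^ (2 * CARD('n)) * om v"
proof -
  have "1 / (1 + \<bar>v $ i + c $ i\<bar>) ^ 2 \<le> (1 + p) ^ 2 * (1 / (1 + \<bar>v $ i\<bar>) ^ 2)" for i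
  proof -
    have p: "0 \<le> p" using assms[of i] by linarith
    have "\<bar>v $ i\<bar> \<le> \<bar>v $ i + c $ i\<bar> + p" using assms[of i] by linarith
    moreover have "0 \<le> p * \<bar>v $ i + c $ i\<bar>" using p by simp
    ultimately have "1 + \<bar>v $ i\<bar> \<le> (1 + p) * (1 + \<bar>v $ i + c $ i\<bar>)" by (simp add: algebra_simps)
    then have "(1 + \<bar>v $ i\<bar>) ^ 2 \<le> ((1 + p) * (1 + \<bar>v $ i + c $ i\<bar>)) ^ 2" by (intro power_mono) auto
    moreover have "(1 + \<bar>v $ i\<bar>) ^ 2 > 0" "(1 + \<bar>v $ i + c $ i\<bar>) ^ 2 > 0" by (intro zero_less_power; linarith)+
    ultimately show ?thesis by (simp add: divide_simps power_mult_distrib)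
  qed
  then have "(\<Prod>i\<in>UNIV. 1 / (1 + \<bar>v $ i + c $ i\<bar>) ^ 2) \<le> (\<Prod>i\<in>(UNIV :: 'n set). (1 + p) ^ 2 * (1 / (1 + \<bar>v $ i\<bar>) ^ 2))"
    by (intro prod_mono conjI) auto
  also have "\<dots> = ((1 + p) ^ 2) ^ CARD('n) * om v" unfolding prod.distrib om_def by (simp only: prod_constant)
  finally show ?thesis unfolding om_def[of "v + c"] vector_add_component by (simp only: power_mult)
qed

section \<open>Repeated differences along a line\<close>

lemma dcl_bound: "dcl k \<phi> W \<Longrightarrow> norm (\<phi> t) \<le> W t"
  by (cases k) auto

lemma dcl_SucI:
  "(\<And>t. norm (\<phi> t) \<le> W t) \<Longrightarrow> (\<And>t. (\<phi> has_vector_derivative \<phi>' t) (at t)) \<Longrightarrow> dcl k \<phi>' W \<Longrightarrow> dcl (Suc k) \<phi> W"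
  unfolding dcl.simps(2) by blast

lemma dif_Suc: "(dif c ^^ Suc k) F v = (dif c ^^ k) F (v + c) - (dif c ^^ k) F v"
  unfolding funpow.simps o_apply dif_def[of c "(dif c ^^ k) F"] ..

lemma dcl_SucD: "dcl (Suc k) \<phi> W \<Longrightarrow> dcl k \<phi> W"
proof (induction k arbitrary: \<phi>)
  case (Suc k)
  from Suc.prems obtain \<phi>' where d: "\<forall>t. (\<phi> has_vector_derivative \<phi>' t) (at t)" "dcl (Suc k) \<phi>' W"
    unfolding dcl.simps(2)[of "Suc k"] by blast
  then show ?case using Suc.IH[OF d(2)] Suc.prems unfolding dcl.simps(2) by blast
qed simp

lemma dcl_add: "dcl k u U \<Longrightarrow> dcl k v V \<Longrightarrow> dcl k (\<lambda>t. u t + v t) (\<lambda>t. U t + V t)"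
proof (induction k arbitrary: u v)
  case 0
  then show ?case by (auto intro: norm_triangle_le add_mono)
next
  case (Suc k)
  obtain u' where u: "\<And>t. (u has_vector_derivative u' t) (at t)" "dcl k u' U" using Suc.prems by auto
  obtain v' where v: "\<And>t. (v has_vector_derivative v' t) (at t)" "dcl k v' V" using Suc.prems by auto
  have "((\<lambda>t. u t + v t) has_vector_derivative u' t + v' t) (at t)" for t by (rule has_vector_derivative_add[OF u(1) v(1)])
  moreover have "norm (u t + v t) \<le> U t + V t" for t
    using dcl_bound[OF Suc.prems(1)] dcl_bound[OF Suc.prems(2)] by (intro norm_triangle_le add_mono)
  ultimately show ?case using Suc.IH[OF u(2) v(2)] by (intro dcl_SucI)
qed

lemma dcl_mult: "dcl k u U \<Longrightarrow> dcl k v V \<Longrightarrow> dcl k (\<lambda>t. u t * v t) (\<lambda>t. 2 ^ k * (U t * V t))"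
proof (induction k arbitrary: u v)
  case 0
  then show ?case by (auto simp: norm_mult intro!: mult_mono intro: order_trans[OF norm_ge_zero])
next
  case (Suc k)
  obtain u' where u: "\<And>t. (u has_vector_derivative u' t) (at t)" "dcl k u' U" using Suc.prems by auto
  obtain v' where v: "\<And>t. (v has_vector_derivative v' t) (at t)" "dcl k v' V" using Suc.prems by auto
  have nu: "norm (u t) \<le> U t" and nv: "norm (v t) \<le> V t" for t
    using dcl_bound[OF Suc.prems(1)] dcl_bound[OF Suc.prems(2)] by auto
  have UV: "0 \<le> U t * V t" for t using nu[of t] nv[of t] by (meson mult_nonneg_nonneg norm_ge_zero order_trans)
  have "norm (u t * v t) \<le> 2 ^ Suc k * (U t * V t)" for t
  proof -
    have "norm (u t * v t) \<le> U t * V t" unfolding norm_mult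
      using nu[of t] nv[of t] by (intro mult_mono) (auto intro: order_trans[OF norm_ge_zero])
    also have "\<dots> \<le> 2 ^ Suc k * (U t * V t)" using mult_right_mono[OF one_le_power[of 2 "Suc k"] UV[of t]] by simp
    finally show ?thesis .
  qed
  moreover have "((\<lambda>t. u t * v t) has_vector_derivative u t * v' t + u' t * v t) (at t)" for t
    by (rule has_vector_derivative_mult[OF u(1) v(1)])
  moreover have "dcl k (\<lambda>t. u t * v' t + u' t * v t) (\<lambda>t. 2 ^ k * (U t * V t) + 2 ^ k * (U t * V t))"
    by (intro dcl_add Suc.IH u(2) v(2) dcl_SucD[OF Suc.prems(1)] dcl_SucD[OF Suc.prems(2)])
  moreover have "2 ^ k * (U t * V t) + 2 ^ k * (U t * V t) = 2 ^ Suc k * (U t * V t)" for t by simp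
  ultimately show ?case by (intro dcl_SucI) (simp_all only:)
qed

lemma dcl_cnj: "dcl k u U \<Longrightarrow> dcl k (\<lambda>t. cnj (u t)) U"
proof (induction k arbitrary: u)
  case (Suc k)
  obtain u' where u: "\<And>t. (u has_vector_derivative u' t) (at t)" "dcl k u' U" using Suc.prems by auto
  have "((\<lambda>t. cnj (u t)) has_vector_derivative cnj (u' t)) (at t)" for t by (rule has_vector_derivative_cnj[OF u(1)])
  then show ?case by (rule dcl_SucI[rotated]) (simp_all add: Suc.IH[OF u(2)] dcl_bound[OF Suc.prems])
qed simp

lemma dif_pow_has_derivative:
  assumes "\<And>t. (\<phi> has_vector_derivative \<phi>' t) (at t)"
  shows "((dif c ^^ k) \<phi> has_vector_derivative (dif c ^^ k) \<phi>' t) (at t)"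
proof (induction k arbitrary: t)
  case 0
  then show ?case using assms by simp
next
  case (Suc k)
  let ?p = "(dif c ^^ k) \<phi>" and ?p' = "(dif c ^^ k) \<phi>'"
  have "((\<lambda>t. t + c) has_vector_derivative 1) (at t)" by (auto intro!: derivative_eq_intros)
  from vector_diff_chain_at[OF this Suc.IH] have "((\<lambda>t. ?p (t + c)) has_vector_derivative ?p' (t + c)) (at t)"
    by (simp add: o_def)
  from has_vector_derivative_diff[OF this Suc.IH] show ?case unfolding dif_Suc .
qed

text \<open>Differences commute with differentiation, so the mean value inequality can be applied k
  times, each time gaining a factor \<delta> and moving at most \<delta> to the right.\<close>

lemma dif_pow_bound:
  assumes "dcl k \<phi> W" "\<delta> > 0" "\<And>s. t \<le> s \<Longrightarrow> s \<le> t + real k * \<delta> \<Longrightarrow> W s \<le> B"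
  shows "norm ((dif \<delta> ^^ k) \<phi> t) \<le> \<delta> ^ k * B"
  using assms(1,3)
proof (induction k arbitrary: \<phi> t)
  case 0
  then show ?case by (auto intro: order_trans)
next
  case (Suc k)
  obtain \<phi>' where d: "\<And>t. (\<phi> has_vector_derivative \<phi>' t) (at t)" "dcl k \<phi>' W" using Suc.prems(1) by auto
  let ?p = "(dif \<delta> ^^ k) \<phi>" and ?p' = "(dif \<delta> ^^ k) \<phi>'"
  have der: "(?p has_vector_derivative ?p' s) (at s)" for s by (rule dif_pow_has_derivative[OF d(1)])
  have cont: "continuous_on {t..t + \<delta>} ?p"
    using der by (meson continuous_at_imp_continuous_on has_vector_derivative_continuous)
  have "\<exists>x\<in>{t<..<t + \<delta>}. norm (?p (t + \<delta>) - ?p t) \<le> norm ((\<lambda>h. h *\<^sub>R ?p' x) (t + \<delta> - t))"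
    by (rule mvt_general[of t "t + \<delta>" ?p "\<lambda>x h. h *\<^sub>R ?p' x"]) (use assms(2) cont der in \<open>auto simp: has_vector_derivative_def\<close>)
  then obtain x where x: "t < x" "x < t + \<delta>" "norm (?p (t + \<delta>) - ?p t) \<le> \<delta> * norm (?p' x)"
    using assms(2) by auto
  have "norm (?p' x) \<le> \<delta> ^ k * B"
  proof (rule Suc.IH[OF d(2)])
    fix s assume "x \<le> s" "s \<le> x + real k * \<delta>"
    then show "W s \<le> B" using x by (intro Suc.prems(2)) (auto simp: algebra_simps)
  qed
  then have "\<delta> * norm (?p' x) \<le> \<delta> * (\<delta> ^ k * B)" using assms(2) by simp
  then show ?case using x(3) unfolding dif_Suc power_Suc mult.assoc by linarith
qed

lemma dif_line: "(dif (\<delta> *\<^sub>R e) ^^ p) F (v + t *\<^sub>R e) = (dif \<delta> ^^ p) (\<lambda>t. F (v + t *\<^sub>R e)) t"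
proof (induction p arbitrary: t)
  case (Suc p)
  have e: "v + t *\<^sub>R e + \<delta> *\<^sub>R e = v + (t + \<delta>) *\<^sub>R e" by (simp add: algebra_simps)
  show ?case unfolding dif_Suc e Suc ..
qed simp

text \<open>Since \<open>(1 + \<bar>t\<bar>) ^ 4\<close> is at most 16 times
  \<open>1 + \<bar>t\<bar> ^ 4\<close>, multiplying out the inverse of \<open>rho\<close> leaves
  monomials with exponents 0 and 4, each bounded by the Schwartz condition.\<close>

lemma schwartz_decay:
  fixes f :: "real^'n::finite \<Rightarrow> complex"
  assumes f: "schwartz f"
  shows "\<exists>C\<ge>0. \<forall>v. norm (iter_partial is f v) \<le> C * rho v"
proof -
  let ?g = "iter_partial is f" and ?P = "\<Pi>\<^sub>E i\<in>(UNIV :: 'n set). {0, 4::nat}"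
  have fP: "finite ?P" by (rule finite_PiE) simp_all
  have "\<exists>B. \<forall>v. norm ((\<Prod>i\<in>UNIV. (v $ i) ^ \<alpha> i) *\<^sub>R ?g v) \<le> B" for \<alpha>
    using f unfolding schwartz_def bounded_iff by blast
  then obtain B where B: "\<And>\<alpha> v. norm ((\<Prod>i\<in>UNIV. (v $ i) ^ \<alpha> i) *\<^sub>R ?g v) \<le> B \<alpha>" by metis
  define C where "C = 16 ^ CARD('n) * (\<Sum>\<alpha>\<in>?P. B \<alpha>)"
  have B0: "0 \<le> B \<alpha>" for \<alpha> using B[of 0 \<alpha>] by (meson norm_ge_zero order_trans)
  have C0: "C \<ge> 0" unfolding C_def using B0 by (simp add: sum_nonneg)
  have t4: "(1 + \<bar>t\<bar>) ^ 4 \<le> 16 * (\<Sum>e\<in>{0, 4::nat}. \<bar>t\<bar> ^ e)" for t :: real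
  proof (cases "\<bar>t\<bar> \<le> 1")
    case True
    have "(1 + \<bar>t\<bar>) ^ 4 \<le> 2 ^ 4" using True by (intro power_mono) auto
    also have "\<dots> \<le> 16 * (1 + \<bar>t\<bar> ^ 4)" by simp
    finally show ?thesis by simp
  next
    case False
    have "(1 + \<bar>t\<bar>) ^ 4 \<le> (2 * \<bar>t\<bar>) ^ 4" using False by (intro power_mono) auto
    also have "\<dots> \<le> 16 * (1 + \<bar>t\<bar> ^ 4)" by (simp add: power_mult_distrib)
    finally show ?thesis by simp
  qed
  have "norm (?g v) \<le> C * rho v" for v
  proof -
    let ?Q = "\<Prod>i\<in>UNIV. (1 + \<bar>v $ i\<bar>) ^ 4"
    have Qp: "?Q > 0" by (intro prod_pos) (auto intro!: zero_less_power)
    have "?Q \<le> (\<Prod>i\<in>(UNIV :: 'n set). 16 * (\<Sum>e\<in>{0, 4::nat}. \<bar>v $ i\<bar> ^ e))"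
      using t4 by (intro prod_mono conjI) auto
    also have "\<dots> = 16 ^ CARD('n) * (\<Prod>i\<in>(UNIV :: 'n set). \<Sum>e\<in>{0, 4::nat}. \<bar>v $ i\<bar> ^ e)"
      unfolding prod.distrib by (simp only: prod_constant)
    also have "(\<Prod>i\<in>(UNIV :: 'n set). \<Sum>e\<in>{0, 4::nat}. \<bar>v $ i\<bar> ^ e) = (\<Sum>\<alpha>\<in>?P. \<Prod>i\<in>UNIV. \<bar>v $ i\<bar> ^ \<alpha> i)"
      by (rule prod_sum_PiE) simp_all
    finally have "?Q * norm (?g v) \<le> (16 ^ CARD('n) * (\<Sum>\<alpha>\<in>?P. \<Prod>i\<in>UNIV. \<bar>v $ i\<bar> ^ \<alpha> i)) * norm (?g v)"
      by (rule mult_right_mono) simp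
    also have "\<dots> = 16 ^ CARD('n) * (\<Sum>\<alpha>\<in>?P. norm ((\<Prod>i\<in>UNIV. (v $ i) ^ \<alpha> i) *\<^sub>R ?g v))"
      by (simp add: sum_distrib_right abs_prod power_abs mult.assoc)
    also have "\<dots> \<le> C" unfolding C_def using B by (intro mult_left_mono sum_mono) auto
    finally have "norm (?g v) \<le> C * (1 / ?Q)" using Qp by (simp add: pos_le_divide_eq mult.commute)
    also have "1 / ?Q = rho v" unfolding rho_def by (simp add: prod_dividef)
    finally show ?thesis .
  qed
  then show ?thesis using C0 by blast
qed

lemma line_dcl:
  fixes f :: "real^'n::finite \<Rightarrow> complex"
  assumes f: "schwartz f" and C: "\<And>i v. i \<le> p \<Longrightarrow> norm (iter_partial (replicate i j) f v) \<le> C * rho v"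
  shows "i + k \<le> p \<Longrightarrow> dcl k (\<lambda>t. iter_partial (replicate i j) f (v + t *\<^sub>R axis j 1)) (\<lambda>t. C * rho (v + t *\<^sub>R axis j 1))"
proof (induction k arbitrary: i)
  case 0
  then show ?case using C by simp
next
  case (Suc k)
  let ?g = "iter_partial (replicate i j) f" and ?e = "axis j 1 :: real^'n"
  have "((\<lambda>t. ?g (v + t *\<^sub>R ?e)) has_vector_derivative iter_partial (replicate (Suc i) j) f (v + t *\<^sub>R ?e)) (at t)" for t
  proof -
    have "?g differentiable_on UNIV" using f unfolding schwartz_def by blast
    then have "?g differentiable (at (v + t *\<^sub>R ?e))" by (simp add: differentiable_on_def)
    then have g: "(?g has_derivative frechet_derivative ?g (at (v + t *\<^sub>R ?e))) (at (v + t *\<^sub>R ?e))"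
      unfolding frechet_derivative_works .
    have l: "((\<lambda>t. v + t *\<^sub>R ?e) has_derivative (\<lambda>s. s *\<^sub>R ?e)) (at t)" by (auto intro!: derivative_eq_intros)
    have "frechet_derivative ?g (at (v + t *\<^sub>R ?e)) (s *\<^sub>R ?e) = s *\<^sub>R partial_deriv j ?g (v + t *\<^sub>R ?e)" for s
      unfolding partial_deriv_def using linear_scale[OF has_derivative_linear[OF g]] .
    then show ?thesis using diff_chain_at[OF l g]
      unfolding has_vector_derivative_def by (simp add: o_def iter_partial_def)
  qed
  moreover have "dcl k (\<lambda>t. iter_partial (replicate (Suc i) j) f (v + t *\<^sub>R ?e)) (\<lambda>t. C * rho (v + t *\<^sub>R ?e))"
    using Suc.prems by (intro Suc.IH) simp
  moreover have "norm (?g (v + t *\<^sub>R ?e)) \<le> C * rho (v + t *\<^sub>R ?e)" for t using Suc.prems by (intro C) simp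
  ultimately show ?case by (intro dcl_SucI)
qed

text \<open>The step \<open>1 / M\<close> is one lattice step in the rescaled variable. With
  \<open>M \<ge> 1\<close>, p steps move by at most p, so the decay weights change by a constant
  factor.\<close>

lemma difference_bound:
  fixes f :: "real^'n::finite \<Rightarrow> complex"
  assumes f: "schwartz f"
  shows "\<exists>K\<ge>0. \<forall>j u v M. M \<ge> 1 \<longrightarrow>
    norm ((dif ((1 / M) *\<^sub>R axis j 1) ^^ p) (\<lambda>v. f (v + u) * cnj (f v)) v) \<le> K * ((1 / M) ^ p * (om u * om v))"
proof -
  have "\<exists>C. C \<ge> 0 \<and> (\<forall>v. norm (iter_partial is f v) \<le> C * rho v)" for "is" using schwartz_decay[OF f] by blast
  then obtain D where D: "\<And>is. D is \<ge> 0" "\<And>is v. norm (iter_partial is f v) \<le> D is * rho v" by metis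
  define C where "C = (\<Sum>j\<in>UNIV. \<Sum>i\<le>p. D (replicate i j))"
  have C0: "C \<ge> 0" unfolding C_def by (intro sum_nonneg D(1))
  have CD: "norm (iter_partial (replicate i j) f v) \<le> C * rho v" if "i \<le> p" for i j v
  proof -
    have "D (replicate i j) \<le> (\<Sum>i\<le>p. D (replicate i j))" by (rule member_le_sum) (use that D(1) in auto)
    also have "\<dots> \<le> C" unfolding C_def by (rule member_le_sum) (auto intro: sum_nonneg D(1))
    finally show ?thesis using D(2)[of "replicate i j" v] mult_right_mono[OF _ rho_nonneg[of v]] by (meson order_trans)
  qed
  define K where "K = 2 ^ p * (C * C) * (1 + real p) ^ (2 * CARD('n))"
  have "norm ((dif ((1 / M) *\<^sub>R axis j 1) ^^ p) (\<lambda>v. f (v + u) * cnj (f v)) v) \<le> K * ((1 / M) ^ p * (om u * om v))"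
    if M: "M \<ge> 1" for j u v and M :: real
  proof -
    let ?e = "axis j 1 :: real^'n" and ?F = "\<lambda>v. f (v + u) * cnj (f v)"
    have f0: "iter_partial (replicate 0 j) f = f" by (simp add: iter_partial_def)
    have d1: "dcl p (\<lambda>t. f (v' + t *\<^sub>R ?e)) (\<lambda>t. C * rho (v' + t *\<^sub>R ?e))" for v'
      using line_dcl[OF f, of p j C 0 p v', OF CD] unfolding f0 by simp
    have d: "dcl p (\<lambda>t. f (v + t *\<^sub>R ?e + u) * cnj (f (v + t *\<^sub>R ?e)))
      (\<lambda>t. 2 ^ p * ((C * rho (v + t *\<^sub>R ?e + u)) * (C * rho (v + t *\<^sub>R ?e))))"
      using dcl_mult[OF d1[of "v + u"] dcl_cnj[OF d1[of v]]] by (simp add: add_ac)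
    have W: "2 ^ p * ((C * rho (v + s *\<^sub>R ?e + u)) * (C * rho (v + s *\<^sub>R ?e))) \<le> K * (om u * om v)"
      if s: "0 \<le> s" "s \<le> 0 + real p * (1 / M)" for s
    proof -
      have "real p * (1 / M) \<le> real p * 1" using M by (intro mult_left_mono) auto
      then have sp: "s \<le> real p" using s by simp
      have "rho (v + s *\<^sub>R ?e + u) * rho (v + s *\<^sub>R ?e) \<le> om u * om (v + s *\<^sub>R ?e)"
        using rho_mult_le[of "v + s *\<^sub>R ?e + u" "v + s *\<^sub>R ?e"] by simp
      also have "\<dots> \<le> om u * ((1 + real p) ^ (2 * CARD('n)) * om v)"
        using sp s by (intro mult_left_mono om_shift_le om_nonneg) (auto simp: axis_def)
      finally have "2 ^ p * (C * C) * (rho (v + s *\<^sub>R ?e + u) * rho (v + s *\<^sub>R ?e)) \<le>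
        2 ^ p * (C * C) * (om u * ((1 + real p) ^ (2 * CARD('n)) * om v))" using C0 by (intro mult_left_mono) auto
      then show ?thesis by (simp add: K_def mult_ac)
    qed
    have Mp: "1 / M > 0" using M by simp
    have "norm ((dif (1 / M) ^^ p) (\<lambda>t. ?F (v + t *\<^sub>R ?e)) 0) \<le> (1 / M) ^ p * (K * (om u * om v))"
      by (rule dif_pow_bound[OF d Mp W])
    then show ?thesis using dif_line[where \<delta> = "1 / M" and e = ?e and F = ?F and t = 0 and p = p and v = v] by (simp add: mult_ac)
  qed
  moreover have "K \<ge> 0" using C0 by (simp add: K_def)
  ultimately show ?thesis by blast
qed

section \<open>Sums over cells\<close>

text \<open>The correction \<open>2 / (K + 1)\<close> lets the induction telescope; the sum is then
  below 3 for every K.\<close>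

lemma sum_inverse_squares_le:
  "(\<Sum>k\<in>{- int K..int K}. 1 / (1 + real_of_int \<bar>k\<bar>) ^ 2) \<le> 3 - 2 / (real K + 1)"
proof (induction K)
  case (Suc K)
  have e: "{- int (Suc K)..int (Suc K)} = insert (int (Suc K)) (insert (- int (Suc K)) {- int K..int K})" by auto
  have "(\<Sum>k\<in>{- int (Suc K)..int (Suc K)}. 1 / (1 + real_of_int \<bar>k\<bar>) ^ 2) =
    2 * (1 / (real K + 2) ^ 2) + (\<Sum>k\<in>{- int K..int K}. 1 / (1 + real_of_int \<bar>k\<bar>) ^ 2)"
    unfolding e by (simp add: add.commute[of 2])
  also have "\<dots> \<le> 2 * (1 / (real K + 2) ^ 2) + (3 - 2 / (real K + 1))" using Suc by simp
  also have "\<dots> \<le> 3 - 2 / (real (Suc K) + 1)"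
  proof -
    have "1 / (real K + 2) ^ 2 \<le> 1 / ((real K + 1) * (real K + 2))"
      by (intro divide_left_mono) (auto simp: power2_eq_square)
    also have "\<dots> = 1 / (real K + 1) - 1 / (real K + 2)" by (simp add: field_simps)
    finally show ?thesis by (simp add: algebra_simps)
  qed
  finally show ?case .
qed simp

lemma floor_weight_le:
  fixes t \<epsilon> :: real
  assumes "0 < \<epsilon>" "\<epsilon> \<le> 1 / 2"
  shows "1 / (1 + \<bar>t\<bar>) ^ 2 \<le> (1 / \<epsilon> ^ 2) * (1 / (1 + real_of_int \<bar>\<lfloor>t / \<epsilon>\<rfloor>\<bar>) ^ 2)"
proof -
  let ?k = "real_of_int \<bar>\<lfloor>t / \<epsilon>\<rfloor>\<bar>"
  have "?k \<le> \<bar>t / \<epsilon>\<bar> + 1" by linarith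
  then have "\<epsilon> * ?k \<le> \<epsilon> * (\<bar>t / \<epsilon>\<bar> + 1)" using assms by (intro mult_left_mono) auto
  also have "\<dots> = \<bar>t\<bar> + \<epsilon>" using assms by (simp add: abs_divide distrib_left)
  finally have "\<epsilon> * (1 + ?k) \<le> 1 + \<bar>t\<bar>" using assms by (simp add: distrib_left)
  then have "(\<epsilon> * (1 + ?k)) ^ 2 \<le> (1 + \<bar>t\<bar>) ^ 2" using assms by (intro power_mono) auto
  moreover have "0 < (\<epsilon> * (1 + ?k)) ^ 2" using assms by (intro zero_less_power mult_pos_pos) auto
  ultimately have "1 / (1 + \<bar>t\<bar>) ^ 2 \<le> 1 / (\<epsilon> * (1 + ?k)) ^ 2" by (intro divide_left_mono mult_pos_pos) auto
  then show ?thesis by (simp add: power_mult_distrib)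
qed

text \<open>Points with equal floors of \<open>T / \<epsilon>\<close> are \<epsilon>-close in every
  coordinate, so a cell holds at most B of them. The weights of the cells form a product of
  one-dimensional sums, each at most \<open>3 / \<epsilon> ^ 2\<close>.\<close>

lemma cell_sum:
  fixes T :: "'h \<Rightarrow> 'i::finite \<Rightarrow> real"
  assumes H: "finite H" and e: "0 < \<epsilon>" "\<epsilon> \<le> 1 / 2" and B: "B \<ge> 0"
    and fib: "\<And>h0. h0 \<in> H \<Longrightarrow> real (card {h\<in>H. \<forall>i. \<bar>T h i - T h0 i\<bar> \<le> \<epsilon>}) \<le> B"
  shows "(\<Sum>h\<in>H. \<Prod>i\<in>UNIV. 1 / (1 + \<bar>T h i\<bar>) ^ 2) \<le> B * (3 / \<epsilon> ^ 2) ^ CARD('i)"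
proof -
  define key where "key h = (\<lambda>i. \<lfloor>T h i / \<epsilon>\<rfloor>)" for h
  define wt where "wt k = (\<Prod>i\<in>UNIV. (1 / \<epsilon> ^ 2) * (1 / (1 + real_of_int \<bar>k i\<bar>) ^ 2))" for k :: "'i \<Rightarrow> int"
  have wt0: "wt k \<ge> 0" for k unfolding wt_def by (intro prod_nonneg) simp
  have wle: "(\<Prod>i\<in>UNIV. 1 / (1 + \<bar>T h i\<bar>) ^ 2) \<le> wt (key h)" for h
    unfolding wt_def key_def using floor_weight_le[OF e] by (intro prod_mono conjI) auto
  have "(\<Sum>h\<in>H. \<Prod>i\<in>UNIV. 1 / (1 + \<bar>T h i\<bar>) ^ 2) \<le> (\<Sum>h\<in>H. wt (key h))" by (intro sum_mono wle)
  also have "\<dots> = (\<Sum>k\<in>key ` H. \<Sum>h\<in>{h\<in>H. key h = k}. wt (key h))" by (rule sum.image_gen[OF H])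
  also have "\<dots> = (\<Sum>k\<in>key ` H. real (card {h\<in>H. key h = k}) * wt k)" by (intro sum.cong refl) simp
  also have "\<dots> \<le> (\<Sum>k\<in>key ` H. B * wt k)"
  proof (intro sum_mono mult_right_mono wt0)
    fix k assume "k \<in> key ` H"
    then obtain h0 where h0: "h0 \<in> H" "k = key h0" by blast
    have "{h\<in>H. key h = k} \<subseteq> {h\<in>H. \<forall>i. \<bar>T h i - T h0 i\<bar> \<le> \<epsilon>}"
    proof (rule subsetI)
      fix h assume "h \<in> {h\<in>H. key h = k}"
      then have h: "h \<in> H" "key h = key h0" using h0 by auto
      have "\<bar>T h i - T h0 i\<bar> \<le> \<epsilon>" for i
      proof -
        have "\<lfloor>T h i / \<epsilon>\<rfloor> = \<lfloor>T h0 i / \<epsilon>\<rfloor>" using fun_cong[OF h(2), of i] by (simp add: key_def)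
        then have "\<bar>T h i / \<epsilon> - T h0 i / \<epsilon>\<bar> \<le> 1" by linarith
        then have "\<bar>(T h i - T h0 i) / \<epsilon>\<bar> \<le> 1" by (simp add: diff_divide_distrib)
        then show ?thesis using e by (simp add: abs_divide)
      qed
      then show "h \<in> {h\<in>H. \<forall>i. \<bar>T h i - T h0 i\<bar> \<le> \<epsilon>}" using h(1) by blast
    qed
    then have "card {h\<in>H. key h = k} \<le> card {h\<in>H. \<forall>i. \<bar>T h i - T h0 i\<bar> \<le> \<epsilon>}" by (intro card_mono) (simp_all add: H)
    then show "real (card {h\<in>H. key h = k}) \<le> B" using fib[OF h0(1)] by linarith
  qed
  also have "\<dots> = B * (\<Sum>k\<in>key ` H. wt k)" by (rule sum_distrib_left[symmetric])
  also have "\<dots> \<le> B * (3 / \<epsilon> ^ 2) ^ CARD('i)"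
  proof (rule mult_left_mono[OF _ B])
    define K where "K = (\<Sum>h\<in>H. \<Sum>i\<in>UNIV. nat \<bar>key h i\<bar>)"
    let ?I = "{- int K..int K}"
    have "key ` H \<subseteq> (\<Pi>\<^sub>E i\<in>UNIV. ?I)"
    proof (rule image_subsetI)
      fix h assume h: "h \<in> H"
      have "nat \<bar>key h i\<bar> \<le> K" for i
      proof -
        have "nat \<bar>key h i\<bar> \<le> (\<Sum>i\<in>UNIV. nat \<bar>key h i\<bar>)" by (rule member_le_sum) simp_all
        also have "\<dots> \<le> K" unfolding K_def by (rule member_le_sum[OF h _ H]) simp
        finally show ?thesis .
      qed
      then have "key h i \<in> ?I" for i by (simp add: nat_le_iff abs_le_iff) (meson minus_le_iff)
      then show "key h \<in> (\<Pi>\<^sub>E i\<in>UNIV. ?I)" by (simp add: PiE_iff)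
    qed
    then have "(\<Sum>k\<in>key ` H. wt k) \<le> (\<Sum>k\<in>(\<Pi>\<^sub>E i\<in>UNIV. ?I). wt k)"
      by (intro sum_mono2 finite_PiE) (simp_all add: wt0)
    also have "\<dots> = (\<Prod>i\<in>(UNIV :: 'i set). \<Sum>k\<in>?I. (1 / \<epsilon> ^ 2) * (1 / (1 + real_of_int \<bar>k\<bar>) ^ 2))"
      unfolding wt_def by (rule prod_sum_PiE[symmetric]) simp_all
    also have "\<dots> = ((1 / \<epsilon> ^ 2) * (\<Sum>k\<in>?I. 1 / (1 + real_of_int \<bar>k\<bar>) ^ 2)) ^ CARD('i)"
      by (simp only: sum_distrib_left[symmetric] prod_constant)
    also have "\<dots> \<le> ((1 / \<epsilon> ^ 2) * 3) ^ CARD('i)"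
    proof (intro power_mono mult_left_mono)
      have "2 / (real K + 1) \<ge> 0" by simp
      then show "(\<Sum>k\<in>?I. 1 / (1 + real_of_int \<bar>k\<bar>) ^ 2) \<le> 3" using sum_inverse_squares_le[of K] by linarith
      show "0 \<le> 1 / \<epsilon> ^ 2 * (\<Sum>k\<in>?I. 1 / (1 + real_of_int \<bar>k\<bar>) ^ 2)" by (intro mult_nonneg_nonneg sum_nonneg) simp_all
    qed simp
    finally show "(\<Sum>k\<in>key ` H. wt k) \<le> (3 / \<epsilon> ^ 2) ^ CARD('i)" by simp
  qed
  finally show ?thesis .
qed

section \<open>Theta sums and short vectors\<close>

definition ee :: "real \<Rightarrow> complex" where
  "ee t = e_fun (complex_of_real t)"

lemma ee_cis: "ee t = cis (2 * pi * t)"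
  by (simp add: ee_def e_fun_def cis_conv_exp mult_ac)

lemma ee_add: "ee (s + t) = ee s * ee t"
  by (simp add: ee_cis cis_mult distrib_left)

lemma norm_ee [simp]: "norm (ee t) = 1"
  by (simp add: ee_cis)

lemma cnj_ee: "cnj (ee t) = ee (- t)"
  by (simp add: ee_cis cis_cnj)

lemma ee_Ints: "k \<in> \<int> \<Longrightarrow> ee (t + k) = ee t"
proof -
  assume "k \<in> \<int>"
  then have "ee k = 1" unfolding ee_cis by (rule cis_multiple_2pi)
  then show ?thesis by (simp add: ee_add)
qed

text \<open>The norm equals \<open>2 * sin (pi * \<bar>t\<bar>)\<close>, and the argument is at most
  2, where Taylor's formula of order 3 gives \<open>sin x \<ge> x / 3\<close>.\<close>

lemma norm_ee_minus_one_ge: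
  assumes "\<bar>t\<bar> \<le> 1 / 2"
  shows "\<bar>t\<bar> \<le> norm (ee t - 1)"
proof -
  have sin3: "x / 3 \<le> sin x" if x: "0 \<le> x" "x \<le> 2" for x :: real
  proof -
    obtain s where s: "sin x = (\<Sum>m<3. sin_coeff m * x ^ m) + (sin (s + 1 / 2 * real 3 * pi) / fact 3) * x ^ 3"
      using Maclaurin_sin_expansion[of x 3] by blast
    have c: "(\<Sum>m<3. sin_coeff m * x ^ m) = x" by (simp add: sin_coeff_def eval_nat_numeral)
    have "- (x ^ 3) \<le> sin (s + 1 / 2 * real 3 * pi) * x ^ 3"
      using mult_right_mono[OF sin_ge_minus_one, of "x ^ 3"] x by simp
    then have "x - x ^ 3 / 6 \<le> sin x" unfolding s c by (simp add: fact_numeral field_simps)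
    moreover have "x ^ 3 \<le> 4 * x"
    proof -
      have "x ^ 2 \<le> 2 ^ 2" using x by (intro power_mono) auto
      then have "x ^ 2 * x \<le> 4 * x" using x by (intro mult_right_mono) auto
      then show ?thesis by (simp add: power3_eq_cube power2_eq_square)
    qed
    ultimately show ?thesis by linarith
  qed
  have "(norm (ee t - 1))\<^sup>2 = (cos (2 * (pi * t)) - 1)\<^sup>2 + (sin (2 * (pi * t)))\<^sup>2"
    unfolding ee_cis cmod_power2 by (simp add: mult.assoc)
  also have "\<dots> = 2 - 2 * cos (2 * (pi * t))"
    using sin_cos_squared_add[of "2 * (pi * t)"] by (simp add: power2_diff)
  also have "\<dots> = (2 * sin (pi * t))\<^sup>2" unfolding cos_double_sin by (simp add: power_mult_distrib)
  finally have "norm (ee t - 1) = \<bar>2 * sin (pi * t)\<bar>" by (metis norm_ge_zero abs_of_nonneg power2_eq_iff_nonneg real_sqrt_abs real_sqrt_unique)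
  also have "\<dots> = 2 * sin (pi * \<bar>t\<bar>)"
  proof -
    have "pi * \<bar>t\<bar> \<le> pi" using assms mult_left_mono[of "\<bar>t\<bar>" 1 pi] by simp
    then have "0 \<le> sin (pi * \<bar>t\<bar>)" by (intro sin_ge_zero) simp_all
    then show ?thesis by (cases "t \<ge> 0") (simp_all add: abs_mult)
  qed
  also have "2 * sin (pi * \<bar>t\<bar>) \<ge> 2 * (pi * \<bar>t\<bar> / 3)"
  proof -
    have "pi * \<bar>t\<bar> \<le> 4 * (1 / 2)" using assms pi_less_4 by (intro mult_mono) auto
    then show ?thesis using sin3[of "pi * \<bar>t\<bar>"] by simp
  qed
  finally have "2 * (pi * \<bar>t\<bar> / 3) \<le> norm (ee t - 1)" .
  moreover have "2 * \<bar>t\<bar> \<le> pi * \<bar>t\<bar>" using pi_ge_two by (intro mult_right_mono) auto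
  ultimately show ?thesis by linarith
qed

section \<open>Sums of the decay weight over integer vectors\<close>

lemma card_int_box_le:
  assumes "c \<ge> 0"
  shows "real (card {h\<in>ZJ (UNIV :: 'n::finite set). \<forall>i. \<bar>h $ i\<bar> \<le> c}) \<le> (2 * c + 1) ^ CARD('n)"
proof -
  let ?B = "{h\<in>ZJ (UNIV :: 'n set). \<forall>i. \<bar>h $ i\<bar> \<le> c}" and ?P = "\<Pi>\<^sub>E i\<in>(UNIV :: 'n set). {- \<lfloor>c\<rfloor>..\<lfloor>c\<rfloor>}"
  have inj: "inj_on (\<lambda>h i. \<lfloor>h $ i\<rfloor>) ?B"
  proof (rule inj_onI)
    fix h g :: "real^'n" assume hg: "h \<in> ?B" "g \<in> ?B" "(\<lambda>i. \<lfloor>h $ i\<rfloor>) = (\<lambda>i. \<lfloor>g $ i\<rfloor>)"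
    have "h $ i = g $ i" for i
    proof -
      have "h $ i = of_int \<lfloor>h $ i\<rfloor>" "g $ i = of_int \<lfloor>g $ i\<rfloor>" using hg(1,2) by (auto simp: ZJ_def)
      then show ?thesis using fun_cong[OF hg(3), of i] by simp
    qed
    then show "h = g" by (simp add: vec_eq_iff)
  qed
  have "card ?B \<le> card ?P"
  proof (rule card_inj_on_le[OF inj])
    show "(\<lambda>h i. \<lfloor>h $ i\<rfloor>) ` ?B \<subseteq> ?P"
    proof (rule image_subsetI)
      fix h assume h: "h \<in> ?B"
      have "\<lfloor>h $ i\<rfloor> \<in> {- \<lfloor>c\<rfloor>..\<lfloor>c\<rfloor>}" for i
      proof -
        have "h $ i \<in> \<int>" using h by (simp add: ZJ_def)
        then obtain z where z: "h $ i = of_int z" by (rule Ints_cases)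
        have "\<bar>h $ i\<bar> \<le> c" using h by simp
        then have "\<bar>real_of_int z\<bar> \<le> c" unfolding z .
        then have "z \<le> \<lfloor>c\<rfloor>" "- z \<le> \<lfloor>c\<rfloor>" by (simp_all add: le_floor_iff)
        then show ?thesis using z by simp
      qed
      then show "(\<lambda>i. \<lfloor>h $ i\<rfloor>) \<in> ?P" by (simp add: PiE_iff)
    qed
    show "finite ?P" by (rule finite_PiE) simp_all
  qed
  also have "card ?P = nat (2 * \<lfloor>c\<rfloor> + 1) ^ CARD('n)" by (simp add: card_PiE)
  finally have "real (card ?B) \<le> real (nat (2 * \<lfloor>c\<rfloor> + 1)) ^ CARD('n)" by (simp only: of_nat_power[symmetric] of_nat_le_iff)
  also have "\<dots> \<le> (2 * c + 1) ^ CARD('n)" using assms by (intro power_mono) (auto simp: of_nat_nat)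
  finally show ?thesis .
qed

text \<open>\<open>cell_sum\<close> with \<epsilon> = 1/2: a cell has side \<open>M / 2\<close> in
  m, hence at most \<open>(M + 1) ^ n\<close> integer points, and the weights contribute
  \<open>12 ^ n\<close>.\<close>

lemma om_sum_le:
  fixes x :: "real^'n::finite"
  assumes M: "M \<ge> 1" and F: "finite F" "F \<subseteq> ZJ UNIV"
  shows "(\<Sum>m\<in>F. om ((1 / M) *\<^sub>R (m + x))) \<le> (24 * M) ^ CARD('n)"
proof -
  let ?T = "\<lambda>m i. ((1 / M) *\<^sub>R (m + x)) $ i"
  have "(\<Sum>m\<in>F. \<Prod>i\<in>UNIV. 1 / (1 + \<bar>?T m i\<bar>) ^ 2) \<le> (2 * M) ^ CARD('n) * (3 / (1 / 2) ^ 2) ^ CARD('n)"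
  proof (rule cell_sum[OF F(1)])
    fix m0 assume m0: "m0 \<in> F"
    let ?B = "{h\<in>ZJ (UNIV :: 'n set). \<forall>i. \<bar>h $ i\<bar> \<le> M / 2}"
    have "card {m\<in>F. \<forall>i. \<bar>?T m i - ?T m0 i\<bar> \<le> 1 / 2} \<le> card ?B"
    proof (rule card_inj_on_le[of "\<lambda>m. m - m0"])
      show "(\<lambda>m. m - m0) ` {m\<in>F. \<forall>i. \<bar>?T m i - ?T m0 i\<bar> \<le> 1 / 2} \<subseteq> ?B"
      proof (rule image_subsetI)
        fix m assume m: "m \<in> {m\<in>F. \<forall>i. \<bar>?T m i - ?T m0 i\<bar> \<le> 1 / 2}"
        have "\<bar>(m - m0) $ i\<bar> \<le> M / 2" for i
        proof -
          have "?T m i - ?T m0 i = (m - m0) $ i / M" by (simp add: diff_divide_distrib[symmetric])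
          then have "\<bar>(m - m0) $ i / M\<bar> \<le> 1 / 2" using m by (metis (mono_tags, lifting) mem_Collect_eq)
          then show ?thesis using M by (simp add: abs_divide field_simps)
        qed
        moreover have "m - m0 \<in> ZJ UNIV" using m m0 F(2) by (intro subgrp_diff[OF subgrp_ZJ]) auto
        ultimately show "m - m0 \<in> ?B" by blast
      qed
    qed (use finite_int_box[of "UNIV :: 'n set" "M / 2"] in \<open>auto simp: inj_on_def\<close>)
    then have "real (card {m\<in>F. \<forall>i. \<bar>?T m i - ?T m0 i\<bar> \<le> 1 / 2}) \<le> (2 * (M / 2) + 1) ^ CARD('n)"
      using card_int_box_le[of "M / 2", where 'n = 'n] M by linarith
    also have "\<dots> \<le> (2 * M) ^ CARD('n)" using M by (intro power_mono) auto
    finally show "real (card {m\<in>F. \<forall>i. \<bar>?T m i - ?T m0 i\<bar> \<le> 1 / 2}) \<le> (2 * M) ^ CARD('n)" .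
  qed (use M in auto)
  also have "\<dots> = (24 * M) ^ CARD('n)" unfolding power_mult_distrib[symmetric] by (simp add: power2_eq_square)
  finally show ?thesis unfolding om_def .
qed

lemma om_summable:
  fixes x :: "real^'n::finite"
  assumes M: "M \<ge> 1"
  shows "(\<lambda>m. om ((1 / M) *\<^sub>R (m + x))) summable_on ZJ UNIV"
    "(\<Sum>\<^sub>\<infinity>m\<in>ZJ UNIV. om ((1 / M) *\<^sub>R (m + x))) \<le> (24 * M) ^ CARD('n)"
proof -
  show s: "(\<lambda>m. om ((1 / M) *\<^sub>R (m + x))) summable_on ZJ UNIV"
    by (rule nonneg_bdd_above_summable_on[OF om_nonneg], rule bdd_aboveI2[where M = "(24 * M) ^ CARD('n)"])
      (use om_sum_le[OF M] in blast)
  show "(\<Sum>\<^sub>\<infinity>m\<in>ZJ UNIV. om ((1 / M) *\<^sub>R (m + x))) \<le> (24 * M) ^ CARD('n)"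
    by (rule infsum_le_finite_sums[OF s]) (rule om_sum_le[OF M])
qed

section \<open>Summation by parts\<close>

lemma bij_shift_ZJ: "h \<in> ZJ UNIV \<Longrightarrow> bij_betw (\<lambda>m. m + h) (ZJ UNIV) (ZJ UNIV)"
  by (rule bij_betwI[where g = "\<lambda>m. m - h"]) (auto intro: subgrp_add[OF subgrp_ZJ] subgrp_diff[OF subgrp_ZJ])

text \<open>Shifting m by \<open>axis j 1\<close> multiplies the character by a constant, so each
  difference on G becomes a factor \<open>ee (- \<alpha> $ j) - 1\<close> on the sum.\<close>

lemma dif_pow_sum:
  fixes G :: "real^'n::finite \<Rightarrow> complex"
  assumes "(\<lambda>m. norm (G m)) summable_on ZJ UNIV"
  shows "(\<lambda>m. norm ((dif (axis j 1) ^^ p) G m)) summable_on ZJ UNIV \<and>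
    (\<Sum>\<^sub>\<infinity>m\<in>ZJ UNIV. (dif (axis j 1) ^^ p) G m * ee (m \<bullet> \<alpha>)) = (ee (- \<alpha> $ j) - 1) ^ p * (\<Sum>\<^sub>\<infinity>m\<in>ZJ UNIV. G m * ee (m \<bullet> \<alpha>))"
proof (induction p)
  case 0
  then show ?case using assms by simp
next
  case (Suc p)
  let ?Z = "ZJ (UNIV :: 'n set)" and ?e = "axis j 1 :: real^'n" and ?H = "(dif (axis j 1) ^^ p) G"
  have bij: "bij_betw (\<lambda>m. m + ?e) ?Z ?Z" by (rule bij_shift_ZJ) (simp add: axis_in_ZJ)
  have s1: "(\<lambda>m. norm (?H m)) summable_on ?Z" using Suc by blast
  have s2: "(\<lambda>m. norm (?H (m + ?e))) summable_on ?Z"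
    using summable_on_reindex_bij_betw[OF bij, of "\<lambda>m. norm (?H m)"] s1 by simp
  have s3: "(\<lambda>m. norm ((dif ?e ^^ Suc p) G m)) summable_on ?Z"
  proof (rule summable_on_comparison_test[OF summable_on_add[OF s2 s1]])
    show "norm ((dif ?e ^^ Suc p) G m) \<le> norm (?H (m + ?e)) + norm (?H m)" for m
      unfolding dif_Suc by (rule norm_triangle_ineq4)
  qed simp
  have t1: "(\<lambda>m. ?H m * ee (m \<bullet> \<alpha>)) summable_on ?Z"
    by (rule abs_summable_summable) (simp add: norm_mult s1)
  have t2: "(\<lambda>m. ?H (m + ?e) * ee ((m + ?e) \<bullet> \<alpha>)) summable_on ?Z"
    by (rule abs_summable_summable) (simp add: norm_mult s2)
  have eq: "(dif ?e ^^ Suc p) G m * ee (m \<bullet> \<alpha>) = ee (- \<alpha> $ j) * (?H (m + ?e) * ee ((m + ?e) \<bullet> \<alpha>)) - ?H m * ee (m \<bullet> \<alpha>)" for m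
  proof -
    have "m \<bullet> \<alpha> = - \<alpha> $ j + (m + ?e) \<bullet> \<alpha>" by (simp add: inner_add_left inner_axis')
    then have "ee (m \<bullet> \<alpha>) = ee (- \<alpha> $ j) * ee ((m + ?e) \<bullet> \<alpha>)" by (simp only: ee_add)
    then have "?H (m + ?e) * ee (m \<bullet> \<alpha>) = ee (- \<alpha> $ j) * (?H (m + ?e) * ee ((m + ?e) \<bullet> \<alpha>))" by (simp only: mult_ac)
    then show ?thesis unfolding dif_Suc left_diff_distrib by simp
  qed
  have "(\<Sum>\<^sub>\<infinity>m\<in>?Z. (dif ?e ^^ Suc p) G m * ee (m \<bullet> \<alpha>)) =
    (\<Sum>\<^sub>\<infinity>m\<in>?Z. ee (- \<alpha> $ j) * (?H (m + ?e) * ee ((m + ?e) \<bullet> \<alpha>))) - (\<Sum>\<^sub>\<infinity>m\<in>?Z. ?H m * ee (m \<bullet> \<alpha>))"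
    unfolding eq diff_conv_add_uminus infsum_uminus[symmetric]
    by (rule infsum_add[OF summable_on_cmult_right[OF t2] summable_on_uminus[THEN iffD2, OF t1]])
  also have "(\<Sum>\<^sub>\<infinity>m\<in>?Z. ee (- \<alpha> $ j) * (?H (m + ?e) * ee ((m + ?e) \<bullet> \<alpha>))) =
    ee (- \<alpha> $ j) * (\<Sum>\<^sub>\<infinity>m\<in>?Z. ?H (m + ?e) * ee ((m + ?e) \<bullet> \<alpha>))" by (rule infsum_cmult_right) (rule t2)
  also have "(\<Sum>\<^sub>\<infinity>m\<in>?Z. ?H (m + ?e) * ee ((m + ?e) \<bullet> \<alpha>)) = (\<Sum>\<^sub>\<infinity>m\<in>?Z. ?H m * ee (m \<bullet> \<alpha>))"
    by (rule infsum_reindex_bij_betw[OF bij, of "\<lambda>m. ?H m * ee (m \<bullet> \<alpha>)"])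
  finally have "(\<Sum>\<^sub>\<infinity>m\<in>?Z. (dif ?e ^^ Suc p) G m * ee (m \<bullet> \<alpha>)) = (ee (- \<alpha> $ j) - 1) * (\<Sum>\<^sub>\<infinity>m\<in>?Z. ?H m * ee (m \<bullet> \<alpha>))"
    by (simp add: left_diff_distrib)
  then show ?case using s3 Suc by (simp add: mult.assoc del: funpow.simps)
qed

lemma dif_affine: "(dif e ^^ p) (\<lambda>m. F (c *\<^sub>R (m + x))) m = (dif (c *\<^sub>R e) ^^ p) F (c *\<^sub>R (m + x))"
proof (induction p arbitrary: m)
  case (Suc p)
  have "c *\<^sub>R (m + e + x) = c *\<^sub>R (m + x) + c *\<^sub>R e" by (simp add: algebra_simps)
  then show ?case unfolding dif_Suc Suc by simp
qed simp

definition dlt :: "real^'n::finite \<Rightarrow> real^'n" where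
  "dlt \<alpha> = (\<chi> i. \<alpha> $ i - of_int (round (\<alpha> $ i)))"

text \<open>The sum over m that belongs to a fixed difference h in the expansion of the squared
  theta sum, up to a factor of modulus 1; \<alpha> will be \<open>h X\<close>.\<close>

definition corr :: "(real^'n::finite \<Rightarrow> complex) \<Rightarrow> real \<Rightarrow> real^'n \<Rightarrow> real^'n \<Rightarrow> real^'n \<Rightarrow> complex" where
  "corr f M x h \<alpha> = (\<Sum>\<^sub>\<infinity>m\<in>ZJ UNIV. f ((1 / M) *\<^sub>R (m + x) + (1 / M) *\<^sub>R h) * cnj (f ((1 / M) *\<^sub>R (m + x))) * ee (m \<bullet> \<alpha>))"

text \<open>Let r be the largest entry of \<open>dlt \<alpha>\<close>. Differences of order
  \<open>2 * n\<close> in that coordinate gain the power \<open>- 2 * n\<close> of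
  \<open>M * r\<close>. This order suffices because \<open>om\<close> is a product of n inverse
  squares, each at least the inverse square of \<open>1 + M * r\<close>.\<close>

lemma corr_bound:
  fixes f :: "real^'n::finite \<Rightarrow> complex"
  assumes f: "schwartz f"
  shows "\<exists>K\<ge>0. \<forall>M\<ge>1. \<forall>x h \<alpha>. norm (corr f M x h \<alpha>) \<le> K * M ^ CARD('n) * (om ((1 / M) *\<^sub>R h) * om (M *\<^sub>R dlt \<alpha>))"
proof -
  let ?n = "CARD('n)" and ?Z = "ZJ (UNIV :: 'n set)"
  define p where "p = 2 * ?n"
  have "\<forall>q. \<exists>K. K \<ge> 0 \<and> (\<forall>j u v M. M \<ge> 1 \<longrightarrow>
    norm ((dif ((1 / M) *\<^sub>R axis j 1) ^^ q) (\<lambda>v. f (v + u) * cnj (f v)) v) \<le> K * ((1 / M) ^ q * (om u * om v)))"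
    using difference_bound[OF f] by simp
  from choice[OF this] obtain Kq where Kall: "\<forall>q. Kq q \<ge> 0 \<and> (\<forall>j u v M. M \<ge> 1 \<longrightarrow>
    norm ((dif ((1 / M) *\<^sub>R axis j 1) ^^ q) (\<lambda>v. f (v + u) * cnj (f v)) v) \<le> Kq q * ((1 / M) ^ q * (om u * om v)))" ..
  have Kq: "Kq q \<ge> 0" "M \<ge> 1 \<Longrightarrow>
    norm ((dif ((1 / M) *\<^sub>R axis j 1) ^^ q) (\<lambda>v. f (v + u) * cnj (f v)) v) \<le> Kq q * ((1 / M) ^ q * (om u * om v))" for q j u v M
    using Kall by simp_all
  define K where "K = (Kq 0 + Kq p) * 24 ^ ?n * 2 ^ p"
  have K0: "K \<ge> 0" using Kq(1) by (simp add: K_def add_nonneg_nonneg)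
  have "norm (corr f M x h \<alpha>) \<le> K * M ^ ?n * (om ((1 / M) *\<^sub>R h) * om (M *\<^sub>R dlt \<alpha>))" if M: "M \<ge> 1" for M x h \<alpha>
  proof -
    let ?u = "(1 / M) *\<^sub>R h" and ?F = "\<lambda>v. f (v + (1 / M) *\<^sub>R h) * cnj (f v)"
    let ?G = "\<lambda>m. ?F ((1 / M) *\<^sub>R (m + x))"
    have bnd: "norm ((dif (axis j 1) ^^ q) ?G m) \<le> (Kq q * (1 / M) ^ q * om ?u) * om ((1 / M) *\<^sub>R (m + x))" for j q m
      unfolding dif_affine[where F = ?F] using Kq(2)[OF M, of q j ?u "(1 / M) *\<^sub>R (m + x)"] by (simp add: mult_ac)
    have sb: "(\<lambda>m. c * om ((1 / M) *\<^sub>R (m + x))) summable_on ?Z" for c by (rule summable_on_cmult_right[OF om_summable(1)[OF M]])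
    have sG: "(\<lambda>m. norm (?G m)) summable_on ?Z"
      by (rule summable_on_comparison_test[OF sb[of "Kq 0 * (1 / M) ^ 0 * om ?u"]]) (use bnd[of 0] in simp_all)
    have main: "norm (ee (- \<alpha> $ j) - 1) ^ q * norm (corr f M x h \<alpha>) \<le> (Kq q * (1 / M) ^ q * om ?u) * (24 * M) ^ ?n" for j q
    proof -
      note d = dif_pow_sum[OF sG, of q j \<alpha>]
      have "norm (ee (- \<alpha> $ j) - 1) ^ q * norm (corr f M x h \<alpha>) = norm (\<Sum>\<^sub>\<infinity>m\<in>?Z. (dif (axis j 1) ^^ q) ?G m * ee (m \<bullet> \<alpha>))"
        unfolding conjunct2[OF d] corr_def by (simp only: norm_mult norm_power)
      also have "\<dots> \<le> (\<Sum>\<^sub>\<infinity>m\<in>?Z. norm ((dif (axis j 1) ^^ q) ?G m * ee (m \<bullet> \<alpha>)))"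
        by (rule norm_infsum_bound) (use conjunct1[OF d] in \<open>simp only: norm_mult norm_ee mult_1_right\<close>)
      also have "\<dots> = (\<Sum>\<^sub>\<infinity>m\<in>?Z. norm ((dif (axis j 1) ^^ q) ?G m))" by (simp only: norm_mult norm_ee mult_1_right)
      also have "\<dots> \<le> (\<Sum>\<^sub>\<infinity>m\<in>?Z. (Kq q * (1 / M) ^ q * om ?u) * om ((1 / M) *\<^sub>R (m + x)))"
        by (rule infsum_mono[OF conjunct1[OF d] sb bnd])
      also have "\<dots> = (Kq q * (1 / M) ^ q * om ?u) * (\<Sum>\<^sub>\<infinity>m\<in>?Z. om ((1 / M) *\<^sub>R (m + x)))"
        by (rule infsum_cmult_right) (rule om_summable(1)[OF M])
      also have "\<dots> \<le> (Kq q * (1 / M) ^ q * om ?u) * (24 * M) ^ ?n"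
        using Kq(1)[of q] M by (intro mult_left_mono om_summable(2)[OF M] mult_nonneg_nonneg om_nonneg) auto
      finally show ?thesis .
    qed
    define r where "r = Max (range (\<lambda>i. \<bar>dlt \<alpha> $ i\<bar>))"
    have rge: "\<bar>dlt \<alpha> $ i\<bar> \<le> r" for i unfolding r_def by (rule Max_ge) auto
    have "r \<in> range (\<lambda>i. \<bar>dlt \<alpha> $ i\<bar>)" unfolding r_def by (rule Max_in) auto
    then obtain j where j: "r = \<bar>dlt \<alpha> $ j\<bar>" by blast
    have r0: "r \<ge> 0" using j by simp
    have omr: "1 / (1 + M * r) ^ p \<le> om (M *\<^sub>R dlt \<alpha>)"
    proof -
      have "1 / (1 + M * r) ^ p = (\<Prod>i\<in>(UNIV :: 'n set). 1 / (1 + M * r) ^ 2)"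
        by (simp add: p_def power_mult power_one_over)
      also have "\<dots> \<le> (\<Prod>i\<in>UNIV. 1 / (1 + \<bar>(M *\<^sub>R dlt \<alpha>) $ i\<bar>) ^ 2)"
      proof (intro prod_mono conjI divide_left_mono power_mono mult_pos_pos zero_less_power)
        show "1 + \<bar>(M *\<^sub>R dlt \<alpha>) $ i\<bar> \<le> 1 + M * r" for i
          using mult_left_mono[OF rge[of i], of M] M by (simp add: abs_mult)
      qed (use M r0 in \<open>auto intro: add_pos_nonneg\<close>)
      finally show ?thesis unfolding om_def .
    qed
    have ou: "om ?u \<ge> 0" by (rule om_nonneg)
    have Mp: "0 \<le> M ^ ?n" "0 < 1 + M * r" using M r0 by (auto intro: add_pos_nonneg)
    have step: "norm (corr f M x h \<alpha>) \<le> (Kq 0 + Kq p) * om ?u * (24 * M) ^ ?n * (2 ^ p / (1 + M * r) ^ p)"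
    \<comment> \<open>For small \<open>M * r\<close> the estimate without differences is good
      enough; otherwise \<open>M * r\<close> and \<open>1 + M * r\<close> are comparable.\<close>
    proof (cases "M * r \<le> 1")
      case True
      have "(1 + M * r) ^ p \<le> 2 ^ p" using True Mp by (intro power_mono) auto
      then have one: "1 \<le> 2 ^ p / (1 + M * r) ^ p" using Mp by simp
      have "norm (corr f M x h \<alpha>) \<le> Kq 0 * om ?u * (24 * M) ^ ?n" using main[of j 0] by simp
      also have "\<dots> \<le> (Kq 0 + Kq p) * om ?u * (24 * M) ^ ?n"
        using Kq(1)[of p] ou M by (intro mult_right_mono) auto
      also have "\<dots> \<le> (Kq 0 + Kq p) * om ?u * (24 * M) ^ ?n * (2 ^ p / (1 + M * r) ^ p)"
        using mult_left_mono[OF one, of "(Kq 0 + Kq p) * om ?u * (24 * M) ^ ?n"] Kq(1)[of p] Kq(1)[of 0] ou M by simp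
      finally show ?thesis .
    next
      case False
      then have rp: "r > 0" using r0 M by (cases "r = 0") auto
      have "ee (- \<alpha> $ j) = ee (- dlt \<alpha> $ j)"
        using ee_Ints[of "- of_int (round (\<alpha> $ j))" "- dlt \<alpha> $ j"] by (simp add: dlt_def)
      moreover have "\<bar>- dlt \<alpha> $ j\<bar> \<le> 1 / 2"
        using of_int_round_abs_le[of "\<alpha> $ j"] by (simp add: dlt_def abs_minus_commute)
      ultimately have rn: "r \<le> norm (ee (- \<alpha> $ j) - 1)" using norm_ee_minus_one_ge[of "- dlt \<alpha> $ j"] j by simp
      have "r ^ p * norm (corr f M x h \<alpha>) \<le> norm (ee (- \<alpha> $ j) - 1) ^ p * norm (corr f M x h \<alpha>)"
        using rn r0 by (intro mult_right_mono power_mono) auto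
      also have "\<dots> \<le> (Kq p * (1 / M) ^ p * om ?u) * (24 * M) ^ ?n" by (rule main)
      finally have "norm (corr f M x h \<alpha>) \<le> (Kq p * (1 / M) ^ p * om ?u) * (24 * M) ^ ?n / r ^ p"
        using rp by (simp add: pos_le_divide_eq mult.commute)
      also have "\<dots> = Kq p * om ?u * (24 * M) ^ ?n * (1 / (M * r) ^ p)" by (simp add: power_mult_distrib power_one_over divide_inverse power_inverse mult_ac)
      also have "\<dots> \<le> (Kq 0 + Kq p) * om ?u * (24 * M) ^ ?n * (2 ^ p / (1 + M * r) ^ p)"
      proof (rule mult_mono)
        show "Kq p * om ?u * (24 * M) ^ ?n \<le> (Kq 0 + Kq p) * om ?u * (24 * M) ^ ?n"
          using Kq(1)[of 0] ou M by (intro mult_right_mono) auto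
        have "(1 + M * r) ^ p \<le> (2 * (M * r)) ^ p" using False Mp by (intro power_mono) auto
        then have "(1 + M * r) ^ p \<le> 2 ^ p * (M * r) ^ p" by (simp only: power_mult_distrib)
        moreover have "(M * r) ^ p > 0" "(1 + M * r) ^ p > 0" using rp M Mp by (auto intro!: zero_less_power)
        ultimately show "1 / (M * r) ^ p \<le> 2 ^ p / (1 + M * r) ^ p" by (simp add: divide_simps)
        show "0 \<le> (Kq 0 + Kq p) * om ?u * (24 * M) ^ ?n" using Kq(1)[of p] Kq(1)[of 0] ou M by simp
        show "0 \<le> 1 / (M * r) ^ p" using M r0 by simp
      qed
      finally show ?thesis .
    qed
    also have "\<dots> = K * M ^ ?n * (om ?u * (1 / (1 + M * r) ^ p))" by (simp add: K_def power_mult_distrib mult_ac)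
    also have "\<dots> \<le> K * M ^ ?n * (om ?u * om (M *\<^sub>R dlt \<alpha>))"
      using K0 Mp ou by (intro mult_left_mono omr) auto
    finally show ?thesis .
  qed
  then show ?thesis using K0 by blast
qed

text \<open>The \<open>2 * n\<close> coordinates of \<open>h / M\<close> and
  \<open>M * dlt (h X)\<close>, indexed by \<open>'n \<times> bool\<close>, are fed into
  \<open>cell_sum\<close>. Two h in one cell differ by a vector of \<open>SX\<close>, so each cell
  holds at most that many.\<close>

lemma sum_om_SX_le:
  fixes w :: "'n::finite uprod \<Rightarrow> real"
  assumes M: "M \<ge> 1" and e: "0 < \<epsilon>" "\<epsilon> \<le> 1 / 2" and H: "finite H" "H \<subseteq> ZJ UNIV"
  shows "(\<Sum>h\<in>H. om ((1 / M) *\<^sub>R h) * om (M *\<^sub>R dlt (mulW UNIV h w))) \<le>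
    real (card (SX w (\<epsilon> * M) (\<epsilon> / M))) * (3 / \<epsilon> ^ 2) ^ (2 * CARD('n))"
proof -
  define T where "T h q = (case q of (i, b) \<Rightarrow> if b then h $ i / M else M * dlt (mulW UNIV h w) $ i)" for h and q :: "'n \<times> bool"
  have "om ((1 / M) *\<^sub>R h) * om (M *\<^sub>R dlt (mulW UNIV h w)) = (\<Prod>q\<in>UNIV. 1 / (1 + \<bar>T h q\<bar>) ^ 2)" for h
  proof -
    have "(\<Prod>q\<in>UNIV. 1 / (1 + \<bar>T h q\<bar>) ^ 2) = (\<Prod>i\<in>UNIV. \<Prod>b\<in>UNIV. 1 / (1 + \<bar>T h (i, b)\<bar>) ^ 2)"
      unfolding UNIV_Times_UNIV[symmetric] prod.cartesian_product by (simp add: case_prod_beta)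
    also have "\<dots> = (\<Prod>i\<in>UNIV. 1 / (1 + \<bar>h $ i / M\<bar>) ^ 2 * (1 / (1 + \<bar>M * dlt (mulW UNIV h w) $ i\<bar>) ^ 2))"
      by (intro prod.cong refl) (simp add: T_def UNIV_bool mult.commute)
    also have "\<dots> = om ((1 / M) *\<^sub>R h) * om (M *\<^sub>R dlt (mulW UNIV h w))" unfolding om_def prod.distrib by simp
    finally show ?thesis ..
  qed
  then have "(\<Sum>h\<in>H. om ((1 / M) *\<^sub>R h) * om (M *\<^sub>R dlt (mulW UNIV h w))) = (\<Sum>h\<in>H. \<Prod>q\<in>UNIV. 1 / (1 + \<bar>T h q\<bar>) ^ 2)" by simp
  also have "\<dots> \<le> real (card (SX w (\<epsilon> * M) (\<epsilon> / M))) * (3 / \<epsilon> ^ 2) ^ CARD('n \<times> bool)"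
  proof (rule cell_sum[OF H(1) e])
    fix h0 assume h0: "h0 \<in> H"
    have "card {h\<in>H. \<forall>q. \<bar>T h q - T h0 q\<bar> \<le> \<epsilon>} \<le> card (SX w (\<epsilon> * M) (\<epsilon> / M))"
    proof (rule card_inj_on_le[of "\<lambda>h. h - h0"])
      show "(\<lambda>h. h - h0) ` {h\<in>H. \<forall>q. \<bar>T h q - T h0 q\<bar> \<le> \<epsilon>} \<subseteq> SX w (\<epsilon> * M) (\<epsilon> / M)"
      proof (rule image_subsetI)
        fix h assume "h \<in> {h\<in>H. \<forall>q. \<bar>T h q - T h0 q\<bar> \<le> \<epsilon>}"
        then have h: "h \<in> H" "\<And>q. \<bar>T h q - T h0 q\<bar> \<le> \<epsilon>" by auto
        have Z: "h - h0 \<in> ZJ UNIV" using h(1) h0 H(2) by (intro subgrp_diff[OF subgrp_ZJ]) auto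
        have 1: "\<bar>(h - h0) $ i\<bar> \<le> \<epsilon> * M" for i
        proof -
          have "\<bar>(h $ i - h0 $ i) / M\<bar> \<le> \<epsilon>" using h(2)[of "(i, True)"] by (simp add: T_def diff_divide_distrib)
          then show ?thesis using M by (simp add: abs_divide pos_divide_le_eq)
        qed
        define k :: "real^'n" where "k = (\<chi> i. of_int (round (mulW UNIV h0 w $ i)) - of_int (round (mulW UNIV h w $ i)))"
        have kZ: "k \<in> ZJ UNIV" by (simp add: ZJ_def k_def)
        have 2: "\<bar>mulW UNIV (h - h0) w $ i + k $ i\<bar> \<le> \<epsilon> / M" for i
        proof -
          have "mulW UNIV (h - h0) w $ i + k $ i = dlt (mulW UNIV h w) $ i - dlt (mulW UNIV h0 w) $ i"
            by (simp add: mulW_diff k_def dlt_def)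
          moreover have "\<bar>M * (dlt (mulW UNIV h w) $ i - dlt (mulW UNIV h0 w) $ i)\<bar> \<le> \<epsilon>"
            using h(2)[of "(i, False)"] by (simp add: T_def right_diff_distrib)
          ultimately show ?thesis using M by (simp add: abs_mult pos_le_divide_eq mult.commute)
        qed
        show "h - h0 \<in> SX w (\<epsilon> * M) (\<epsilon> / M)" unfolding SX_def good_def using Z 1 2 kZ by blast
      qed
    qed (auto simp: finite_SX inj_on_def)
    then show "real (card {h\<in>H. \<forall>q. \<bar>T h q - T h0 q\<bar> \<le> \<epsilon>}) \<le> real (card (SX w (\<epsilon> * M) (\<epsilon> / M)))" by simp
  qed simp
  also have "CARD('n \<times> bool) = 2 * CARD('n)" by simp
  finally show ?thesis .
qed

lemma int_vectors_ZJ: "int_vectors = ZJ UNIV"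
  by (auto simp: int_vectors_def ZJ_def)

lemma vector_sym_matrix: "m v* sym_matrix v = mulW UNIV m (($) v)"
  by (simp add: vec_eq_iff vector_matrix_mult_def mulW_nth sym_matrix_def mult.commute)

lemma rho_le_om: "rho x \<le> om x"
  unfolding rho_def om_def
proof (intro prod_mono conjI)
  fix i
  have "(1 + \<bar>x $ i\<bar>) ^ 2 \<le> (1 + \<bar>x $ i\<bar>) ^ 4" by (intro power_increasing) auto
  moreover have "(1 + \<bar>x $ i\<bar>) ^ 2 > 0" by (intro zero_less_power) auto
  ultimately show "1 / (1 + \<bar>x $ i\<bar>) ^ 4 \<le> 1 / (1 + \<bar>x $ i\<bar>) ^ 2" by (intro divide_left_mono mult_pos_pos) auto
qed simp

text \<open>The phase at \<open>m + h\<close> minus that at m is linear in m with frequency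
  \<open>h X\<close>. The vector y enters only a factor of modulus 1 that depends on h, and x only
  the translation in \<open>corr\<close>, whose bound is uniform in it; hence the constant is
  uniform in both.\<close>

lemma theta_square_le:
  fixes f :: "real^'n::finite \<Rightarrow> complex"
  assumes f: "schwartz f" and e: "0 < \<epsilon>" "\<epsilon> \<le> 1 / 2"
  shows "\<exists>K\<ge>0. \<forall>v M x y. M \<ge> 1 \<longrightarrow>
    (cmod (theta f M (sym_matrix v) x y))\<^sup>2 \<le> K * M ^ CARD('n) * real (card (SX (($) v) (\<epsilon> * M) (\<epsilon> / M)))"
proof -
  let ?n = "CARD('n)" and ?Z = "ZJ (UNIV :: 'n set)"
  obtain Kc where Kc: "Kc \<ge> 0" "\<forall>M\<ge>1. \<forall>x h \<alpha>. norm (corr f M x h \<alpha>) \<le> Kc * M ^ ?n * (om ((1 / M) *\<^sub>R h) * om (M *\<^sub>R dlt \<alpha>))"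
    using corr_bound[OF f] by blast
  obtain C where C: "C \<ge> 0" "\<And>v. norm (f v) \<le> C * rho v"
    using schwartz_decay[OF f, of "[]"] unfolding iter_partial_def by auto
  define K where "K = Kc * (3 / \<epsilon> ^ 2) ^ (2 * ?n)"
  have "(cmod (theta f M (sym_matrix v) x y))\<^sup>2 \<le> K * M ^ ?n * real (card (SX (($) v) (\<epsilon> * M) (\<epsilon> / M)))"
    if M: "M \<ge> 1" for v M x y
  proof -
    let ?w = "($) v"
    define q where "q m = 1 / 2 * (mulW UNIV m ?w \<bullet> m) + m \<bullet> y" for m
    define g where "g m = f ((1 / M) *\<^sub>R (m + x)) * ee (q m)" for m
    define \<theta> where "\<theta> = (\<Sum>\<^sub>\<infinity>m\<in>?Z. g m)"
    have th: "theta f M (sym_matrix v) x y = \<theta>"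
      unfolding theta_def int_vectors_ZJ vector_sym_matrix \<theta>_def g_def q_def ee_def by (simp add: inverse_eq_divide)
    have os: "(\<lambda>m. om ((1 / M) *\<^sub>R (m + z))) summable_on ?Z" for z by (rule om_summable(1)[OF M])
    have osh: "(\<lambda>h. om ((1 / M) *\<^sub>R h)) summable_on ?Z" using os[of 0] by simp
    have absg: "(\<lambda>m. norm (g m)) summable_on ?Z"
    proof (rule summable_on_comparison_test[OF summable_on_cmult_right[OF os[of x], of C]])
      fix m
      have "norm (g m) \<le> C * rho ((1 / M) *\<^sub>R (m + x))" unfolding g_def by (simp add: norm_mult C(2))
      also have "\<dots> \<le> C * om ((1 / M) *\<^sub>R (m + x))" by (intro mult_left_mono rho_le_om C(1))
      finally show "norm (g m) \<le> C * om ((1 / M) *\<^sub>R (m + x))" .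
    qed simp
    have sg: "g summable_on ?Z" by (rule abs_summable_summable[OF absg])
    define A where "A m h = g (m + h) * cnj (g m)" for m h
    define P :: "(real^'n) \<times> (real^'n) \<Rightarrow> real" where "P = (\<lambda>(m, h). C * C * (om ((1 / M) *\<^sub>R h) * om ((1 / M) *\<^sub>R (m + x))))"
    define S where "S = (\<Sum>\<^sub>\<infinity>h\<in>?Z. om ((1 / M) *\<^sub>R h))"
    \<comment> \<open>The majorant that allows the sums over m and h to be interchanged.\<close>
    have Ps: "P summable_on (?Z \<times> ?Z)"
    proof (rule summable_on_SigmaI[where g = "\<lambda>m. C * C * (S * om ((1 / M) *\<^sub>R (m + x)))"])
      show "((\<lambda>h. P (m, h)) has_sum C * C * (S * om ((1 / M) *\<^sub>R (m + x)))) ?Z" for m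
        unfolding P_def prod.case S_def by (intro has_sum_cmult_right has_sum_cmult_left has_sum_infsum osh)
      show "(\<lambda>m. C * C * (S * om ((1 / M) *\<^sub>R (m + x)))) summable_on ?Z"
        by (intro summable_on_cmult_right os)
      show "0 \<le> P (m, h)" for m h unfolding P_def prod.case by (intro mult_nonneg_nonneg om_nonneg C(1))
    qed
    have nA: "norm (A m h) \<le> P (m, h)" for m h
    proof -
      let ?a = "(1 / M) *\<^sub>R (m + h + x)" and ?b = "(1 / M) *\<^sub>R (m + x)"
      have "norm (A m h) = norm (f ?a) * norm (f ?b)" unfolding A_def g_def by (simp add: norm_mult)
      also have "\<dots> \<le> (C * rho ?a) * (C * rho ?b)"
        using C by (intro mult_mono mult_nonneg_nonneg rho_nonneg) auto
      also have "\<dots> = C * C * (rho ?a * rho ?b)" by simp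
      also have "\<dots> \<le> C * C * (om (?a - ?b) * om ?b)" using C(1) by (intro mult_left_mono rho_mult_le) auto
      also have "?a - ?b = (1 / M) *\<^sub>R h" by (simp add: algebra_simps)
      finally show ?thesis by (simp add: P_def)
    qed
    have As: "(\<lambda>(m, h). A m h) summable_on (?Z \<times> ?Z)"
    proof (rule abs_summable_summable, rule summable_on_comparison_test[OF Ps])
      show "norm (case z of (m, h) \<Rightarrow> A m h) \<le> P z" for z using nA by (cases z) simp
    qed simp
    have sh: "(\<Sum>\<^sub>\<infinity>h\<in>?Z. A m h) = \<theta> * cnj (g m)" if m: "m \<in> ?Z" for m
    proof -
      have bij: "bij_betw (\<lambda>h. h + m) ?Z ?Z" by (rule bij_shift_ZJ[OF m])
      have sgm: "(\<lambda>h. g (h + m)) summable_on ?Z" using summable_on_reindex_bij_betw[OF bij, of g] sg by simp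
      have "(\<Sum>\<^sub>\<infinity>h\<in>?Z. A m h) = (\<Sum>\<^sub>\<infinity>h\<in>?Z. g (h + m) * cnj (g m))" unfolding A_def by (simp add: add.commute)
      also have "\<dots> = (\<Sum>\<^sub>\<infinity>h\<in>?Z. g (h + m)) * cnj (g m)" by (rule infsum_cmult_left) (rule sgm)
      also have "(\<Sum>\<^sub>\<infinity>h\<in>?Z. g (h + m)) = \<theta>" unfolding \<theta>_def by (rule infsum_reindex_bij_betw[OF bij])
      finally show ?thesis .
    qed
    have scg: "(\<lambda>m. cnj (g m)) summable_on ?Z" by (rule abs_summable_summable) (simp add: absg)
    have "\<theta> * cnj \<theta> = \<theta> * (\<Sum>\<^sub>\<infinity>m\<in>?Z. cnj (g m))" unfolding \<theta>_def by simp
    also have "\<dots> = (\<Sum>\<^sub>\<infinity>m\<in>?Z. \<theta> * cnj (g m))" by (rule infsum_cmult_right[symmetric]) (rule scg)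
    also have "\<dots> = (\<Sum>\<^sub>\<infinity>m\<in>?Z. \<Sum>\<^sub>\<infinity>h\<in>?Z. A m h)" by (rule infsum_cong) (simp add: sh)
    also have "\<dots> = (\<Sum>\<^sub>\<infinity>h\<in>?Z. \<Sum>\<^sub>\<infinity>m\<in>?Z. A m h)" by (rule infsum_swap_banach[OF As])
    finally have tt: "\<theta> * cnj \<theta> = (\<Sum>\<^sub>\<infinity>h\<in>?Z. \<Sum>\<^sub>\<infinity>m\<in>?Z. A m h)" .
    have nB: "norm (\<Sum>\<^sub>\<infinity>m\<in>?Z. A m h) = norm (corr f M x h (mulW UNIV h ?w))" for h
    proof -
      let ?al = "mulW UNIV h ?w"
      have Aeq: "A m h = ee (q h) * (f ((1 / M) *\<^sub>R (m + x) + (1 / M) *\<^sub>R h) * cnj (f ((1 / M) *\<^sub>R (m + x))) * ee (m \<bullet> ?al))" for m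
      proof -
        have U: "z \<in> supp_on UNIV" for z :: "real^'n" by (simp add: supp_on_def)
        have sw: "mulW UNIV m ?w \<bullet> h = m \<bullet> ?al" by (rule inner_mulW_swap[OF U U])
        \<comment> \<open>Symmetry of X merges the two cross terms, cancelling the factor 1/2 of the
          quadratic form.\<close>
        have "q (m + h) = q m + (q h + m \<bullet> ?al)"
          unfolding q_def mulW_add inner_add_left inner_add_right sw by (simp add: inner_commute[of ?al m] algebra_simps)
        then have e1: "ee (q (m + h)) * cnj (ee (q m)) = ee (q h) * ee (m \<bullet> ?al)"
          unfolding cnj_ee ee_add[symmetric] by simp
        have e2: "(1 / M) *\<^sub>R (m + h + x) = (1 / M) *\<^sub>R (m + x) + (1 / M) *\<^sub>R h" by (simp add: algebra_simps)
        have "A m h = f ((1 / M) *\<^sub>R (m + h + x)) * cnj (f ((1 / M) *\<^sub>R (m + x))) * (ee (q (m + h)) * cnj (ee (q m)))"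
          unfolding A_def g_def complex_cnj_mult by (simp only: mult_ac)
        then show ?thesis unfolding e1 e2 by (simp only: mult_ac)
      qed
      show ?thesis unfolding Aeq corr_def infsum_cmult_right' by (simp add: norm_mult)
    qed
    let ?B = "K * M ^ ?n * real (card (SX ?w (\<epsilon> * M) (\<epsilon> / M)))"
    have fin: "(\<Sum>h\<in>H. norm (\<Sum>\<^sub>\<infinity>m\<in>?Z. A m h)) \<le> ?B" if H: "finite H" "H \<subseteq> ?Z" for H
    proof -
      have "(\<Sum>h\<in>H. norm (\<Sum>\<^sub>\<infinity>m\<in>?Z. A m h)) \<le> (\<Sum>h\<in>H. Kc * M ^ ?n * (om ((1 / M) *\<^sub>R h) * om (M *\<^sub>R dlt (mulW UNIV h ?w))))"
        unfolding nB using Kc(2) M by (intro sum_mono) blast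
      also have "\<dots> = Kc * M ^ ?n * (\<Sum>h\<in>H. om ((1 / M) *\<^sub>R h) * om (M *\<^sub>R dlt (mulW UNIV h ?w)))"
        by (rule sum_distrib_left[symmetric])
      also have "\<dots> \<le> Kc * M ^ ?n * (real (card (SX ?w (\<epsilon> * M) (\<epsilon> / M))) * (3 / \<epsilon> ^ 2) ^ (2 * ?n))"
        using Kc(1) M by (intro mult_left_mono sum_om_SX_le[OF M e H]) auto
      finally show ?thesis by (simp add: K_def mult_ac)
    qed
    have sB: "(\<lambda>h. norm (\<Sum>\<^sub>\<infinity>m\<in>?Z. A m h)) summable_on ?Z"
      by (rule nonneg_bdd_above_summable_on, simp, rule bdd_aboveI2[where M = ?B]) (use fin in blast)
    have "(cmod \<theta>)\<^sup>2 = norm (\<theta> * cnj \<theta>)" by (simp add: norm_mult power2_eq_square)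
    also have "\<dots> \<le> (\<Sum>\<^sub>\<infinity>h\<in>?Z. norm (\<Sum>\<^sub>\<infinity>m\<in>?Z. A m h))" unfolding tt by (rule norm_infsum_bound[OF sB])
    also have "\<dots> \<le> ?B" by (rule infsum_le_finite_sums[OF sB fin])
    finally show ?thesis unfolding th .
  qed
  moreover have "K \<ge> 0" using Kc(1) by (simp add: K_def)
  ultimately show ?thesis by blast
qed

section \<open>Almost every symmetric matrix\<close>

lemma SX_mono:
  assumes "a \<le> a'" "b \<le> b'"
  shows "SX w a b \<subseteq> SX w a' b'"
  unfolding SX_def good_def using assms by (blast intro: order_trans)

lemma SX_periodic:
  assumes "z \<in> intsE UNIV"
  shows "SX (\<lambda>p. w p + z p) a b = SX w a b"
proof -
  have "good b (mulW UNIV h (\<lambda>p. w p + z p)) \<longleftrightarrow> good b (mulW UNIV h w)" if "h \<in> ZJ UNIV" for h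
    unfolding mulW_add_right by (rule good_shift[OF mulW_intsE_ZJ[OF that assms]])
  then show ?thesis unfolding SX_def by blast
qed

text \<open>Some integer translation, minus the floor, brings any w into the cube, and the
  translations are countable in number, so the exceptional sets still form a null set.\<close>

lemma AE_LB_of_cube:
  fixes Q :: "('i::finite \<Rightarrow> real) \<Rightarrow> bool"
  assumes cube: "AE w in LB UNIV. w \<in> cubeI UNIV \<longrightarrow> Q w"
    and per: "\<And>w z. z \<in> intsE UNIV \<Longrightarrow> Q (\<lambda>p. w p + z p) \<longleftrightarrow> Q w"
  shows "AE w in LB UNIV. Q w"
proof -
  have "AE w in LB UNIV. shf UNIV z w \<in> cubeI UNIV \<longrightarrow> Q (shf UNIV z w)" for z :: "'i \<Rightarrow> real"
  proof (rule AE_distrD[where M' = "LB UNIV"])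
    show "AE w in distr (LB UNIV) (LB UNIV) (shf UNIV z). w \<in> cubeI UNIV \<longrightarrow> Q w"
      unfolding distr_shf[OF finite] by (rule cube)
  qed (rule measurable_shf)
  then have "AE w in LB UNIV. \<forall>z\<in>intsE UNIV. shf UNIV z w \<in> cubeI UNIV \<longrightarrow> Q (shf UNIV z w)"
    by (intro AE_ball_countable' countable_intsE) simp_all
  then show ?thesis
  proof (rule AE_mp, intro AE_I2 impI)
    fix w :: "'i \<Rightarrow> real" assume *: "\<forall>z\<in>intsE UNIV. shf UNIV z w \<in> cubeI UNIV \<longrightarrow> Q (shf UNIV z w)"
    define z where "z i = - real_of_int \<lfloor>w i\<rfloor>" for i
    have z: "z \<in> intsE UNIV" by (simp add: z_def intsE_def PiE_iff)
    have "0 \<le> w i + z i" "w i + z i < 1" for i unfolding z_def by linarith+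
    then have "shf UNIV z w \<in> cubeI UNIV" by (simp add: shf_UNIV cubeI_def PiE_iff)
    then have "Q (shf UNIV z w)" using * z by blast
    then show "Q w" unfolding shf_UNIV per[OF z] .
  qed
qed

section \<open>Transfer to Lebesgue measure on symmetric matrices\<close>

lemma borel_measurable_vec_lambda:
  fixes f :: "'b \<Rightarrow> 'i::finite \<Rightarrow> real"
  assumes "\<And>i. (\<lambda>w. f w i) \<in> borel_measurable M"
  shows "(\<lambda>w. \<chi> i. f w i) \<in> borel_measurable M"
  unfolding borel_measurable_euclidean_space[of "\<lambda>w. \<chi> i. f w i"]
  using assms by (auto simp: Basis_vec_def inner_axis)

lemma lborel_vec_eq_distr:
  "(lborel :: (real^'i::finite) measure) = distr (LB UNIV) borel (\<lambda>w. \<chi> i. w i)"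
proof (rule lborel_eqI)
  have m: "(\<lambda>w. (\<chi> i. w i) :: real^'i) \<in> LB UNIV \<rightarrow>\<^sub>M borel"
    by (intro borel_measurable_vec_lambda LB_component) simp
  fix l u :: "real^'i" assume lu: "\<And>b. b \<in> Basis \<Longrightarrow> l \<bullet> b \<le> u \<bullet> b"
  have lu': "l $ i \<le> u $ i" for i using lu[of "axis i 1"] by (simp add: inner_axis)
  have pre: "(\<lambda>w. (\<chi> i. w i) :: real^'i) -` box l u \<inter> space (LB UNIV) = (\<Pi>\<^sub>E i\<in>UNIV. {l $ i<..<u $ i})"
    by (auto simp: mem_box_cart space_LB PiE_iff)
  have inj: "inj (\<lambda>i :: 'i. axis i (1 :: real))" by (auto simp: inj_on_def axis_eq_axis)
  have B: "(Basis :: (real^'i) set) = range (\<lambda>i. axis i 1)" by (auto simp: Basis_vec_def)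
  have "emeasure (distr (LB UNIV) borel (\<lambda>w. \<chi> i. w i)) (box l u) = emeasure (LB UNIV) (\<Pi>\<^sub>E i\<in>UNIV. {l $ i<..<u $ i})"
    unfolding pre[symmetric] by (rule emeasure_distr[OF m]) simp
  also have "\<dots> = (\<Prod>i\<in>UNIV. emeasure lborel {l $ i<..<u $ i})" by (rule lb.emeasure_PiM) simp_all
  also have "\<dots> = (\<Prod>i\<in>UNIV. ennreal (u $ i - l $ i))" using lu' by simp
  also have "\<dots> = ennreal (\<Prod>i\<in>UNIV. u $ i - l $ i)" using lu' by (intro prod_ennreal) simp
  also have "(\<Prod>i\<in>UNIV. u $ i - l $ i) = (\<Prod>b\<in>Basis. (u - l) \<bullet> b)"
    unfolding B prod.reindex[OF inj] by (simp add: inner_axis)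
  finally show "emeasure (distr (LB UNIV) borel (\<lambda>w. \<chi> i. w i)) (box l u) = ennreal (\<Prod>b\<in>Basis. (u - l) \<bullet> b)" .
qed simp

lemma AE_lborel_vec:
  fixes Q :: "('i::finite \<Rightarrow> real) \<Rightarrow> bool"
  assumes "AE w in LB UNIV. Q w"
  shows "AE v in (lborel :: (real^'i) measure). Q (($) v)"
proof (rule AE_distrD[where M' = "LB UNIV"])
  have m: "(\<lambda>w. (\<chi> i. w i) :: real^'i) \<in> LB UNIV \<rightarrow>\<^sub>M borel"
    by (intro borel_measurable_vec_lambda LB_component) simp
  have n: "(($) :: real^'i \<Rightarrow> _) \<in> borel \<rightarrow>\<^sub>M LB UNIV"
  proof -
    have "(\<lambda>v :: real^'i. \<lambda>i\<in>UNIV. v $ i) \<in> borel \<rightarrow>\<^sub>M LB UNIV" by (rule measurable_restrict) simp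
    then show ?thesis by (simp add: restrict_UNIV)
  qed
  then show "(($) :: real^'i \<Rightarrow> _) \<in> lborel \<rightarrow>\<^sub>M LB UNIV" by simp
  have "distr (lborel :: (real^'i) measure) (LB UNIV) ($) = distr (LB UNIV) (LB UNIV) (($) \<circ> (\<lambda>w. (\<chi> i. w i) :: real^'i))"
    unfolding lborel_vec_eq_distr by (rule distr_distr[OF n m])
  also have "\<dots> = LB UNIV"
  proof -
    have "(($) \<circ> (\<lambda>w. (\<chi> i. w i) :: real^'i)) = (\<lambda>w. w)" by (simp add: fun_eq_iff)
    then show ?thesis by (simp add: distr_id2)
  qed
  finally have dd: "distr (lborel :: (real^'i) measure) (LB UNIV) ($) = LB UNIV" .
  show "AE w in distr (lborel :: (real^'i) measure) (LB UNIV) ($). Q w" by (subst dd) (rule assms)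
qed

lemma sym_of_sym_matrix: "sym_of (\<lambda>i j. sym_matrix v $ i $ j) p = v $ p"
proof (cases p)
  case (Upair i j)
  have "v $ Upair i j = v $ Upair j i" by (rule arg_cong[where f = "($) v"]) simp
  then show ?thesis unfolding Upair by (subst sym_of_Upair) (simp_all add: sym_matrix_def)
qed

text \<open>The inverse of \<open>sym_matrix\<close> is written with \<open>sym_of\<close> and is
  Borel measurable, so the set is measurable and its preimage under \<open>sym_matrix\<close> is N
  itself.\<close>

lemma null_set_sym_matrix:
  fixes N :: "(real^('n::finite uprod)) set"
  assumes N: "N \<in> null_sets lborel"
  shows "{X\<in>sym_matrices. (\<chi> p. sym_of (\<lambda>i j. X $ i $ j) p) \<in> N} \<in> null_sets (sym_lebesgue :: (real^'n^'n) measure)"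
proof -
  let ?inv = "\<lambda>X :: real^'n^'n. (\<chi> p. sym_of (\<lambda>i j. X $ i $ j) p) :: real^('n uprod)"
  let ?R = "restrict_space borel (sym_matrices :: (real^'n^'n) set)"
  let ?S = "{X\<in>sym_matrices. ?inv X \<in> N}"
  have "(\<lambda>X :: real^'n^'n. sym_of (\<lambda>i j. X $ i $ j) p) \<in> borel_measurable borel" for p
    unfolding sym_of_def
    by (cases "SOME (i, j). Upair i j = p") (simp add: borel_measurable_continuous_onI continuous_intros)
  then have "?inv \<in> borel \<rightarrow>\<^sub>M borel" by (rule borel_measurable_vec_lambda)
  then have "?inv \<in> ?R \<rightarrow>\<^sub>M borel" by (rule measurable_restrict_space1)
  moreover have "N \<in> sets borel" using N by auto
  ultimately have "?inv -` N \<inter> space ?R \<in> sets ?R" by (rule measurable_sets)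
  moreover have "?inv -` N \<inter> space ?R = ?S" by (auto simp: space_restrict_space)
  ultimately have S: "?S \<in> sets ?R" by simp
  have pre: "sym_matrix -` ?S \<inter> space lborel = N"
  proof -
    have "?inv (sym_matrix v) = v" for v by (simp add: vec_eq_iff sym_of_sym_matrix)
    moreover have "sym_matrix v \<in> sym_matrices" for v :: "real^('n uprod)" using bij_betw_sym_matrix by (auto simp: bij_betw_def)
    ultimately show ?thesis by auto
  qed
  have "emeasure (distr lborel ?R sym_matrix) ?S = emeasure lborel N"
    unfolding emeasure_distr[OF measurable_sym_matrix S] pre ..
  also have "\<dots> = 0" using N by auto
  finally have "?S \<in> null_sets (distr lborel ?R sym_matrix)" using S by (auto simp: null_sets_def)
  then show ?thesis unfolding sym_lebesgue_def by (rule null_sets_completionI)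
qed

theorem theorem1p1:
  fixes \<psi> :: "real \<Rightarrow> real"
  assumes "\<And>t. t \<ge> 0 \<Longrightarrow> \<psi> t \<ge> 1"
    and "mono_on {0..} \<psi>"
    and "summable (\<lambda>k::nat. \<psi> (real k) powi (- (2 * int CARD('n::finite) + 2)))"
  shows "\<exists>\<X> :: (real^'n^'n) set.
    \<X> \<subseteq> sym_matrices \<and> sym_matrices - \<X> \<in> null_sets sym_lebesgue \<and>
    (\<forall>f :: real^'n \<Rightarrow> complex. schwartz f \<longrightarrow>
      (\<forall>X\<in>\<X>. \<exists>c::real. \<forall>M\<ge>1. \<forall>x y.
        cmod (theta f M X x y) \<le> c * M powr (real CARD('n) / 2) * \<psi> (ln M)))"
proof -
  let ?n = "CARD('n)"
  have n1: "real ?n \<ge> 1" by (simp add: Suc_le_eq)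
  \<comment> \<open>With \<open>a k * b k = \<epsilon> * \<epsilon> * exp 1\<close>, this value
    turns \<open>8 * n * (a k * b k)\<close> into \<open>\<epsilon> * exp 1\<close>, at most 3/8. It
    does not depend on f.\<close>
  define \<epsilon> where "\<epsilon> = 1 / (8 * real ?n)"
  have e8: "\<epsilon> \<le> 1 / 8" unfolding \<epsilon>_def by (rule divide_left_mono) (use n1 in auto)
  then have e2: "\<epsilon> \<le> 1 / 2" by linarith
  have e0: "0 < \<epsilon>" using n1 by (simp add: \<epsilon>_def)
  note e = e0 e2
  \<comment> \<open>For M between \<open>exp k\<close> and \<open>exp (k + 1)\<close>, both
    \<open>\<epsilon> * M \<le> a k\<close> and \<open>\<epsilon> / M \<le> b k\<close> hold, so one
    k controls the whole range of M.\<close>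
  define a where "a k = \<epsilon> * exp (real k + 1)" for k :: nat
  define b where "b k = \<epsilon> * exp (- real k)" for k :: nat
  have ab: "0 < a k" "0 < b k" "8 * (real ?n * (a k * b k)) < 1" for k
  proof -
    show "0 < a k" "0 < b k" using e by (simp_all add: a_def b_def)
    have "a k * b k = \<epsilon> * \<epsilon> * (exp (real k + 1) * exp (- real k))" by (simp add: a_def b_def)
    also have "exp (real k + 1) * exp (- real k) = exp (1 :: real)" by (simp add: exp_add[symmetric])
    finally have "8 * (real ?n * (a k * b k)) = \<epsilon> * exp 1" using n1 by (simp add: \<epsilon>_def)
    also have "\<dots> \<le> 1 / 8 * 3" using e8 exp_le by (intro mult_mono) simp_all
    finally show "8 * (real ?n * (a k * b k)) < 1" by simp
  qed
  \<comment> \<open>The square matches the squared theta sum and makes \<open>T k ^ (n + 1)\<close>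
    the power of \<psi> in the assumed series.\<close>
  define T where "T k = \<psi> (real k) ^ 2" for k :: nat
  have T1: "T k \<ge> 1" for k unfolding T_def by (rule one_le_power) (rule assms(1), simp)
  obtain C where C: "C > 0" "\<forall>a b T. 0 < a \<longrightarrow> 0 < b \<longrightarrow> 8 * (real ?n * (a * b)) < 1 \<longrightarrow> 1 \<le> T \<longrightarrow>
    emeasure (LB UNIV) {w\<in>cubeI (UNIV :: 'n uprod set). T \<le> real (card (SX w a b))} \<le> ennreal (C / T ^ (?n + 1))"
    using emeasure_many_SX_le[where 'n = 'n] by blast
  define Bad where "Bad k = {w\<in>cubeI (UNIV :: 'n uprod set). T k \<le> real (card (SX w (a k) (b k)))}" for k
  have Bs: "Bad k \<in> sets (LB UNIV)" for k unfolding Bad_def by (rule sets_many_SX)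
  have Be: "emeasure (LB UNIV) (Bad k) \<le> ennreal (C / T k ^ (?n + 1))" for k
    unfolding Bad_def using C(2) ab[of k] T1[of k] by blast
  have Bfin: "emeasure (LB UNIV) (Bad k) < \<infinity>" for k using Be[of k] by (rule order_le_less_trans) simp
  have Tpow: "1 / T k ^ (?n + 1) = \<psi> (real k) powi (- (2 * int ?n + 2))" for k
  proof -
    have "\<psi> (real k) powi (- (2 * int ?n + 2)) = inverse (\<psi> (real k) powi (int (2 * ?n + 2)))"
      by (simp only: power_int_minus of_nat_add of_nat_mult of_nat_numeral)
    also have "\<dots> = inverse (\<psi> (real k) ^ (2 * ?n + 2))" by (simp only: power_int_of_nat)
    also have "\<psi> (real k) ^ (2 * ?n + 2) = T k ^ (?n + 1)" unfolding T_def power_mult[symmetric] by (simp add: distrib_left)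
    finally show ?thesis by (simp only: inverse_eq_divide)
  qed
  have Bsum: "summable (\<lambda>k. measure (LB UNIV) (Bad k))"
  proof (rule summable_comparison_test)
    show "summable (\<lambda>k. C * (\<psi> (real k) powi (- (2 * int ?n + 2))))" by (rule summable_mult[OF assms(3)])
    have "norm (measure (LB UNIV) (Bad k)) \<le> C * (\<psi> (real k) powi (- (2 * int ?n + 2)))" for k
    proof -
      have "0 \<le> C / T k ^ (?n + 1)" using C(1) T1[of k] by simp
      then have "measure (LB UNIV) (Bad k) \<le> C / T k ^ (?n + 1)"
        unfolding measure_def using enn2real_mono[OF Be[of k]] by simp
      then show ?thesis unfolding Tpow[symmetric] by simp
    qed
    then show "\<exists>N. \<forall>k\<ge>N. norm (measure (LB UNIV) (Bad k)) \<le> C * (\<psi> (real k) powi (- (2 * int ?n + 2)))" by blast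
  qed
  \<comment> \<open>Q mentions neither f nor x nor y, so a single set of matrices works for all
    Schwartz functions.\<close>
  define Q where "Q w \<longleftrightarrow> eventually (\<lambda>k. real (card (SX w (a k) (b k))) \<le> T k) sequentially" for w :: "'n uprod \<Rightarrow> real"
  have "AE w in LB UNIV. eventually (\<lambda>k. w \<in> space (LB UNIV) - Bad k) sequentially"
    by (rule borel_cantelli_AE1[OF Bs Bfin Bsum])
  then have "AE w in LB UNIV. w \<in> cubeI UNIV \<longrightarrow> Q w"
  proof (rule AE_mp, intro AE_I2 impI)
    fix w :: "'n uprod \<Rightarrow> real"
    assume ev: "eventually (\<lambda>k. w \<in> space (LB UNIV) - Bad k) sequentially" and w: "w \<in> cubeI UNIV"
    show "Q w" unfolding Q_def using ev by (rule eventually_mono) (use w in \<open>auto simp: Bad_def\<close>)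
  qed
  then have "AE w in LB UNIV. Q w" by (rule AE_LB_of_cube) (simp add: Q_def SX_periodic)
  then have "AE v in (lborel :: (real^('n uprod)) measure). Q (($) v)" by (rule AE_lborel_vec)
  then obtain N where N: "\<And>v :: real^('n uprod). v \<in> space lborel - N \<Longrightarrow> Q (($) v)" "N \<in> null_sets lborel"
    by (rule AE_E3) blast
  define S where "S = {X\<in>sym_matrices :: (real^'n^'n) set. (\<chi> p. sym_of (\<lambda>i j. X $ i $ j) p) \<in> N}"
  have Snull: "S \<in> null_sets sym_lebesgue" unfolding S_def by (rule null_set_sym_matrix[OF N(2)])
  have bound: "\<exists>c. \<forall>M\<ge>1. \<forall>x y. cmod (theta f M X x y) \<le> c * M powr (real ?n / 2) * \<psi> (ln M)"
    if f: "schwartz f" and X: "X \<in> sym_matrices - S" for f :: "real^'n \<Rightarrow> complex" and X :: "real^'n^'n"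
  proof -
    obtain v :: "real^('n uprod)" where v: "X = sym_matrix v"
      using X bij_betw_sym_matrix[where 'n = 'n] unfolding bij_betw_def by blast
    have "(\<chi> p. sym_of (\<lambda>i j. sym_matrix v $ i $ j) p) = v" by (simp add: vec_eq_iff sym_of_sym_matrix)
    then have "v \<notin> N" using X unfolding S_def v by auto
    then have "Q (($) v)" using N(1) by simp
    then obtain k0 where k0: "\<And>k. k \<ge> k0 \<Longrightarrow> real (card (SX (($) v) (a k) (b k))) \<le> T k"
      unfolding Q_def eventually_sequentially by blast
    \<comment> \<open>The finitely many k before \<open>k0\<close> are absorbed into a constant
      depending on X, which is possible since \<open>T k \<ge> 1\<close>.\<close>
    define D where "D = 1 + (\<Sum>k<k0. real (card (SX (($) v) (a k) (b k))))"
    have D1: "D \<ge> 1" unfolding D_def by (simp add: sum_nonneg)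
    have SD: "real (card (SX (($) v) (a k) (b k))) \<le> D * T k" for k
    proof (cases "k < k0")
      case True
      have "real (card (SX (($) v) (a k) (b k))) \<le> (\<Sum>k<k0. real (card (SX (($) v) (a k) (b k))))"
        by (rule member_le_sum) (use True in auto)
      also have "\<dots> \<le> D * 1" by (simp add: D_def)
      also have "\<dots> \<le> D * T k" using D1 T1 by (intro mult_left_mono) auto
      finally show ?thesis .
    next
      case False
      have "real (card (SX (($) v) (a k) (b k))) \<le> 1 * T k" using k0[of k] False by simp
      also have "\<dots> \<le> D * T k" using D1 T1[of k] by (intro mult_right_mono) auto
      finally show ?thesis .
    qed
    obtain K where K: "K \<ge> 0" "\<forall>v M x y. M \<ge> 1 \<longrightarrow>
      (cmod (theta f M (sym_matrix v) x y))\<^sup>2 \<le> K * M ^ ?n * real (card (SX (($) v) (\<epsilon> * M) (\<epsilon> / M)))"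
      using theta_square_le[OF f e] by blast
    have "cmod (theta f M X x y) \<le> sqrt (K * D) * M powr (real ?n / 2) * \<psi> (ln M)" if M: "M \<ge> 1" for M x y
    proof -
      define k where "k = nat \<lfloor>ln M\<rfloor>"
      have l0: "ln M \<ge> 0" using M by simp
      have k: "real k \<le> ln M" "ln M < real k + 1" using l0 unfolding k_def by linarith+
      have "exp (ln M) \<le> exp (real k + 1)" using k(2) by (simp only: exp_le_cancel_iff less_imp_le)
      then have "M \<le> exp (real k + 1)" using M by simp
      then have A: "\<epsilon> * M \<le> a k" unfolding a_def using e by (intro mult_left_mono) auto
      have "exp (real k) \<le> exp (ln M)" using k(1) by (simp only: exp_le_cancel_iff)
      then have "exp (real k) \<le> M" using M by simp
      then have "1 / M \<le> 1 / exp (real k)" using M by (intro divide_left_mono) auto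
      then have "\<epsilon> * (1 / M) \<le> \<epsilon> * (1 / exp (real k))" using e by (intro mult_left_mono) auto
      then have B: "\<epsilon> / M \<le> b k" unfolding b_def by (simp add: exp_minus inverse_eq_divide)
      have "card (SX (($) v) (\<epsilon> * M) (\<epsilon> / M)) \<le> card (SX (($) v) (a k) (b k))"
        by (rule card_mono[OF finite_SX SX_mono[OF A B]])
      then have "real (card (SX (($) v) (\<epsilon> * M) (\<epsilon> / M))) \<le> D * T k" using SD[of k] by linarith
      also have "\<dots> \<le> D * \<psi> (ln M) ^ 2"
      proof -
        have "\<psi> (real k) \<le> \<psi> (ln M)" using mono_onD[OF assms(2), of "real k" "ln M"] k(1) l0 by simp
        then show ?thesis unfolding T_def using D1 assms(1)[of "real k"] by (intro mult_left_mono power_mono) auto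
      qed
      finally have cs: "real (card (SX (($) v) (\<epsilon> * M) (\<epsilon> / M))) \<le> D * \<psi> (ln M) ^ 2" .
      have "(cmod (theta f M X x y))\<^sup>2 \<le> K * M ^ ?n * (D * \<psi> (ln M) ^ 2)"
        unfolding v using K M by (intro order_trans[OF K(2)[rule_format, OF M] mult_left_mono[OF cs]]) simp
      also have "\<dots> = (sqrt (K * D) * M powr (real ?n / 2) * \<psi> (ln M)) ^ 2"
      proof -
        have "(M powr (real ?n / 2)) ^ 2 = M ^ ?n"
          using M by (simp add: powr_realpow[symmetric] powr_powr)
        moreover have "(sqrt (K * D)) ^ 2 = K * D" using K(1) D1 by simp
        ultimately show ?thesis by (simp only: power_mult_distrib) (simp add: mult_ac)
      qed
      finally show ?thesis
      proof (rule power2_le_imp_le)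
        show "0 \<le> sqrt (K * D) * M powr (real ?n / 2) * \<psi> (ln M)"
          using K(1) D1 assms(1)[OF l0] by simp
      qed
    qed
    then show ?thesis by blast
  qed
  show ?thesis
  proof (intro exI[of _ "sym_matrices - S"] conjI allI impI ballI)
    have "sym_matrices - (sym_matrices - S) = S" unfolding S_def by blast
    then show "sym_matrices - (sym_matrices - S) \<in> null_sets sym_lebesgue" using Snull by simp
  qed (use bound in auto)
qed

end
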